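(* Let $f\in L^2_0(\pi)$. Then $$\lim_{\mu\to\infty}\sigma_f^2(\mu)=\sigma_{\Pi f}^2(0)\le\sigma_f^2(0).$$
   Context: Let $J\in\mathbb{R}^{d\times d}$ be skew-symmetric, $\gamma>0$, $\mu\in\mathbb{R}$, $W$ a standard $d$-dimensional Brownian motion, and consider on $\mathbb{R}^{2d}$ $$\mathrm{d}q_t=p_t\,\mathrm{d}t-\mu Jq_t\,\mathrm{d}t,\qquad \mathrm{d}p_t=-q_t\,\mathrm{d}t-\mu Jp_t\,\mathrm{d}t-\gamma p_t\,\mathrm{d}t+\sqrt{2\gamma}\,\mathrm{d}W_t .$$ It is ergodic with invariant measure $\widehat\pi=\mathcal{N}(0,I_{2d})$, whose $q$-marginal is $\pi=\mathcal{N}(0,I_d)$. Let $\mathcal{L}$ be the generator of its Markov semigroup on $L^2(\widehat\pi)$. $L^2_0(\pi)=\{f\in L^2(\pi):\pi(f)=0\}$; elements of it are regarded as functions of $(q,p)$ depending on $q$ only. The asymptotic variance is $\sigma_f^2(\mu)=\langle\chi,f\rangle_{L^2(\widehat\pi)}$, where $\chi\in\mathcal{D}(\mathcal{L})$ is the unique solution of $-\mathcal{L}\chi=f$, $\widehat\pi(\chi)=0$ (the argument $\mu$ records the dependence on the perturbation strength). $Jq\cdot\nabla_q$ is understood as an unbounded operator on $L^2_0(\pi)$, obtained as the smallest closed extension of $Jq\cdot\nabla_q$ acting on $C_c^\infty(\mathbb{R}^d)$; $\Pi$ is the $L^2_0(\pi)$-orthogonal projection onto the closed subspace $\ker(Jq\cdot\nabla_q)\subset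 L^2_0(\pi)$. *)

theory Defs
  imports "HOL-Probability.Probability"
begin

text \<open>The Gaussian measure \<open>N(0, I)\<close> on a Euclidean space. At type \<^typ>\<open>real ^ 'd\<close> this is
  \<open>\<pi>\<close>, at type \<^typ>\<open>(real ^ 'd) \<times> (real ^ 'd)\<close> it is \<open>\<pi>\<close>-hat.\<close>

definition std_gaussian :: "'a::euclidean_space measure" where
  "std_gaussian = density lborel (\<lambda>x. \<Prod>b\<in>Basis. ennreal (std_normal_density (x \<bullet> b)))"

text \<open>Elements of \<open>L\<^sup>2\<close> are represented by functions; all notions below are invariant under
  changes on null sets.\<close>

definition L2 :: "'a measure \<Rightarrow> ('a \<Rightarrow> real) set" where
  "L2 M = {f \<in> borel_measurable M. integrable M (\<lambda>x. (f x)\<^sup>2)}"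

definition L2_zero_mean :: "'a measure \<Rightarrow> ('a \<Rightarrow> real) set" where
  "L2_zero_mean M = {f \<in> L2 M. (\<integral>x. f x \<partial>M) = 0}"

definition L2_inner :: "'a measure \<Rightarrow> ('a \<Rightarrow> real) \<Rightarrow> ('a \<Rightarrow> real) \<Rightarrow> real" where
  "L2_inner M f g = (\<integral>x. f x * g x \<partial>M)"

definition L2_norm :: "'a measure \<Rightarrow> ('a \<Rightarrow> real) \<Rightarrow> real" where
  "L2_norm M f = sqrt (L2_inner M f f)"

definition L2_tendsto ::
  "'a measure \<Rightarrow> ('i \<Rightarrow> 'a \<Rightarrow> real) \<Rightarrow> ('a \<Rightarrow> real) \<Rightarrow> 'i filter \<Rightarrow> bool" where
  "L2_tendsto M g f F \<longleftrightarrow> f \<in> L2 M \<and> (\<forall>\<^sub>F i in F. g i \<in> L2 M) \<and>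
     ((\<lambda>i. L2_norm M (\<lambda>x. g i x - f x)) \<longlongrightarrow> 0) F"


definition standard_brownian_motion ::
  "'w measure \<Rightarrow> (real \<Rightarrow> 'w \<Rightarrow> 'a::euclidean_space) \<Rightarrow> bool" where
  "standard_brownian_motion M W \<longleftrightarrow>
     (\<forall>t\<ge>0. W t \<in> borel_measurable M) \<and>
     (AE \<omega> in M. W 0 \<omega> = 0) \<and>
     (AE \<omega> in M. continuous_on {0..} (\<lambda>t. W t \<omega>)) \<and>
     (\<forall>s t. 0 \<le> s \<and> s \<le> t \<longrightarrow>
        distr M borel (\<lambda>\<omega>. W t \<omega> - W s \<omega>) = distr std_gaussian borel (\<lambda>z. sqrt (t - s) *\<^sub>R z)) \<and>
     (\<forall>n (t :: nat \<Rightarrow> real). 0 \<le> t 0 \<and> mono t \<longrightarrow>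
        prob_space.indep_vars M (\<lambda>_. borel) (\<lambda>i \<omega>. W (t (Suc i)) \<omega> - W (t i) \<omega>) {..<n})"

text \<open>A (strong) solution \<open>X = (q, p)\<close>, started at \<open>x\<close>, of
  \<open>dq = p dt - \<mu> J q dt\<close>, \<open>dp = - q dt - \<mu> J p dt - \<gamma> p dt + sqrt (2 \<gamma>) dW\<close>. The noise is
  additive, so the stochastic integral of the constant \<open>sqrt (2 \<gamma>)\<close> is just
  \<open>sqrt (2 \<gamma>) (W\<^sub>t - W\<^sub>0)\<close>.\<close>

definition langevin_solution ::
  "'w measure \<Rightarrow> (real \<Rightarrow> 'w \<Rightarrow> real ^ 'd) \<Rightarrow> real ^ 'd ^ 'd \<Rightarrow> real \<Rightarrow> real \<Rightarrow>
   (real ^ 'd) \<times> (real ^ 'd) \<Rightarrow> (real \<Rightarrow> 'w \<Rightarrow> (real ^ 'd) \<times> (real ^ 'd)) \<Rightarrow> bool" where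
  "langevin_solution M W J \<gamma> \<mu> x X \<longleftrightarrow>
     (\<forall>t\<ge>0. X t \<in> borel_measurable M) \<and>
     (AE \<omega> in M. continuous_on {0..} (\<lambda>t. X t \<omega>) \<and>
       (\<forall>t\<ge>0.
          fst (X t \<omega>) = fst x
            + integral {0..t} (\<lambda>s. snd (X s \<omega>) - \<mu> *\<^sub>R (J *v fst (X s \<omega>))) \<and>
          snd (X t \<omega>) = snd x
            + integral {0..t} (\<lambda>s. - fst (X s \<omega>) - \<mu> *\<^sub>R (J *v snd (X s \<omega>)) - \<gamma> *\<^sub>R snd (X s \<omega>))
            + sqrt (2 * \<gamma>) *\<^sub>R (W t \<omega> - W 0 \<omega>)))"


text \<open>Here \<open>X x\<close> is the process started at \<open>x\<close>.\<close>

definition markov_semigroup ::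
  "'w measure \<Rightarrow> ('s \<Rightarrow> real \<Rightarrow> 'w \<Rightarrow> 's) \<Rightarrow> real \<Rightarrow> ('s \<Rightarrow> real) \<Rightarrow> 's \<Rightarrow> real" where
  "markov_semigroup M X t g x = (\<integral>\<omega>. g (X x t \<omega>) \<partial>M)"

text \<open>The graph of the generator in \<open>L\<^sup>2(\<nu>)\<close> of a semigroup \<open>P\<close>.\<close>

definition L2_generator ::
  "'s measure \<Rightarrow> (real \<Rightarrow> ('s \<Rightarrow> real) \<Rightarrow> 's \<Rightarrow> real) \<Rightarrow> (('s \<Rightarrow> real) \<times> ('s \<Rightarrow> real)) set" where
  "L2_generator \<nu> P =
     {(u, g). u \<in> L2 \<nu> \<and> L2_tendsto \<nu> (\<lambda>t x. (P t u x - u x) / t) g (at_right 0)}"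

text \<open>The function \<open>f\<close> of \<open>q\<close> is regarded as the function \<^term>\<open>\<lambda>x. f (fst x)\<close> of \<open>x = (q, p)\<close>.
  The solution \<open>u\<close> of the Poisson equation is unique only up to null sets, whence the description of
  the value instead of \<open>u\<close>.\<close>

definition asymptotic_variance ::
  "'w measure \<Rightarrow> ((real ^ 'd) \<times> (real ^ 'd) \<Rightarrow> real \<Rightarrow> 'w \<Rightarrow> (real ^ 'd) \<times> (real ^ 'd)) \<Rightarrow>
   (real ^ 'd \<Rightarrow> real) \<Rightarrow> real" where
  "asymptotic_variance M X f =
     (THE v. \<exists>u. (u, \<lambda>x. - f (fst x)) \<in> L2_generator std_gaussian (markov_semigroup M X) \<and>
        (\<integral>x. u x \<partial>std_gaussian) = 0 \<and>
        v = L2_inner std_gaussian u (\<lambda>x. f (fst x)))"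


fun Ck :: "nat \<Rightarrow> ('a::euclidean_space \<Rightarrow> real) \<Rightarrow> bool" where
  "Ck 0 f \<longleftrightarrow> continuous_on UNIV f"
| "Ck (Suc k) f \<longleftrightarrow> (\<forall>x. f differentiable at x) \<and>
     (\<forall>b\<in>Basis. Ck k (\<lambda>x. frechet_derivative f (at x) b))"

definition Cc_infinity :: "('a::euclidean_space \<Rightarrow> real) set" where
  "Cc_infinity = {\<phi>. (\<forall>k. Ck k \<phi>) \<and> compact (closure {x. \<phi> x \<noteq> 0})}"

text \<open>\<open>Jq \<sqdot> \<nabla>\<phi>(q)\<close> is the derivative of \<open>\<phi>\<close> at \<open>q\<close> in direction \<open>Jq\<close>.\<close>

definition rot_deriv :: "real ^ 'd ^ 'd \<Rightarrow> (real ^ 'd \<Rightarrow> real) \<Rightarrow> real ^ 'd \<Rightarrow> real" where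
  "rot_deriv J \<phi> q = frechet_derivative \<phi> (at q) (J *v q)"

text \<open>The graph of the smallest closed extension, i.e. the closure of the graph of
  \<open>Jq \<sqdot> \<nabla>\<close> on the zero-mean test functions, in \<open>L\<^sup>2\<^sub>0(\<pi>) \<times> L\<^sup>2\<^sub>0(\<pi>)\<close>.\<close>

definition rot_closure :: "real ^ 'd ^ 'd \<Rightarrow> ((real ^ 'd \<Rightarrow> real) \<times> (real ^ 'd \<Rightarrow> real)) set" where
  "rot_closure J =
     {(g, h). g \<in> L2_zero_mean std_gaussian \<and> h \<in> L2_zero_mean std_gaussian \<and>
        (\<exists>\<phi> :: nat \<Rightarrow> real ^ 'd \<Rightarrow> real.
           (\<forall>n. \<phi> n \<in> Cc_infinity \<inter> L2_zero_mean std_gaussian) \<and>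
           L2_tendsto std_gaussian \<phi> g sequentially \<and>
           L2_tendsto std_gaussian (\<lambda>n. rot_deriv J (\<phi> n)) h sequentially)}"

definition rot_kernel :: "real ^ 'd ^ 'd \<Rightarrow> (real ^ 'd \<Rightarrow> real) set" where
  "rot_kernel J = {g. (g, \<lambda>_. 0) \<in> rot_closure J}"

text \<open>(A representative of) the orthogonal projection of \<open>f\<close> onto the closed subspace
  \<^term>\<open>rot_kernel J\<close>.\<close>

definition kernel_projection ::
  "real ^ 'd ^ 'd \<Rightarrow> (real ^ 'd \<Rightarrow> real) \<Rightarrow> (real ^ 'd \<Rightarrow> real)" where
  "kernel_projection J f =
     (SOME g. g \<in> rot_kernel J \<and>
        (\<forall>h\<in>rot_kernel J. L2_inner std_gaussian (\<lambda>q. f q - g q) h = 0))"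

end

theory Submission
  imports Defs
begin

text \<open>Let \<open>R\<^sub>s\<close> be the rotation \<open>exp (s J)\<close>. In the stationary regime the position is
  \<open>q\<^sub>t = R\<^sub>-\<^sub>\<mu>\<^sub>t (a q\<^sub>0 + b p\<^sub>0) + \<close> independent Gaussian noise, where \<open>(a, b)\<close> is a damped oscillator that
  depends on \<open>t\<close> and \<open>\<gamma>\<close> only. Hence the asymptotic variance is
  \<open>\<integral>\<^sub>0\<^sup>\<infinity> \<langle>f \<circ> R\<^sub>-\<^sub>\<mu>\<^sub>t, T\<^sub>a\<^sub>(\<^sub>t\<^sub>) f\<rangle> dt\<close>, with \<open>T\<^sub>c\<close> the Mehler operator of correlation \<open>c\<close>, whose spectral gap
  makes the integral converge. The space \<open>L\<^sup>2\<^sub>0(\<pi>)\<close> is the orthogonal sum of the rotation invariant functions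
  and of the closure of the coboundaries \<open>\<psi> \<circ> R\<^sub>-\<^sub>\<delta> - \<psi>\<close>. The first part of \<open>f\<close> contributes a term that does not
  depend on \<open>\<mu>\<close>; the contribution of a coboundary vanishes as \<open>\<mu> \<longlongrightarrow> \<infinity>\<close>, because rotating by \<open>\<delta>\<close> is a
  time shift by \<open>\<delta> / \<mu>\<close>. The invariant functions are the kernel of the closure of \<open>Jq \<sqdot> \<nabla>\<close>, since test
  functions can be averaged along the orbits of the rotations. The inequality follows from the absence of cross
  terms at \<open>\<mu> = 0\<close> and the dissipativity of the generator.\<close>

section \<open>Characteristic functions\<close>

text \<open>The drift is linear and the noise additive, so along each path
  \<open>v \<bullet> X T\<close> is explicit up to a Wiener integral, and characteristic functions
  identify all laws. \<open>J\<close> acts in the same way on \<open>q\<close> and \<open>p\<close>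
  and therefore commutes with the oscillator; \<mu> enters only through the angle. All decay
  estimates are thus uniform in \<mu>, which is what permits dominated convergence. The friction
  acts on \<open>p\<close> alone, so decay is proved for the finite-dimensional flow by a modified
  quadratic form and carried over to L2 by the Mehler operators. The variance is defined by a
  definite description: besides the existence of a solution of the Poisson equation, its uniqueness
  up to null sets has to be shown, which amounts to a trivial kernel of the generator on centred
  functions. The correlation \<open>osc_q \<gamma> t\<close> may change sign, so the integrand of
  the variance need not be nonnegative even at \<mu> = 0; only its integral is, which is why
  dissipativity enters.\<close>

definition char_vec :: "'a::euclidean_space measure \<Rightarrow> 'a \<Rightarrow> complex" where
  "char_vec N v = (CLINT x|N. iexp (v \<bullet> x))"

lemma sets_std_gaussian [simp, measurable_cong]: "sets std_gaussian = sets borel"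
  by (simp add: std_gaussian_def)

lemma space_std_gaussian [simp]: "space std_gaussian = UNIV"
  by (simp add: std_gaussian_def)

lemma prob_space_std_gaussian: "prob_space (std_gaussian :: 'a::euclidean_space measure)"
proof
  have 1: "(\<integral>\<^sup>+x. std_normal_density x \<partial>lborel) = 1"
    using prob_space.emeasure_space_1[OF prob_space_normal_density[of 1 0]]
    by (simp add: emeasure_density)
  show "emeasure (std_gaussian :: 'a measure) (space std_gaussian) = 1"
    using nn_integral_lborel_prod[of "\<lambda>_::'a. \<lambda>x. ennreal (std_normal_density x)"]
    by (simp add: std_gaussian_def emeasure_density 1)
qed

lemma norm_power2_eq_sum_Basis:
  fixes x :: "'a::euclidean_space"
  shows "(norm x)\<^sup>2 = (\<Sum>b\<in>Basis. (x \<bullet> b)\<^sup>2)"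
  using euclidean_inner[of x x] by (simp only: power2_eq_square flip: power2_norm_eq_inner)

lemma std_gaussian_density:
  "(\<Prod>b\<in>Basis. ennreal (std_normal_density (x \<bullet> b))) =
     ennreal ((1 / sqrt (2 * pi)) ^ DIM('a) * exp (- (norm x)\<^sup>2 / 2))" for x :: "'a::euclidean_space"
proof -
  have "(\<Prod>b\<in>Basis. std_normal_density (x \<bullet> b)) =
      (\<Prod>b\<in>(Basis::'a set). 1 / sqrt (2 * pi)) * exp (\<Sum>b\<in>Basis. - (x \<bullet> b)\<^sup>2 / 2)"
    by (simp add: std_normal_density_def exp_sum prod_dividef power_one_over)
  also have "(\<Sum>b\<in>Basis. - (x \<bullet> b)\<^sup>2 / 2) = - (norm x)\<^sup>2 / 2"
    by (simp add: norm_power2_eq_sum_Basis sum_divide_distrib sum_negf)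
  finally show ?thesis
    by (simp add: prod_ennreal normal_density_nonneg)
qed

lemma std_gaussian_eq:
  "(std_gaussian :: 'a::euclidean_space measure) =
     density lborel (\<lambda>x. ennreal ((1 / sqrt (2 * pi)) ^ DIM('a) * exp (- (norm x)\<^sup>2 / 2)))"
  by (simp add: std_gaussian_def std_gaussian_density)

lemma integrable_iexp_finite:
  assumes "finite_measure N" "g \<in> borel_measurable N"
  shows "integrable N (\<lambda>x. iexp (g x))"
proof -
  interpret finite_measure N by fact
  show ?thesis
    by (rule integrable_const_bound[where B=1]) (use assms in \<open>auto simp: norm_exp_eq_Re\<close>)
qed

text \<open>The density is a product over the basis, so the transform factorises into
  one-dimensional ones.\<close>

lemma char_vec_std_gaussian:
  fixes v :: "'a::euclidean_space"
  shows "char_vec std_gaussian v = exp (- (norm v)\<^sup>2 / 2)"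
proof -
  interpret product_sigma_finite "\<lambda>_::'a. lborel :: real measure"
    by standard
  define h :: "'a \<Rightarrow> real \<Rightarrow> complex" where
    "h b t = std_normal_density t *\<^sub>R iexp ((v \<bullet> b) * t)" for b t
  have hint: "integrable lborel (h b)" for b
  proof -
    have "integrable std_normal_distribution (\<lambda>t. iexp ((v \<bullet> b) * t))"
      by (rule integrable_iexp_finite) (auto intro!: prob_space.finite_measure prob_space_normal_density)
    then show ?thesis
      by (subst (asm) integrable_density) (auto simp: h_def[abs_def] normal_density_nonneg)
  qed
  have hval: "integral\<^sup>L lborel (h b) = exp (- (v \<bullet> b)\<^sup>2 / 2)" for b
  proof -
    have "integral\<^sup>L lborel (h b) = char std_normal_distribution (v \<bullet> b)"
      unfolding char_def h_def[abs_def]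
      by (subst integral_density) (auto simp: normal_density_nonneg)
    then show ?thesis by (simp add: char_std_normal_distribution)
  qed
  have "char_vec std_gaussian v =
      (\<integral>x. (\<Prod>b\<in>Basis. std_normal_density (x \<bullet> b)) *\<^sub>R iexp (v \<bullet> x) \<partial>lborel)"
    unfolding char_vec_def std_gaussian_def
    by (subst integral_density[symmetric]) (auto simp: prod_ennreal normal_density_nonneg prod_nonneg)
  also have "\<dots> = (\<integral>x. (\<Prod>b\<in>Basis. h b (x \<bullet> b)) \<partial>(lborel::'a measure))"
  proof (rule Bochner_Integration.integral_cong[OF refl])
    fix x :: 'a
    have "iexp (v \<bullet> x) = (\<Prod>b\<in>Basis. iexp ((v \<bullet> b) * (x \<bullet> b)))"
      by (subst euclidean_inner) (simp add: exp_sum sum_distrib_left)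
    then show "(\<Prod>b\<in>Basis. std_normal_density (x \<bullet> b)) *\<^sub>R iexp (v \<bullet> x) = (\<Prod>b\<in>Basis. h b (x \<bullet> b))"
      by (simp add: h_def scaleR_conv_of_real prod.distrib)
  qed
  also have "\<dots> = (\<integral>f. (\<Prod>b\<in>Basis. h b ((\<Sum>b\<in>Basis. f b *\<^sub>R b) \<bullet> b)) \<partial>(\<Pi>\<^sub>M b\<in>(Basis::'a set). lborel))"
    by (subst lborel_eq, subst integral_distr) (auto simp: h_def[abs_def])
  also have "\<dots> = (\<integral>f. (\<Prod>b\<in>Basis. h b (f b)) \<partial>(\<Pi>\<^sub>M b\<in>(Basis::'a set). lborel))"
    by (intro Bochner_Integration.integral_cong prod.cong refl) (simp add: inner_sum_left_Basis)
  also have "\<dots> = (\<Prod>b\<in>Basis. exp (- (v \<bullet> b)\<^sup>2 / 2))"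
    by (subst product_integral_prod) (auto simp: hint hval)
  also have "\<dots> = exp (- (norm v)\<^sup>2 / 2)"
    by (simp add: norm_power2_eq_sum_Basis exp_sum[symmetric] sum_divide_distrib sum_negf
         flip: of_real_prod)
  finally show ?thesis by simp
qed

subsection \<open>Uniqueness of characteristic functions\<close>

text \<open>A Parseval identity: the Gaussian kernel is itself the transform of
  \<open>std_gaussian\<close>, and inserting this and exchanging the integrals expresses the
  smoothed measure through \<open>char_vec M\<close> alone.\<close>

lemma gaussian_smoothing_eq:
  fixes M N :: "'a::euclidean_space measure"
  assumes M: "finite_measure M" "sets M = sets borel"
    and N: "finite_measure N" "sets N = sets borel"
    and eq: "\<And>v. char_vec M v = char_vec N v"
  shows "(\<integral>y. exp (- (norm (s *\<^sub>R (x - y)))\<^sup>2 / 2) \<partial>M) = (\<integral>y. exp (- (norm (s *\<^sub>R (x - y)))\<^sup>2 / 2) \<partial>N)"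
proof -
  have *: "complex_of_real (\<integral>y. exp (- (norm (s *\<^sub>R (x - y)))\<^sup>2 / 2) \<partial>M) =
     (CLINT z|std_gaussian. iexp (s * (x \<bullet> z)) * char_vec M (- s *\<^sub>R z))"
    if M: "finite_measure M" "sets M = sets borel" for M :: "'a measure"
  proof -
    interpret finite_measure M by fact
    interpret G: prob_space "std_gaussian :: 'a measure" by (rule prob_space_std_gaussian)
    interpret P: pair_sigma_finite M "std_gaussian :: 'a measure" ..
    interpret PF: finite_measure "M \<Otimes>\<^sub>M (std_gaussian :: 'a measure)"
      by (rule finite_measure_pair_measure) unfold_locales
    note [measurable_cong] = that(2)
    have i: "integrable (M \<Otimes>\<^sub>M std_gaussian) (\<lambda>(y, z). iexp (s *\<^sub>R (x - y) \<bullet> z))"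
      using integrable_iexp_finite[of "M \<Otimes>\<^sub>M std_gaussian" "\<lambda>(y, z). s *\<^sub>R (x - y) \<bullet> z"]
      by (simp add: PF.finite_measure_axioms case_prod_beta' that(2))
    have "complex_of_real (\<integral>y. exp (- (norm (s *\<^sub>R (x - y)))\<^sup>2 / 2) \<partial>M) =
       (CLINT y|M. char_vec std_gaussian (s *\<^sub>R (x - y)))"
      by (simp only: char_vec_std_gaussian integral_complex_of_real)
    also have "\<dots> = (CLINT y|M. CLINT z|std_gaussian. iexp (s *\<^sub>R (x - y) \<bullet> z))"
      by (simp add: char_vec_def)
    also have "\<dots> = (CLINT z|std_gaussian. CLINT y|M. iexp (s *\<^sub>R (x - y) \<bullet> z))"
      using P.Fubini_integral[OF i] by simp
    also have "\<dots> = (CLINT z|std_gaussian. CLINT y|M. iexp (s * (x \<bullet> z)) * iexp ((- s *\<^sub>R z) \<bullet> y))"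
      by (intro Bochner_Integration.integral_cong refl)
         (simp add: exp_add[symmetric] algebra_simps inner_diff_left inner_commute flip: of_real_add)
    finally show ?thesis by (simp add: char_vec_def)
  qed
  have "complex_of_real (\<integral>y. exp (- (norm (s *\<^sub>R (x - y)))\<^sup>2 / 2) \<partial>M) =
      complex_of_real (\<integral>y. exp (- (norm (s *\<^sub>R (x - y)))\<^sup>2 / 2) \<partial>N)"
    unfolding *[OF M] *[OF N] by (simp only: eq)
  then show ?thesis by (simp only: of_real_eq_iff)
qed

text \<open>The substitution \<open>x = y + s z\<close> turns the average over a Gaussian
  perturbation of \<open>y\<close> into an integral against a kernel in which \<open>x\<close> and
  \<open>y\<close> play symmetric roles; later \<open>y\<close> can then be integrated out for fixed
  \<open>x\<close>.\<close>

lemma gaussian_convolution: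
  fixes g :: "'a::euclidean_space \<Rightarrow> real"
  assumes [measurable]: "g \<in> borel_measurable borel" and g: "\<And>x. 0 \<le> g x" and s: "s > 0"
  shows "(\<integral>\<^sup>+z. g (y + s *\<^sub>R z) \<partial>std_gaussian) =
    ennreal ((1 / (s * sqrt (2 * pi))) ^ DIM('a)) *
      (\<integral>\<^sup>+x. g x * exp (- (norm ((1 / s) *\<^sub>R (x - y)))\<^sup>2 / 2) \<partial>lborel)"
proof -
  have "(\<integral>\<^sup>+x. g x * exp (- (norm ((1 / s) *\<^sub>R (x - y)))\<^sup>2 / 2) \<partial>lborel) =
     ennreal (s ^ DIM('a)) * (\<integral>\<^sup>+z. g (y + s *\<^sub>R z) * exp (- (norm z)\<^sup>2 / 2) \<partial>lborel)"
    using s by (subst lborel_affine[of s y])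
      (auto simp: nn_integral_density nn_integral_distr nn_integral_cmult)
  moreover have "(\<integral>\<^sup>+z. g (y + s *\<^sub>R z) \<partial>std_gaussian) =
     ennreal ((1 / sqrt (2 * pi)) ^ DIM('a)) * (\<integral>\<^sup>+z. g (y + s *\<^sub>R z) * exp (- (norm z)\<^sup>2 / 2) \<partial>lborel)"
  proof -
    have *: "ennreal (c * e) * ennreal a = ennreal c * ennreal (a * e)" if "0 \<le> c" "0 \<le> e" "0 \<le> a" for c e a
      using that by (simp add: ac_simps flip: ennreal_mult')
    show ?thesis
      unfolding std_gaussian_eq
      by (subst nn_integral_density, simp, simp, subst nn_integral_cmult[symmetric], simp)
         (intro nn_integral_cong *, auto simp: g)
  qed
  moreover have "ennreal ((1 / (s * sqrt (2 * pi))) ^ DIM('a)) * ennreal (s ^ DIM('a)) =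
     ennreal ((1 / sqrt (2 * pi)) ^ DIM('a))"
  proof -
    have "1 / (s * sqrt (2 * pi)) * s = 1 / sqrt (2 * pi)" using s by simp
    then show ?thesis
      using s by (subst ennreal_mult'[symmetric]) (simp_all only: power_mult_distrib[symmetric], simp)
  qed
  ultimately show ?thesis by (simp add: mult.assoc[symmetric])
qed

lemma nn_integral_smoothed_eq:
  fixes M N :: "'a::euclidean_space measure" and g :: "'a \<Rightarrow> real"
  assumes M: "finite_measure M" "sets M = sets borel"
    and N: "finite_measure N" "sets N = sets borel"
    and eq: "\<And>v. char_vec M v = char_vec N v"
    and [measurable]: "g \<in> borel_measurable borel" and g: "\<And>x. 0 \<le> g x" and s: "s > 0"
  shows "(\<integral>\<^sup>+y. \<integral>\<^sup>+z. g (y + s *\<^sub>R z) \<partial>std_gaussian \<partial>M) = (\<integral>\<^sup>+y. \<integral>\<^sup>+z. g (y + s *\<^sub>R z) \<partial>std_gaussian \<partial>N)"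
proof -
  have *: "(\<integral>\<^sup>+y. \<integral>\<^sup>+z. g (y + s *\<^sub>R z) \<partial>std_gaussian \<partial>M) =
     ennreal ((1 / (s * sqrt (2 * pi))) ^ DIM('a)) *
      (\<integral>\<^sup>+x. ennreal (g x) * ennreal (\<integral>y. exp (- (norm ((1 / s) *\<^sub>R (x - y)))\<^sup>2 / 2) \<partial>M) \<partial>lborel)"
    if M: "finite_measure M" "sets M = sets borel" for M :: "'a measure"
  proof -
    interpret finite_measure M by fact
    interpret P: pair_sigma_finite M "lborel :: 'a measure" ..
    note [measurable_cong] = that(2)
    have e: "(\<integral>\<^sup>+y. exp (- (norm ((1 / s) *\<^sub>R (x - y)))\<^sup>2 / 2) \<partial>M) =
        ennreal (\<integral>y. exp (- (norm ((1 / s) *\<^sub>R (x - y)))\<^sup>2 / 2) \<partial>M)" for x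
      by (rule nn_integral_eq_integral) (auto intro!: integrable_const_bound[where B=1] simp del: norm_scaleR)
    have "(\<integral>\<^sup>+y. \<integral>\<^sup>+z. g (y + s *\<^sub>R z) \<partial>std_gaussian \<partial>M) =
      ennreal ((1 / (s * sqrt (2 * pi))) ^ DIM('a)) *
      (\<integral>\<^sup>+y. \<integral>\<^sup>+x. g x * exp (- (norm ((1 / s) *\<^sub>R (x - y)))\<^sup>2 / 2) \<partial>lborel \<partial>M)"
      by (subst gaussian_convolution) (auto simp: g s nn_integral_cmult)
    also have "(\<integral>\<^sup>+y. \<integral>\<^sup>+x. g x * exp (- (norm ((1 / s) *\<^sub>R (x - y)))\<^sup>2 / 2) \<partial>lborel \<partial>M) =
       (\<integral>\<^sup>+x. \<integral>\<^sup>+y. g x * exp (- (norm ((1 / s) *\<^sub>R (x - y)))\<^sup>2 / 2) \<partial>M \<partial>lborel)"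
      by (rule P.Fubini'[symmetric]) simp
    also have "\<dots> = (\<integral>\<^sup>+x. ennreal (g x) * ennreal (\<integral>y. exp (- (norm ((1 / s) *\<^sub>R (x - y)))\<^sup>2 / 2) \<partial>M) \<partial>lborel)"
      by (intro nn_integral_cong, subst ennreal_mult'[OF g], subst nn_integral_cmult, simp, subst e, rule refl)
    finally show ?thesis .
  qed
  show ?thesis
    unfolding *[OF M] *[OF N] gaussian_smoothing_eq[OF M N eq] ..
qed

text \<open>The smoothing is removed by letting its width \<open>s n\<close> tend to 0; as
  \<open>g\<close> is bounded and continuous, dominated convergence applies.\<close>

lemma integral_eq_if_char_vec_eq:
  fixes M N :: "'a::euclidean_space measure" and g :: "'a \<Rightarrow> real"
  assumes M: "finite_measure M" "sets M = sets borel"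
    and N: "finite_measure N" "sets N = sets borel"
    and eq: "\<And>v. char_vec M v = char_vec N v"
    and g: "continuous_on UNIV g" "\<And>x. 0 \<le> g x" "\<And>x. g x \<le> 1"
  shows "(\<integral>x. g x \<partial>M) = (\<integral>x. g x \<partial>N)"
proof -
  have [measurable]: "g \<in> borel_measurable borel"
    using g(1) by (rule borel_measurable_continuous_onI)
  define s :: "nat \<Rightarrow> real" where "s n = 1 / Suc n" for n
  have s: "s n > 0" for n by (simp add: s_def)
  define I where "I M n = (\<integral>p. g (fst p + s n *\<^sub>R snd p) \<partial>(M \<Otimes>\<^sub>M std_gaussian))" for M n
  have *: "ennreal (I M n) = (\<integral>\<^sup>+y. \<integral>\<^sup>+z. g (y + s n *\<^sub>R z) \<partial>std_gaussian \<partial>M)"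
     "I M n \<ge> 0" "(\<lambda>n. I M n) \<longlonglongrightarrow> (\<integral>x. g x \<partial>M)"
    if M: "finite_measure M" "sets M = sets borel" for M and n
  proof -
    interpret finite_measure M by fact
    interpret G: prob_space "std_gaussian :: 'a measure" by (rule prob_space_std_gaussian)
    interpret P: pair_sigma_finite M "std_gaussian :: 'a measure" ..
    interpret PF: finite_measure "M \<Otimes>\<^sub>M (std_gaussian :: 'a measure)"
      by (rule finite_measure_pair_measure) unfold_locales
    note [measurable_cong] = that(2)
    show "ennreal (I M n) = (\<integral>\<^sup>+y. \<integral>\<^sup>+z. g (y + s n *\<^sub>R z) \<partial>std_gaussian \<partial>M)"
      unfolding I_def
      by (subst nn_integral_eq_integral[symmetric])
         (auto intro!: PF.integrable_const_bound[where B=1] simp: g G.nn_integral_fst[symmetric])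
    show "I M n \<ge> 0" by (simp add: I_def g)
    have "(\<lambda>n. I M n) \<longlonglongrightarrow> (\<integral>p. g (fst p) \<partial>(M \<Otimes>\<^sub>M (std_gaussian :: 'a measure)))"
      unfolding I_def
    proof (rule integral_dominated_convergence[where w="\<lambda>_. 1"])
      have "s \<longlonglongrightarrow> 0" unfolding s_def by (rule lim_1_over_n[THEN LIMSEQ_Suc])
      then show "AE p in M \<Otimes>\<^sub>M std_gaussian. (\<lambda>i. g (fst p + s i *\<^sub>R snd p)) \<longlonglongrightarrow> g (fst p)"
        by (intro AE_I2 isCont_tendsto_compose[where g=g])
           (auto intro!: tendsto_eq_intros simp: g(1)[unfolded continuous_on_eq_continuous_at[OF open_UNIV]])
    qed (auto simp: g)
    also have "(\<integral>p. g (fst p) \<partial>(M \<Otimes>\<^sub>M (std_gaussian :: 'a measure))) = (\<integral>x. g x \<partial>M)"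
      by (subst P.integral_fst'[symmetric])
         (auto intro!: PF.integrable_const_bound[where B=1] simp: g G.prob_space[simplified])
    finally show "(\<lambda>n. I M n) \<longlonglongrightarrow> (\<integral>x. g x \<partial>M)" .
  qed
  have "ennreal (I M n) = ennreal (I N n)" for n
    unfolding *(1)[OF M] *(1)[OF N]
    by (rule nn_integral_smoothed_eq[OF M N eq]) (auto simp: g s)
  then have "I M n = I N n" for n
    using *(2)[OF M] *(2)[OF N] by simp
  then show ?thesis
    using *(3)[OF M] *(3)[OF N] LIMSEQ_unique by simp
qed

text \<open>Open sets are stable under intersection and generate the Borel sets, and the indicator
  of an open set is a pointwise limit of the continuous functions
  \<open>min 1 (n * infdist x (- U))\<close>.\<close>

lemma char_vec_unique:
  fixes M N :: "'a::euclidean_space measure"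
  assumes M: "finite_measure M" "sets M = sets borel"
    and N: "finite_measure N" "sets N = sets borel"
    and eq: "\<And>v. char_vec M v = char_vec N v"
  shows "M = N"
proof (rule measure_eqI_generator_eq[where E="Collect open" and \<Omega>=UNIV and A="\<lambda>_. UNIV"])
  interpret M: finite_measure M by fact
  interpret N: finite_measure N by fact
  note [measurable_cong] = M(2) N(2)
  fix U :: "'a set" assume "U \<in> Collect open"
  then have U: "open U" by simp
  show "emeasure M U = emeasure N U"
  \<comment> \<open>For \<open>U = UNIV\<close> the complement is empty and \<open>infdist\<close>
    to it is 0, so the approximation below would fail; the total masses are compared
    directly.\<close>
  proof (cases "U = UNIV")
    case True
    have "(\<integral>x. 1 \<partial>M) = (\<integral>x. 1 \<partial>N :: real)"
      by (rule integral_eq_if_char_vec_eq[OF M N eq]) auto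
    then show ?thesis
      using True by (simp add: M.emeasure_eq_measure N.emeasure_eq_measure sets_eq_imp_space_eq[OF M(2)] sets_eq_imp_space_eq[OF N(2)])
  next
    case False
    then have ne: "- U \<noteq> {}" by auto
    define g where "g n x = min 1 (real n * infdist x (- U))" for n x
    have lim: "(\<lambda>n. g n x) \<longlonglongrightarrow> indicator U x" for x
    proof (cases "x \<in> U")
      case True
      then have "infdist x (- U) > 0"
        using U ne in_closed_iff_infdist_zero[of "- U" x] infdist_nonneg[of x "- U"]
        by (auto simp: less_le)
      then obtain n where n: "1 \<le> real n * infdist x (- U)"
        by (metis ex_less_of_nat_mult less_imp_le)
      have "eventually (\<lambda>m. g m x = 1) sequentially"
        using eventually_ge_at_top[of n]
      proof eventually_elim
        case (elim m)
        then have "real n * infdist x (- U) \<le> real m * infdist x (- U)"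
          by (intro mult_right_mono) (auto simp: infdist_nonneg)
        with n show ?case by (simp add: g_def)
      qed
      then show ?thesis using True by (simp add: tendsto_eventually)
    next
      case False
      then have "infdist x (- U) = 0" by simp
      then show ?thesis using False by (simp add: g_def)
    qed
    have cont: "continuous_on UNIV (g n)" for n
      unfolding g_def by (intro continuous_intros)
    have b: "0 \<le> g n x" "g n x \<le> 1" for n x by (auto simp: g_def infdist_nonneg)
    have [measurable]: "g n \<in> borel_measurable borel" for n
      using cont by (rule borel_measurable_continuous_onI)
    have [measurable]: "U \<in> sets borel" using U by simp
    have *: "(\<lambda>n. \<integral>x. g n x \<partial>M) \<longlonglongrightarrow> (\<integral>x. indicator U x \<partial>M)"
      if "finite_measure M" "sets M = sets borel" for M :: "'a measure"
    proof (rule integral_dominated_convergence[where w="\<lambda>_. 1"])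
      interpret finite_measure M by fact
      note [measurable_cong] = that(2)
      show "integrable M (\<lambda>_. 1 :: real)" by simp
      show "g n \<in> borel_measurable M" for n by measurable
    qed (use that lim b in \<open>auto simp: measurable_cong_sets[OF that(2) refl]\<close>)
    have "(\<integral>x. indicator U x \<partial>M) = (\<integral>x. indicator U x \<partial>N :: real)"
      using *[OF M] *[OF N] integral_eq_if_char_vec_eq[OF M N eq cont b] LIMSEQ_unique by simp
    then show ?thesis by (simp add: M.emeasure_eq_measure N.emeasure_eq_measure M(2) N(2) sets_eq_imp_space_eq[OF M(2)] sets_eq_imp_space_eq[OF N(2)])
  qed
next
  interpret M: finite_measure M by fact
  show "emeasure M UNIV \<noteq> \<infinity>" by simp
qed (auto simp: Int_stable_def M(2) N(2) borel_def)

lemma measurable_std_gaussian_iff [simp]: "measurable std_gaussian N = measurable borel N"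
  by (rule measurable_cong_sets) simp_all

lemma char_vec_distr:
  assumes "L \<in> borel_measurable N"
  shows "char_vec (distr N borel L) v = (CLINT x|N. iexp (v \<bullet> L x))"
  unfolding char_vec_def using assms by (subst integral_distr) auto

text \<open>Independence in the form used below: the summands live on the two factors, so Fubini
  splits the transform.\<close>

lemma char_vec_pair_sum:
  fixes S :: "'s \<Rightarrow> 'a::euclidean_space" and T :: "'t \<Rightarrow> 'a"
  assumes A: "prob_space A" and B: "prob_space B"
    and [measurable]: "S \<in> borel_measurable A" "T \<in> borel_measurable B"
  shows "char_vec (distr (A \<Otimes>\<^sub>M B) borel (\<lambda>p. S (fst p) + T (snd p))) v =
    char_vec (distr A borel S) v * char_vec (distr B borel T) v"
proof -
  interpret A: prob_space A by fact
  interpret B: prob_space B by fact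
  interpret P: pair_prob_space A B ..
  have i: "integrable (A \<Otimes>\<^sub>M B) (\<lambda>p. iexp (v \<bullet> S (fst p)) * iexp (v \<bullet> T (snd p)))"
    by (rule P.integrable_const_bound[where B=1]) (auto simp: norm_mult)
  have "char_vec (distr (A \<Otimes>\<^sub>M B) borel (\<lambda>p. S (fst p) + T (snd p))) v =
     (CLINT p|A \<Otimes>\<^sub>M B. iexp (v \<bullet> S (fst p)) * iexp (v \<bullet> T (snd p)))"
    by (subst char_vec_distr) (auto simp: inner_add_right exp_add[symmetric] algebra_simps)
  also have "\<dots> = (CLINT x|A. CLINT y|B. iexp (v \<bullet> S x) * iexp (v \<bullet> T y))"
    using P.integral_fst'[OF i] by simp
  also have "\<dots> = char_vec (distr A borel S) v * char_vec (distr B borel T) v"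
    by (simp add: char_vec_distr)
  finally show ?thesis .
qed

lemma borel_measurable_linear_euclidean:
  fixes L :: "'a::euclidean_space \<Rightarrow> 'b::real_normed_vector"
  assumes "linear L" shows "L \<in> borel_measurable borel"
  using assms by (intro borel_measurable_continuous_onI linear_continuous_on)
    (simp add: linear_conv_bounded_linear)

lemma char_vec_linear:
  fixes L :: "'a::euclidean_space \<Rightarrow> 'b::euclidean_space"
  assumes "linear L" "sets N = sets borel" "\<And>x v. v \<bullet> L x = L' v \<bullet> x"
  shows "char_vec (distr N borel L) v = char_vec N (L' v)"
  using borel_measurable_linear_euclidean[OF assms(1)]
  by (subst char_vec_distr) (simp_all add: assms(3) char_vec_def measurable_cong_sets[OF assms(2) refl])

lemma char_vec_std_gaussian_linear:
  fixes L :: "'a::euclidean_space \<Rightarrow> 'b::euclidean_space"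
  assumes "linear L" "\<And>x v. v \<bullet> L x = L' v \<bullet> x"
  shows "char_vec (distr std_gaussian borel L) v = exp (- (norm (L' v))\<^sup>2 / 2)"
  by (subst char_vec_linear[OF assms(1) _ assms(2)]) (simp_all add: char_vec_std_gaussian)

text \<open>The image of a standard Gaussian under a linear map is centred, and the squared norm of
  the adjoint is its covariance form. Identities in law between linear images, even from different
  spaces, are thereby reduced to comparing two norms.\<close>

lemma std_gaussian_distr_eqI:
  fixes L1 :: "'a::euclidean_space \<Rightarrow> 'c::euclidean_space" and L2 :: "'b::euclidean_space \<Rightarrow> 'c"
  assumes 1: "linear L1" "\<And>x v. v \<bullet> L1 x = L1' v \<bullet> x" and 2: "linear L2" "\<And>x v. v \<bullet> L2 x = L2' v \<bullet> x"
    and "\<And>v. norm (L1' v) = norm (L2' v)"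
  shows "distr std_gaussian borel L1 = distr std_gaussian borel L2"
proof (rule char_vec_unique)
  have "prob_space (distr (std_gaussian :: 'a measure) borel L1)"
    by (rule prob_space.prob_space_distr[OF prob_space_std_gaussian])
       (simp add: borel_measurable_linear_euclidean 1)
  then show "finite_measure (distr (std_gaussian :: 'a measure) borel L1)"
    by (rule prob_space.finite_measure)
  have "prob_space (distr (std_gaussian :: 'b measure) borel L2)"
    by (rule prob_space.prob_space_distr[OF prob_space_std_gaussian])
       (simp add: borel_measurable_linear_euclidean 2)
  then show "finite_measure (distr (std_gaussian :: 'b measure) borel L2)"
    by (rule prob_space.finite_measure)
qed (simp_all add: char_vec_std_gaussian_linear[OF 1] char_vec_std_gaussian_linear[OF 2] assms(5))

text \<open>It is the adjoint that is isometric, so \<open>L\<close> may lower the dimension: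
  projections and normalised mixtures of independent Gaussians are covered, not only
  rotations.\<close>

lemma std_gaussian_distr_isometry:
  fixes L :: "'a::euclidean_space \<Rightarrow> 'b::euclidean_space"
  assumes "linear L" "\<And>x v. v \<bullet> L x = L' v \<bullet> x" and "\<And>v. norm (L' v) = norm v"
  shows "distr std_gaussian borel L = std_gaussian"
proof -
  have "distr std_gaussian borel L = distr (std_gaussian :: 'b measure) borel (\<lambda>x. x)"
    by (rule std_gaussian_distr_eqI[OF assms(1,2), where L2'="\<lambda>x. x"]) (auto simp: assms(3) linear_iff)
  also have "\<dots> = std_gaussian"
    using distr_id2[of borel "std_gaussian :: 'b measure"] by simp
  finally show ?thesis .
qed

text \<open>With this, a pair of independent Gaussians is a single Gaussian vector on the product
  space, and the lemmas on linear images apply to it.\<close>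

lemma std_gaussian_pair:
  "(std_gaussian :: 'a::euclidean_space measure) \<Otimes>\<^sub>M (std_gaussian :: 'b::euclidean_space measure) = std_gaussian"
proof (rule char_vec_unique)
  interpret A: prob_space "std_gaussian :: 'a measure" by (rule prob_space_std_gaussian)
  interpret B: prob_space "std_gaussian :: 'b measure" by (rule prob_space_std_gaussian)
  interpret P: pair_prob_space "std_gaussian :: 'a measure" "std_gaussian :: 'b measure" ..
  have s: "sets ((std_gaussian :: 'a measure) \<Otimes>\<^sub>M (std_gaussian :: 'b measure)) = sets (borel \<Otimes>\<^sub>M borel)"
    by (rule sets_pair_measure_cong) simp_all
  then show s': "sets ((std_gaussian :: 'a measure) \<Otimes>\<^sub>M (std_gaussian :: 'b measure)) = sets borel"
    using borel_prod[where 'a='a and 'b='b] by metis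
  show "finite_measure ((std_gaussian :: 'a measure) \<Otimes>\<^sub>M (std_gaussian :: 'b measure))"
    by (intro prob_space.finite_measure prob_space_pair A.prob_space_axioms B.prob_space_axioms)
  show "finite_measure (std_gaussian :: ('a \<times> 'b) measure)"
    by (rule prob_space.finite_measure[OF prob_space_std_gaussian])
  fix v :: "'a \<times> 'b"
  have "char_vec ((std_gaussian :: 'a measure) \<Otimes>\<^sub>M (std_gaussian :: 'b measure)) v =
     char_vec (distr (std_gaussian \<Otimes>\<^sub>M std_gaussian) borel (\<lambda>p. (fst p, 0::'b) + (0::'a, snd p))) v"
    using distr_id2[OF s'[symmetric]] by (simp add: case_prod_beta')
  also have "\<dots> = char_vec (distr std_gaussian borel (\<lambda>x::'a. (x, 0::'b))) v *
      char_vec (distr std_gaussian borel (\<lambda>y::'b. (0::'a, y))) v"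
    by (rule char_vec_pair_sum) (auto intro: prob_space_std_gaussian)
  also have "\<dots> = exp (- (norm (fst v))\<^sup>2 / 2) * exp (- (norm (snd v))\<^sup>2 / 2)"
    by (subst char_vec_std_gaussian_linear[where L'=fst], simp add: linear_iff, simp add: inner_prod_def,
        subst char_vec_std_gaussian_linear[where L'=snd], simp add: linear_iff, simp add: inner_prod_def, simp)
  also have "\<dots> = char_vec std_gaussian v"
    by (simp add: char_vec_std_gaussian norm_prod_def exp_add[symmetric] field_simps flip: of_real_mult)
  finally show "char_vec ((std_gaussian :: 'a measure) \<Otimes>\<^sub>M (std_gaussian :: 'b measure)) v = char_vec std_gaussian v" .
qed simp

section \<open>The space L2 of a probability measure\<close>

lemma L2_measurable: "f \<in> L2 M \<Longrightarrow> f \<in> borel_measurable M"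
  and L2_square_integrable: "f \<in> L2 M \<Longrightarrow> integrable M (\<lambda>x. (f x)\<^sup>2)"
  by (auto simp: L2_def)

lemma L2I: "f \<in> borel_measurable M \<Longrightarrow> integrable M (\<lambda>x. (f x)\<^sup>2) \<Longrightarrow> f \<in> L2 M"
  by (auto simp: L2_def)

lemma L2_integrable_mult:
  assumes f: "f \<in> L2 M" and g: "g \<in> L2 M"
  shows "integrable M (\<lambda>x. f x * g x)"
proof (rule Bochner_Integration.integrable_bound)
  show "integrable M (\<lambda>x. (f x)\<^sup>2 + (g x)\<^sup>2)"
    using f g by (auto intro: L2_square_integrable)
  show "AE x in M. norm (f x * g x) \<le> norm ((f x)\<^sup>2 + (g x)\<^sup>2)"
  proof (rule AE_I2)
    fix x
    have "0 \<le> (\<bar>f x\<bar> - \<bar>g x\<bar>)\<^sup>2" by simp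
    then have "2 * (\<bar>f x\<bar> * \<bar>g x\<bar>) \<le> (f x)\<^sup>2 + (g x)\<^sup>2" by (simp add: power2_diff)
    moreover have "0 \<le> \<bar>f x\<bar> * \<bar>g x\<bar>" by simp
    ultimately show "norm (f x * g x) \<le> norm ((f x)\<^sup>2 + (g x)\<^sup>2)"
      unfolding real_norm_def abs_mult by linarith
  qed
qed (use L2_measurable[OF f] L2_measurable[OF g] in simp)

lemma L2_add:
  assumes "f \<in> L2 M" "g \<in> L2 M" shows "(\<lambda>x. f x + g x) \<in> L2 M"
  using assms[THEN L2_measurable] assms[THEN L2_square_integrable] L2_integrable_mult[OF assms]
  by (intro L2I) (auto simp: power2_sum mult.assoc)

lemma L2_scale: "f \<in> L2 M \<Longrightarrow> (\<lambda>x. c * f x) \<in> L2 M" for c :: real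
  by (rule L2I) (auto dest: L2_measurable L2_square_integrable simp: power_mult_distrib)

lemma L2_uminus: "f \<in> L2 M \<Longrightarrow> (\<lambda>x. - f x) \<in> L2 M"
  using L2_scale[of f M "-1"] by simp

lemma L2_diff: "f \<in> L2 M \<Longrightarrow> g \<in> L2 M \<Longrightarrow> (\<lambda>x. f x - g x) \<in> L2 M"
  using L2_add[OF _ L2_uminus] by simp

lemma L2_divide: "f \<in> L2 M \<Longrightarrow> (\<lambda>x. f x / c) \<in> L2 M" for c :: real
  using L2_scale[of f M "1 / c"] by simp

lemma L2_sum: "(\<And>i. i \<in> I \<Longrightarrow> f i \<in> L2 M) \<Longrightarrow> (\<lambda>x. \<Sum>i\<in>I. f i x) \<in> L2 M"
proof (induction I rule: infinite_finite_induct)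
  case (insert i I) then show ?case by (auto intro!: L2_add)
qed (auto simp: L2_def)

lemma L2_zero: "(\<lambda>_. 0) \<in> L2 M"
  by (auto simp: L2_def)

lemma L2_inner_commute: "L2_inner M f g = L2_inner M g f"
  by (simp add: L2_inner_def mult.commute)

lemma L2_inner_add_left: "f \<in> L2 M \<Longrightarrow> g \<in> L2 M \<Longrightarrow> h \<in> L2 M \<Longrightarrow>
    L2_inner M (\<lambda>x. f x + g x) h = L2_inner M f h + L2_inner M g h"
  by (simp add: L2_inner_def distrib_right L2_integrable_mult)

lemma L2_inner_diff_left: "f \<in> L2 M \<Longrightarrow> g \<in> L2 M \<Longrightarrow> h \<in> L2 M \<Longrightarrow>
    L2_inner M (\<lambda>x. f x - g x) h = L2_inner M f h - L2_inner M g h"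
  by (simp add: L2_inner_def left_diff_distrib L2_integrable_mult)

lemma L2_inner_diff_right: "f \<in> L2 M \<Longrightarrow> g \<in> L2 M \<Longrightarrow> h \<in> L2 M \<Longrightarrow>
    L2_inner M h (\<lambda>x. f x - g x) = L2_inner M h f - L2_inner M h g"
  by (simp add: L2_inner_def right_diff_distrib L2_integrable_mult)

lemma L2_inner_scale_left: "L2_inner M (\<lambda>x. c * f x) h = c * L2_inner M f h"
  by (simp add: L2_inner_def mult.assoc)

lemma L2_inner_scale_right: "L2_inner M f (\<lambda>x. c * h x) = c * L2_inner M f h"
  by (simp add: L2_inner_def mult.left_commute)

lemma L2_norm_nonneg: "0 \<le> L2_norm M f"
  by (simp add: L2_norm_def L2_inner_def)

lemma L2_norm_power2: "(L2_norm M f)\<^sup>2 = (\<integral>x. (f x)\<^sup>2 \<partial>M)"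
  unfolding L2_norm_def L2_inner_def by (subst real_sqrt_pow2) (auto simp: power2_eq_square)

lemma L2_inner_self: "L2_inner M f f = (L2_norm M f)\<^sup>2"
  by (simp add: L2_norm_power2) (simp add: L2_inner_def power2_eq_square)

lemma L2_norm_scale: "L2_norm M (\<lambda>x. c * f x) = \<bar>c\<bar> * L2_norm M f"
  by (simp add: L2_norm_def L2_inner_scale_left L2_inner_scale_right real_sqrt_mult[symmetric] mult.assoc[symmetric])
     (simp add: real_sqrt_mult)

lemma L2_norm_divide: "L2_norm M (\<lambda>x. f x / c) = L2_norm M f / \<bar>c\<bar>"
  using L2_norm_scale[of M "1 / c" f] by simp

lemma L2_norm_minus_commute: "L2_norm M (\<lambda>x. f x - g x) = L2_norm M (\<lambda>x. g x - f x)"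
  by (simp add: L2_norm_def L2_inner_def algebra_simps)

lemma L2_norm_diff_power2:
  assumes "f \<in> L2 M" "g \<in> L2 M"
  shows "(L2_norm M (\<lambda>x. f x - g x))\<^sup>2 = (L2_norm M f)\<^sup>2 - 2 * L2_inner M f g + (L2_norm M g)\<^sup>2"
  using assms by (simp add: L2_inner_self[symmetric] L2_inner_diff_left L2_inner_diff_right L2_diff L2_inner_commute[of M g f])

lemma L2_Cauchy_Schwarz:
  assumes f: "f \<in> L2 M" and g: "g \<in> L2 M"
  shows "\<bar>L2_inner M f g\<bar> \<le> L2_norm M f * L2_norm M g"
proof (rule power2_le_imp_le)
  let ?a = "L2_inner M f g" and ?A = "(L2_norm M f)\<^sup>2" and ?b = "(L2_norm M g)\<^sup>2"
  have *: "0 \<le> s\<^sup>2 * ?A - 2 * (s * t * ?a) + t\<^sup>2 * ?b" for s t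
    using L2_norm_diff_power2[OF L2_scale[OF f, of s] L2_scale[OF g, of t]]
    by (simp add: L2_norm_scale L2_inner_scale_left L2_inner_scale_right power_mult_distrib mult.assoc)
       (metis mult.left_commute zero_le_power2)
  have "?a\<^sup>2 \<le> ?A * ?b"
  proof (cases "?b = 0")
    case True
    have "?a = 0"
    proof (rule ccontr)
      assume "?a \<noteq> 0"
      \<comment> \<open>With \<open>L2_norm M g = 0\<close> the quadratic form is affine in
        \<open>t\<close>; this \<open>t\<close> makes it equal to -1.\<close>
      then show False using *[of 1 "(?A + 1) / (2 * ?a)"] True by simp
    qed
    then show ?thesis by simp
  next
    case False
    then have b: "?b > 0" using zero_le_power2[of "L2_norm M g"] by linarith
    from *[of ?b ?a] have "0 \<le> ?b * (?b * ?A - ?a\<^sup>2)" by (simp add: power2_eq_square algebra_simps)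
    with b have "0 \<le> ?b * ?A - ?a\<^sup>2" by (simp add: zero_le_mult_iff)
    then show ?thesis by (simp add: mult.commute)
  qed
  then show "\<bar>?a\<bar>\<^sup>2 \<le> (L2_norm M f * L2_norm M g)\<^sup>2" by (simp add: power_mult_distrib)
qed (simp add: L2_norm_nonneg)

lemma L2_norm_triangle:
  assumes f: "f \<in> L2 M" and g: "g \<in> L2 M"
  shows "L2_norm M (\<lambda>x. f x + g x) \<le> L2_norm M f + L2_norm M g"
proof (rule power2_le_imp_le)
  have "(L2_norm M (\<lambda>x. f x + g x))\<^sup>2 = (L2_norm M f)\<^sup>2 + 2 * L2_inner M f g + (L2_norm M g)\<^sup>2"
    using L2_norm_diff_power2[OF f L2_uminus[OF g]] L2_inner_scale_right[of M f "-1" g] L2_norm_scale[of M "-1" g]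
    by simp
  also have "\<dots> \<le> (L2_norm M f + L2_norm M g)\<^sup>2"
    using L2_Cauchy_Schwarz[OF f g] by (simp add: power2_sum)
  finally show "(L2_norm M (\<lambda>x. f x + g x))\<^sup>2 \<le> (L2_norm M f + L2_norm M g)\<^sup>2" .
qed (simp add: L2_norm_nonneg)

lemma L2_norm_triangle_diff:
  assumes "f \<in> L2 M" "g \<in> L2 M" "h \<in> L2 M"
  shows "L2_norm M (\<lambda>x. f x - h x) \<le> L2_norm M (\<lambda>x. f x - g x) + L2_norm M (\<lambda>x. g x - h x)"
  using L2_norm_triangle[OF L2_diff[OF assms(1,2)] L2_diff[OF assms(2,3)]] by simp

lemma L2_norm_triangle_sum:
  assumes "finite I" "\<And>i. i \<in> I \<Longrightarrow> f i \<in> L2 M"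
  shows "L2_norm M (\<lambda>x. \<Sum>i\<in>I. f i x) \<le> (\<Sum>i\<in>I. L2_norm M (f i))"
  using assms
proof (induction I rule: finite_induct)
  case (insert i I)
  then have "L2_norm M (\<lambda>x. f i x + (\<Sum>i\<in>I. f i x)) \<le> L2_norm M (f i) + L2_norm M (\<lambda>x. \<Sum>i\<in>I. f i x)"
    by (intro L2_norm_triangle L2_sum) auto
  with insert show ?case by (simp add: add_left_mono order_trans)
qed (simp add: L2_norm_def L2_inner_def)

lemma L2_norm_AE_cong:
  assumes "f \<in> borel_measurable M" "g \<in> borel_measurable M" "AE x in M. f x = g x"
  shows "L2_norm M f = L2_norm M g"
  unfolding L2_norm_def L2_inner_def using assms
  by (intro arg_cong[where f=sqrt] integral_cong_AE) auto

lemma L2_inner_AE_cong: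
  assumes "f \<in> borel_measurable M" "g \<in> borel_measurable M" "AE x in M. f x = g x" "h \<in> borel_measurable M"
  shows "L2_inner M f h = L2_inner M g h"
  unfolding L2_inner_def using assms by (intro integral_cong_AE) auto

lemma L2_norm_0_AE:
  assumes "f \<in> L2 M" "L2_norm M f = 0" shows "AE x in M. f x = 0"
proof -
  have "(\<integral>x. (f x)\<^sup>2 \<partial>M) = 0" using assms(2) by (simp add: L2_norm_power2[symmetric])
  then show ?thesis
    using integral_nonneg_eq_0_iff_AE[OF L2_square_integrable[OF assms(1)]] by simp
qed

context prob_space begin

lemma L2_const: "(\<lambda>_. c) \<in> L2 M"
  by (auto simp: L2_def)

lemma L2_norm_const: "L2_norm M (\<lambda>_. c) = \<bar>c\<bar>"
  by (simp add: L2_norm_def L2_inner_def prob_space real_sqrt_mult_self)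

lemma L2_integrable: "f \<in> L2 M \<Longrightarrow> integrable M f"
  using L2_integrable_mult[OF _ L2_const[of 1]] by simp

lemma L2_bounded:
  assumes "f \<in> borel_measurable M" "\<And>x. \<bar>f x\<bar> \<le> B" shows "f \<in> L2 M"
proof (rule L2I)
  show "integrable M (\<lambda>x. (f x)\<^sup>2)"
  proof (rule integrable_const_bound[where B="B\<^sup>2"])
    have "(f x)\<^sup>2 \<le> B\<^sup>2" for x
      using power_mono[OF assms(2)[of x], of 2] by simp
    then show "AE x in M. norm ((f x)\<^sup>2) \<le> B\<^sup>2" by simp
  qed (use assms(1) in auto)
qed fact

lemma L2_abs_integral_le: "f \<in> L2 M \<Longrightarrow> (\<integral>x. \<bar>f x\<bar> \<partial>M) \<le> L2_norm M f"
proof -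
  assume f: "f \<in> L2 M"
  then have a: "(\<lambda>x. \<bar>f x\<bar>) \<in> L2 M" by (auto simp: L2_def)
  have "\<bar>L2_inner M (\<lambda>x. \<bar>f x\<bar>) (\<lambda>_. 1)\<bar> \<le> L2_norm M (\<lambda>x. \<bar>f x\<bar>) * L2_norm M (\<lambda>_. 1)"
    by (rule L2_Cauchy_Schwarz[OF a L2_const])
  moreover have "L2_norm M (\<lambda>x. \<bar>f x\<bar>) = L2_norm M f" by (simp add: L2_norm_def L2_inner_def)
  ultimately show ?thesis by (simp add: L2_norm_const) (simp add: L2_inner_def)
qed

lemma L2_integral_le: "f \<in> L2 M \<Longrightarrow> \<bar>\<integral>x. f x \<partial>M\<bar> \<le> L2_norm M f"
  using L2_abs_integral_le[of f] integral_abs_bound[of M f] by linarith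

lemma L2_integral_power2_le: "f \<in> L2 M \<Longrightarrow> (\<integral>x. f x \<partial>M)\<^sup>2 \<le> (\<integral>x. (f x)\<^sup>2 \<partial>M)"
  using power_mono[OF L2_integral_le[of f], where n=2] by (simp add: L2_norm_power2)

text \<open>Riesz-Fischer: an L2 Cauchy sequence is Cauchy in L1, which yields an almost everywhere
  convergent subsequence; Fatou turns the Cauchy bound into a bound for the distance to its
  limit.\<close>

lemma L2_complete:
  fixes f :: "nat \<Rightarrow> 'a \<Rightarrow> real"
  assumes f: "\<And>n. f n \<in> L2 M"
    and C: "\<And>e. e > 0 \<Longrightarrow> \<exists>N. \<forall>m\<ge>N. \<forall>n\<ge>N. L2_norm M (\<lambda>x. f m x - f n x) < e"
  obtains g where "g \<in> L2 M" "(\<lambda>n. L2_norm M (\<lambda>x. f n x - g x)) \<longlonglongrightarrow> 0"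
proof -
  note [measurable] = L2_measurable[OF f]
  have "\<exists>N. \<forall>i\<ge>N. \<forall>j\<ge>N. (LINT x|M. norm (f i x - f j x)) < e" if "e > 0" for e
  proof -
    from C[OF that] obtain N where N: "\<And>m n. m \<ge> N \<Longrightarrow> n \<ge> N \<Longrightarrow> L2_norm M (\<lambda>x. f m x - f n x) < e"
      by blast
    show ?thesis
      using N L2_abs_integral_le[OF L2_diff[OF f f]] by (intro exI[of _ N]) (simp, meson le_less_trans)
  qed
  then obtain r where r: "strict_mono r" "AE x in M. Cauchy (\<lambda>i. f (r i) x)"
    using cauchy_L1_AE_cauchy_subseq[of M f] L2_integrable[OF f] by blast
  \<comment> \<open>Where the subsequence does not converge, \<open>lim\<close> is an unspecified
    value; this happens on a null set only.\<close>
  define g where "g x = lim (\<lambda>i. f (r i) x)" for x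
  have [measurable]: "g \<in> borel_measurable M" unfolding g_def by measurable
  have lim: "AE x in M. (\<lambda>i. f (r i) x) \<longlonglongrightarrow> g x"
    using r(2) by eventually_elim (simp add: g_def Cauchy_convergent_iff convergent_LIMSEQ_iff)
  have bnd: "(\<integral>\<^sup>+x. ennreal ((f n x - g x)\<^sup>2) \<partial>M) \<le> ennreal (e\<^sup>2)"
    if N: "\<And>m n. m \<ge> N \<Longrightarrow> n \<ge> N \<Longrightarrow> L2_norm M (\<lambda>x. f m x - f n x) < e" and n: "n \<ge> N" for N n e
  proof -
    have "(\<integral>\<^sup>+x. ennreal ((f n x - g x)\<^sup>2) \<partial>M) = (\<integral>\<^sup>+x. liminf (\<lambda>i. ennreal ((f n x - f (r i) x)\<^sup>2)) \<partial>M)"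
    proof (rule nn_integral_cong_AE)
      show "AE x in M. ennreal ((f n x - g x)\<^sup>2) = liminf (\<lambda>i. ennreal ((f n x - f (r i) x)\<^sup>2))"
        using lim
      proof eventually_elim
        case (elim x)
        then have "(\<lambda>i. ennreal ((f n x - f (r i) x)\<^sup>2)) \<longlonglongrightarrow> ennreal ((f n x - g x)\<^sup>2)"
          by (intro tendsto_ennrealI tendsto_intros)
        then show ?case by (rule lim_imp_Liminf[OF trivial_limit_sequentially, symmetric])
      qed
    qed
    also have "\<dots> \<le> liminf (\<lambda>i. \<integral>\<^sup>+x. ennreal ((f n x - f (r i) x)\<^sup>2) \<partial>M)"
      by (rule nn_integral_liminf) measurable
    also have "\<dots> \<le> ennreal (e\<^sup>2)"
    proof (rule Liminf_le)
      show "\<forall>\<^sub>F i in sequentially. (\<integral>\<^sup>+x. ennreal ((f n x - f (r i) x)\<^sup>2) \<partial>M) \<le> ennreal (e\<^sup>2)"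
        using eventually_ge_at_top[of N]
      proof eventually_elim
        case (elim i)
        then have "r i \<ge> N" using seq_suble[OF r(1), of i] by linarith
        then have "L2_norm M (\<lambda>x. f n x - f (r i) x) < e" using N n by blast
        then have "(L2_norm M (\<lambda>x. f n x - f (r i) x))\<^sup>2 \<le> e\<^sup>2"
          by (intro power_mono) (auto simp: L2_norm_nonneg)
        then show ?case
          by (subst nn_integral_eq_integral)
             (auto simp: L2_norm_power2[symmetric] intro!: L2_square_integrable L2_diff f ennreal_leI)
      qed
    qed simp
    finally show ?thesis .
  qed
  have gd: "(\<lambda>x. f n x - g x) \<in> L2 M" "L2_norm M (\<lambda>x. f n x - g x) \<le> e"
    if N: "\<And>m n. m \<ge> N \<Longrightarrow> n \<ge> N \<Longrightarrow> L2_norm M (\<lambda>x. f m x - f n x) < e" and n: "n \<ge> N" and e: "e > 0" for N n e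
  proof -
    show *: "(\<lambda>x. f n x - g x) \<in> L2 M"
      using bnd[OF N n] by (intro L2I) (auto simp: integrable_iff_bounded intro: le_less_trans)
    have "ennreal (\<integral>x. (f n x - g x)\<^sup>2 \<partial>M) \<le> ennreal (e\<^sup>2)"
      using bnd[OF N n] nn_integral_eq_integral[OF L2_square_integrable[OF *]] by simp
    then show "L2_norm M (\<lambda>x. f n x - g x) \<le> e"
      by - (rule power2_le_imp_le, use e in \<open>auto simp: L2_norm_power2\<close>)
  qed
  obtain N where N: "\<And>m n. m \<ge> N \<Longrightarrow> n \<ge> N \<Longrightarrow> L2_norm M (\<lambda>x. f m x - f n x) < 1"
    using C[of 1] by auto
  have "(\<lambda>x. f N x - g x) \<in> L2 M"
    by (rule gd(1)[OF N order_refl]) auto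
  then have "g \<in> L2 M" using L2_diff[OF f[of N]] by force
  moreover have "(\<lambda>n. L2_norm M (\<lambda>x. f n x - g x)) \<longlonglongrightarrow> 0"
  proof (rule LIMSEQ_I)
    fix e :: real assume "e > 0"
    then obtain N where N: "\<And>m n. m \<ge> N \<Longrightarrow> n \<ge> N \<Longrightarrow> L2_norm M (\<lambda>x. f m x - f n x) < e / 2"
      using C[of "e / 2"] by auto
    show "\<exists>N. \<forall>n\<ge>N. norm (L2_norm M (\<lambda>x. f n x - g x) - 0) < e"
      using gd(2)[OF N] \<open>e > 0\<close> by (intro exI[of _ N]) (force simp: L2_norm_nonneg)
  qed
  ultimately show thesis by (rule that)
qed

text \<open>Functions stand for their classes, so closedness is stated through approximation in the
  seminorm; \<open>S\<close> is then also stable under measurable changes on null sets. A minimising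
  sequence is Cauchy by the parallelogram identity, and its limit is varied inside
  \<open>S\<close>.\<close>

lemma L2_projection:
  assumes S: "S \<subseteq> L2 M" "S \<noteq> {}"
    and add: "\<And>f g. f \<in> S \<Longrightarrow> g \<in> S \<Longrightarrow> (\<lambda>x. f x + g x) \<in> S"
    and scale: "\<And>c f. f \<in> S \<Longrightarrow> (\<lambda>x. c * f x) \<in> S"
    and closed: "\<And>f. f \<in> L2 M \<Longrightarrow> (\<And>e. e > 0 \<Longrightarrow> \<exists>g\<in>S. L2_norm M (\<lambda>x. f x - g x) < e) \<Longrightarrow> f \<in> S"
    and f: "f \<in> L2 M"
  obtains g where "g \<in> S" "\<And>h. h \<in> S \<Longrightarrow> L2_inner M (\<lambda>x. f x - g x) h = 0"
proof -
  let ?D = "(\<lambda>g. (L2_norm M (\<lambda>x. f x - g x))\<^sup>2) ` S"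
  define d where "d = Inf ?D"
  have bdd: "bdd_below ?D" by (rule bdd_belowI[of _ 0]) auto
  have d_le: "d \<le> (L2_norm M (\<lambda>x. f x - g x))\<^sup>2" if "g \<in> S" for g
    unfolding d_def by (rule cInf_lower[OF _ bdd]) (use that in auto)
  have "\<exists>g\<in>S. (L2_norm M (\<lambda>x. f x - g x))\<^sup>2 < d + 1 / Suc n" for n
    using cInf_lessD[of ?D "d + 1 / Suc n"] S(2) by (auto simp: d_def)
  then obtain g where g: "\<And>n. g n \<in> S" "\<And>n. (L2_norm M (\<lambda>x. f x - g n x))\<^sup>2 < d + 1 / Suc n"
    by metis
  have gL: "g n \<in> L2 M" for n using g(1) S(1) by auto
  have par: "(L2_norm M (\<lambda>x. g m x - g n x))\<^sup>2 \<le> 2 / Suc m + 2 / Suc n" for m n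
  proof -
    define a b where "a = (\<lambda>x. f x - g m x)" and "b = (\<lambda>x. f x - g n x)"
    have ab: "a \<in> L2 M" "b \<in> L2 M" unfolding a_def b_def by (auto intro: L2_diff f gL)
    \<comment> \<open>The midpoint is a competitor; with the parallelogram identity this bounds the
      distance of \<open>g m\<close> and \<open>g n\<close>.\<close>
    have "(\<lambda>x. (1/2) * (g m x + g n x)) \<in> S" by (intro scale add g)
    from d_le[OF this] have "4 * d \<le> 4 * (L2_norm M (\<lambda>x. (1/2) * (a x + b x)))\<^sup>2"
      by (simp add: a_def b_def algebra_simps add_divide_distrib)
    also have "\<dots> = (L2_norm M (\<lambda>x. a x + b x))\<^sup>2"
      by (subst L2_norm_scale) (simp add: power_divide)
    also have "\<dots> = (L2_norm M a)\<^sup>2 + 2 * L2_inner M a b + (L2_norm M b)\<^sup>2"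
      using L2_norm_diff_power2[OF ab(1) L2_uminus[OF ab(2)]] L2_inner_scale_right[of M a "-1" b] L2_norm_scale[of M "-1" b]
      by simp
    finally have 1: "4 * d \<le> (L2_norm M a)\<^sup>2 + 2 * L2_inner M a b + (L2_norm M b)\<^sup>2" .
    have "L2_norm M (\<lambda>x. g m x - g n x) = L2_norm M (\<lambda>x. b x - a x)" by (simp add: a_def b_def)
    then have "(L2_norm M (\<lambda>x. g m x - g n x))\<^sup>2 = (L2_norm M b)\<^sup>2 - 2 * L2_inner M b a + (L2_norm M a)\<^sup>2"
      by (simp add: L2_norm_diff_power2[OF ab(2,1)])
    with 1 have "(L2_norm M (\<lambda>x. g m x - g n x))\<^sup>2 \<le> 2 * (L2_norm M a)\<^sup>2 + 2 * (L2_norm M b)\<^sup>2 - 4 * d"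
      by (simp add: L2_inner_commute[of M b a])
    also have "\<dots> \<le> 2 / Suc m + 2 / Suc n"
      using g(2)[of m] g(2)[of n] by (simp add: a_def b_def)
    finally show ?thesis .
  qed
  obtain p where p: "p \<in> L2 M" "(\<lambda>n. L2_norm M (\<lambda>x. g n x - p x)) \<longlonglongrightarrow> 0"
  proof (rule L2_complete[of g])
    fix e :: real assume e: "e > 0"
    obtain N where N: "4 / e\<^sup>2 < real N" using reals_Archimedean2 by blast
    have "L2_norm M (\<lambda>x. g m x - g n x) < e" if "m \<ge> N" "n \<ge> N" for m n
    proof (rule power2_less_imp_less)
      have "4 / e\<^sup>2 < Suc m" "4 / e\<^sup>2 < Suc n" using N that by linarith+
      then have "2 / Suc m < e\<^sup>2 / 2" "2 / Suc n < e\<^sup>2 / 2" using e by (simp_all add: field_simps)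
      then show "(L2_norm M (\<lambda>x. g m x - g n x))\<^sup>2 < e\<^sup>2" using par[of m n] by linarith
    qed (use e in simp)
    then show "\<exists>N. \<forall>m\<ge>N. \<forall>n\<ge>N. L2_norm M (\<lambda>x. g m x - g n x) < e" by blast
  qed (use gL in auto)
  have pS: "p \<in> S"
  proof (rule closed[OF p(1)])
    fix e :: real assume "e > 0"
    with p(2) obtain n where "L2_norm M (\<lambda>x. g n x - p x) < e"
      by (metis (no_types, lifting) order_tendstoD(2) eventually_happens trivial_limit_sequentially)
    then show "\<exists>g\<in>S. L2_norm M (\<lambda>x. p x - g x) < e"
      using g(1) by (intro bexI[of _ "g n"]) (simp_all add: L2_norm_minus_commute[of M p])
  qed
  have pd: "(L2_norm M (\<lambda>x. f x - p x))\<^sup>2 \<le> d"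
  proof (rule LIMSEQ_le)
    have "(\<lambda>n. (sqrt (d + 1 / Suc n) + L2_norm M (\<lambda>x. g n x - p x))\<^sup>2) \<longlonglongrightarrow> (sqrt (d + 0) + 0)\<^sup>2"
      by (intro tendsto_intros p(2) lim_1_over_n[THEN LIMSEQ_Suc])
    then show "(\<lambda>n. (sqrt (d + 1 / Suc n) + L2_norm M (\<lambda>x. g n x - p x))\<^sup>2) \<longlonglongrightarrow> d"
    proof -
      have "0 \<le> d" unfolding d_def by (rule cInf_greatest) (use S(2) in auto)
      with \<open>_ \<longlonglongrightarrow> (sqrt (d + 0) + 0)\<^sup>2\<close> show ?thesis by simp
    qed
    have "L2_norm M (\<lambda>x. f x - p x) \<le> sqrt (d + 1 / Suc n) + L2_norm M (\<lambda>x. g n x - p x)" for n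
    proof -
      have "L2_norm M (\<lambda>x. f x - g n x) \<le> sqrt (d + 1 / Suc n)"
        using g(2)[of n] by (intro real_le_rsqrt) simp
      then show ?thesis using L2_norm_triangle_diff[OF f gL p(1), of n] by linarith
    qed
    then show "\<exists>N. \<forall>n\<ge>N. (L2_norm M (\<lambda>x. f x - p x))\<^sup>2 \<le> (sqrt (d + 1 / Suc n) + L2_norm M (\<lambda>x. g n x - p x))\<^sup>2"
      by (intro exI[of _ 0] allI impI power_mono) (auto simp: L2_norm_nonneg)
  qed simp
  have "L2_inner M (\<lambda>x. f x - p x) h = 0" if h: "h \<in> S" for h
  proof (rule ccontr)
    let ?a = "L2_inner M (\<lambda>x. f x - p x) h"
    have hL: "h \<in> L2 M" using h S by auto
    assume a: "?a \<noteq> 0"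
    have *: "2 * (t * ?a) \<le> t\<^sup>2 * (L2_norm M h)\<^sup>2" for t
    proof -
      have "(\<lambda>x. p x + t * h x) \<in> S" by (intro add scale pS h)
      from d_le[OF this] pd have "(L2_norm M (\<lambda>x. f x - p x))\<^sup>2 \<le> (L2_norm M (\<lambda>x. (f x - p x) - t * h x))\<^sup>2"
        by (simp add: algebra_simps)
      then show ?thesis
        by (subst (asm) (2) L2_norm_diff_power2)
           (auto intro!: L2_diff L2_scale f p hL simp: L2_inner_scale_right L2_norm_scale power_mult_distrib)
    qed
    \<comment> \<open>The summand 1 keeps \<open>K\<close> positive when \<open>h\<close> has norm
      0.\<close>
    define K where "K = (L2_norm M h)\<^sup>2 + 1"
    have K: "K > 0" by (simp add: K_def add_nonneg_pos)
    have "2 * (?a / K * ?a) \<le> (?a / K)\<^sup>2 * (K - 1)" using *[of "?a / K"] by (simp add: K_def)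
    also have "\<dots> \<le> (?a / K)\<^sup>2 * K" by (intro mult_left_mono) auto
    also have "\<dots> = ?a / K * ?a" using K by (simp add: power2_eq_square field_simps)
    finally have "?a / K * ?a \<le> 0" by linarith
    moreover have "?a / K * ?a = ?a\<^sup>2 / K" by (simp add: power2_eq_square)
    then have "?a / K * ?a > 0" using K a by simp
    ultimately show False by linarith
  qed
  with pS show thesis by (rule that)
qed

end

section \<open>Transport along measure-preserving maps and partial integration\<close>

lemma L2_distr_iff:
  assumes "Z \<in> measurable M N" "f \<in> borel_measurable N"
  shows "f \<in> L2 (distr M N Z) \<longleftrightarrow> (\<lambda>x. f (Z x)) \<in> L2 M"
  using assms by (auto simp: L2_def integrable_distr_eq)

lemma L2_compose:
  assumes "Z \<in> measurable M N" "distr M N Z = N" "f \<in> L2 N"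
  shows "(\<lambda>x. f (Z x)) \<in> L2 M"
  using L2_distr_iff[OF assms(1) L2_measurable[OF assms(3)]] assms by simp

lemma integral_compose:
  fixes f :: "'a \<Rightarrow> real"
  assumes "Z \<in> measurable M N" "distr M N Z = N" "f \<in> borel_measurable N"
  shows "(\<integral>x. f (Z x) \<partial>M) = (\<integral>x. f x \<partial>N)"
  using integral_distr[OF assms(1,3)] assms by simp

lemma L2_inner_compose:
  assumes "Z \<in> measurable M N" "distr M N Z = N" "f \<in> borel_measurable N" "g \<in> borel_measurable N"
  shows "L2_inner M (\<lambda>x. f (Z x)) (\<lambda>x. g (Z x)) = L2_inner N f g"
  using integral_compose[OF assms(1,2), of "\<lambda>x. f x * g x"] assms by (simp add: L2_inner_def)

lemma L2_norm_compose:
  assumes "Z \<in> measurable M N" "distr M N Z = N" "f \<in> borel_measurable N"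
  shows "L2_norm M (\<lambda>x. f (Z x)) = L2_norm N f"
  using L2_inner_compose[OF assms assms(3)] by (simp add: L2_norm_def)

lemma AE_compose:
  assumes "Z \<in> measurable M N" "distr M N Z = N" "AE x in N. P x"
  shows "AE x in M. P (Z x)"
  by (rule AE_distrD[OF assms(1)]) (unfold assms(2), rule assms(3))

text \<open>\<open>T\<close> is the conditional expectation of \<open>G\<close> given the first
  coordinate: Jensen gives the contraction, and the identity for \<open>L2_inner\<close> says that
  it is adjoint to \<open>h \<mapsto> h \<circ> fst\<close>. The Mehler operators, the transition
  semigroup and its time integral are all instances.\<close>

lemma (in pair_prob_space) L2_partial_integral:
  fixes G :: "'a \<times> 'b \<Rightarrow> real"
  assumes G: "G \<in> L2 (M1 \<Otimes>\<^sub>M M2)"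
  defines "T \<equiv> \<lambda>x. \<integral>y. G (x, y) \<partial>M2"
  shows "T \<in> L2 M1" "L2_norm M1 T \<le> L2_norm (M1 \<Otimes>\<^sub>M M2) G" "(\<integral>x. T x \<partial>M1) = (\<integral>p. G p \<partial>(M1 \<Otimes>\<^sub>M M2))"
    "\<And>h. h \<in> L2 M1 \<Longrightarrow> L2_inner M1 T h = L2_inner (M1 \<Otimes>\<^sub>M M2) G (\<lambda>p. h (fst p))"
    "\<And>h. h \<in> L2 M1 \<Longrightarrow> (\<lambda>p. h (fst p)) \<in> L2 (M1 \<Otimes>\<^sub>M M2)"
    "AE x in M1. integrable M2 (\<lambda>y. G (x, y))"
proof -
  note [measurable] = L2_measurable[OF G]
  have m [measurable]: "T \<in> borel_measurable M1" unfolding T_def by measurable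
  note iG2 = L2_square_integrable[OF G]
  have "AE x in M1. integrable M2 (\<lambda>y. (G (x, y))\<^sup>2)"
    using AE_integrable_fst'[OF iG2] .
  then have le: "AE x in M1. (T x)\<^sup>2 \<le> (\<integral>y. (G (x, y))\<^sup>2 \<partial>M2) \<and> integrable M2 (\<lambda>y. G (x, y))"
    using AE_space
  proof eventually_elim
    case (elim x)
    then have "(\<lambda>y. G (x, y)) \<in> L2 M2" by (intro L2I) auto
    then show ?case unfolding T_def using M2.L2_integral_power2_le M2.L2_integrable by blast
  qed
  then show "AE x in M1. integrable M2 (\<lambda>y. G (x, y))" by auto
  have i2: "integrable M1 (\<lambda>x. \<integral>y. (G (x, y))\<^sup>2 \<partial>M2)" by (rule integrable_fst'[OF iG2])
  have iT: "integrable M1 (\<lambda>x. (T x)\<^sup>2)"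
    by (rule Bochner_Integration.integrable_bound[OF i2]) (use le in \<open>auto elim!: eventually_mono\<close>)
  then show TL: "T \<in> L2 M1" by (intro L2I m)
  have "(\<integral>x. (T x)\<^sup>2 \<partial>M1) \<le> (\<integral>x. \<integral>y. (G (x, y))\<^sup>2 \<partial>M2 \<partial>M1)"
    by (rule integral_mono_AE[OF iT i2]) (use le in auto)
  also have "\<dots> = (\<integral>p. (G p)\<^sup>2 \<partial>(M1 \<Otimes>\<^sub>M M2))" by (rule integral_fst'[OF iG2])
  finally show "L2_norm M1 T \<le> L2_norm (M1 \<Otimes>\<^sub>M M2) G"
    by - (rule power2_le_imp_le, auto simp: L2_norm_power2 L2_norm_nonneg)
  show "(\<integral>x. T x \<partial>M1) = (\<integral>p. G p \<partial>(M1 \<Otimes>\<^sub>M M2))"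
    unfolding T_def by (rule integral_fst'[OF P.L2_integrable[OF G]])
  fix h assume h: "h \<in> L2 M1"
  note [measurable] = L2_measurable[OF h]
  show h': "(\<lambda>p. h (fst p)) \<in> L2 (M1 \<Otimes>\<^sub>M M2)"
    using L2_distr_iff[of fst "M1 \<Otimes>\<^sub>M M2" M1 h] h M2.distr_pair_fst[of M1] by simp
  show "L2_inner M1 T h = L2_inner (M1 \<Otimes>\<^sub>M M2) G (\<lambda>p. h (fst p))"
    unfolding L2_inner_def T_def
    using integral_fst'[OF L2_integrable_mult[OF G h']] by simp
qed

lemma L2_zero_mean_L2: "f \<in> L2_zero_mean M \<Longrightarrow> f \<in> L2 M"
  by (simp add: L2_zero_mean_def)

lemma L2_zero_mean_add: "prob_space M \<Longrightarrow> f \<in> L2_zero_mean M \<Longrightarrow> g \<in> L2_zero_mean M \<Longrightarrow> (\<lambda>x. f x + g x) \<in> L2_zero_mean M"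
  by (auto simp: L2_zero_mean_def L2_add prob_space.L2_integrable)

lemma L2_zero_mean_diff: "prob_space M \<Longrightarrow> f \<in> L2_zero_mean M \<Longrightarrow> g \<in> L2_zero_mean M \<Longrightarrow> (\<lambda>x. f x - g x) \<in> L2_zero_mean M"
  by (auto simp: L2_zero_mean_def L2_diff prob_space.L2_integrable)

lemma L2_zero_mean_scale: "f \<in> L2_zero_mean M \<Longrightarrow> (\<lambda>x. c * f x) \<in> L2_zero_mean M"
  by (auto simp: L2_zero_mean_def L2_scale)

lemma L2_zero_mean_closed:
  assumes M: "prob_space M" and u: "u \<in> L2 M"
    and ap: "\<And>e. e > 0 \<Longrightarrow> \<exists>g\<in>L2_zero_mean M. L2_norm M (\<lambda>x. u x - g x) < e"
  shows "u \<in> L2_zero_mean M"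
proof -
  interpret prob_space M by fact
  have "\<bar>\<integral>x. u x \<partial>M\<bar> < e" if pos: "e > 0" for e
  proof -
    obtain g where g: "g \<in> L2_zero_mean M" "L2_norm M (\<lambda>x. u x - g x) < e" using ap[OF pos] by blast
    have gL: "g \<in> L2 M" using g(1) by (rule L2_zero_mean_L2)
    have "(\<integral>x. u x \<partial>M) = (\<integral>x. u x - g x \<partial>M)"
      using g(1) L2_integrable[OF u] L2_integrable[OF gL] by (simp add: L2_zero_mean_def)
    then show ?thesis using g(2) L2_integral_le[OF L2_diff[OF u gL]] by simp
  qed
  then have "(\<integral>x. u x \<partial>M) = 0" by (metis less_irrefl zero_less_abs_iff)
  then show ?thesis using u by (simp add: L2_zero_mean_def)
qed

section \<open>Test functions\<close>

lemma Ck_SucI: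
  assumes "\<And>x. (f has_derivative f' x) (at x)" "\<And>b. b \<in> Basis \<Longrightarrow> Ck k (\<lambda>x. f' x b)"
  shows "Ck (Suc k) f"
proof -
  have "frechet_derivative f (at x) = f' x" for x
    using frechet_derivative_at[OF assms(1)] by simp
  then show ?thesis using assms by (auto simp: differentiable_def)
qed

lemma Ck_has_derivative: "Ck (Suc k) f \<Longrightarrow> (f has_derivative frechet_derivative f (at x)) (at x)"
  by (simp add: frechet_derivative_works)

lemma Ck_Suc_imp_Ck: "Ck (Suc k) f \<Longrightarrow> Ck k f"
proof (induction k arbitrary: f)
  case 0
  then show ?case
    by (auto simp: continuous_on_eq_continuous_at intro: differentiable_imp_continuous_within)
next
  case (Suc k)
  then show ?case by (metis Ck.simps(2))
qed

lemma Ck_continuous: "Ck k f \<Longrightarrow> continuous_on UNIV f"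
proof (induction k)
  case (Suc k) then show ?case using Ck_Suc_imp_Ck by blast
qed simp

lemma Ck_const: "Ck k (\<lambda>_. c)"
proof (induction k arbitrary: c)
  case (Suc k) show ?case by (rule Ck_SucI[where f'="\<lambda>_ _. 0"]) (auto intro: Suc)
qed simp

lemma Ck_add: "Ck k f \<Longrightarrow> Ck k g \<Longrightarrow> Ck k (\<lambda>x. f x + g x)"
proof (induction k arbitrary: f g)
  case (Suc k)
  show ?case
    by (rule Ck_SucI[OF has_derivative_add[OF Ck_has_derivative[OF Suc.prems(1)] Ck_has_derivative[OF Suc.prems(2)]]])
       (use Suc in auto)
qed (auto intro: continuous_intros)

lemma Ck_mult: "Ck k f \<Longrightarrow> Ck k g \<Longrightarrow> Ck k (\<lambda>x. f x * g x)"
proof (induction k arbitrary: f g)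
  case (Suc k)
  show ?case
  proof (rule Ck_SucI[OF has_derivative_mult[OF Ck_has_derivative[OF Suc.prems(1)] Ck_has_derivative[OF Suc.prems(2)]]])
    fix b :: 'a assume b: "b \<in> Basis"
    show "Ck k (\<lambda>x. f x * frechet_derivative g (at x) b + frechet_derivative f (at x) b * g x)"
      by (intro Ck_add Suc.IH Ck_Suc_imp_Ck[OF Suc.prems(1)] Ck_Suc_imp_Ck[OF Suc.prems(2)])
         (use Suc.prems b in auto)
  qed
qed (auto intro: continuous_intros)

lemma Ck_scale: "Ck k f \<Longrightarrow> Ck k (\<lambda>x. c * f x)"
  by (rule Ck_mult[OF Ck_const])

lemma Ck_sum: "(\<And>i. i \<in> I \<Longrightarrow> Ck k (f i)) \<Longrightarrow> Ck k (\<lambda>x. \<Sum>i\<in>I. f i x)"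
  by (induction I rule: infinite_finite_induct) (auto intro: Ck_add Ck_const)

lemma Ck_inner: "Ck k (\<lambda>x. v \<bullet> x)"
proof (cases k)
  case (Suc j)
  show ?thesis
    unfolding Suc by (rule Ck_SucI[where f'="\<lambda>_ h. v \<bullet> h"]) (rule Ck_const | auto intro!: derivative_eq_intros)+
qed (auto intro: continuous_intros)

text \<open>Differentiation exchanges the two families up to constants, hence the simultaneous
  induction.\<close>

lemma Ck_cos_sin: "Ck k (\<lambda>x. cos (v \<bullet> x)) \<and> Ck k (\<lambda>x. sin (v \<bullet> x))"
proof (induction k)
  case (Suc k)
  have "Ck (Suc k) (\<lambda>x. cos (v \<bullet> x))"
    by (rule Ck_SucI[where f'="\<lambda>x h. (- 1) * ((v \<bullet> h) * sin (v \<bullet> x))"])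
       ((auto intro!: derivative_eq_intros)[1], intro Ck_mult Ck_const, use Suc in simp)
  moreover have "Ck (Suc k) (\<lambda>x. sin (v \<bullet> x))"
    by (rule Ck_SucI[where f'="\<lambda>x h. (v \<bullet> h) * cos (v \<bullet> x)"])
       ((auto intro!: derivative_eq_intros)[1], intro Ck_mult Ck_const, use Suc in simp)
  ultimately show ?case ..
qed (auto intro!: continuous_intros)

text \<open>\<open>Ck\<close> speaks of derivatives along basis vectors, whereas the chain rule
  produces the direction \<open>A b\<close>; it is expanded in the basis before the induction
  hypothesis applies.\<close>

lemma Ck_compose_linear:
  fixes A :: "'a::euclidean_space \<Rightarrow> 'b::euclidean_space"
  assumes A: "linear A"
  shows "Ck k f \<Longrightarrow> Ck k (\<lambda>x. f (A x))"
proof (induction k arbitrary: f)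
  case 0
  then show ?case
    using continuous_on_compose2[of UNIV f UNIV A] linear_continuous_on[OF linear_conv_bounded_linear[THEN iffD1, OF A]]
    by auto
next
  case (Suc k)
  have hA: "(A has_derivative A) (at x)" for x
    using A by (simp add: bounded_linear_imp_has_derivative linear_conv_bounded_linear)
  note d = has_derivative_compose[OF hA Ck_has_derivative[OF Suc.prems]]
  show ?case
  proof (rule Ck_SucI[OF d])
    fix b :: 'a
    have "frechet_derivative f (at y) (A b) = (\<Sum>c\<in>Basis. (A b \<bullet> c) * frechet_derivative f (at y) c)" for y
    proof -
      have l: "linear (frechet_derivative f (at y))"
        using Ck_has_derivative[OF Suc.prems] by (rule has_derivative_linear)
      have "frechet_derivative f (at y) (\<Sum>c\<in>Basis. (A b \<bullet> c) *\<^sub>R c) =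
          (\<Sum>c\<in>Basis. (A b \<bullet> c) * frechet_derivative f (at y) c)"
        by (simp add: linear_sum[OF l] linear_cmul[OF l])
      then show ?thesis by (simp add: euclidean_representation)
    qed
    moreover have "Ck k (\<lambda>x. \<Sum>c\<in>Basis. (A b \<bullet> c) * frechet_derivative f (at (A x)) c)"
      using Suc.prems by (intro Ck_sum Ck_scale Suc.IH[of "\<lambda>y. frechet_derivative f (at y) _"]) auto
    ultimately show "Ck k (\<lambda>x. frechet_derivative f (at (A x)) (A b))" by simp
  qed
qed

section \<open>A smooth cutoff function\<close>

definition flat_exp :: "real poly \<Rightarrow> real \<Rightarrow> real" where
  "flat_exp p t = (if t > 0 then poly p (1 / t) * exp (- (1 / t)) else 0)"

lemma poly_times_exp_tendsto_0: "((\<lambda>x. poly p x * exp (- x)) \<longlongrightarrow> 0) at_top" for p :: "real poly"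
proof -
  have "((\<lambda>x. \<Sum>i\<le>degree p. coeff p i * (x ^ i / exp x)) \<longlongrightarrow> (\<Sum>i\<le>degree p. coeff p i * 0)) at_top"
    by (intro tendsto_intros tendsto_power_div_exp_0)
  then show ?thesis
    by (simp add: poly_altdef exp_minus sum_distrib_right divide_inverse mult.assoc)
qed

text \<open>The polynomial factor makes the family closed under differentiation: with u = 1 / t the
  derivative is u^2 (p - p')(u) exp (- u), and the two \<open>pCons 0\<close> are the multiplication
  by u^2. At 0 the right difference quotient is again a polynomial in u times exp (- u) and tends to
  0.\<close>

lemma flat_exp_derivative:
  "(flat_exp p has_real_derivative flat_exp (pCons 0 (pCons 0 (p - pderiv p))) t) (at t)"
proof -
  consider "t > 0" | "t < 0" | "t = 0" by linarith
  then show ?thesis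
  proof cases
    case 1
    define u where "u = 1 / t"
    have a: "((\<lambda>t. 1 / t) has_real_derivative - (u * u)) (at t)"
      using 1 by (auto intro!: derivative_eq_intros simp: u_def)
    have val: "flat_exp (pCons 0 (pCons 0 (p - pderiv p))) t = u * (u * (poly p u - poly (pderiv p) u)) * exp (- u)"
      using 1 by (simp add: flat_exp_def u_def)
    have "((\<lambda>t. poly p (1 / t) * exp (- (1 / t))) has_real_derivative
        flat_exp (pCons 0 (pCons 0 (p - pderiv p))) t) (at t)"
    proof -
      have 1: "((\<lambda>t. poly p (1 / t)) has_real_derivative poly (pderiv p) u * - (u * u)) (at t)"
        using DERIV_chain2[where f="poly p" and g="\<lambda>t. 1 / t", OF poly_DERIV a] by (simp add: u_def)
      have 2: "((\<lambda>t. exp (- (1 / t))) has_real_derivative exp (- u) * (u * u)) (at t)"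
        using DERIV_chain2[where f=exp and g="\<lambda>t. - (1 / t)", OF DERIV_exp DERIV_minus[OF a]] by (simp add: u_def)
      have "A * - (u * u) * E + E * (u * u) * B = u * (u * (B - A)) * E" for A B E :: real
        by (simp add: algebra_simps)
      then have "poly (pderiv p) u * - (u * u) * exp (- (1 / t)) + exp (- u) * (u * u) * poly p (1 / t) =
          flat_exp (pCons 0 (pCons 0 (p - pderiv p))) t"
        unfolding val u_def[symmetric] .
      then show ?thesis
        by (rule DERIV_cong[OF DERIV_mult[OF 1 2]])
    qed
    moreover have "eventually (\<lambda>s. flat_exp p s = poly p (1 / s) * exp (- (1 / s))) (nhds t)"
      using eventually_nhds_in_open[of "{0<..}" t] 1 by (auto elim!: eventually_mono simp: flat_exp_def)
    ultimately show ?thesis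
      by - (rule DERIV_cong_ev[OF refl _ refl, THEN iffD2])
  next
    case 2
    have "eventually (\<lambda>s. flat_exp p s = 0) (nhds t)"
      using eventually_nhds_in_open[of "{..<0}" t] 2 by (auto elim!: eventually_mono simp: flat_exp_def)
    moreover have "((\<lambda>_. 0) has_real_derivative flat_exp (pCons 0 (pCons 0 (p - pderiv p))) t) (at t)"
      using 2 by (simp add: flat_exp_def)
    ultimately show ?thesis
      by - (rule DERIV_cong_ev[OF refl _ refl, THEN iffD2])
  next
    case 3
    have l: "((\<lambda>y. flat_exp p y / y) \<longlongrightarrow> 0) (at_left 0)"
      by (rule tendsto_eventually) (auto simp: eventually_at_left_field flat_exp_def intro: exI[of _ "-1"])
    have "((\<lambda>y. poly (pCons 0 p) (inverse y) * exp (- inverse y)) \<longlongrightarrow> 0) (at_right 0)"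
      by (rule filterlim_compose[OF poly_times_exp_tendsto_0 filterlim_inverse_at_top_right])
    then have r: "((\<lambda>y. flat_exp p y / y) \<longlongrightarrow> 0) (at_right 0)"
      by (rule Lim_transform_eventually)
         (auto simp: eventually_at_right_field flat_exp_def field_simps intro!: exI[of _ 1])
    from l r have "((\<lambda>y. flat_exp p y / y) \<longlongrightarrow> 0) (at 0)"
      by (simp add: filterlim_at_split)
    then show ?thesis using 3 by (simp add: has_field_derivative_iff flat_exp_def)
  qed
qed

lemma Ck_flat_exp: "Ck k (\<lambda>x::'a::euclidean_space. flat_exp p (c - x \<bullet> x))"
proof (induction k arbitrary: p)
  case 0
  have "isCont (flat_exp p) t" for t
    using flat_exp_derivative by (rule DERIV_isCont)
  then have "continuous_on UNIV (flat_exp p)" by (simp add: continuous_at_imp_continuous_on)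
  then show ?case
    unfolding Ck.simps
    by (rule continuous_on_compose2[of UNIV "flat_exp p" UNIV]) (auto intro!: continuous_intros)
next
  case (Suc k)
  let ?q = "pCons 0 (pCons 0 (p - pderiv p))"
  show ?case
  proof (rule Ck_SucI)
    fix x :: 'a
    have "((\<lambda>x::'a. c - x \<bullet> x) has_derivative (\<lambda>h. - 2 * (x \<bullet> h))) (at x)"
      by (auto intro!: derivative_eq_intros simp: inner_commute)
    from has_derivative_compose[OF this flat_exp_derivative[unfolded has_field_derivative_def]]
    show "((\<lambda>x. flat_exp p (c - x \<bullet> x)) has_derivative
        (\<lambda>h. flat_exp ?q (c - x \<bullet> x) * (- 2 * (h \<bullet> x)))) (at x)"
      by (simp add: inner_commute)
  next
    fix b :: 'a
    show "Ck k (\<lambda>x. flat_exp ?q (c - x \<bullet> x) * (- 2 * (b \<bullet> x)))"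
      by (intro Ck_mult Suc.IH Ck_const Ck_inner)
  qed
qed

text \<open>The inner product, unlike the norm, is smooth at the origin. As \<open>r\<close> grows
  the value exp (- 1 / (r^2 - |x|^2)) tends to 1, so these functions serve as cutoffs without
  normalisation.\<close>

definition bump :: "real \<Rightarrow> 'a::euclidean_space \<Rightarrow> real" where
  "bump r x = flat_exp 1 (r\<^sup>2 - x \<bullet> x)"

lemma bump_nonneg: "0 \<le> bump r x" and bump_le_1: "bump r x \<le> 1"
  by (auto simp: bump_def flat_exp_def)

lemma bump_pos: "norm x < r \<Longrightarrow> 0 < bump r x"
  by (simp add: bump_def flat_exp_def power2_norm_eq_inner[symmetric] power_strict_mono)

lemma bump_eq_0: "0 \<le> r \<Longrightarrow> r \<le> norm x \<Longrightarrow> bump r x = 0"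
  by (simp add: bump_def flat_exp_def power2_norm_eq_inner[symmetric] power_mono not_less)

lemma bump_tendsto_1: "(\<lambda>n. bump (real n) x) \<longlonglongrightarrow> 1"
proof -
  have "filterlim (\<lambda>n. (real n)\<^sup>2 - x \<bullet> x) at_top sequentially"
    using filterlim_tendsto_add_at_top[OF tendsto_const[of "- (x \<bullet> x)"]
        filterlim_pow_at_top[OF _ filterlim_real_sequentially, of 2]]
    by simp
  then have "(\<lambda>n. exp (- inverse ((real n)\<^sup>2 - x \<bullet> x))) \<longlonglongrightarrow> exp (- 0)"
    by (intro tendsto_intros tendsto_inverse_0_at_top)
  moreover have "eventually (\<lambda>n. exp (- inverse ((real n)\<^sup>2 - x \<bullet> x)) = bump (real n) x) sequentially"
    using \<open>filterlim (\<lambda>n. (real n)\<^sup>2 - x \<bullet> x) at_top sequentially\<close>[unfolded filterlim_at_top_dense, rule_format, of 0]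
    by eventually_elim (simp add: bump_def flat_exp_def inverse_eq_divide)
  ultimately show ?thesis by (simp add: Lim_transform_eventually)
qed

lemma Cc_infinity_iff: "\<phi> \<in> Cc_infinity \<longleftrightarrow> (\<forall>k. Ck k \<phi>) \<and> (\<exists>r\<ge>0. \<forall>x. r \<le> norm x \<longrightarrow> \<phi> x = 0)"
proof -
  have "bounded {x. \<phi> x \<noteq> 0} \<longleftrightarrow> (\<exists>r\<ge>0. \<forall>x. r \<le> norm x \<longrightarrow> \<phi> x = 0)"
  proof
    assume "bounded {x. \<phi> x \<noteq> 0}"
    then obtain a where "\<And>x. \<phi> x \<noteq> 0 \<Longrightarrow> norm x \<le> a" by (auto simp: bounded_iff)
    then show "\<exists>r\<ge>0. \<forall>x. r \<le> norm x \<longrightarrow> \<phi> x = 0"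
      by (intro exI[of _ "max 0 (a + 1)"]) force
  next
    assume "\<exists>r\<ge>0. \<forall>x. r \<le> norm x \<longrightarrow> \<phi> x = 0"
    then show "bounded {x. \<phi> x \<noteq> 0}" unfolding bounded_iff by (metis (mono_tags) linear mem_Collect_eq)
  qed
  then show ?thesis by (simp add: Cc_infinity_def)
qed

lemma Cc_infinityI: "(\<And>k. Ck k \<phi>) \<Longrightarrow> 0 \<le> r \<Longrightarrow> (\<And>x. r \<le> norm x \<Longrightarrow> \<phi> x = 0) \<Longrightarrow> \<phi> \<in> Cc_infinity"
  by (auto simp: Cc_infinity_iff)

lemma Cc_infinity_Ck: "\<phi> \<in> Cc_infinity \<Longrightarrow> Ck k \<phi>"
  by (simp add: Cc_infinity_iff)

lemma Cc_infinity_support: "\<phi> \<in> Cc_infinity \<Longrightarrow> \<exists>r\<ge>0. \<forall>x. r \<le> norm x \<longrightarrow> \<phi> x = 0"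
  by (simp add: Cc_infinity_iff)

lemma Cc_infinity_add:
  assumes "f \<in> Cc_infinity" "g \<in> Cc_infinity" shows "(\<lambda>x. f x + g x) \<in> Cc_infinity"
proof -
  obtain r s where "r \<ge> 0" "\<And>x. r \<le> norm x \<Longrightarrow> f x = 0" "s \<ge> 0" "\<And>x. s \<le> norm x \<Longrightarrow> g x = 0"
    using assms[THEN Cc_infinity_support] by auto
  then have "f x + g x = 0" if "max r s \<le> norm x" for x using that by simp
  then show ?thesis
    using Ck_add[OF Cc_infinity_Ck[OF assms(1)] Cc_infinity_Ck[OF assms(2)]] \<open>r \<ge> 0\<close>
    unfolding Cc_infinity_iff by (intro conjI allI exI[of _ "max r s"]) auto
qed

lemma Cc_infinity_scale: "f \<in> Cc_infinity \<Longrightarrow> (\<lambda>x. c * f x) \<in> Cc_infinity"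
  by (auto simp: Cc_infinity_iff intro: Ck_scale)

lemma Cc_infinity_zero: "(\<lambda>_. 0) \<in> Cc_infinity"
  by (auto simp: Cc_infinity_iff intro: Ck_const)

lemma Cc_infinity_sum: "(\<And>i. i \<in> I \<Longrightarrow> f i \<in> Cc_infinity) \<Longrightarrow> (\<lambda>x. \<Sum>i\<in>I. f i x) \<in> Cc_infinity"
  by (induction I rule: infinite_finite_induct) (auto intro: Cc_infinity_add Cc_infinity_zero)

lemma bump_times_Ck: "(\<And>k. Ck k h) \<Longrightarrow> 0 \<le> r \<Longrightarrow> (\<lambda>x. bump r x * h x) \<in> Cc_infinity"
  by (rule Cc_infinityI[where r=r]) (auto intro!: Ck_mult Ck_flat_exp simp: bump_eq_0, auto simp: bump_def intro: Ck_flat_exp)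

lemma compact_support_bounded:
  fixes f :: "'a::euclidean_space \<Rightarrow> real"
  assumes "continuous_on UNIV f" "\<And>x. r \<le> norm x \<Longrightarrow> f x = 0"
  obtains B where "B \<ge> 0" "\<And>x. \<bar>f x\<bar> \<le> B"
proof -
  have "compact (f ` cball 0 r)"
    by (intro compact_continuous_image continuous_on_subset[OF assms(1)]) auto
  then have "bounded (f ` cball 0 r)" by (rule compact_imp_bounded)
  then obtain B where B: "\<And>x. x \<in> cball 0 r \<Longrightarrow> norm (f x) \<le> B"
    unfolding bounded_iff by blast
  have "\<bar>f x\<bar> \<le> max 0 B" for x
    using B[of x] assms(2)[of x] by (cases "norm x \<le> r") auto
  then show thesis by (intro that[of "max 0 B"]) auto
qed

lemma Cc_infinity_continuous: "\<phi> \<in> Cc_infinity \<Longrightarrow> continuous_on UNIV \<phi>"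
  using Cc_infinity_Ck Ck_continuous by blast

lemma Cc_infinity_measurable: "\<phi> \<in> Cc_infinity \<Longrightarrow> \<phi> \<in> borel_measurable borel"
  by (intro borel_measurable_continuous_onI Cc_infinity_continuous)

lemma Cc_infinity_bounded: "\<phi> \<in> Cc_infinity \<Longrightarrow> \<exists>B\<ge>0. \<forall>x. \<bar>\<phi> x\<bar> \<le> B"
  using Cc_infinity_support[of \<phi>] compact_support_bounded[OF Cc_infinity_continuous] by metis

lemma Cc_infinity_L2: "\<phi> \<in> Cc_infinity \<Longrightarrow> \<phi> \<in> L2 std_gaussian"
  using Cc_infinity_bounded[of \<phi>] prob_space.L2_bounded[OF prob_space_std_gaussian, of \<phi>]
    Cc_infinity_measurable[of \<phi>] by auto

section \<open>Density of the test functions\<close>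

text \<open>The positive and the negative part of \<open>w\<close> are densities of two finite
  measures with the same characteristic function, which therefore agree.\<close>

lemma AE_zero_if_fourier_zero:
  fixes N :: "'a::euclidean_space measure" and w :: "'a \<Rightarrow> real"
  assumes N: "sets N = sets borel" and w: "integrable N w"
    and 0: "\<And>v. (CLINT x|N. w x * iexp (v \<bullet> x)) = 0"
  shows "AE x in N. w x = 0"
proof -
  note [measurable_cong] = N
  have [measurable]: "w \<in> borel_measurable N" using w by simp
  define P where "P g = density N (\<lambda>x. ennreal (max 0 (g x)))" for g
  have fin: "finite_measure (P g)" if "integrable N g" for g
  proof
    have "(\<integral>\<^sup>+x. ennreal (max 0 (g x)) \<partial>N) = ennreal (\<integral>x. max 0 (g x) \<partial>N)"
      by (rule nn_integral_eq_integral) (use that in auto)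
    moreover have "g \<in> borel_measurable N" using that by simp
    ultimately show "emeasure (P g) (space (P g)) \<noteq> \<infinity>"
      by (simp add: P_def emeasure_density)
  qed
  have char: "char_vec (P g) v = (CLINT x|N. complex_of_real (max 0 (g x)) * iexp (v \<bullet> x))" if [measurable]: "g \<in> borel_measurable N" for g v
    unfolding char_vec_def P_def by (subst integral_density) (auto simp: scaleR_conv_of_real)
  have "P w = P (\<lambda>x. - w x)"
  proof (rule char_vec_unique)
    fix v
    have i: "integrable N (\<lambda>x. complex_of_real (max 0 (g x)) * iexp (v \<bullet> x))" if "integrable N g" for g
    proof (rule Bochner_Integration.integrable_bound[OF that])
      have [measurable]: "g \<in> borel_measurable N" using that by simp
      show "(\<lambda>x. complex_of_real (max 0 (g x)) * iexp (v \<bullet> x)) \<in> borel_measurable N" by measurable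
    qed (auto simp: norm_mult)
    have "char_vec (P w) v - char_vec (P (\<lambda>x. - w x)) v =
       (CLINT x|N. complex_of_real (max 0 (w x)) * iexp (v \<bullet> x) - complex_of_real (max 0 (- w x)) * iexp (v \<bullet> x))"
      by (subst Bochner_Integration.integral_diff) (use w in \<open>auto simp: char i\<close>)
    also have "\<dots> = (CLINT x|N. w x * iexp (v \<bullet> x))"
      by (intro Bochner_Integration.integral_cong refl) (auto simp: max_def)
    finally show "char_vec (P w) v = char_vec (P (\<lambda>x. - w x)) v" using 0 by simp
  qed (use w fin in \<open>auto simp: P_def N\<close>)
  moreover have "(\<integral>\<^sup>+x. ennreal (max 0 (w x)) \<partial>N) \<noteq> \<infinity>"
    using finite_measure.emeasure_finite[OF fin[OF w], of "space N"] by (simp add: P_def emeasure_density)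
  ultimately have "AE x in N. ennreal (max 0 (w x)) = ennreal (max 0 (- w x))"
    unfolding P_def
    by (subst finite_density_unique[symmetric])
       simp_all
  then show ?thesis by eventually_elim (auto simp: max_def split: if_splits)
qed

text \<open>\<open>S\<close> is the closure of the centred test functions and \<open>h\<close> the
  residual of \<open>f\<close> after projection onto it. Being orthogonal to centred test functions
  only, \<open>h\<close> is first seen to be a constant \<open>\<kappa> n\<close> on the ball of
  radius \<open>n\<close>; these constants tend to 0 because \<open>h\<close> has mean zero.\<close>

lemma test_functions_dense:
  fixes f :: "'a::euclidean_space \<Rightarrow> real"
  assumes f: "f \<in> L2_zero_mean std_gaussian" and e: "e > 0"
  obtains \<phi> where "\<phi> \<in> Cc_infinity" "\<phi> \<in> L2_zero_mean std_gaussian" "L2_norm std_gaussian (\<lambda>x. f x - \<phi> x) < e"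
proof -
  let ?G = "std_gaussian :: 'a measure"
  interpret G: prob_space ?G by (rule prob_space_std_gaussian)
  let ?T = "Cc_infinity \<inter> L2_zero_mean ?G"
  define S where "S = {g \<in> L2_zero_mean ?G. \<forall>e>0. \<exists>\<phi>\<in>?T. L2_norm ?G (\<lambda>x. g x - \<phi> x) < e}"
  have TL: "\<phi> \<in> L2 ?G" if "\<phi> \<in> ?T" for \<phi> using that by (auto simp: L2_zero_mean_def)
  have SL: "g \<in> L2 ?G" if "g \<in> S" for g using that by (auto simp: S_def L2_zero_mean_def)
  have add0: "(\<lambda>x. g x + h x) \<in> L2_zero_mean ?G" if "g \<in> L2_zero_mean ?G" "h \<in> L2_zero_mean ?G" for g h
    using that by (rule L2_zero_mean_add[OF prob_space_std_gaussian])
  have scale0: "(\<lambda>x. c * g x) \<in> L2_zero_mean ?G" if "g \<in> L2_zero_mean ?G" for g c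
    using that by (rule L2_zero_mean_scale)
  have TS: "\<phi> \<in> S" if "\<phi> \<in> ?T" for \<phi>
    using that by (auto simp: S_def L2_norm_def L2_inner_def intro!: bexI[of _ \<phi>])
  obtain g where g: "g \<in> S" "\<And>h. h \<in> S \<Longrightarrow> L2_inner ?G (\<lambda>x. f x - g x) h = 0"
  proof (rule G.L2_projection[of S f])
    show "S \<subseteq> L2 ?G" using SL by blast
    have "(\<lambda>_. 0) \<in> ?T" by (auto simp: Cc_infinity_zero L2_zero_mean_def L2_zero)
    then show "S \<noteq> {}" using TS by blast
    show "f \<in> L2 ?G" using f by (simp add: L2_zero_mean_def)
  next
    fix u v assume uv: "u \<in> S" "v \<in> S"
    show "(\<lambda>x. u x + v x) \<in> S"
      unfolding S_def
    proof (intro CollectI conjI allI impI)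
      fix e :: real assume "e > 0"
      then have e2: "e / 2 > 0" by simp
      obtain \<phi> where p1: "\<phi> \<in> ?T" "L2_norm ?G (\<lambda>x. u x - \<phi> x) < e / 2"
        using uv(1) e2 unfolding S_def by blast
      obtain \<psi> where p2: "\<psi> \<in> ?T" "L2_norm ?G (\<lambda>x. v x - \<psi> x) < e / 2"
        using uv(2) e2 unfolding S_def by blast
      note p = p1 p2
      have "L2_norm ?G (\<lambda>x. (u x + v x) - (\<phi> x + \<psi> x)) < e"
        using L2_norm_triangle[OF L2_diff[OF SL[OF uv(1)] TL[OF p(1)]] L2_diff[OF SL[OF uv(2)] TL[OF p(3)]]] p
        by (simp add: algebra_simps)
      moreover have "(\<lambda>x. \<phi> x + \<psi> x) \<in> ?T" using p add0 Cc_infinity_add by blast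
      ultimately show "\<exists>\<phi>\<in>?T. L2_norm ?G (\<lambda>x. u x + v x - \<phi> x) < e"
        by (intro bexI[of _ "\<lambda>x. \<phi> x + \<psi> x"])
    qed (use uv in \<open>auto simp: S_def intro: add0\<close>)
  next
    fix c and u assume u: "u \<in> S"
    show "(\<lambda>x. c * u x) \<in> S"
      unfolding S_def
    proof (intro CollectI conjI allI impI)
      fix e :: real assume "e > 0"
      then have "e / (\<bar>c\<bar> + 1) > 0" by simp
      then obtain \<phi> where p: "\<phi> \<in> ?T" "L2_norm ?G (\<lambda>x. u x - \<phi> x) < e / (\<bar>c\<bar> + 1)"
        using u unfolding S_def by blast
      have "L2_norm ?G (\<lambda>x. c * u x - c * \<phi> x) = \<bar>c\<bar> * L2_norm ?G (\<lambda>x. u x - \<phi> x)"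
        by (simp add: L2_norm_scale[symmetric] right_diff_distrib)
      also have "\<dots> \<le> (\<bar>c\<bar> + 1) * L2_norm ?G (\<lambda>x. u x - \<phi> x)"
        by (simp add: mult_right_mono L2_norm_nonneg)
      also have "\<dots> < e" using p(2) by (simp add: pos_less_divide_eq mult.commute add_nonneg_pos)
      finally show "\<exists>\<phi>\<in>?T. L2_norm ?G (\<lambda>x. c * u x - \<phi> x) < e"
        using p(1) scale0 Cc_infinity_scale[of \<phi> c] by (intro bexI[of _ "\<lambda>x. c * \<phi> x"]) auto
    qed (use u in \<open>auto simp: S_def intro: scale0\<close>)
  next
    fix u assume u: "u \<in> L2 ?G" and ap: "\<And>e. e > 0 \<Longrightarrow> \<exists>g\<in>S. L2_norm ?G (\<lambda>x. u x - g x) < e"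
    have "u \<in> L2_zero_mean ?G"
      by (rule L2_zero_mean_closed[OF prob_space_std_gaussian u]) (use ap in \<open>fastforce simp: S_def\<close>)
    moreover have "\<exists>\<phi>\<in>?T. L2_norm ?G (\<lambda>x. u x - \<phi> x) < e" if "e > 0" for e
    proof -
      obtain g where gg: "g \<in> S" "L2_norm ?G (\<lambda>x. u x - g x) < e / 2" using ap[of "e / 2"] \<open>e > 0\<close> by auto
      then obtain \<phi> where p: "\<phi> \<in> ?T" "L2_norm ?G (\<lambda>x. g x - \<phi> x) < e / 2"
        using half_gt_zero[OF \<open>e > 0\<close>] unfolding S_def by blast
      have "L2_norm ?G (\<lambda>x. u x - \<phi> x) < e"
        using L2_norm_triangle_diff[OF u SL[OF gg(1)] TL[OF p(1)]] gg p by simp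
      then show ?thesis using p by blast
    qed
    ultimately show "u \<in> S" by (simp add: S_def)
  qed (rule that)
  define h where "h = (\<lambda>x. f x - g x)"
  have hL: "h \<in> L2 ?G" and h0: "(\<integral>x. h x \<partial>?G) = 0"
    using f g(1) by (auto simp: h_def S_def L2_zero_mean_def L2_diff G.L2_integrable)
  note [measurable] = L2_measurable[OF hL, simplified]
  have hT: "L2_inner ?G h \<phi> = 0" if "\<phi> \<in> ?T" for \<phi>
    using g(2)[OF TS[OF that]] by (simp add: h_def)
  have bC: "bump (real n) \<in> (Cc_infinity :: ('a \<Rightarrow> real) set)" for n
    using bump_times_Ck[OF Ck_const, of "real n" 1] by simp
  have [measurable]: "bump (real n) \<in> borel_measurable (borel :: 'a measure)" for n
    by (rule Cc_infinity_measurable[OF bC])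
  define E where "E n = (\<integral>x. bump (real n) x \<partial>?G)" for n
  \<comment> \<open>The mean of \<open>h\<close> weighted by the bump; it converges to the mean of
    \<open>h\<close>.\<close>
  define \<kappa> where "\<kappa> n = L2_inner ?G h (bump (real n)) / E n" for n
  have E1: "E \<longlonglongrightarrow> (\<integral>x. 1 \<partial>?G)"
    unfolding E_def
    by (rule integral_dominated_convergence[where w="\<lambda>_. 1"]) (auto simp: bump_tendsto_1 bump_nonneg bump_le_1)
  then have E1: "E \<longlonglongrightarrow> 1" by (simp add: G.prob_space[simplified])
  have "(\<lambda>n. L2_inner ?G h (bump (real n))) \<longlonglongrightarrow> (\<integral>x. h x \<partial>?G)"
    unfolding L2_inner_def
  proof (rule integral_dominated_convergence[where w="\<lambda>x. \<bar>h x\<bar>"])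
    show "AE x in ?G. (\<lambda>n. h x * bump (real n) x) \<longlonglongrightarrow> h x"
      using tendsto_mult[OF tendsto_const bump_tendsto_1] by auto
  qed (auto simp: abs_mult bump_nonneg bump_le_1 mult_left_le intro!: integrable_abs[OF G.L2_integrable[OF hL]])
  then have "(\<lambda>n. L2_inner ?G h (bump (real n)) / E n) \<longlonglongrightarrow> (\<integral>x. h x \<partial>?G) / 1"
    by (intro tendsto_divide E1) simp_all
  then have k0: "\<kappa> \<longlonglongrightarrow> 0" unfolding \<kappa>_def by (simp add: h0)
  have \<kappa>: "L2_inner ?G h \<phi> = \<kappa> n * (\<integral>x. \<phi> x \<partial>?G)" if \<phi>: "\<phi> \<in> Cc_infinity" and n: "E n > 0" for \<phi> n
  proof -
    \<comment> \<open>Adding this multiple of the bump makes \<open>\<phi>\<close> centred, so that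
      the orthogonality of \<open>h\<close> applies.\<close>
    let ?c = "- (\<integral>x. \<phi> x \<partial>?G) / E n"
    have "(\<lambda>x. \<phi> x + ?c * bump (real n) x) \<in> Cc_infinity"
      by (intro Cc_infinity_add Cc_infinity_scale \<phi> bC)
    moreover have "(\<integral>x. \<phi> x + ?c * bump (real n) x \<partial>?G) = 0"
      using n G.L2_integrable[OF Cc_infinity_L2[OF \<phi>]] G.L2_integrable[OF Cc_infinity_L2[OF bC[of n]]]
      by (simp add: E_def)
    ultimately have "(\<lambda>x. \<phi> x + ?c * bump (real n) x) \<in> ?T"
      by (simp add: L2_zero_mean_def Cc_infinity_L2)
    then have "L2_inner ?G (\<lambda>x. \<phi> x + ?c * bump (real n) x) h = 0"
      using hT L2_inner_commute by metis
    then have "L2_inner ?G \<phi> h + ?c * L2_inner ?G (bump (real n)) h = 0"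
      unfolding L2_inner_add_left[OF Cc_infinity_L2[OF \<phi>] L2_scale[OF Cc_infinity_L2[OF bC]] hL]
      by (simp only: L2_inner_scale_left)
    then show ?thesis by (simp add: \<kappa>_def L2_inner_commute[of _ h] field_simps)
  qed
  have zero: "AE x in ?G. norm x < real n \<longrightarrow> h x = \<kappa> n" if n: "E n > 0" for n
  proof -
    have cs: "(\<integral>x. (h x - \<kappa> n) * bump (real n) x * u x \<partial>?G) = 0"
      if u: "\<And>k. Ck k u" for u
    proof -
      have *: "(\<lambda>x. bump (real n) x * u x) \<in> Cc_infinity" by (rule bump_times_Ck[OF u]) simp
      have "(\<integral>x. (h x - \<kappa> n) * bump (real n) x * u x \<partial>?G) =
         (\<integral>x. h x * (bump (real n) x * u x) - \<kappa> n * (bump (real n) x * u x) \<partial>?G)"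
        by (simp add: algebra_simps)
      also have "\<dots> = 0"
        using \<kappa>[OF * n] L2_integrable_mult[OF hL Cc_infinity_L2[OF *]] G.L2_integrable[OF Cc_infinity_L2[OF *]]
        by (simp add: L2_inner_def)
      finally show ?thesis .
    qed
    have i0: "integrable ?G (\<lambda>x. (h x - \<kappa> n) * bump (real n) x)"
      by (rule L2_integrable_mult[OF L2_diff[OF hL G.L2_const] Cc_infinity_L2[OF bC]])
    \<comment> \<open>The bump turns the real and imaginary parts of a character into test
      functions, so all Fourier coefficients of the truncated function vanish.\<close>
    have "AE x in ?G. (h x - \<kappa> n) * bump (real n) x = 0"
    proof (rule AE_zero_if_fourier_zero[OF _ i0])
      fix v :: 'a
      have "continuous_on UNIV (\<lambda>x. cos (v \<bullet> x))" "continuous_on UNIV (\<lambda>x. sin (v \<bullet> x))"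
        by (auto intro!: continuous_intros)
      then have [measurable]: "(\<lambda>x. cos (v \<bullet> x)) \<in> borel_measurable borel" "(\<lambda>x. sin (v \<bullet> x)) \<in> borel_measurable borel"
        by (auto intro: borel_measurable_continuous_onI)
      have ic: "integrable ?G (\<lambda>x. (h x - \<kappa> n) * bump (real n) x * cos (v \<bullet> x))"
        by (rule Bochner_Integration.integrable_bound[OF i0]) (auto simp: abs_mult mult_left_le)
      have isn: "integrable ?G (\<lambda>x. (h x - \<kappa> n) * bump (real n) x * sin (v \<bullet> x))"
        by (rule Bochner_Integration.integrable_bound[OF i0]) (auto simp: abs_mult mult_left_le)
      have "(CLINT x|?G. ((h x - \<kappa> n) * bump (real n) x) * iexp (v \<bullet> x)) =
        (CLINT x|?G. complex_of_real ((h x - \<kappa> n) * bump (real n) x * cos (v \<bullet> x)) +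
           \<i> * complex_of_real ((h x - \<kappa> n) * bump (real n) x * sin (v \<bullet> x)))"
        by (intro Bochner_Integration.integral_cong refl) (simp add: complex_eq_iff Re_exp Im_exp)
      also have "\<dots> = 0"
        using cs[OF Ck_cos_sin[THEN conjunct1]] cs[OF Ck_cos_sin[THEN conjunct2]] ic isn
        by (simp add: integral_complex_of_real del: of_real_mult)
      finally show "(CLINT x|?G. ((h x - \<kappa> n) * bump (real n) x) * iexp (v \<bullet> x)) = 0" .
    qed simp
    then show ?thesis by eventually_elim (auto dest: bump_pos)
  qed
  have "AE x in ?G. h x = 0"
  proof -
    have "\<forall>\<^sub>F n in sequentially. E n > 0" using E1 by (rule order_tendstoD) simp
    then obtain N where N: "\<And>n. n \<ge> N \<Longrightarrow> E n > 0" by (auto simp: eventually_sequentially)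
    have "AE x in ?G. \<forall>n\<ge>N. norm x < real n \<longrightarrow> h x = \<kappa> n"
      unfolding AE_all_countable using zero N by auto
    then show ?thesis
    proof eventually_elim
      case (elim x)
      obtain m where m: "norm x < real m" using reals_Archimedean2 by blast
      have "\<forall>\<^sub>F n in sequentially. \<kappa> n = h x"
        using eventually_ge_at_top[of N] eventually_ge_at_top[of m]
      proof eventually_elim
        case (elim n)
        then have "norm x < real n" using m by linarith
        then show ?case using elim \<open>\<forall>n\<ge>N. norm x < real n \<longrightarrow> h x = \<kappa> n\<close> by auto
      qed
      then have "\<kappa> \<longlonglongrightarrow> h x" by (rule tendsto_eventually)
      then show ?case using k0 LIMSEQ_unique by blast
    qed
  qed
  then have fg: "AE x in ?G. f x = g x" by eventually_elim (simp add: h_def)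
  obtain \<phi> where \<phi>: "\<phi> \<in> ?T" "L2_norm ?G (\<lambda>x. g x - \<phi> x) < e" using g(1) e unfolding S_def by blast
  have "f \<in> L2 ?G" using f by (simp add: L2_zero_mean_def)
  then have "L2_norm ?G (\<lambda>x. f x - \<phi> x) = L2_norm ?G (\<lambda>x. g x - \<phi> x)"
    using fg TL[OF \<phi>(1)] SL[OF g(1)]
    by (intro L2_norm_AE_cong L2_measurable[OF L2_diff]) (auto elim: eventually_mono)
  then show thesis using \<phi> that by auto
qed

text \<open>All \<open>Z n\<close> have the same law, so replacing \<open>f\<close> by a nearby test
  function costs an error that does not depend on \<open>n\<close>; for a test function dominated
  convergence applies. In this way a merely square integrable \<open>f\<close> behaves as if it were
  continuous.\<close>

lemma L2_norm_compose_tendsto_0: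
  fixes Z :: "nat \<Rightarrow> 'w \<Rightarrow> 'a::euclidean_space"
  assumes "prob_space M" and Zm: "\<And>n. Z n \<in> borel_measurable M" "Z' \<in> borel_measurable M"
    and Zd: "\<And>n. distr M borel (Z n) = std_gaussian" "distr M borel Z' = std_gaussian"
    and lim: "AE \<omega> in M. (\<lambda>n. Z n \<omega>) \<longlonglongrightarrow> Z' \<omega>"
    and f: "f \<in> L2 std_gaussian"
  shows "(\<lambda>n. L2_norm M (\<lambda>\<omega>. f (Z n \<omega>) - f (Z' \<omega>))) \<longlonglongrightarrow> 0"
proof (rule LIMSEQ_I)
  interpret prob_space M by fact
  interpret G: prob_space "std_gaussian :: 'a measure" by (rule prob_space_std_gaussian)
  fix e :: real assume e: "e > 0"
  define c where "c = (\<integral>x. f x \<partial>std_gaussian)"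
  \<comment> \<open>Density of the test functions is available for centred functions; the constant
    cancels in the differences.\<close>
  define g where "g = (\<lambda>x. f x - c)"
  have "g \<in> L2_zero_mean std_gaussian"
    using f G.prob_space by (auto simp: g_def L2_zero_mean_def L2_diff G.L2_const G.L2_integrable c_def)
  then obtain \<phi> where \<phi>: "\<phi> \<in> Cc_infinity" "L2_norm std_gaussian (\<lambda>x. g x - \<phi> x) < e / 3"
    using test_functions_dense[of g "e / 3"] e by auto
  have d: "(\<lambda>x. g x - \<phi> x) \<in> L2 std_gaussian"
    using L2_diff[OF L2_diff[OF f G.L2_const] Cc_infinity_L2[OF \<phi>(1)]] by (simp add: g_def)
  obtain B where B: "B \<ge> 0" "\<And>x. \<bar>\<phi> x\<bar> \<le> B" using Cc_infinity_bounded[OF \<phi>(1)] by blast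
  have [measurable]: "\<phi> \<in> borel_measurable borel" using \<phi>(1) by (rule Cc_infinity_measurable)
  note [measurable] = Zm
  have comp: "(\<lambda>\<omega>. h (Y \<omega>)) \<in> L2 M" "L2_norm M (\<lambda>\<omega>. h (Y \<omega>)) = L2_norm std_gaussian h"
    if "Y \<in> borel_measurable M" "distr M borel Y = std_gaussian" "h \<in> L2 std_gaussian" for h and Y :: "'w \<Rightarrow> 'a"
  proof -
    have Y: "Y \<in> measurable M std_gaussian" "distr M std_gaussian Y = std_gaussian"
      using that(1,2) distr_cong[OF refl sets_std_gaussian, of M Y Y]
      by (auto simp: measurable_cong_sets[OF refl sets_std_gaussian])
    show "(\<lambda>\<omega>. h (Y \<omega>)) \<in> L2 M" by (rule L2_compose[OF Y that(3)])
    show "L2_norm M (\<lambda>\<omega>. h (Y \<omega>)) = L2_norm std_gaussian h"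
      by (rule L2_norm_compose[OF Y L2_measurable[OF that(3)]])
  qed
  have \<phi>L: "(\<lambda>\<omega>. \<phi> (Y \<omega>)) \<in> L2 M" if [measurable]: "Y \<in> borel_measurable M" for Y
    using B by (intro L2_bounded[where B=B]) auto
  have "(\<lambda>n. \<integral>\<omega>. (\<phi> (Z n \<omega>) - \<phi> (Z' \<omega>))\<^sup>2 \<partial>M) \<longlonglongrightarrow> (\<integral>\<omega>. 0 \<partial>M)"
  proof (rule integral_dominated_convergence[where w="\<lambda>_. (2 * B)\<^sup>2"])
    show "AE \<omega> in M. (\<lambda>n. (\<phi> (Z n \<omega>) - \<phi> (Z' \<omega>))\<^sup>2) \<longlonglongrightarrow> 0"
      using lim
    proof eventually_elim
      case (elim \<omega>)
      have "isCont \<phi> (Z' \<omega>)"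
        using Cc_infinity_continuous[OF \<phi>(1)] by (simp add: continuous_on_eq_continuous_at)
      from isCont_tendsto_compose[OF this elim]
      have "(\<lambda>n. (\<phi> (Z n \<omega>) - \<phi> (Z' \<omega>))\<^sup>2) \<longlonglongrightarrow> (\<phi> (Z' \<omega>) - \<phi> (Z' \<omega>))\<^sup>2"
        by (intro tendsto_intros)
      then show ?case by simp
    qed
    fix n
    have "\<bar>\<phi> (Z n \<omega>) - \<phi> (Z' \<omega>)\<bar> \<le> 2 * B" for \<omega> using B(2)[of "Z n \<omega>"] B(2)[of "Z' \<omega>"] by linarith
    then have "(\<phi> (Z n \<omega>) - \<phi> (Z' \<omega>))\<^sup>2 \<le> (2 * B)\<^sup>2" for \<omega>
      using power_mono[of "\<bar>\<phi> (Z n \<omega>) - \<phi> (Z' \<omega>)\<bar>" "2 * B" 2] by simp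
    then show "AE \<omega> in M. norm ((\<phi> (Z n \<omega>) - \<phi> (Z' \<omega>))\<^sup>2) \<le> (2 * B)\<^sup>2" by simp
  qed simp_all
  then have "(\<lambda>n. sqrt (\<integral>\<omega>. (\<phi> (Z n \<omega>) - \<phi> (Z' \<omega>))\<^sup>2 \<partial>M)) \<longlonglongrightarrow> sqrt 0"
    by (intro tendsto_real_sqrt) simp
  then have "(\<lambda>n. L2_norm M (\<lambda>\<omega>. \<phi> (Z n \<omega>) - \<phi> (Z' \<omega>))) \<longlonglongrightarrow> 0"
    by (simp add: L2_norm_def L2_inner_def power2_eq_square)
  then obtain N where N: "\<And>n. n \<ge> N \<Longrightarrow> L2_norm M (\<lambda>\<omega>. \<phi> (Z n \<omega>) - \<phi> (Z' \<omega>)) < e / 3"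
    using LIMSEQ_D[of _ 0 "e / 3"] e by (force simp: L2_norm_nonneg)
  have "L2_norm M (\<lambda>\<omega>. f (Z n \<omega>) - f (Z' \<omega>)) < e" if "n \<ge> N" for n
  proof -
    let ?a = "\<lambda>\<omega>. g (Z n \<omega>) - \<phi> (Z n \<omega>)" and ?b = "\<lambda>\<omega>. \<phi> (Z n \<omega>) - \<phi> (Z' \<omega>)" and ?c = "\<lambda>\<omega>. g (Z' \<omega>) - \<phi> (Z' \<omega>)"
    have L: "?a \<in> L2 M" "?b \<in> L2 M" "?c \<in> L2 M"
      using comp(1)[OF Zm(1) Zd(1) d] comp(1)[OF Zm(2) Zd(2) d] by (auto intro!: L2_diff \<phi>L Zm)
    have "L2_norm M (\<lambda>\<omega>. f (Z n \<omega>) - f (Z' \<omega>)) = L2_norm M (\<lambda>\<omega>. (?a \<omega> + ?b \<omega>) + - 1 * ?c \<omega>)"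
      by (simp add: g_def algebra_simps)
    also have "\<dots> \<le> L2_norm M (\<lambda>\<omega>. ?a \<omega> + ?b \<omega>) + L2_norm M (\<lambda>\<omega>. - 1 * ?c \<omega>)"
      by (intro L2_norm_triangle L2_add L2_scale L)
    also have "L2_norm M (\<lambda>\<omega>. ?a \<omega> + ?b \<omega>) \<le> L2_norm M ?a + L2_norm M ?b"
      by (intro L2_norm_triangle L)
    also have "L2_norm M (\<lambda>\<omega>. - 1 * ?c \<omega>) = L2_norm M ?c" by (subst L2_norm_scale) simp
    also have "L2_norm M ?a + L2_norm M ?b + L2_norm M ?c < e"
      using comp(2)[OF Zm(1) Zd(1) d, of n] comp(2)[OF Zm(2) Zd(2) d] \<phi>(2) N[OF that] by simp
    finally show ?thesis by simp
  qed
  then show "\<exists>N. \<forall>n\<ge>N. norm (L2_norm M (\<lambda>\<omega>. f (Z n \<omega>) - f (Z' \<omega>)) - 0) < e"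
    by (intro exI[of _ N]) (simp add: L2_norm_nonneg)
qed

section \<open>Linear differential equations\<close>

text \<open>The exponential of \<open>t B\<close> applied to \<open>v\<close>. Summing at each
  vector separately avoids a norm on operators and reduces differentiation in \<open>t\<close> to
  scalar power series in each coordinate.\<close>

definition lin_exp :: "('a::euclidean_space \<Rightarrow> 'a) \<Rightarrow> real \<Rightarrow> 'a \<Rightarrow> 'a" where
  "lin_exp B t v = (\<Sum>n. (t ^ n / fact n) *\<^sub>R ((B ^^ n) v))"

lemma lin_exp_summable:
  fixes B :: "'a::euclidean_space \<Rightarrow> 'a"
  assumes "linear B"
  shows "summable (\<lambda>n. (t ^ n / fact n) *\<^sub>R ((B ^^ n) v))"
proof -
  obtain K where K: "K > 0" "\<And>x. norm (B x) \<le> norm x * K"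
    using bounded_linear.pos_bounded[of B] assms by (auto simp: linear_conv_bounded_linear)
  have bnd: "norm ((B ^^ n) v) \<le> K ^ n * norm v" for n
  proof (induction n)
    case (Suc n)
    have "norm ((B ^^ Suc n) v) \<le> norm ((B ^^ n) v) * K" using K(2) by simp
    also have "\<dots> \<le> K ^ n * norm v * K" using Suc K(1) by (intro mult_right_mono) auto
    finally show ?case by (simp add: ac_simps)
  qed simp
  show ?thesis
  proof (rule summable_comparison_test')
    show "summable (\<lambda>n. (inverse (fact n) * (\<bar>t\<bar> * K) ^ n) * norm v)"
      by (intro summable_mult2 summable_exp)
    fix n :: nat assume "n \<ge> 0"
    have "norm ((t ^ n / fact n) *\<^sub>R ((B ^^ n) v)) \<le> (\<bar>t\<bar> ^ n / fact n) * (K ^ n * norm v)"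
      using bnd[of n] by (simp add: power_abs mult_left_mono divide_right_mono)
    then show "norm ((t ^ n / fact n) *\<^sub>R ((B ^^ n) v)) \<le> (inverse (fact n) * (\<bar>t\<bar> * K) ^ n) * norm v"
      by (simp add: power_mult_distrib divide_inverse ac_simps)
  qed
qed

lemma lin_exp_0 [simp]: "lin_exp B 0 v = v"
proof -
  have "(\<Sum>n. ((0::real) ^ n / fact n) *\<^sub>R ((B ^^ n) v)) = (\<Sum>n\<in>{0}. ((0::real) ^ n / fact n) *\<^sub>R ((B ^^ n) v))"
    by (rule suminf_finite) (auto simp: power_0_left)
  then show ?thesis by (simp add: lin_exp_def)
qed

lemma lin_exp_commute:
  assumes "linear B" shows "lin_exp B t (B v) = B (lin_exp B t v)"
proof -
  have bl: "bounded_linear B" using assms by (simp add: linear_conv_bounded_linear)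
  have "B (lin_exp B t v) = (\<Sum>n. B ((t ^ n / fact n) *\<^sub>R ((B ^^ n) v)))"
    unfolding lin_exp_def by (rule bounded_linear.suminf[OF bl lin_exp_summable[OF assms]])
  also have "\<dots> = lin_exp B t (B v)"
    unfolding lin_exp_def by (simp add: linear_cmul[OF assms] funpow_swap1)
  finally show ?thesis ..
qed

lemma lin_exp_linear: assumes "linear B" shows "linear (lin_exp B t)"
proof (rule linearI)
  have lin: "linear (B ^^ n)" for n
  proof (induction n)
    case (Suc n) then show ?case using linear_compose[OF Suc assms] by (simp add: o_def)
  qed (simp add: linear_iff)
  note sm = lin_exp_summable[OF assms]
  show "lin_exp B t (x + y) = lin_exp B t x + lin_exp B t y" for x y
    unfolding lin_exp_def
    by (subst suminf_add[OF sm sm]) (simp add: linear_add[OF lin] scaleR_add_right)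
  show "lin_exp B t (c *\<^sub>R x) = c *\<^sub>R lin_exp B t x" for c x
    unfolding lin_exp_def
    by (subst suminf_scaleR_right[OF sm]) (simp add: linear_cmul[OF lin] mult.commute)
qed

lemma lin_exp_derivative:
  fixes B :: "'a::euclidean_space \<Rightarrow> 'a"
  assumes "linear B"
  shows "((\<lambda>t. lin_exp B t v) has_vector_derivative B (lin_exp B t v)) (at t)"
  unfolding has_vector_derivative_def
proof (subst has_derivative_componentwise_within, intro ballI)
  fix i :: 'a assume "i \<in> Basis"
  define c where "c n = ((B ^^ n) v \<bullet> i) / fact n" for n
  have comp: "lin_exp B s w \<bullet> i = (\<Sum>n. (s ^ n / fact n) * ((B ^^ n) w \<bullet> i))" for s w
    unfolding lin_exp_def
    using bounded_linear.suminf[OF bounded_linear_inner_left[of i] lin_exp_summable[OF assms, of s w]] by simp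
  have sm: "summable (\<lambda>n. c n * y ^ n)" for y
    using bounded_linear.summable[OF bounded_linear_inner_left[of i] lin_exp_summable[OF assms, of y v]]
    by (simp add: c_def ac_simps)
  have "((\<lambda>x. \<Sum>n. c n * x ^ n) has_real_derivative (\<Sum>n. diffs c n * t ^ n)) (at t)"
    by (rule termdiffs_strong_converges_everywhere[OF sm])
  moreover have "(\<lambda>x. \<Sum>n. c n * x ^ n) = (\<lambda>x. lin_exp B x v \<bullet> i)"
    by (simp add: comp c_def ac_simps)
  moreover have "(\<Sum>n. diffs c n * t ^ n) = B (lin_exp B t v) \<bullet> i"
  proof -
    have "diffs c n = ((B ^^ n) (B v) \<bullet> i) / fact n" for n
      by (simp add: diffs_def c_def funpow_swap1 divide_simps del: of_nat_Suc)
    then show ?thesis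
      unfolding lin_exp_commute[OF assms, symmetric] comp by (simp add: ac_simps)
  qed
  ultimately show "((\<lambda>t. lin_exp B t v \<bullet> i) has_derivative (\<lambda>x. x *\<^sub>R B (lin_exp B t v) \<bullet> i)) (at t)"
    by (simp add: has_field_derivative_def mult_commute_abs)
qed

lemma inner_has_real_derivative:
  fixes y z :: "real \<Rightarrow> 'a::real_inner"
  assumes "(y has_vector_derivative y') (at t within S)" "(z has_vector_derivative z') (at t within S)"
  shows "((\<lambda>t. y t \<bullet> z t) has_real_derivative (y t \<bullet> z' + y' \<bullet> z t)) (at t within S)"
  unfolding has_field_derivative_def
  by (rule has_derivative_eq_rhs[OF has_derivative_inner[OF assms[unfolded has_vector_derivative_def]]])
     (auto simp: algebra_simps)

lemma has_vector_derivative_affine: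
  fixes a b t :: real
  assumes "(f has_vector_derivative f') (at (a * t + b))"
  shows "((\<lambda>t. f (a * t + b)) has_vector_derivative a *\<^sub>R f') (at t)"
proof -
  have "((\<lambda>t. a * t + b) has_vector_derivative a) (at t)"
    unfolding has_real_derivative_iff_has_vector_derivative[symmetric] by (auto intro!: derivative_eq_intros)
  from vector_diff_chain_at[OF this assms] show ?thesis by (simp add: o_def)
qed

lemma norm_nonincreasing_if_dissipative:
  fixes w :: "real \<Rightarrow> 'a::real_inner"
  assumes w: "\<And>t. (w has_vector_derivative w' t) (at t)" and d: "\<And>t. w t \<bullet> w' t \<le> 0" and t: "s \<le> t"
  shows "norm (w t) \<le> norm (w s)"
proof -
  have "w t \<bullet> w t \<le> w s \<bullet> w s"
    by (rule DERIV_nonpos_imp_nonincreasing[OF t])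
       (use inner_has_real_derivative[OF w w] d in \<open>auto simp: inner_commute intro!: exI\<close>)
  then show ?thesis by (simp add: norm_le)
qed

text \<open>By linearity the difference of two solutions is a solution, and dissipativity keeps its
  norm from growing. This serves to recognise explicit formulas for the flows.\<close>

lemma dissipative_ode_unique:
  fixes B :: "'a::euclidean_space \<Rightarrow> 'a"
  assumes B: "linear B" "\<And>v. v \<bullet> B v \<le> 0"
    and y: "\<And>t. (y has_vector_derivative B (y t)) (at t)" "\<And>t. (z has_vector_derivative B (z t)) (at t)"
    and "y 0 = z 0" "0 \<le> t"
  shows "y t = z t"
proof -
  have "norm (y t - z t) \<le> norm (y 0 - z 0)"
    by (rule norm_nonincreasing_if_dissipative[where w="\<lambda>t. y t - z t" and w'="\<lambda>t. B (y t - z t)"])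
       (auto intro!: B has_vector_derivative_eq_rhs[OF has_vector_derivative_diff[OF y]] assms simp: linear_diff[OF B(1), symmetric])
  then show ?thesis using assms by simp
qed

lemma lin_exp_norm_le:
  assumes "linear B" "\<And>v. v \<bullet> B v \<le> 0" "0 \<le> t" shows "norm (lin_exp B t v) \<le> norm v"
  using norm_nonincreasing_if_dissipative[OF lin_exp_derivative[OF assms(1)] assms(2,3)] by simp

text \<open>Both sides solve the same equation in \<open>s\<close>; dissipativity gives uniqueness
  forward in time, hence \<open>0 \<le> s\<close>.\<close>

lemma lin_exp_add:
  assumes B: "linear B" "\<And>v. v \<bullet> B v \<le> 0" and "0 \<le> s"
  shows "lin_exp B s (lin_exp B t v) = lin_exp B (s + t) v"
proof (rule dissipative_ode_unique[OF B, where y="\<lambda>s. lin_exp B s (lin_exp B t v)" and z="\<lambda>s. lin_exp B (s + t) v"])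
  fix s
  show "((\<lambda>s. lin_exp B s (lin_exp B t v)) has_vector_derivative B (lin_exp B s (lin_exp B t v))) (at s)"
    by (rule lin_exp_derivative[OF B(1)])
  show "((\<lambda>s. lin_exp B (s + t) v) has_vector_derivative B (lin_exp B (s + t) v)) (at s)"
    using has_vector_derivative_affine[of "\<lambda>s. lin_exp B s v" _ 1 s t, OF lin_exp_derivative[OF B(1)]] by simp
qed (use assms in auto)

lemma lin_exp_continuous_on:
  assumes "linear B" shows "continuous_on S (\<lambda>t. lin_exp B t v)"
  using has_vector_derivative_continuous[OF lin_exp_derivative[OF assms]]
  by (auto intro: continuous_at_imp_continuous_on)

subsection \<open>The rotation group generated by a skew-symmetric matrix\<close>

definition rot :: "real ^ 'd ^ 'd \<Rightarrow> real \<Rightarrow> real ^ 'd \<Rightarrow> real ^ 'd" where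
  "rot J = lin_exp ((*v) J)"

lemma skew_inner: "transpose J = - J \<Longrightarrow> u \<bullet> (J *v v) = - ((J *v u) \<bullet> v)" for J :: "real ^ 'd ^ 'd"
proof -
  assume J: "transpose J = - J"
  have "u \<bullet> (J *v v) = (transpose J *v u) \<bullet> v" by (simp add: dot_lmul_matrix transpose_matrix_vector)
  then show ?thesis by (simp add: J matrix_vector_mult_def sum_negf vec_eq_iff inner_vec_def)
qed

lemma skew_inner_self: "transpose J = - J \<Longrightarrow> v \<bullet> (J *v v) = 0" for J :: "real ^ 'd ^ 'd"
  using skew_inner[of J v v] by (simp add: inner_commute)

lemma rot_linear: "linear (rot J s)"
  unfolding rot_def by (rule lin_exp_linear) simp

lemma rot_0 [simp]: "rot J 0 v = v"
  by (simp add: rot_def)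

lemma rot_commute: "rot J s (J *v v) = J *v rot J s v"
  unfolding rot_def by (rule lin_exp_commute) simp

lemma rot_derivative: "((\<lambda>s. rot J s v) has_vector_derivative J *v rot J s v) (at s)"
  unfolding rot_def by (rule lin_exp_derivative) simp

lemma rot_inner:
  assumes J: "transpose J = - J" shows "rot J s u \<bullet> rot J s v = u \<bullet> v"
proof -
  have "((\<lambda>s. rot J s u \<bullet> rot J s v) has_real_derivative 0) (at s)" for s
    using inner_has_real_derivative[OF rot_derivative[of J u s] rot_derivative[of J v s]] skew_inner[OF J] by simp
  from DERIV_isconst_all[OF allI[OF this], of s 0] show ?thesis by simp
qed

lemma rot_norm: "transpose J = - J \<Longrightarrow> norm (rot J s v) = norm v"
  by (simp add: norm_eq rot_inner)

lemma rot_add: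
  assumes J: "transpose J = - J" shows "rot J s (rot J t v) = rot J (s + t) v"
proof -
  have d: "v \<bullet> (J *v v) \<le> 0" for v using skew_inner_self[OF J] by simp
  have pos: "rot J s (rot J t v) = rot J (s + t) v" if "s \<ge> 0" for s t v
    unfolding rot_def using that d by (intro lin_exp_add) auto
  show ?thesis
  proof (cases "s \<ge> 0")
    case False
    \<comment> \<open>For negative \<open>s\<close>, the isometry \<open>rot J (- s)\<close> maps
      both sides to \<open>rot J t v\<close> by the case already settled.\<close>
    have "norm (rot J (- s) (rot J s (rot J t v) - rot J (s + t) v)) = 0"
      using pos[of "- s" s "rot J t v"] pos[of "- s" "s + t" v] False
      by (simp add: linear_diff[OF rot_linear])
    then show ?thesis unfolding rot_norm[OF J] by simp
  qed (use pos in auto)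
qed

lemma rot_inner_minus: "transpose J = - J \<Longrightarrow> u \<bullet> rot J s v = rot J (- s) u \<bullet> v"
  using rot_inner[of J s "rot J (- s) u" v] by (simp add: rot_add)

lemma rot_continuous_on: "continuous_on UNIV (\<lambda>p. rot J (fst p) (snd p))"
proof -
  have e: "rot J s x = (\<Sum>b\<in>Basis. (x \<bullet> b) *\<^sub>R rot J s b)" for s x
    using linear_sum[OF rot_linear, of J s "\<lambda>b. (x \<bullet> b) *\<^sub>R b" Basis]
    by (simp add: euclidean_representation linear_cmul[OF rot_linear])
  have c: "continuous_on UNIV (\<lambda>s. rot J s b)" for b
    unfolding rot_def by (rule lin_exp_continuous_on) simp
  show ?thesis
    by (subst e) (intro continuous_intros continuous_on_compose2[OF c], auto)
qed

lemma rot_measurable [measurable]: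
  assumes [measurable]: "f \<in> borel_measurable M" "g \<in> borel_measurable M"
  shows "(\<lambda>x. rot J (f x) (g x)) \<in> borel_measurable M"
proof -
  have "(\<lambda>p. rot J (fst p) (snd p)) \<in> borel_measurable borel"
    by (rule borel_measurable_continuous_onI[OF rot_continuous_on])
  from measurable_compose[OF _ this, of "\<lambda>x. (f x, g x)" M] show ?thesis
    by (simp add: borel_prod[symmetric])
qed

lemma rot_distr:
  assumes J: "transpose J = - J" shows "distr std_gaussian borel (rot J s) = std_gaussian"
  by (rule std_gaussian_distr_isometry[OF rot_linear rot_inner_minus[OF J] rot_norm[OF J]])

subsection \<open>The dual of the Langevin drift\<close>

definition langevin_drift :: "real ^ 'd ^ 'd \<Rightarrow> real \<Rightarrow> real \<Rightarrow> (real ^ 'd) \<times> (real ^ 'd) \<Rightarrow> (real ^ 'd) \<times> (real ^ 'd)" where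
  "langevin_drift J \<gamma> \<mu> x = (snd x - \<mu> *\<^sub>R (J *v fst x), - fst x - \<mu> *\<^sub>R (J *v snd x) - \<gamma> *\<^sub>R snd x)"

text \<open>The transpose of \<open>langevin_drift\<close> for skew \<open>J\<close>, which is why
  \<open>J\<close> changes its sign. It governs the functionals \<open>v \<bullet> X t\<close> that
  characteristic functions see.\<close>

definition langevin_dual :: "real ^ 'd ^ 'd \<Rightarrow> real \<Rightarrow> real \<Rightarrow> (real ^ 'd) \<times> (real ^ 'd) \<Rightarrow> (real ^ 'd) \<times> (real ^ 'd)" where
  "langevin_dual J \<gamma> \<mu> v = (- snd v + \<mu> *\<^sub>R (J *v fst v), fst v - \<gamma> *\<^sub>R snd v + \<mu> *\<^sub>R (J *v snd v))"

definition dual_flow :: "real ^ 'd ^ 'd \<Rightarrow> real \<Rightarrow> real \<Rightarrow> real \<Rightarrow> (real ^ 'd) \<times> (real ^ 'd) \<Rightarrow> (real ^ 'd) \<times> (real ^ 'd)" where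
  "dual_flow J \<gamma> \<mu> = lin_exp (langevin_dual J \<gamma> \<mu>)"

lemma langevin_dual_linear: "linear (langevin_dual J \<gamma> \<mu>)"
  by (rule linearI) (auto simp: langevin_dual_def matrix_vector_right_distrib matrix_vector_mult_scaleR algebra_simps)

lemma langevin_dual_inner:
  "transpose J = - J \<Longrightarrow> v \<bullet> langevin_drift J \<gamma> \<mu> x = langevin_dual J \<gamma> \<mu> v \<bullet> x"
  by (simp add: langevin_drift_def langevin_dual_def inner_prod_def inner_diff_right inner_diff_left
      inner_add_left skew_inner[of J "fst v"] skew_inner[of J "snd v"] algebra_simps)

text \<open>Rotation and the exchange of \<open>q\<close> and \<open>p\<close> are skew, so only the
  velocity part is dissipated. This identity gives the contraction of the flow and later the
  variance of the noise.\<close>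

lemma langevin_dual_inner_self:
  "transpose J = - J \<Longrightarrow> v \<bullet> langevin_dual J \<gamma> \<mu> v = - \<gamma> * (norm (snd v))\<^sup>2"
  by (simp add: langevin_dual_def inner_prod_def inner_diff_right inner_add_right skew_inner_self
      power2_norm_eq_inner inner_commute)

context
  fixes J :: "real ^ 'd ^ 'd" and \<gamma> \<mu> :: real
  assumes J: "transpose J = - J" and \<gamma>: "\<gamma> > 0"
begin

lemma langevin_dual_dissipative: "v \<bullet> langevin_dual J \<gamma> \<mu> v \<le> 0"
  using \<gamma> by (simp add: langevin_dual_inner_self[OF J])

lemma dual_flow_linear: "linear (dual_flow J \<gamma> \<mu> t)"
  unfolding dual_flow_def by (rule lin_exp_linear[OF langevin_dual_linear])

lemma dual_flow_derivative:
  "((\<lambda>t. dual_flow J \<gamma> \<mu> t v) has_vector_derivative langevin_dual J \<gamma> \<mu> (dual_flow J \<gamma> \<mu> t v)) (at t)"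
  unfolding dual_flow_def by (rule lin_exp_derivative[OF langevin_dual_linear])

lemma dual_flow_add: "0 \<le> s \<Longrightarrow> dual_flow J \<gamma> \<mu> s (dual_flow J \<gamma> \<mu> t v) = dual_flow J \<gamma> \<mu> (s + t) v"
  unfolding dual_flow_def by (rule lin_exp_add[OF langevin_dual_linear langevin_dual_dissipative])

lemma dual_flow_norm_le: "0 \<le> t \<Longrightarrow> norm (dual_flow J \<gamma> \<mu> t v) \<le> norm v"
  unfolding dual_flow_def by (rule lin_exp_norm_le[OF langevin_dual_linear langevin_dual_dissipative])

text \<open>Exponential decay of a degenerate (hypocoercive) flow: the Lyapunov function
  \<open>|v\<^sub>1|\<^sup>2 + |v\<^sub>2|\<^sup>2 - 2 \<epsilon> v\<^sub>1 \<sqdot> v\<^sub>2\<close> also dissipates the component that is not damped.\<close>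

lemma dual_flow_decay:
  assumes t: "0 \<le> t"
  shows "(norm (dual_flow J \<gamma> \<mu> t v))\<^sup>2 \<le> 4 * exp (- (\<gamma> / (3 + \<gamma>\<^sup>2)) / 2 * t) * (norm v)\<^sup>2"
proof -
  \<comment> \<open>The weight of the cross term: \<open>e \<le> 1 / 2\<close> keeps
    \<open>V\<close> comparable with the squared norm, and
    \<open>e * (3 + \<gamma>\<^sup>2) = \<gamma>\<close> leaves at least \<open>e\<close> of the
    damping of \<open>b\<close> once the cross term has been estimated.\<close>
  define e where "e = \<gamma> / (3 + \<gamma>\<^sup>2)"
  have p: "3 + \<gamma>\<^sup>2 > 0" by (simp add: add_pos_nonneg)
  have e0: "e > 0" using \<gamma> p by (simp add: e_def)
  have e1: "e * (3 + \<gamma>\<^sup>2) = \<gamma>" using p by (simp add: e_def)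
  have e2: "e \<le> 1 / 2"
  proof -
    have "0 \<le> (\<gamma> - 1)\<^sup>2" by simp
    then have "2 * \<gamma> \<le> 3 + \<gamma>\<^sup>2" by (simp add: power2_diff)
    then show ?thesis using p by (simp add: e_def pos_divide_le_eq)
  qed
  define y where "y t = dual_flow J \<gamma> \<mu> t v" for t
  define a where "a t = fst (y t)" for t
  define b where "b t = snd (y t)" for t
  define V where "V t = a t \<bullet> a t + b t \<bullet> b t - 2 * e * (a t \<bullet> b t)" for t
  have N: "(norm (y t))\<^sup>2 = a t \<bullet> a t + b t \<bullet> b t" for t
    by (simp add: power2_norm_eq_inner inner_prod_def a_def b_def)
  have ab: "\<bar>2 * (a t \<bullet> b t)\<bar> \<le> a t \<bullet> a t + b t \<bullet> b t" for t
    using inner_ge_zero[of "a t - b t"] inner_ge_zero[of "a t + b t"]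
    by (simp add: inner_diff_left inner_diff_right inner_add_left inner_add_right inner_commute)
  \<comment> \<open>The two factors 2 multiply to the 4 in the statement.\<close>
  have V1: "V t \<le> 2 * (norm (y t))\<^sup>2" and V2: "(norm (y t))\<^sup>2 \<le> 2 * V t" for t
  proof -
    have "\<bar>e * (2 * (a t \<bullet> b t))\<bar> \<le> 1 / 2 * (a t \<bullet> a t + b t \<bullet> b t)"
      unfolding abs_mult using e0 e2 ab[of t] by (intro mult_mono) auto
    then have "\<bar>2 * e * (a t \<bullet> b t)\<bar> \<le> 1 / 2 * (norm (y t))\<^sup>2"
      by (simp add: N mult.assoc mult.left_commute)
    then have "2 * e * (a t \<bullet> b t) \<le> 1 / 2 * (norm (y t))\<^sup>2" "- (2 * e * (a t \<bullet> b t)) \<le> 1 / 2 * (norm (y t))\<^sup>2"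
      by linarith+
    moreover have "V t = (norm (y t))\<^sup>2 - 2 * e * (a t \<bullet> b t)" by (simp add: V_def N)
    ultimately show "V t \<le> 2 * (norm (y t))\<^sup>2" "(norm (y t))\<^sup>2 \<le> 2 * V t"
      using zero_le_power2[of "norm (y t)"] by linarith+
  qed
  have dy: "(y has_vector_derivative langevin_dual J \<gamma> \<mu> (y t)) (at t)" for t
    using dual_flow_derivative[of v t] by (simp add: y_def[abs_def])
  have da: "(a has_vector_derivative - b t + \<mu> *\<^sub>R (J *v a t)) (at t)" for t
    using bounded_linear.has_vector_derivative[OF bounded_linear_fst dy[of t]]
    by (simp add: a_def[abs_def] b_def langevin_dual_def)
  have db: "(b has_vector_derivative a t - \<gamma> *\<^sub>R b t + \<mu> *\<^sub>R (J *v b t)) (at t)" for t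
    using bounded_linear.has_vector_derivative[OF bounded_linear_snd dy[of t]]
    by (simp add: a_def b_def[abs_def] langevin_dual_def)
  define V' where "V' t = - 2 * \<gamma> * (b t \<bullet> b t) - 2 * e * (a t \<bullet> a t - b t \<bullet> b t - \<gamma> * (a t \<bullet> b t))" for t
  have dV: "(V has_real_derivative V' t) (at t)" for t
  proof -
    have "((\<lambda>t. a t \<bullet> a t + b t \<bullet> b t - 2 * e * (a t \<bullet> b t)) has_real_derivative
      (a t \<bullet> (- b t + \<mu> *\<^sub>R (J *v a t)) + (- b t + \<mu> *\<^sub>R (J *v a t)) \<bullet> a t) +
      (b t \<bullet> (a t - \<gamma> *\<^sub>R b t + \<mu> *\<^sub>R (J *v b t)) + (a t - \<gamma> *\<^sub>R b t + \<mu> *\<^sub>R (J *v b t)) \<bullet> b t) -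
      2 * e * (a t \<bullet> (a t - \<gamma> *\<^sub>R b t + \<mu> *\<^sub>R (J *v b t)) + (- b t + \<mu> *\<^sub>R (J *v a t)) \<bullet> b t)) (at t)"
      by (intro DERIV_diff DERIV_add DERIV_cmult inner_has_real_derivative da db)
    moreover have "(J *v a t) \<bullet> b t = - (a t \<bullet> (J *v b t))" using skew_inner[OF J, of "a t" "b t"] by simp
    ultimately show ?thesis
      using skew_inner_self[OF J]
      by (simp add: V_def[abs_def] V'_def inner_add_left inner_add_right inner_diff_left inner_diff_right
          inner_commute[of "b t" "a t"] inner_commute[of "J *v _"] algebra_simps)
  qed
  \<comment> \<open>The mixed term in \<open>a t \<bullet> b t\<close> is absorbed by Young's
    inequality, from the square of \<open>a t - \<gamma> *\<^sub>R b t\<close>.\<close>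
  have V': "V' t + e / 2 * V t \<le> 0" for t
  proof -
    have "0 \<le> (a t - \<gamma> *\<^sub>R b t) \<bullet> (a t - \<gamma> *\<^sub>R b t)" by (rule inner_ge_zero)
    then have "2 * \<gamma> * (a t \<bullet> b t) \<le> a t \<bullet> a t + \<gamma>\<^sup>2 * (b t \<bullet> b t)"
      by (simp add: inner_diff_left inner_diff_right inner_commute power2_eq_square algebra_simps)
    from mult_left_mono[OF this, of e]
    have "2 * e * \<gamma> * (a t \<bullet> b t) \<le> e * (a t \<bullet> a t) + e * \<gamma>\<^sup>2 * (b t \<bullet> b t)"
      using e0 by (simp add: algebra_simps)
    then have "V' t \<le> - e * (a t \<bullet> a t) - (2 * \<gamma> - 2 * e - e * \<gamma>\<^sup>2) * (b t \<bullet> b t)"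
      by (simp add: V'_def algebra_simps)
    also have "\<dots> \<le> - e * (a t \<bullet> a t) - e * (b t \<bullet> b t)"
    proof -
      have "e \<le> 2 * \<gamma> - 2 * e - e * \<gamma>\<^sup>2" using e1 \<gamma> by (simp add: algebra_simps)
      then show ?thesis using mult_right_mono[of e _ "b t \<bullet> b t"] by auto
    qed
    also have "\<dots> = - e * (norm (y t))\<^sup>2" by (simp add: N algebra_simps)
    finally have "V' t \<le> - e * (norm (y t))\<^sup>2" .
    moreover have "e / 2 * V t \<le> e * (norm (y t))\<^sup>2"
      using mult_left_mono[OF V1[of t], of "e / 2"] e0 by simp
    ultimately show ?thesis by linarith
  qed
  have "exp (e / 2 * t) * V t \<le> exp (e / 2 * 0) * V 0"
  proof (rule DERIV_nonpos_imp_nonincreasing[OF t])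
    fix s
    have "((\<lambda>t. exp (e / 2 * t) * V t) has_real_derivative exp (e / 2 * s) * (V' s + e / 2 * V s)) (at s)"
      by (auto intro!: derivative_eq_intros dV simp: algebra_simps)
    moreover have "exp (e / 2 * s) * (V' s + e / 2 * V s) \<le> 0"
      using V'[of s] by (simp add: mult_le_0_iff)
    ultimately show "\<exists>y. ((\<lambda>t. exp (e / 2 * t) * V t) has_real_derivative y) (at s) \<and> y \<le> 0" by blast
  qed
  then have "V t \<le> exp (- (e / 2 * t)) * V 0"
    by (simp add: exp_minus field_simps)
  also have "\<dots> \<le> exp (- (e / 2 * t)) * (2 * (norm v)\<^sup>2)"
    using V1[of 0] by (intro mult_left_mono) (auto simp: y_def dual_flow_def)
  finally show ?thesis using V2[of t] by (simp add: y_def e_def)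
qed

lemma dual_flow_tendsto_0: "((\<lambda>n. dual_flow J \<gamma> \<mu> (real n) v) \<longlongrightarrow> 0) sequentially"
proof -
  define b where "b = \<gamma> / (3 + \<gamma>\<^sup>2) / 2"
  have b: "b > 0" using \<gamma> by (simp add: b_def add_pos_nonneg)
  have le: "(norm (dual_flow J \<gamma> \<mu> (real n) v))\<^sup>2 \<le> 4 * exp (- b * real n) * (norm v)\<^sup>2" for n
    using dual_flow_decay[of "real n" v] by (simp add: b_def)
  have "(\<lambda>n. 4 * exp (- b * real n) * (norm v)\<^sup>2) \<longlonglongrightarrow> 4 * 0 * (norm v)\<^sup>2"
  proof (intro tendsto_intros filterlim_compose[OF exp_at_bot])
    show "filterlim (\<lambda>n. - b * real n) at_bot sequentially"
      using filterlim_tendsto_neg_mult_at_bot[OF tendsto_const _ filterlim_real_sequentially, of "- b"] b by simp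
  qed
  then have "(\<lambda>n. (norm (dual_flow J \<gamma> \<mu> (real n) v))\<^sup>2) \<longlonglongrightarrow> 0"
    by - (rule Lim_null_comparison[where g="\<lambda>n. 4 * exp (- b * real n) * (norm v)\<^sup>2"], use le in simp_all)
  then have "(\<lambda>n. sqrt ((norm (dual_flow J \<gamma> \<mu> (real n) v))\<^sup>2)) \<longlonglongrightarrow> sqrt 0" by (intro tendsto_real_sqrt)
  then show ?thesis by (simp add: tendsto_norm_zero_iff)
qed

end

section \<open>The damped oscillator\<close>

definition oscillator :: "real \<Rightarrow> real \<times> real \<Rightarrow> real \<times> real" where
  "oscillator \<gamma> v = (- snd v, fst v - \<gamma> * snd v)"

text \<open>Together with \<open>osc_p\<close>, the coefficients with which the initial position and
  velocity enter the position at time \<open>t\<close>, up to rotation.\<close>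

definition osc_q :: "real \<Rightarrow> real \<Rightarrow> real" where
  "osc_q \<gamma> t = fst (lin_exp (oscillator \<gamma>) t (1, 0))"

definition osc_p :: "real \<Rightarrow> real \<Rightarrow> real" where
  "osc_p \<gamma> t = snd (lin_exp (oscillator \<gamma>) t (1, 0))"

lemma oscillator_linear: "linear (oscillator \<gamma>)"
  by (rule linearI) (auto simp: oscillator_def algebra_simps)

lemma osc_0 [simp]: "osc_q \<gamma> 0 = 1" "osc_p \<gamma> 0 = 0"
  by (simp_all add: osc_q_def osc_p_def)

lemma osc_continuous_on: "continuous_on S (osc_q \<gamma>)" "continuous_on S (osc_p \<gamma>)"
  unfolding osc_q_def osc_p_def
  by (intro continuous_intros lin_exp_continuous_on oscillator_linear)+

lemma osc_measurable [measurable]: "osc_q \<gamma> \<in> borel_measurable borel" "osc_p \<gamma> \<in> borel_measurable borel"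
  by (intro borel_measurable_continuous_onI osc_continuous_on)+

lemma osc_derivative:
  "(osc_q \<gamma> has_real_derivative - osc_p \<gamma> t) (at t)"
  "(osc_p \<gamma> has_real_derivative osc_q \<gamma> t - \<gamma> * osc_p \<gamma> t) (at t)"
  using bounded_linear.has_vector_derivative[OF bounded_linear_fst lin_exp_derivative[OF oscillator_linear[of \<gamma>], of "(1, 0)" t]]
    bounded_linear.has_vector_derivative[OF bounded_linear_snd lin_exp_derivative[OF oscillator_linear[of \<gamma>], of "(1, 0)" t]]
  by (simp_all add: osc_q_def[abs_def] osc_p_def[abs_def] oscillator_def has_real_derivative_iff_has_vector_derivative)

text \<open>The rotation commutes with the oscillator, so the product of the two flows solves the
  dual equation, and uniqueness identifies it. On positions, \<mu> now occurs in the angle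
  alone.\<close>

lemma dual_flow_position:
  fixes J :: "real ^ 'd ^ 'd"
  assumes J: "transpose J = - J" and \<gamma>: "\<gamma> > 0" and t: "0 \<le> t"
  shows "dual_flow J \<gamma> \<mu> t (v, 0) = (osc_q \<gamma> t *\<^sub>R rot J (\<mu> * t) v, osc_p \<gamma> t *\<^sub>R rot J (\<mu> * t) v)"
proof (rule dissipative_ode_unique[OF langevin_dual_linear langevin_dual_dissipative[OF J \<gamma>] dual_flow_derivative[OF J \<gamma>]
      _ _ t, where z="\<lambda>t. (osc_q \<gamma> t *\<^sub>R rot J (\<mu> * t) v, osc_p \<gamma> t *\<^sub>R rot J (\<mu> * t) v)"])
  fix t
  have r: "((\<lambda>t. rot J (\<mu> * t) v) has_vector_derivative \<mu> *\<^sub>R (J *v rot J (\<mu> * t) v)) (at t)"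
    using has_vector_derivative_affine[of "\<lambda>s. rot J s v" _ \<mu> t 0, OF rot_derivative] by simp
  show "((\<lambda>t. (osc_q \<gamma> t *\<^sub>R rot J (\<mu> * t) v, osc_p \<gamma> t *\<^sub>R rot J (\<mu> * t) v)) has_vector_derivative
      langevin_dual J \<gamma> \<mu> (osc_q \<gamma> t *\<^sub>R rot J (\<mu> * t) v, osc_p \<gamma> t *\<^sub>R rot J (\<mu> * t) v)) (at t)"
    unfolding langevin_dual_def fst_conv snd_conv
    by (rule has_vector_derivative_eq_rhs[OF has_vector_derivative_Pair[OF
          has_vector_derivative_scaleR[OF osc_derivative(1) r] has_vector_derivative_scaleR[OF osc_derivative(2) r]]])
       (simp add: matrix_vector_mult_scaleR algebra_simps)
qed (simp add: dual_flow_def)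

lemma osc_norm:
  fixes J :: "real ^ 'd ^ 'd"
  assumes J: "transpose J = - J" and \<gamma>: "\<gamma> > 0" and t: "0 \<le> t"
  shows "(norm (dual_flow J \<gamma> \<mu> t (v, 0)))\<^sup>2 = ((osc_q \<gamma> t)\<^sup>2 + (osc_p \<gamma> t)\<^sup>2) * (norm v)\<^sup>2"
  by (simp add: dual_flow_position[OF assms] norm_prod_def rot_norm[OF J] power_mult_distrib algebra_simps)

text \<open>The scalar oscillator is the dual flow in dimension one with \<open>J = 0\<close>, so
  the Lyapunov argument need not be repeated.\<close>

lemma osc_bounds:
  assumes \<gamma>: "\<gamma> > 0" and t: "0 \<le> t"
  shows "(osc_q \<gamma> t)\<^sup>2 + (osc_p \<gamma> t)\<^sup>2 \<le> 1"
    "(osc_q \<gamma> t)\<^sup>2 + (osc_p \<gamma> t)\<^sup>2 \<le> 4 * exp (- (\<gamma> / (3 + \<gamma>\<^sup>2)) / 2 * t)"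
proof -
  have J: "transpose (0 :: real ^ 1 ^ 1) = - 0" by (simp add: transpose_def vec_eq_iff)
  have n: "norm (axis 1 1 :: real ^ 1) = 1" "norm (axis 1 1 :: real ^ 1, 0 :: real ^ 1) = 1"
    by (simp_all add: norm_prod_def)
  show "(osc_q \<gamma> t)\<^sup>2 + (osc_p \<gamma> t)\<^sup>2 \<le> 1"
    using power_mono[OF dual_flow_norm_le[OF J \<gamma> t, of 0 "(axis 1 1, 0)"] norm_ge_zero, of 2]
      osc_norm[OF J \<gamma> t, of 0 "axis 1 1"] n by simp
  show "(osc_q \<gamma> t)\<^sup>2 + (osc_p \<gamma> t)\<^sup>2 \<le> 4 * exp (- (\<gamma> / (3 + \<gamma>\<^sup>2)) / 2 * t)"
    using dual_flow_decay[OF J \<gamma> t, of 0 "(axis 1 1, 0)"] osc_norm[OF J \<gamma> t, of 0 "axis 1 1"] n by simp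
qed

section \<open>The law of the Langevin process\<close>

lemma integral_sum_partition:
  fixes h :: "real \<Rightarrow> 'a::banach"
  assumes "continuous_on {0..T} h" and "0 \<le> d" "real n * d \<le> T"
  shows "integral {0..real n * d} h = (\<Sum>k<n. integral {real k * d..real (Suc k) * d} h)"
  using assms(3)
proof (induction n)
  case (Suc n)
  have le: "real n * d \<le> real (Suc n) * d" using assms(2) by (simp add: algebra_simps)
  have "h integrable_on {0..real (Suc n) * d}"
    by (rule integrable_continuous_interval, rule continuous_on_subset[OF assms(1)]) (use Suc.prems in auto)
  then have "integral {0..real (Suc n) * d} h = integral {0..real n * d} h + integral {real n * d..real (Suc n) * d} h"
    using le assms(2) by (intro Henstock_Kurzweil_Integration.integral_combine[symmetric]) auto
  with Suc le show ?case by simp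
qed simp

text \<open>On each cell the increment of \<open>g\<close> is the integral of \<open>g'\<close>, so
  only the modulus of continuity of \<open>w\<close> enters. The tags are arbitrary in their cells:
  left end points occur in the variance of the noise, right ones in the summation by parts.\<close>

lemma riemann_stieltjes_sum_tendsto:
  fixes g g' w :: "real \<Rightarrow> 'a::euclidean_space"
  assumes g: "\<And>t. (g has_vector_derivative g' t) (at t)" and g': "continuous_on {0..T} g'"
    and w: "continuous_on {0..T} w" and T: "0 \<le> T"
    and \<tau>: "\<And>n k. k < Suc n \<Longrightarrow> T * real k / Suc n \<le> \<tau> n k \<and> \<tau> n k \<le> T * real (Suc k) / Suc n"
  shows "(\<lambda>n. \<Sum>k<Suc n. (g (T * real (Suc k) / Suc n) - g (T * real k / Suc n)) \<bullet> w (\<tau> n k))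
    \<longlonglongrightarrow> integral {0..T} (\<lambda>s. g' s \<bullet> w s)"
proof (rule LIMSEQ_I)
  fix e :: real assume e: "e > 0"
  have "compact (g' ` {0..T})" by (rule compact_continuous_image[OF g' compact_Icc])
  then obtain B where B: "\<And>s. s \<in> {0..T} \<Longrightarrow> norm (g' s) \<le> B" "B > 0"
    using compact_imp_bounded[THEN bounded_pos[THEN iffD1]] by (metis (no_types, lifting) image_eqI)
  \<comment> \<open>\<open>T + 1\<close> in place of \<open>T\<close> keeps the quotient meaningful
    for \<open>T = 0\<close>.\<close>
  define \<eta> where "\<eta> = e / (2 * B * (T + 1))"
  have \<eta>: "\<eta> > 0" using e B T by (simp add: \<eta>_def)
  obtain \<delta> where \<delta>: "\<delta> > 0" "\<And>s r. s \<in> {0..T} \<Longrightarrow> r \<in> {0..T} \<Longrightarrow> dist r s < \<delta> \<Longrightarrow> dist (w r) (w s) < \<eta>"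
    using compact_uniformly_continuous[OF w compact_Icc] \<eta> unfolding uniformly_continuous_on_def by metis
  obtain N where N: "T / \<delta> < real N" using reals_Archimedean2 by blast
  have "norm ((\<Sum>k<Suc n. (g (T * real (Suc k) / Suc n) - g (T * real k / Suc n)) \<bullet> w (\<tau> n k)) -
      integral {0..T} (\<lambda>s. g' s \<bullet> w s)) < e" if n: "n \<ge> N" for n
  proof -
    define d where "d = T / Suc n"
    have d: "d \<ge> 0" "real (Suc n) * d = T" using T by (simp_all add: d_def)
    have t: "T * real k / Suc n = real k * d" for k by (simp add: d_def)
    have d\<delta>: "d < \<delta>"
    proof -
      have "T / \<delta> < real (Suc n)" using N n by linarith
      then show ?thesis using \<delta>(1) by (simp add: d_def field_simps)
    qed
    have cw: "continuous_on {0..T} (\<lambda>s. g' s \<bullet> w s)" by (intro continuous_intros g' w)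
    have sub: "{real k * d..real (Suc k) * d} \<subseteq> {0..T}" if "k < Suc n" for k
    proof -
      have "real (Suc k) * d \<le> real (Suc n) * d" using that d(1) by (intro mult_right_mono) auto
      then show ?thesis using d by auto
    qed
    have int: "(g (T * real (Suc k) / Suc n) - g (T * real k / Suc n)) \<bullet> w (\<tau> n k) -
       integral {real k * d..real (Suc k) * d} (\<lambda>s. g' s \<bullet> w s) =
       integral {real k * d..real (Suc k) * d} (\<lambda>s. g' s \<bullet> (w (\<tau> n k) - w s))" if k: "k < Suc n" for k
    proof -
      have le: "real k * d \<le> real (Suc k) * d" using d by (simp add: algebra_simps)
      have "((\<lambda>s. g' s) has_integral (g (real (Suc k) * d) - g (real k * d))) {real k * d..real (Suc k) * d}"
        by (rule fundamental_theorem_of_calculus[OF le]) (auto intro: has_vector_derivative_at_within g)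
      from has_integral_linear[OF this bounded_linear_inner_left[of "w (\<tau> n k)"]]
      have 1: "((\<lambda>s. g' s \<bullet> w (\<tau> n k)) has_integral (g (real (Suc k) * d) - g (real k * d)) \<bullet> w (\<tau> n k))
          {real k * d..real (Suc k) * d}"
        by (simp add: o_def)
      have "(\<lambda>s. g' s \<bullet> w s) integrable_on {real k * d..real (Suc k) * d}"
        by (rule integrable_continuous_interval[OF continuous_on_subset[OF cw sub[OF k]]])
      from has_integral_diff[OF 1 integrable_integral[OF this]]
      show ?thesis unfolding t by (simp add: inner_diff_right integral_unique del: of_nat_Suc)
    qed
    have bnd: "\<bar>integral {real k * d..real (Suc k) * d} (\<lambda>s. g' s \<bullet> (w (\<tau> n k) - w s))\<bar> \<le> (B * \<eta>) * d"
      if k: "k < Suc n" for k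
    proof -
      have le: "real k * d \<le> real (Suc k) * d" using d by (simp add: algebra_simps)
      have "norm (integral {real k * d..real (Suc k) * d} (\<lambda>s. g' s \<bullet> (w (\<tau> n k) - w s)))
          \<le> (B * \<eta>) * (real (Suc k) * d - real k * d)"
      proof (rule integral_bound[OF le])
        show "continuous_on {real k * d..real (Suc k) * d} (\<lambda>s. g' s \<bullet> (w (\<tau> n k) - w s))"
          by (intro continuous_intros continuous_on_subset[OF g' sub[OF k]] continuous_on_subset[OF w sub[OF k]])
        fix s assume s: "s \<in> {real k * d..real (Suc k) * d}"
        have \<tau>k: "\<tau> n k \<in> {real k * d..real (Suc k) * d}" using \<tau>[OF k] unfolding t by simp
        have "\<bar>\<tau> n k - s\<bar> \<le> d" using s \<tau>k by (auto simp: algebra_simps)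
        then have "dist (w (\<tau> n k)) (w s) < \<eta>"
          using d\<delta> subsetD[OF sub[OF k] s] subsetD[OF sub[OF k] \<tau>k] by (intro \<delta>(2)) (auto simp: dist_real_def)
        moreover have "norm (g' s) \<le> B" using subsetD[OF sub[OF k] s] by (rule B)
        ultimately have "norm (g' s) * norm (w (\<tau> n k) - w s) \<le> B * \<eta>"
          using B(2) by (intro mult_mono) (auto simp: dist_norm)
        then show "norm (g' s \<bullet> (w (\<tau> n k) - w s)) \<le> B * \<eta>"
          using Cauchy_Schwarz_ineq2[of "g' s" "w (\<tau> n k) - w s"] by simp
      qed
      then show ?thesis by (simp add: algebra_simps)
    qed
    have "integral {0..T} (\<lambda>s. g' s \<bullet> w s) = (\<Sum>k<Suc n. integral {real k * d..real (Suc k) * d} (\<lambda>s. g' s \<bullet> w s))"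
      using integral_sum_partition[OF cw d(1), of "Suc n"] d(2) by simp
    then have "norm ((\<Sum>k<Suc n. (g (T * real (Suc k) / Suc n) - g (T * real k / Suc n)) \<bullet> w (\<tau> n k)) -
      integral {0..T} (\<lambda>s. g' s \<bullet> w s)) =
      \<bar>\<Sum>k<Suc n. integral {real k * d..real (Suc k) * d} (\<lambda>s. g' s \<bullet> (w (\<tau> n k) - w s))\<bar>"
      unfolding real_norm_def by (simp only: sum_subtractf[symmetric], intro arg_cong[where f=abs] sum.cong refl int) simp
    also have "\<dots> \<le> (\<Sum>k<Suc n. (B * \<eta>) * d)"
      by (rule order_trans[OF sum_abs sum_mono]) (use bnd in auto)
    also have "\<dots> = B * \<eta> * T" using d(2) by (simp add: mult.assoc mult.left_commute)
    also have "\<dots> = e / 2 * (T / (T + 1))" using B(2) T by (simp add: \<eta>_def)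
    also have "\<dots> \<le> e / 2 * 1" using e T by (intro mult_left_mono) auto
    also have "\<dots> < e" using e by simp
    finally show ?thesis .
  qed
  then show "\<exists>N. \<forall>n\<ge>N. norm ((\<Sum>k<Suc n. (g (T * real (Suc k) / Suc n) - g (T * real k / Suc n)) \<bullet> w (\<tau> n k)) -
      integral {0..T} (\<lambda>s. g' s \<bullet> w s)) < e" by blast
qed

lemma sum_by_parts:
  fixes g w :: "nat \<Rightarrow> 'a::real_inner"
  shows "(\<Sum>k<n. g k \<bullet> (w (Suc k) - w k)) = g n \<bullet> w n - g 0 \<bullet> w 0 - (\<Sum>k<n. (g (Suc k) - g k) \<bullet> w (Suc k))"
  by (induction n) (auto simp: inner_diff_left inner_diff_right)

text \<open>The Wiener integral \<open>\<integral> g dW\<close> of a continuously differentiable \<open>g\<close>, along a fixed path,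
  defined through integration by parts.\<close>

lemma wiener_sum_tendsto:
  fixes g g' w :: "real \<Rightarrow> 'a::euclidean_space"
  assumes g: "\<And>t. (g has_vector_derivative g' t) (at t)" and g': "continuous_on {0..T} g'"
    and w: "continuous_on {0..T} w" and T: "0 \<le> T"
  shows "(\<lambda>n. \<Sum>k<Suc n. g (T * real k / Suc n) \<bullet> (w (T * real (Suc k) / Suc n) - w (T * real k / Suc n)))
    \<longlonglongrightarrow> g T \<bullet> w T - g 0 \<bullet> w 0 - integral {0..T} (\<lambda>s. g' s \<bullet> w s)"
proof -
  have "(\<lambda>n. g T \<bullet> w T - g 0 \<bullet> w 0 - (\<Sum>k<Suc n. (g (T * real (Suc k) / Suc n) - g (T * real k / Suc n)) \<bullet> w (T * real (Suc k) / Suc n)))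
    \<longlonglongrightarrow> g T \<bullet> w T - g 0 \<bullet> w 0 - integral {0..T} (\<lambda>s. g' s \<bullet> w s)"
    using T by (intro tendsto_intros riemann_stieltjes_sum_tendsto[OF g g' w T]) (auto simp: divide_right_mono mult_left_mono)
  moreover have "(\<Sum>k<Suc n. g (T * real k / Suc n) \<bullet> (w (T * real (Suc k) / Suc n) - w (T * real k / Suc n))) =
     g T \<bullet> w T - g 0 \<bullet> w 0 - (\<Sum>k<Suc n. (g (T * real (Suc k) / Suc n) - g (T * real k / Suc n)) \<bullet> w (T * real (Suc k) / Suc n))" for n
    using sum_by_parts[of "\<lambda>k. g (T * real k / Suc n)" "\<lambda>k. w (T * real k / Suc n)" "Suc n"] by simp
  ultimately show ?thesis by simp
qed

text \<open>Variation of constants in dual form. The vector \<open>v\<close> is transported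
  backwards by \<open>y s\<close>, and the path with its noise subtracted, \<open>Y s\<close>, is
  differentiable. In the derivative of \<open>y s \<bullet> Y s\<close> duality cancels the drift
  terms except where the dual drift meets the subtracted noise, so the noise stands under an
  ordinary integral.\<close>

lemma langevin_path_formula:
  fixes J :: "real ^ 'd ^ 'd" and X :: "real \<Rightarrow> (real ^ 'd) \<times> (real ^ 'd)" and w :: "real \<Rightarrow> real ^ 'd"
  assumes J: "transpose J = - J" and \<gamma>: "\<gamma> > 0" and T: "0 \<le> T"
    and X: "continuous_on {0..} X" and w: "continuous_on {0..T} w" "w 0 = 0"
    and q: "\<And>t. 0 \<le> t \<Longrightarrow> fst (X t) = fst x + integral {0..t} (\<lambda>s. snd (X s) - \<mu> *\<^sub>R (J *v fst (X s)))"
    and p: "\<And>t. 0 \<le> t \<Longrightarrow> snd (X t) = snd x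
            + integral {0..t} (\<lambda>s. - fst (X s) - \<mu> *\<^sub>R (J *v snd (X s)) - \<gamma> *\<^sub>R snd (X s)) + \<sigma> *\<^sub>R w t"
  shows "v \<bullet> X T = dual_flow J \<gamma> \<mu> T v \<bullet> x + \<sigma> * (snd v \<bullet> w T -
     integral {0..T} (\<lambda>s. - snd (langevin_dual J \<gamma> \<mu> (dual_flow J \<gamma> \<mu> (T - s) v)) \<bullet> w s))"
proof -
  define y where "y s = dual_flow J \<gamma> \<mu> (T - s) v" for s
  define Y where "Y s = X s - (0, \<sigma> *\<^sub>R w s)" for s
  have cX: "continuous_on {0..T} X" by (rule continuous_on_subset[OF X]) auto
  have dy: "(y has_vector_derivative - langevin_dual J \<gamma> \<mu> (y s)) (at s within {0..T})" for s
    using has_vector_derivative_affine[of "\<lambda>s. dual_flow J \<gamma> \<mu> s v" _ "-1" s T, OF dual_flow_derivative[OF J \<gamma>]]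
    by - (rule has_vector_derivative_at_within, simp add: y_def[abs_def])
  have c1: "continuous_on {0..T} (\<lambda>s. snd (X s) - \<mu> *\<^sub>R (J *v fst (X s)))"
    and c2: "continuous_on {0..T} (\<lambda>s. - fst (X s) - \<mu> *\<^sub>R (J *v snd (X s)) - \<gamma> *\<^sub>R snd (X s))"
    by (intro continuous_intros cX bounded_linear.continuous_on[OF matrix_vector_mul_bounded_linear])+
  have Yeq: "Y s = (fst x + integral {0..s} (\<lambda>s. snd (X s) - \<mu> *\<^sub>R (J *v fst (X s))),
        snd x + integral {0..s} (\<lambda>s. - fst (X s) - \<mu> *\<^sub>R (J *v snd (X s)) - \<gamma> *\<^sub>R snd (X s)))" if "0 \<le> s" for s
    using q[OF that] p[OF that] by (simp add: Y_def prod_eq_iff)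
  have dY: "(Y has_vector_derivative langevin_drift J \<gamma> \<mu> (X s)) (at s within {0..T})" if s: "s \<in> {0..T}" for s
  proof (rule has_vector_derivative_transform[OF s])
    show "Y r = (\<lambda>s. (fst x + integral {0..s} (\<lambda>s. snd (X s) - \<mu> *\<^sub>R (J *v fst (X s))),
        snd x + integral {0..s} (\<lambda>s. - fst (X s) - \<mu> *\<^sub>R (J *v snd (X s)) - \<gamma> *\<^sub>R snd (X s)))) r" if "r \<in> {0..T}" for r
      using Yeq[of r] that by simp
    show "((\<lambda>s. (fst x + integral {0..s} (\<lambda>s. snd (X s) - \<mu> *\<^sub>R (J *v fst (X s))),
        snd x + integral {0..s} (\<lambda>s. - fst (X s) - \<mu> *\<^sub>R (J *v snd (X s)) - \<gamma> *\<^sub>R snd (X s))))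
        has_vector_derivative langevin_drift J \<gamma> \<mu> (X s)) (at s within {0..T})"
      unfolding langevin_drift_def
      by (intro has_vector_derivative_Pair has_vector_derivative_eq_rhs[OF has_vector_derivative_add[OF has_vector_derivative_const
            integral_has_vector_derivative[OF c1 s]]] has_vector_derivative_eq_rhs[OF has_vector_derivative_add[OF has_vector_derivative_const
            integral_has_vector_derivative[OF c2 s]]]) simp_all
  qed
  have "((\<lambda>s. \<sigma> * (snd (langevin_dual J \<gamma> \<mu> (y s)) \<bullet> w s)) has_integral (y T \<bullet> Y T - y 0 \<bullet> Y 0)) {0..T}"
  proof (rule fundamental_theorem_of_calculus[OF T])
    fix s assume s: "s \<in> {0..T}"
    have "((\<lambda>s. y s \<bullet> Y s) has_real_derivative
        (y s \<bullet> langevin_drift J \<gamma> \<mu> (X s) + - langevin_dual J \<gamma> \<mu> (y s) \<bullet> Y s)) (at s within {0..T})"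
      by (rule inner_has_real_derivative[OF dy dY[OF s]])
    moreover have "y s \<bullet> langevin_drift J \<gamma> \<mu> (X s) + - langevin_dual J \<gamma> \<mu> (y s) \<bullet> Y s =
        \<sigma> * (snd (langevin_dual J \<gamma> \<mu> (y s)) \<bullet> w s)"
      unfolding langevin_dual_inner[OF J] by (simp add: Y_def inner_diff_right inner_prod_def)
    ultimately show "((\<lambda>s. y s \<bullet> Y s) has_vector_derivative \<sigma> * (snd (langevin_dual J \<gamma> \<mu> (y s)) \<bullet> w s)) (at s within {0..T})"
      by (simp add: has_real_derivative_iff_has_vector_derivative)
  qed
  then have "\<sigma> * integral {0..T} (\<lambda>s. snd (langevin_dual J \<gamma> \<mu> (y s)) \<bullet> w s) = y T \<bullet> Y T - y 0 \<bullet> Y 0"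
    unfolding integral_mult_right[symmetric] by (rule integral_unique)
  moreover have "y T = v" by (simp add: y_def dual_flow_def)
  moreover have "Y 0 = x" using Yeq[of 0] by simp
  moreover have "y 0 = dual_flow J \<gamma> \<mu> T v" by (simp add: y_def)
  ultimately show ?thesis
    by (simp add: Y_def inner_diff_right inner_prod_def algebra_simps y_def[symmetric])
qed

lemma char_brownian_increment:
  fixes W :: "real \<Rightarrow> 'w \<Rightarrow> 'a::euclidean_space"
  assumes W: "standard_brownian_motion M W" and s: "0 \<le> s" "s \<le> t"
  shows "(CLINT \<omega>|M. iexp (u \<bullet> (W t \<omega> - W s \<omega>))) = exp (- (t - s) * (norm u)\<^sup>2 / 2)"
proof -
  have [measurable]: "W t \<in> borel_measurable M" "W s \<in> borel_measurable M"
    using W s by (auto simp: standard_brownian_motion_def)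
  have "(CLINT \<omega>|M. iexp (u \<bullet> (W t \<omega> - W s \<omega>))) = char_vec (distr M borel (\<lambda>\<omega>. W t \<omega> - W s \<omega>)) u"
    by (subst char_vec_distr) auto
  also have "\<dots> = char_vec (distr std_gaussian borel (\<lambda>z. sqrt (t - s) *\<^sub>R z)) u"
    using W s by (simp add: standard_brownian_motion_def)
  also have "\<dots> = exp (- (norm (sqrt (t - s) *\<^sub>R u))\<^sup>2 / 2)"
    by (rule char_vec_std_gaussian_linear) (auto simp: linear_iff scaleR_add_right)
  also have "(norm (sqrt (t - s) *\<^sub>R u))\<^sup>2 = (t - s) * (norm u)\<^sup>2"
    using s by (simp add: power_mult_distrib)
  finally show ?thesis by (simp only: mult_minus_left)
qed

lemma char_brownian_sum:
  fixes W :: "real \<Rightarrow> 'w \<Rightarrow> 'a::euclidean_space" and c :: "nat \<Rightarrow> 'a"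
  assumes M: "prob_space M" and W: "standard_brownian_motion M W" and t: "0 \<le> t 0" "mono t"
  shows "(CLINT \<omega>|M. iexp (\<Sum>k<n. c k \<bullet> (W (t (Suc k)) \<omega> - W (t k) \<omega>))) =
     exp (- (\<Sum>k<n. (t (Suc k) - t k) * (norm (c k))\<^sup>2) / 2)"
proof -
  interpret prob_space M by fact
  have t0: "0 \<le> t k" "t k \<le> t (Suc k)" for k
    using t(1) monoD[OF t(2), of 0 k] monoD[OF t(2), of k "Suc k"] by auto
  have [measurable]: "W (t k) \<in> borel_measurable M" for k
    using W t0 by (auto simp: standard_brownian_motion_def)
  have ind: "indep_vars (\<lambda>_. borel) (\<lambda>k \<omega>. W (t (Suc k)) \<omega> - W (t k) \<omega>) {..<n}"
    using W t by (auto simp: standard_brownian_motion_def)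
  have ind': "indep_vars (\<lambda>_. borel) (\<lambda>k \<omega>. iexp (c k \<bullet> (W (t (Suc k)) \<omega> - W (t k) \<omega>))) {..<n}"
    by (rule indep_vars_compose2[OF ind, where Y="\<lambda>k z. iexp (c k \<bullet> z)"]) simp
  have "(CLINT \<omega>|M. iexp (\<Sum>k<n. c k \<bullet> (W (t (Suc k)) \<omega> - W (t k) \<omega>))) =
     (CLINT \<omega>|M. (\<Prod>k<n. iexp (c k \<bullet> (W (t (Suc k)) \<omega> - W (t k) \<omega>))))"
    by (simp add: exp_sum sum_distrib_left)
  also have "\<dots> = (\<Prod>k<n. CLINT \<omega>|M. iexp (c k \<bullet> (W (t (Suc k)) \<omega> - W (t k) \<omega>)))"
    by (rule indep_vars_lebesgue_integral[OF _ ind'])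
       (auto intro!: integrable_iexp_finite finite_measure_axioms)
  also have "\<dots> = (\<Prod>k<n. complex_of_real (exp (- ((t (Suc k) - t k) * (norm (c k))\<^sup>2) / 2)))"
    by (simp only: char_brownian_increment[OF W t0]) (simp only: mult_minus_left)
  also have "\<dots> = exp (- (\<Sum>k<n. (t (Suc k) - t k) * (norm (c k))\<^sup>2) / 2)"
    by (simp add: exp_sum[symmetric] sum_negf sum_divide_distrib del: of_real_exp flip: of_real_prod)
  finally show ?thesis .
qed

text \<open>The path formula makes \<open>v \<bullet> X T\<close> a constant plus a limit of sums of
  independent Gaussian increments, so the transforms converge. By
  \<open>langevin_dual_inner_self\<close>, the squared norm of \<open>\<sigma> *\<^sub>R g s\<close>
  is the derivative of that of \<open>y s\<close>; the variance is therefore the squared norm lost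
  along the dual flow.\<close>

lemma langevin_char_vec:
  fixes J :: "real ^ 'd ^ 'd" and X :: "real \<Rightarrow> 'w \<Rightarrow> (real ^ 'd) \<times> (real ^ 'd)"
  assumes J: "transpose J = - J" and \<gamma>: "\<gamma> > 0" and T: "0 \<le> T"
    and M: "prob_space M" and W: "standard_brownian_motion M W"
    and X: "langevin_solution M W J \<gamma> \<mu> x X"
  shows "char_vec (distr M borel (X T)) v =
    iexp (dual_flow J \<gamma> \<mu> T v \<bullet> x) * exp (- ((norm v)\<^sup>2 - (norm (dual_flow J \<gamma> \<mu> T v))\<^sup>2) / 2)"
proof -
  interpret prob_space M by fact
  define \<sigma> where "\<sigma> = sqrt (2 * \<gamma>)"
  define y where "y s = dual_flow J \<gamma> \<mu> (T - s) v" for s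
  define g where "g s = snd (y s)" for s
  define g' where "g' s = - snd (langevin_dual J \<gamma> \<mu> (y s))" for s
  define a where "a = dual_flow J \<gamma> \<mu> T v \<bullet> x"
  define t where "t n k = T * real k / Suc n" for n k :: nat
  define S where "S n \<omega> = (\<Sum>k<Suc n. (\<sigma> *\<^sub>R g (t n k)) \<bullet> (W (t n (Suc k)) \<omega> - W (t n k) \<omega>))" for n \<omega>
  have \<sigma>: "\<sigma>\<^sup>2 = 2 * \<gamma>" using \<gamma> by (simp add: \<sigma>_def)
  have Xm [measurable]: "X T \<in> borel_measurable M" using X T by (simp add: langevin_solution_def)
  have t0: "0 \<le> t n k" for n k using T by (simp add: t_def)
  have tm: "mono (t n)" for n
    using T by (auto simp: t_def intro!: monoI divide_right_mono mult_left_mono)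
  have Wm [measurable]: "W (t n k) \<in> borel_measurable M" for n k
    using W t0 by (auto simp: standard_brownian_motion_def)
  have dy: "(y has_vector_derivative - langevin_dual J \<gamma> \<mu> (y s)) (at s)" for s
    using has_vector_derivative_affine[of "\<lambda>s. dual_flow J \<gamma> \<mu> s v" _ "-1" s T, OF dual_flow_derivative[OF J \<gamma>]]
    by (simp add: y_def[abs_def])
  have cy: "continuous_on A y" for A
    using has_vector_derivative_continuous[OF dy] by (auto intro: continuous_at_imp_continuous_on)
  have dg: "(g has_vector_derivative g' s) (at s)" for s
    using bounded_linear.has_vector_derivative[OF bounded_linear_snd dy[of s]] by (simp add: g_def[abs_def] g'_def)
  have cg: "continuous_on A g" for A unfolding g_def by (intro continuous_intros cy)
  have cg': "continuous_on A g'" for A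
    unfolding g'_def
    by (intro continuous_intros cy linear_continuous_on_compose[OF _ langevin_dual_linear])
  have lim: "AE \<omega> in M. (\<lambda>n. a + S n \<omega>) \<longlonglongrightarrow> v \<bullet> X T \<omega>"
  proof -
    have "AE \<omega> in M. continuous_on {0..} (\<lambda>t. W t \<omega>)" using W by (simp add: standard_brownian_motion_def)
    moreover have "AE \<omega> in M. continuous_on {0..} (\<lambda>t. X t \<omega>) \<and>
       (\<forall>t\<ge>0.
          fst (X t \<omega>) = fst x
            + integral {0..t} (\<lambda>s. snd (X s \<omega>) - \<mu> *\<^sub>R (J *v fst (X s \<omega>))) \<and>
          snd (X t \<omega>) = snd x
            + integral {0..t} (\<lambda>s. - fst (X s \<omega>) - \<mu> *\<^sub>R (J *v snd (X s \<omega>)) - \<gamma> *\<^sub>R snd (X s \<omega>))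
            + sqrt (2 * \<gamma>) *\<^sub>R (W t \<omega> - W 0 \<omega>))"
      using X by (simp add: langevin_solution_def)
    ultimately show ?thesis
    proof eventually_elim
      case (elim \<omega>)
      define w where "w s = W s \<omega> - W 0 \<omega>" for s
      have cw: "continuous_on {0..T} w"
        unfolding w_def by (intro continuous_intros continuous_on_subset[OF elim(1)]) auto
      have "v \<bullet> X T \<omega> = a + \<sigma> * (snd v \<bullet> w T - integral {0..T} (\<lambda>s. g' s \<bullet> w s))"
        unfolding a_def g'_def y_def
        by (rule langevin_path_formula[OF J \<gamma> T _ cw]) (use elim(2) in \<open>auto simp: w_def \<sigma>_def\<close>)
      moreover have "(\<lambda>n. a + \<sigma> * (\<Sum>k<Suc n. g (T * real k / Suc n) \<bullet> (w (T * real (Suc k) / Suc n) - w (T * real k / Suc n))))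
        \<longlonglongrightarrow> a + \<sigma> * (g T \<bullet> w T - g 0 \<bullet> w 0 - integral {0..T} (\<lambda>s. g' s \<bullet> w s))"
        by (intro tendsto_intros wiener_sum_tendsto[OF dg cg' cw T])
      moreover have "g T = snd v" "w 0 = 0" by (simp_all add: g_def y_def w_def dual_flow_def)
      moreover have "S n \<omega> = \<sigma> * (\<Sum>k<Suc n. g (T * real k / Suc n) \<bullet> (w (T * real (Suc k) / Suc n) - w (T * real k / Suc n)))" for n
        unfolding S_def sum_distrib_left by (rule sum.cong) (auto simp: t_def w_def)
      ultimately show ?case by simp
    qed
  qed
  define Q where "Q n = (\<Sum>k<Suc n. (t n (Suc k) - t n k) * (norm (\<sigma> *\<^sub>R g (t n k)))\<^sup>2)" for n
  have char: "(CLINT \<omega>|M. iexp (a + S n \<omega>)) = iexp a * exp (- Q n / 2)" for n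
  proof -
    have "(CLINT \<omega>|M. iexp (a + S n \<omega>)) = (CLINT \<omega>|M. iexp a * iexp (S n \<omega>))"
      by (simp add: exp_add[symmetric] algebra_simps)
    also have "\<dots> = iexp a * exp (- Q n / 2)"
      unfolding S_def Q_def using char_brownian_sum[OF M W t0 tm[of n], where c="\<lambda>k. \<sigma> *\<^sub>R g (t n k)" and n="Suc n"] by simp
    finally show ?thesis .
  qed
  have Qlim: "Q \<longlonglongrightarrow> (norm v)\<^sup>2 - (norm (dual_flow J \<gamma> \<mu> T v))\<^sup>2"
  proof -
    have "(\<lambda>n. \<Sum>k<Suc n. (T * real (Suc k) / Suc n - T * real k / Suc n) \<bullet> (norm (\<sigma> *\<^sub>R g (T * real k / Suc n)))\<^sup>2)
       \<longlonglongrightarrow> integral {0..T} (\<lambda>s. 1 \<bullet> (norm (\<sigma> *\<^sub>R g s))\<^sup>2)"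
      by (rule riemann_stieltjes_sum_tendsto[where g="\<lambda>s. s" and g'="\<lambda>_. 1" and \<tau>="\<lambda>n k. T * real k / Suc n"])
         (use T in \<open>auto intro!: continuous_intros cg simp: divide_right_mono mult_left_mono\<close>)
    moreover have "((\<lambda>s. (norm (\<sigma> *\<^sub>R g s))\<^sup>2) has_integral (y T \<bullet> y T - y 0 \<bullet> y 0)) {0..T}"
    proof (rule fundamental_theorem_of_calculus[OF T])
      fix s
      have "((\<lambda>s. y s \<bullet> y s) has_real_derivative (norm (\<sigma> *\<^sub>R g s))\<^sup>2) (at s within {0..T})"
        by (rule DERIV_cong[OF inner_has_real_derivative[OF dy[THEN has_vector_derivative_at_within] dy[THEN has_vector_derivative_at_within]]])
           (simp add: inner_commute[of "langevin_dual _ _ _ _"] langevin_dual_inner_self[OF J] power_mult_distrib \<sigma> g_def)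
      then show "((\<lambda>s. y s \<bullet> y s) has_vector_derivative (norm (\<sigma> *\<^sub>R g s))\<^sup>2) (at s within {0..T})"
        by (simp add: has_real_derivative_iff_has_vector_derivative)
    qed
    moreover have "y T = v" "y 0 = dual_flow J \<gamma> \<mu> T v" by (simp_all add: y_def dual_flow_def)
    ultimately show ?thesis
      by (simp add: Q_def[abs_def] t_def integral_unique power2_norm_eq_inner)
  qed
  have "(\<lambda>n. CLINT \<omega>|M. iexp (a + S n \<omega>)) \<longlonglongrightarrow> (CLINT \<omega>|M. iexp (v \<bullet> X T \<omega>))"
  proof (rule integral_dominated_convergence[where w="\<lambda>_. 1"])
    have [measurable]: "S n \<in> borel_measurable M" for n unfolding S_def by measurable
    show "(\<lambda>\<omega>. iexp (a + S n \<omega>)) \<in> borel_measurable M" for n by measurable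
    show "AE \<omega> in M. (\<lambda>n. iexp (a + S n \<omega>)) \<longlonglongrightarrow> iexp (v \<bullet> X T \<omega>)"
      using lim by eventually_elim (intro tendsto_intros)
  qed simp_all
  moreover have "(\<lambda>n. iexp a * exp (- Q n / 2)) \<longlonglongrightarrow>
      iexp a * exp (- ((norm v)\<^sup>2 - (norm (dual_flow J \<gamma> \<mu> T v))\<^sup>2) / 2)"
    by (intro tendsto_intros Qlim) simp_all
  ultimately have "(CLINT \<omega>|M. iexp (v \<bullet> X T \<omega>)) =
      iexp a * exp (- ((norm v)\<^sup>2 - (norm (dual_flow J \<gamma> \<mu> T v))\<^sup>2) / 2)"
    unfolding char by (rule LIMSEQ_unique)
  then show ?thesis by (simp add: char_vec_distr a_def)
qed

section \<open>The Ornstein--Uhlenbeck semigroup and its spectral gap\<close>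

lemma borel_measurable_fst_snd [measurable (raw)]:
  fixes f :: "'s \<Rightarrow> 'a::second_countable_topology \<times> 'b::second_countable_topology"
  assumes "f \<in> borel_measurable M"
  shows "(\<lambda>x. fst (f x)) \<in> borel_measurable M" "(\<lambda>x. snd (f x)) \<in> borel_measurable M"
  using assms measurable_compose[OF assms, of fst borel] measurable_compose[OF assms, of snd borel]
  by (auto simp: borel_measurable_continuous_onI continuous_on_fst continuous_on_snd)

text \<open>Invariance of the L2 structure under a map with Gaussian law. In the applications the
  target of \<open>distr\<close> is \<open>borel\<close>, in the general lemmas it is
  \<open>std_gaussian\<close>; the sigma-algebra is the same.\<close>

lemma
  fixes Z :: "'w \<Rightarrow> 'a::euclidean_space"
  assumes "Z \<in> borel_measurable M" "distr M borel Z = std_gaussian"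
  shows L2_gaussian_compose: "f \<in> L2 std_gaussian \<Longrightarrow> (\<lambda>\<omega>. f (Z \<omega>)) \<in> L2 M"
    and L2_norm_gaussian_compose: "f \<in> L2 std_gaussian \<Longrightarrow> L2_norm M (\<lambda>\<omega>. f (Z \<omega>)) = L2_norm std_gaussian f"
    and L2_inner_gaussian_compose: "f \<in> L2 std_gaussian \<Longrightarrow> g \<in> L2 std_gaussian \<Longrightarrow>
      L2_inner M (\<lambda>\<omega>. f (Z \<omega>)) (\<lambda>\<omega>. g (Z \<omega>)) = L2_inner std_gaussian f g"
    and integral_gaussian_compose: "f \<in> borel_measurable borel \<Longrightarrow> (\<integral>\<omega>. f (Z \<omega>) \<partial>M) = (\<integral>x. f x \<partial>std_gaussian :: real)"
    and AE_gaussian_compose: "AE x in std_gaussian. P x \<Longrightarrow> AE \<omega> in M. P (Z \<omega>)"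
proof -
  have Z: "Z \<in> measurable M std_gaussian" "distr M std_gaussian Z = std_gaussian"
    using assms distr_cong[OF refl sets_std_gaussian, of M Z Z]
    by (auto simp: measurable_cong_sets[OF refl sets_std_gaussian])
  show "f \<in> L2 std_gaussian \<Longrightarrow> (\<lambda>\<omega>. f (Z \<omega>)) \<in> L2 M" by (rule L2_compose[OF Z])
  show "f \<in> L2 std_gaussian \<Longrightarrow> L2_norm M (\<lambda>\<omega>. f (Z \<omega>)) = L2_norm std_gaussian f"
    by (rule L2_norm_compose[OF Z L2_measurable])
  show "f \<in> L2 std_gaussian \<Longrightarrow> g \<in> L2 std_gaussian \<Longrightarrow>
      L2_inner M (\<lambda>\<omega>. f (Z \<omega>)) (\<lambda>\<omega>. g (Z \<omega>)) = L2_inner std_gaussian f g"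
    by (rule L2_inner_compose[OF Z L2_measurable L2_measurable])
  show "f \<in> borel_measurable borel \<Longrightarrow> (\<integral>\<omega>. f (Z \<omega>) \<partial>M) = (\<integral>x. f x \<partial>std_gaussian :: real)"
    by (rule integral_compose[OF Z]) simp
  show "AE x in std_gaussian. P x \<Longrightarrow> AE \<omega> in M. P (Z \<omega>)" by (rule AE_compose[OF Z])
qed

lemma L2_zero_mean_gaussian_compose:
  fixes Z :: "'w \<Rightarrow> 'a::euclidean_space"
  assumes "Z \<in> borel_measurable M" "distr M borel Z = std_gaussian" "f \<in> L2_zero_mean std_gaussian"
  shows "(\<lambda>\<omega>. f (Z \<omega>)) \<in> L2_zero_mean M"
  using assms(3) L2_gaussian_compose[OF assms(1,2), of f] integral_gaussian_compose[OF assms(1,2), of f]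
  by (auto simp: L2_zero_mean_def dest: L2_measurable)

lemma L2_gaussian_partial_integral:
  fixes G :: "'a::euclidean_space \<times> 'b::euclidean_space \<Rightarrow> real"
  assumes G: "G \<in> L2 std_gaussian"
  defines "T \<equiv> \<lambda>x. \<integral>y. G (x, y) \<partial>std_gaussian"
  shows "T \<in> L2 std_gaussian" "L2_norm std_gaussian T \<le> L2_norm std_gaussian G"
    "(\<integral>x. T x \<partial>std_gaussian) = (\<integral>p. G p \<partial>std_gaussian)"
    "\<And>h. h \<in> L2 std_gaussian \<Longrightarrow> L2_inner std_gaussian T h = L2_inner std_gaussian G (\<lambda>p. h (fst p))"
    "AE x in std_gaussian. integrable std_gaussian (\<lambda>y. G (x, y))"
proof -
  interpret A: prob_space "std_gaussian :: 'a measure" by (rule prob_space_std_gaussian)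
  interpret B: prob_space "std_gaussian :: 'b measure" by (rule prob_space_std_gaussian)
  interpret P: pair_prob_space "std_gaussian :: 'a measure" "std_gaussian :: 'b measure" ..
  note * = P.L2_partial_integral[of G, unfolded std_gaussian_pair, OF G, folded T_def]
  show "T \<in> L2 std_gaussian" "L2_norm std_gaussian T \<le> L2_norm std_gaussian G"
    "(\<integral>x. T x \<partial>std_gaussian) = (\<integral>p. G p \<partial>std_gaussian)"
    "\<And>h. h \<in> L2 std_gaussian \<Longrightarrow> L2_inner std_gaussian T h = L2_inner std_gaussian G (\<lambda>p. h (fst p))"
    "AE x in std_gaussian. integrable std_gaussian (\<lambda>y. G (x, y))"
    using * by blast+
qed

section \<open>Gaussian mixtures and Mehler operators\<close>

lemma norm_Pair_power2: "(norm (x, y))\<^sup>2 = (norm x)\<^sup>2 + (norm y)\<^sup>2"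
  by (simp add: norm_prod_def)

lemma mix_distr:
  fixes a b :: real
  assumes "a\<^sup>2 + b\<^sup>2 = 1"
  shows "distr (std_gaussian :: ('a::euclidean_space \<times> 'a) measure) borel (\<lambda>p. a *\<^sub>R fst p + b *\<^sub>R snd p) = std_gaussian"
proof (rule std_gaussian_distr_isometry[where L'="\<lambda>v. (a *\<^sub>R v, b *\<^sub>R v)"])
  fix v :: 'a
  have "(norm (a *\<^sub>R v, b *\<^sub>R v))\<^sup>2 = (a\<^sup>2 + b\<^sup>2) * (norm v)\<^sup>2"
    by (simp add: norm_Pair_power2 power_mult_distrib algebra_simps)
  then show "norm (a *\<^sub>R v, b *\<^sub>R v) = norm v" using assms by simp
qed (auto intro!: linearI simp: inner_prod_def inner_add_right algebra_simps)

lemma mix_distr_scaled: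
  fixes a b c :: real
  assumes "a\<^sup>2 + b\<^sup>2 = c\<^sup>2"
  shows "distr (std_gaussian :: ('a::euclidean_space \<times> 'a) measure) borel (\<lambda>p. a *\<^sub>R fst p + b *\<^sub>R snd p) =
    distr std_gaussian borel (\<lambda>x. c *\<^sub>R x)"
proof (rule std_gaussian_distr_eqI[where L1'="\<lambda>v. (a *\<^sub>R v, b *\<^sub>R v)" and L2'="\<lambda>v. c *\<^sub>R v"])
  fix v :: 'a
  have "(norm (a *\<^sub>R v, b *\<^sub>R v))\<^sup>2 = (a\<^sup>2 + b\<^sup>2) * (norm v)\<^sup>2"
    by (simp add: norm_Pair_power2 power_mult_distrib algebra_simps)
  then have "(norm (a *\<^sub>R v, b *\<^sub>R v))\<^sup>2 = (norm (c *\<^sub>R v))\<^sup>2" using assms by (simp add: power_mult_distrib)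
  then show "norm (a *\<^sub>R v, b *\<^sub>R v) = norm (c *\<^sub>R v)" by (simp add: power2_eq_iff_nonneg)
qed (auto intro!: linearI simp: inner_prod_def inner_add_right algebra_simps)

text \<open>The map is an orthogonal involution that exchanges \<open>x\<close> with the mixture
  \<open>a x + b y\<close>; this is the source of the symmetry of the Mehler operators.\<close>

lemma reflection_distr:
  fixes a b :: real
  assumes "a\<^sup>2 + b\<^sup>2 = 1"
  shows "distr (std_gaussian :: ('a::euclidean_space \<times> 'a) measure) borel
     (\<lambda>p. (a *\<^sub>R fst p + b *\<^sub>R snd p, b *\<^sub>R fst p - a *\<^sub>R snd p)) = std_gaussian"
proof (rule std_gaussian_distr_isometry[where L'="\<lambda>p. (a *\<^sub>R fst p + b *\<^sub>R snd p, b *\<^sub>R fst p - a *\<^sub>R snd p)"])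
  fix v :: "'a \<times> 'a"
  have "(norm (a *\<^sub>R fst v + b *\<^sub>R snd v, b *\<^sub>R fst v - a *\<^sub>R snd v))\<^sup>2 = (a\<^sup>2 + b\<^sup>2) * ((norm (fst v))\<^sup>2 + (norm (snd v))\<^sup>2)"
    unfolding norm_Pair_power2 power2_norm_eq_inner
    by (simp add: inner_add_left inner_add_right inner_diff_left inner_diff_right inner_commute power2_eq_square algebra_simps)
  also have "\<dots> = (norm v)\<^sup>2" using assms norm_Pair_power2[of "fst v" "snd v"] by simp
  finally show "norm (a *\<^sub>R fst v + b *\<^sub>R snd v, b *\<^sub>R fst v - a *\<^sub>R snd v) = norm v"
    by (simp add: power2_eq_iff_nonneg)
qed (auto intro!: linearI simp: inner_prod_def inner_add_right inner_add_left inner_diff_right inner_diff_left algebra_simps)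

text \<open>The Ornstein-Uhlenbeck semigroup, parametrised by the correlation instead of by time,
  since the correlation \<open>osc_q \<gamma> t\<close> can be negative.\<close>

definition mehler :: "real \<Rightarrow> ('a::euclidean_space \<Rightarrow> real) \<Rightarrow> 'a \<Rightarrow> real" where
  "mehler c f x = (\<integral>y. f (c *\<^sub>R x + sqrt (1 - c\<^sup>2) *\<^sub>R y) \<partial>std_gaussian)"

lemma sqrt_one_minus_power2: "\<bar>c\<bar> \<le> 1 \<Longrightarrow> c\<^sup>2 + (sqrt (1 - c\<^sup>2))\<^sup>2 = 1" for c :: real
  by (simp add: abs_square_le_1)

context
  fixes c :: real
  assumes c: "\<bar>c\<bar> \<le> 1"
begin

lemma mehler_mix_distr:
  "distr (std_gaussian :: ('a::euclidean_space \<times> 'a) measure) borel (\<lambda>p. c *\<^sub>R fst p + sqrt (1 - c\<^sup>2) *\<^sub>R snd p) = std_gaussian"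
  by (rule mix_distr[OF sqrt_one_minus_power2[OF c]])

lemma mehler_mix_L2:
  fixes f :: "'a::euclidean_space \<Rightarrow> real"
  shows "f \<in> L2 std_gaussian \<Longrightarrow> (\<lambda>p. f (c *\<^sub>R fst p + sqrt (1 - c\<^sup>2) *\<^sub>R snd p)) \<in> L2 std_gaussian"
  by (rule L2_gaussian_compose[OF _ mehler_mix_distr]) simp_all

lemma mehler_L2:
  fixes f :: "'a::euclidean_space \<Rightarrow> real"
  assumes f: "f \<in> L2 std_gaussian"
  shows "mehler c f \<in> L2 std_gaussian" "L2_norm std_gaussian (mehler c f) \<le> L2_norm std_gaussian f"
    "(\<integral>x. mehler c f x \<partial>std_gaussian) = (\<integral>x. f x \<partial>std_gaussian)"
    "AE x in std_gaussian. integrable std_gaussian (\<lambda>y. f (c *\<^sub>R x + sqrt (1 - c\<^sup>2) *\<^sub>R y))"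
    and mehler_inner: "h \<in> L2 std_gaussian \<Longrightarrow> L2_inner std_gaussian (mehler c f) h =
      L2_inner std_gaussian (\<lambda>p. f (c *\<^sub>R fst p + sqrt (1 - c\<^sup>2) *\<^sub>R snd p)) (\<lambda>p. h (fst p))"
proof -
  have Z: "(\<lambda>p::'a \<times> 'a. c *\<^sub>R fst p + sqrt (1 - c\<^sup>2) *\<^sub>R snd p) \<in> borel_measurable std_gaussian" by simp
  have n: "L2_norm std_gaussian (\<lambda>p. f (c *\<^sub>R fst p + sqrt (1 - c\<^sup>2) *\<^sub>R snd p)) = L2_norm std_gaussian f"
    by (rule L2_norm_gaussian_compose[OF Z mehler_mix_distr f])
  have i: "(\<integral>p. f (c *\<^sub>R fst p + sqrt (1 - c\<^sup>2) *\<^sub>R snd p) \<partial>std_gaussian) = (\<integral>x. f x \<partial>std_gaussian)"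
    by (rule integral_gaussian_compose[OF Z mehler_mix_distr]) (use L2_measurable[OF f] in simp)
  have e: "(\<lambda>x. \<integral>y. (\<lambda>p. f (c *\<^sub>R fst p + sqrt (1 - c\<^sup>2) *\<^sub>R snd p)) (x, y) \<partial>std_gaussian) = mehler c f"
    by (simp add: mehler_def fun_eq_iff)
  note * = L2_gaussian_partial_integral[OF mehler_mix_L2[OF f], unfolded e]
  show "mehler c f \<in> L2 std_gaussian" "L2_norm std_gaussian (mehler c f) \<le> L2_norm std_gaussian f"
    "(\<integral>x. mehler c f x \<partial>std_gaussian) = (\<integral>x. f x \<partial>std_gaussian)"
    "AE x in std_gaussian. integrable std_gaussian (\<lambda>y. f (c *\<^sub>R x + sqrt (1 - c\<^sup>2) *\<^sub>R y))"
    "h \<in> L2 std_gaussian \<Longrightarrow> L2_inner std_gaussian (mehler c f) h =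
      L2_inner std_gaussian (\<lambda>p. f (c *\<^sub>R fst p + sqrt (1 - c\<^sup>2) *\<^sub>R snd p)) (\<lambda>p. h (fst p))"
    using * n i by simp_all
qed

text \<open>The reflection preserves the law of the Gaussian pair and exchanges the two correlated
  arguments.\<close>

lemma mehler_symmetric:
  fixes f g :: "'a::euclidean_space \<Rightarrow> real"
  assumes f: "f \<in> L2 std_gaussian" and g: "g \<in> L2 std_gaussian"
  shows "L2_inner std_gaussian (mehler c f) g = L2_inner std_gaussian f (mehler c g)"
proof -
  define R :: "'a \<times> 'a \<Rightarrow> 'a \<times> 'a" where
    "R p = (c *\<^sub>R fst p + sqrt (1 - c\<^sup>2) *\<^sub>R snd p, sqrt (1 - c\<^sup>2) *\<^sub>R fst p - c *\<^sub>R snd p)" for p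
  have R: "R \<in> borel_measurable std_gaussian" "distr std_gaussian borel R = std_gaussian"
    unfolding R_def by (simp_all add: borel_measurable_Pair reflection_distr[OF sqrt_one_minus_power2[OF c]])
  have inv: "c *\<^sub>R fst (R p) + sqrt (1 - c\<^sup>2) *\<^sub>R snd (R p) = fst p" for p
  proof -
    have "c *\<^sub>R fst (R p) + sqrt (1 - c\<^sup>2) *\<^sub>R snd (R p) = (c\<^sup>2 + (sqrt (1 - c\<^sup>2))\<^sup>2) *\<^sub>R fst p"
      unfolding R_def fst_conv snd_conv power2_eq_square by (simp add: algebra_simps)
    then show ?thesis using sqrt_one_minus_power2[OF c] by simp
  qed
  let ?F = "\<lambda>p. f (c *\<^sub>R fst p + sqrt (1 - c\<^sup>2) *\<^sub>R snd p) * g (fst p)"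
  have [measurable]: "f \<in> borel_measurable borel" "g \<in> borel_measurable borel"
    using L2_measurable[OF f] L2_measurable[OF g] by simp_all
  have "L2_inner std_gaussian (mehler c f) g = (\<integral>p. ?F p \<partial>std_gaussian)"
    unfolding mehler_inner[OF f g] by (simp add: L2_inner_def)
  also have "\<dots> = (\<integral>p. ?F (R p) \<partial>std_gaussian)"
    by (rule integral_gaussian_compose[OF R, symmetric]) measurable
  also have "\<dots> = (\<integral>p. f (fst p) * g (c *\<^sub>R fst p + sqrt (1 - c\<^sup>2) *\<^sub>R snd p) \<partial>std_gaussian)"
    unfolding inv by (simp add: R_def)
  also have "\<dots> = L2_inner std_gaussian (mehler c g) f"
    unfolding mehler_inner[OF g f] by (simp add: L2_inner_def mult.commute)
  finally show ?thesis by (simp add: L2_inner_commute)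
qed

end

text \<open>Two successive perturbations add up to one of variance b^2 (1 - a^2) + (1 - b^2) = 1 -
  (a b)^2. The identity holds where the section of \<open>f\<close> is integrable, as Fubini
  requires, hence almost everywhere.\<close>

lemma mehler_mehler:
  fixes f :: "'a::euclidean_space \<Rightarrow> real"
  assumes a: "\<bar>a\<bar> \<le> 1" and b: "\<bar>b\<bar> \<le> 1" and f: "f \<in> L2 std_gaussian"
  shows "AE x in std_gaussian. mehler a (mehler b f) x = mehler (a * b) f x"
proof -
  interpret A: prob_space "std_gaussian :: 'a measure" by (rule prob_space_std_gaussian)
  interpret P: pair_prob_space "std_gaussian :: 'a measure" "std_gaussian :: 'a measure" ..
  have [measurable]: "f \<in> borel_measurable borel" using L2_measurable[OF f] by simp
  have ab: "\<bar>a * b\<bar> \<le> 1" using a b by (simp add: abs_mult mult_le_one)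
  define \<alpha> where "\<alpha> = b * sqrt (1 - a\<^sup>2)"
  define \<beta> where "\<beta> = sqrt (1 - b\<^sup>2)"
  define \<kappa> where "\<kappa> = sqrt (1 - (a * b)\<^sup>2)"
  have "a\<^sup>2 \<le> 1" "b\<^sup>2 \<le> 1" "(a * b)\<^sup>2 \<le> 1" using a b ab by (simp_all add: abs_square_le_1)
  then have sq: "\<alpha>\<^sup>2 + \<beta>\<^sup>2 = \<kappa>\<^sup>2"
    by (simp add: \<alpha>_def \<beta>_def \<kappa>_def power_mult_distrib algebra_simps)
  note law = mix_distr_scaled[OF sq, where 'a='a]
  show ?thesis
    using mehler_L2(4)[OF ab f]
  proof eventually_elim
    case (elim x)
    define h where "h y = f ((a * b) *\<^sub>R x + y)" for y
    have [measurable]: "h \<in> borel_measurable borel" unfolding h_def by simp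
    have "integrable (distr std_gaussian borel (\<lambda>y. \<kappa> *\<^sub>R y)) h"
      by (subst integrable_distr_eq) (use elim in \<open>simp_all add: h_def \<kappa>_def\<close>)
    then have "integrable std_gaussian (\<lambda>p::'a \<times> 'a. h (\<alpha> *\<^sub>R fst p + \<beta> *\<^sub>R snd p))"
      unfolding law[symmetric] by (subst (asm) integrable_distr_eq) simp_all
    then have i: "integrable (std_gaussian \<Otimes>\<^sub>M std_gaussian) (\<lambda>p::'a \<times> 'a. h (\<alpha> *\<^sub>R fst p + \<beta> *\<^sub>R snd p))"
      by (simp only: std_gaussian_pair)
    have "mehler (a * b) f x = (\<integral>y. h y \<partial>distr std_gaussian borel (\<lambda>y. \<kappa> *\<^sub>R y))"
      by (subst integral_distr) (simp_all add: mehler_def h_def \<kappa>_def)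
    also have "\<dots> = (\<integral>p. h (\<alpha> *\<^sub>R fst p + \<beta> *\<^sub>R snd p) \<partial>std_gaussian)"
      unfolding law[symmetric] by (subst integral_distr) simp_all
    also have "\<dots> = (\<integral>y. \<integral>z. h (\<alpha> *\<^sub>R y + \<beta> *\<^sub>R z) \<partial>std_gaussian \<partial>std_gaussian)"
      using P.integral_fst'[OF i] by (simp add: std_gaussian_pair)
    also have "\<dots> = mehler a (mehler b f) x"
      by (simp add: mehler_def h_def \<alpha>_def \<beta>_def scaleR_add_right mult.commute add.assoc)
    finally show ?case ..
  qed
qed

lemma mehler_AE_cong:
  fixes f g :: "'a::euclidean_space \<Rightarrow> real"
  assumes "\<bar>c\<bar> \<le> 1" "f \<in> L2 std_gaussian" "g \<in> L2 std_gaussian" "AE x in std_gaussian. f x = g x"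
  shows "AE x in std_gaussian. mehler c f x = mehler c g x"
proof -
  interpret A: prob_space "std_gaussian :: 'a measure" by (rule prob_space_std_gaussian)
  interpret P: pair_prob_space "std_gaussian :: 'a measure" "std_gaussian :: 'a measure" ..
  have "AE p in std_gaussian. f (c *\<^sub>R fst p + sqrt (1 - c\<^sup>2) *\<^sub>R snd p) = g (c *\<^sub>R fst p + sqrt (1 - c\<^sup>2) *\<^sub>R snd p)"
    by (rule AE_gaussian_compose[OF _ mehler_mix_distr[OF assms(1)] assms(4)]) simp
  then have "AE p in std_gaussian \<Otimes>\<^sub>M std_gaussian. f (c *\<^sub>R fst p + sqrt (1 - c\<^sup>2) *\<^sub>R snd p) = g (c *\<^sub>R fst p + sqrt (1 - c\<^sup>2) *\<^sub>R snd p)"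
    by (simp only: std_gaussian_pair)
  then have "AE x in std_gaussian. AE y in std_gaussian. f (c *\<^sub>R x + sqrt (1 - c\<^sup>2) *\<^sub>R y) = g (c *\<^sub>R x + sqrt (1 - c\<^sup>2) *\<^sub>R y)"
    using P.AE_pair by fastforce
  then show ?thesis
  proof eventually_elim
    case (elim x)
    then show ?case unfolding mehler_def
      using L2_measurable[OF assms(2)] L2_measurable[OF assms(3)] by (intro integral_cong_AE) simp_all
  qed
qed

text \<open>Symmetry and the product law convert a bound of the quadratic form at correlation c^2
  into a bound of the norm at correlation c.\<close>

lemma mehler_norm_power2:
  fixes f :: "'a::euclidean_space \<Rightarrow> real"
  assumes c: "\<bar>c\<bar> \<le> 1" and f: "f \<in> L2 std_gaussian"
  shows "(L2_norm std_gaussian (mehler c f))\<^sup>2 = L2_inner std_gaussian (mehler (c\<^sup>2) f) f"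
proof -
  have c2: "\<bar>c\<^sup>2\<bar> \<le> 1" using c by (simp add: abs_square_le_1)
  have "(L2_norm std_gaussian (mehler c f))\<^sup>2 = L2_inner std_gaussian (mehler c (mehler c f)) f"
    using mehler_symmetric[OF c mehler_L2(1)[OF c f] f] by (simp add: L2_inner_self)
  also have "\<dots> = L2_inner std_gaussian (mehler (c\<^sup>2) f) f"
    using mehler_mehler[OF c c f] mehler_L2(1)[OF c2 f] mehler_L2(1)[OF c mehler_L2(1)[OF c f]] f
    by (intro L2_inner_AE_cong L2_measurable) (auto simp: power2_eq_square)
  finally show ?thesis .
qed

text \<open>Rotating \<open>(x, y)\<close> by a quarter turn in two equal steps turns \<open>x\<close> into \<open>(x + y) / \<surd>2\<close> and then into
  \<open>y\<close>, both steps having the same law; hence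
  \<open>2 \<parallel>f\<parallel>\<^sup>2 = E |f x - f y|\<^sup>2 \<le> 4 E |f x - f ((x + y) / \<surd>2)|\<^sup>2\<close> for centred \<open>f\<close>.\<close>

lemma mehler_gap:
  fixes f :: "'a::euclidean_space \<Rightarrow> real"
  assumes f: "f \<in> L2_zero_mean std_gaussian"
  shows "L2_inner std_gaussian (mehler (1 / sqrt 2) f) f \<le> 3 / 4 * (L2_norm std_gaussian f)\<^sup>2"
proof -
  let ?G = "std_gaussian :: ('a \<times> 'a) measure"
  let ?N = "(L2_norm std_gaussian f)\<^sup>2"
  define r where "r = 1 / sqrt 2"
  have r: "\<bar>r\<bar> \<le> 1" "sqrt (1 - r\<^sup>2) = r" "r\<^sup>2 + r\<^sup>2 = 1"
    by (simp_all add: r_def power_divide real_sqrt_divide)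
  have fL: "f \<in> L2 std_gaussian" using f by (rule L2_zero_mean_L2)
  have [measurable]: "f \<in> borel_measurable borel" using L2_measurable[OF fL] by simp
  define m where "m p = f (r *\<^sub>R fst p + r *\<^sub>R snd p)" for p
  define x where "x p = f (fst p)" for p :: "'a \<times> 'a"
  define y where "y p = f (snd p)" for p :: "'a \<times> 'a"
  have dx: "distr ?G borel fst = std_gaussian"
    using mix_distr[of 1 0] by (simp add: fst_def[symmetric] cong: distr_cong)
  have dy: "distr ?G borel snd = std_gaussian"
    using mix_distr[of 0 1] by (simp add: fst_def[symmetric] cong: distr_cong)
  have xL: "x \<in> L2 ?G" "L2_norm ?G x = L2_norm std_gaussian f"
    unfolding x_def using L2_gaussian_compose[OF _ dx fL] L2_norm_gaussian_compose[OF _ dx fL] by (simp_all add: borel_prod[symmetric])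
  have yL: "y \<in> L2 ?G" "L2_norm ?G y = L2_norm std_gaussian f"
    unfolding y_def using L2_gaussian_compose[OF _ dy fL] L2_norm_gaussian_compose[OF _ dy fL] by (simp_all add: borel_prod[symmetric])
  have mL: "m \<in> L2 ?G" "L2_norm ?G m = L2_norm std_gaussian f"
    unfolding m_def using L2_gaussian_compose[OF _ mix_distr[OF r(3)] fL] L2_norm_gaussian_compose[OF _ mix_distr[OF r(3)] fL] by simp_all
  let ?\<Lambda> = "L2_inner std_gaussian (mehler r f) f"
  have mx: "L2_inner ?G m x = ?\<Lambda>"
    unfolding mehler_inner[OF r(1) fL fL] by (simp add: m_def[abs_def] x_def[abs_def] r(2))
  \<comment> \<open>Swapping the coordinates preserves the law, fixes \<open>m\<close> and maps
    \<open>x\<close> to \<open>y\<close>.\<close>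
  have my: "L2_inner ?G m y = ?\<Lambda>"
  proof -
    define sw :: "'a \<times> 'a \<Rightarrow> 'a \<times> 'a" where "sw p = (snd p, fst p)" for p
    have sw: "sw \<in> borel_measurable ?G" "distr ?G borel sw = ?G"
    proof -
      show "sw \<in> borel_measurable ?G" by (simp add: sw_def[abs_def] borel_prod[symmetric])
      show "distr ?G borel sw = ?G" unfolding sw_def
        by (rule std_gaussian_distr_isometry[where L'="\<lambda>p. (snd p, fst p)"])
           (auto intro!: linearI simp: inner_prod_def norm_prod_def)
    qed
    have "L2_inner ?G (\<lambda>p. m (sw p)) (\<lambda>p. x (sw p)) = L2_inner ?G m x"
      by (rule L2_inner_gaussian_compose[OF sw mL(1) xL(1)])
    moreover have "(\<lambda>p. m (sw p)) = m" "(\<lambda>p. x (sw p)) = y"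
      by (simp_all add: m_def x_def y_def sw_def fun_eq_iff add.commute)
    ultimately show ?thesis by (simp add: mx)
  qed
  have xy: "L2_inner ?G x y = 0"
  proof -
    interpret A: prob_space "std_gaussian :: 'a measure" by (rule prob_space_std_gaussian)
    interpret P: pair_prob_space "std_gaussian :: 'a measure" "std_gaussian :: 'a measure" ..
    have "integrable (std_gaussian \<Otimes>\<^sub>M std_gaussian) (\<lambda>p. x p * y p)"
      using L2_integrable_mult[OF xL(1) yL(1)] by (simp only: std_gaussian_pair)
    from P.integral_fst'[OF this] show ?thesis
      using f by (simp add: std_gaussian_pair L2_inner_def x_def y_def L2_zero_mean_def)
  qed
  have "2 * ?N = (L2_norm ?G (\<lambda>p. x p - y p))\<^sup>2"
    by (simp add: L2_norm_diff_power2[OF xL(1) yL(1)] xy xL(2) yL(2))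
  also have "\<dots> \<le> (L2_norm ?G (\<lambda>p. x p - m p) + L2_norm ?G (\<lambda>p. m p - y p))\<^sup>2"
    by (intro power_mono L2_norm_triangle_diff xL mL yL L2_norm_nonneg)
  also have "\<dots> \<le> 2 * (L2_norm ?G (\<lambda>p. x p - m p))\<^sup>2 + 2 * (L2_norm ?G (\<lambda>p. m p - y p))\<^sup>2"
    using zero_le_power2[of "L2_norm ?G (\<lambda>p. x p - m p) - L2_norm ?G (\<lambda>p. m p - y p)"]
    by (simp add: power2_sum power2_diff)
  \<comment> \<open>Each of the two squared distances equals \<open>2 * ?N - 2 * ?\<Lambda>\<close>;
    solving for \<open>?\<Lambda>\<close> gives the constant 3/4.\<close>
  also have "\<dots> = 8 * ?N - 8 * ?\<Lambda>"
    by (simp add: L2_norm_diff_power2[OF xL(1) mL(1)] L2_norm_diff_power2[OF mL(1) yL(1)] mx my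
        L2_inner_commute[of _ x m] xL(2) yL(2) mL(2))
  finally show ?thesis by (simp add: r_def)
qed

lemma mehler_zero_mean:
  "\<bar>c\<bar> \<le> 1 \<Longrightarrow> f \<in> L2_zero_mean std_gaussian \<Longrightarrow> mehler c f \<in> L2_zero_mean std_gaussian"
  using mehler_L2(1,3)[of c f] by (auto simp: L2_zero_mean_def)

text \<open>By \<open>mehler_norm_power2\<close>, the gap at correlation 1 / sqrt 2 says that at
  \<rho> = 2^(-1/4) = exp (- l) the squared norm shrinks by 3/4. The product law iterates this;
  rounding s / l down to an integer costs the factor 4/3, and ln (4/3) / l is the exponent.\<close>

lemma mehler_decay:
  fixes f :: "'a::euclidean_space \<Rightarrow> real"
  assumes f: "f \<in> L2_zero_mean std_gaussian" and c: "0 \<le> c" "c \<le> 1" and s: "c \<le> exp (- s)"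
  shows "(L2_norm std_gaussian (mehler c f))\<^sup>2 \<le> 4 / 3 * exp (- (4 * ln (4 / 3) / ln 2) * s) * (L2_norm std_gaussian f)\<^sup>2"
proof -
  let ?G = "std_gaussian :: 'a measure"
  define l :: real where "l = ln 2 / 4"
  have l: "l > 0" by (simp add: l_def)
  define \<rho> where "\<rho> = exp (- l)"
  have \<rho>: "0 < \<rho>" "\<bar>\<rho>\<bar> \<le> 1" using l by (simp_all add: \<rho>_def)
  have \<rho>2: "\<rho>\<^sup>2 = 1 / sqrt 2"
  proof -
    have "(\<rho>\<^sup>2)\<^sup>2 = exp (- ln 2)" by (simp add: \<rho>_def l_def power2_eq_square exp_add[symmetric])
    also have "\<dots> = (1 / sqrt 2)\<^sup>2" by (simp add: exp_minus power_divide inverse_eq_divide)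
    finally show ?thesis by (rule power2_eq_imp_eq) simp_all
  qed
  have one: "(L2_norm ?G (mehler \<rho> g))\<^sup>2 \<le> 3 / 4 * (L2_norm ?G g)\<^sup>2" if "g \<in> L2_zero_mean ?G" for g
    using mehler_gap[OF that] by (simp add: mehler_norm_power2[OF \<rho>(2) L2_zero_mean_L2[OF that]] \<rho>2)
  have \<rho>k: "0 < \<rho> ^ k" "\<bar>\<rho> ^ k\<bar> \<le> 1" for k using \<rho> by (simp_all add: power_le_one)
  have fL: "f \<in> L2 ?G" using f by (rule L2_zero_mean_L2)
  have iter: "(L2_norm ?G (mehler (\<rho> ^ k) f))\<^sup>2 \<le> (3 / 4) ^ k * (L2_norm ?G f)\<^sup>2" for k
  proof (induction k)
    case 0
    show ?case using mehler_L2(2)[of 1, OF _ fL] by (simp add: power_mono L2_norm_nonneg)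
  next
    case (Suc k)
    have "L2_norm ?G (mehler (\<rho> ^ Suc k) f) = L2_norm ?G (mehler \<rho> (mehler (\<rho> ^ k) f))"
      using mehler_mehler[OF \<rho>(2) \<rho>k(2)[of k] fL] mehler_L2(1)[OF \<rho>k(2)[of "Suc k"] fL]
        mehler_L2(1)[OF \<rho>(2) mehler_L2(1)[OF \<rho>k(2)[of k] fL]]
      by (intro L2_norm_AE_cong L2_measurable) auto
    then have "(L2_norm ?G (mehler (\<rho> ^ Suc k) f))\<^sup>2 \<le> 3 / 4 * (L2_norm ?G (mehler (\<rho> ^ k) f))\<^sup>2"
      using one[OF mehler_zero_mean[OF \<rho>k(2) f]] by simp
    with Suc show ?case by simp
  qed
  \<comment> \<open>\<open>mehler c\<close> factors through \<open>mehler (\<rho> ^ k)\<close>, and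
    the remaining factor is a contraction.\<close>
  have main: "(L2_norm ?G (mehler c f))\<^sup>2 \<le> (3 / 4) ^ k * (L2_norm ?G f)\<^sup>2" if k: "c \<le> \<rho> ^ k" for k
  proof -
    have q: "\<bar>c / \<rho> ^ k\<bar> \<le> 1" using c k \<rho>k(1)[of k] by simp
    have "L2_norm ?G (mehler c f) = L2_norm ?G (mehler (c / \<rho> ^ k) (mehler (\<rho> ^ k) f))"
    proof (rule L2_norm_AE_cong)
      have c1: "\<bar>c\<bar> \<le> 1" using c by simp
      show "mehler c f \<in> borel_measurable ?G" by (rule L2_measurable[OF mehler_L2(1)[OF c1 fL]])
      show "mehler (c / \<rho> ^ k) (mehler (\<rho> ^ k) f) \<in> borel_measurable ?G"
        by (rule L2_measurable[OF mehler_L2(1)[OF q mehler_L2(1)[OF \<rho>k(2) fL]]])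
      show "AE x in ?G. mehler c f x = mehler (c / \<rho> ^ k) (mehler (\<rho> ^ k) f) x"
      proof -
        have "c / \<rho> ^ k * \<rho> ^ k = c" using \<rho>k(1)[of k] by (metis less_irrefl nonzero_eq_divide_eq)
        then show ?thesis using mehler_mehler[OF q \<rho>k(2)[of k] fL] by (simp only: eq_commute)
      qed
    qed
    also have "\<dots> \<le> L2_norm ?G (mehler (\<rho> ^ k) f)"
      by (rule mehler_L2(2)[OF q mehler_L2(1)[OF \<rho>k(2) fL]])
    finally show ?thesis using iter[of k] power_mono[OF _ L2_norm_nonneg, of ?G "mehler c f" _ 2] by force
  qed
  define k where "k = nat \<lfloor>s / l\<rfloor>"
  show ?thesis
  proof (cases "s \<ge> 0")
    case True
    have kr: "real k \<le> s / l" "s / l - 1 \<le> real k" using True l by (simp_all add: k_def)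
    have "exp (- s) \<le> exp (- (real k * l))" using kr(1) l by (simp add: field_simps)
    also have "\<dots> = \<rho> ^ k" by (simp add: \<rho>_def exp_of_nat_mult[symmetric])
    finally have "c \<le> \<rho> ^ k" using s by linarith
    from main[OF this] have 1: "(L2_norm ?G (mehler c f))\<^sup>2 \<le> (3 / 4) ^ k * (L2_norm ?G f)\<^sup>2" .
    have "((3 / 4) ^ k :: real) = exp (- (real k * ln (4 / 3)))"
      by (simp add: exp_minus exp_of_nat_mult power_divide)
    also have "\<dots> \<le> exp (- ((s / l - 1) * ln (4 / 3)))"
      using kr(2) by (simp add: mult_right_mono)
    also have "- ((s / l - 1) * ln (4 / 3)) = ln (4 / 3) + - (4 * ln (4 / 3) / ln 2) * s"
      by (simp add: l_def field_simps)
    also have "exp (ln (4 / 3) + - (4 * ln (4 / 3) / ln 2) * s) = 4 / 3 * exp (- (4 * ln (4 / 3) / ln 2) * s)"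
      by (simp only: exp_add exp_ln_iff[THEN iffD2])
    finally show ?thesis using 1 mult_right_mono[OF _ zero_le_power2[of "L2_norm ?G f"]] by fastforce
  next
    case False
    \<comment> \<open>For negative \<open>s\<close> the right-hand side is at least the squared norm
      of \<open>f\<close>, so contractivity is enough.\<close>
    have "1 * 1 \<le> 4 / 3 * exp (- (4 * ln (4 / 3) / ln 2) * s)"
      using False by (intro mult_mono) (auto simp: mult_le_0_iff divide_le_0_iff)
    then have "1 * (L2_norm ?G f)\<^sup>2 \<le> 4 / 3 * exp (- (4 * ln (4 / 3) / ln 2) * s) * (L2_norm ?G f)\<^sup>2"
      by (intro mult_right_mono) auto
    then show ?thesis using main[of 0] c by simp
  qed
qed

section \<open>The Poisson equation\<close>

text \<open>Lebesgue measure on the half-line is written as the exponential law of rate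
  \<open>a\<close> times the weight \<open>wt\<close>. Thus \<open>u\<close> becomes a partial
  integral over a probability space, and \<open>L2_partial_integral\<close> applies.\<close>

lemma (in prob_space) L2_time_integral:
  fixes G :: "real \<Rightarrow> 'a \<Rightarrow> real"
  assumes space: "space M = UNIV"
    and Gm: "(\<lambda>p. G (snd p) (fst p)) \<in> borel_measurable (M \<Otimes>\<^sub>M borel)"
    and GL: "\<And>t. 0 \<le> t \<Longrightarrow> G t \<in> L2 M"
    and bnd: "\<And>t. 0 \<le> t \<Longrightarrow> (L2_norm M (G t))\<^sup>2 \<le> C * exp (- b * t)" and b: "b > 0"
  defines "u \<equiv> \<lambda>x. \<integral>t. indicator {0..} t * G t x \<partial>lborel"
  shows "u \<in> L2 M"
    "\<And>k. k \<in> L2 M \<Longrightarrow> integrable lborel (\<lambda>t. indicator {0..} t * L2_inner M (G t) k)"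
    "\<And>k. k \<in> L2 M \<Longrightarrow> L2_inner M u k = (\<integral>t. indicator {0..} t * L2_inner M (G t) k \<partial>lborel)"
proof -
  \<comment> \<open>With half the decay rate, the squared weight exp (2 a t) / a^2 is compensated
    exactly by the decay of \<open>G\<close>, and the section norms in \<open>sec\<close> are
    bounded by C / a^2.\<close>
  define a where "a = b / 2"
  have a: "a > 0" "b = 2 * a" using b by (simp_all add: a_def)
  define \<tau> where "\<tau> = density lborel (exponential_density a)"
  have [simp, measurable_cong]: "sets \<tau> = sets borel" by (simp add: \<tau>_def)
  interpret T: prob_space \<tau> unfolding \<tau>_def by (rule prob_space_exponential_density[OF a(1)])
  interpret P: pair_prob_space M \<tau> ..
  note [measurable] = Gm
  have Gm1 [measurable]: "(\<lambda>t. G t x) \<in> borel_measurable borel" for x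
    using measurable_compose[OF measurable_Pair1'[of x M borel] Gm] space by simp
  have Gm2 [measurable]: "G t \<in> borel_measurable M" for t
    using measurable_compose[OF measurable_Pair2'[of t borel M] Gm] by simp
  define wt where "wt t = indicator {0..} t * exp (a * t) / a" for t :: real
  have [measurable]: "wt \<in> borel_measurable borel" unfolding wt_def by simp
  define H where "H p = wt (snd p) * G (snd p) (fst p)" for p
  have Hm [measurable]: "H \<in> borel_measurable (M \<Otimes>\<^sub>M \<tau>)"
    unfolding H_def by measurable
  have C: "C \<ge> 0" using order_trans[OF zero_le_power2 bnd[of 0]] by simp
  have dens: "exponential_density a t * (wt t * y) = indicator {0..} t * y" for t y :: real
  proof (cases "t < 0")
    case False
    have "exp (- t * a) * exp (a * t) = 1" by (simp add: exp_add[symmetric] algebra_simps)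
    then show ?thesis using a False by (simp add: exponential_density_def indicator_def wt_def)
  qed (simp add: exponential_density_def indicator_def wt_def)
  have sec: "(\<integral>\<^sup>+x. ennreal ((H (x, t))\<^sup>2) \<partial>M) \<le> ennreal (C / a\<^sup>2)" for t
  proof (cases "t \<ge> 0")
    case True
    have "(\<integral>\<^sup>+x. ennreal ((H (x, t))\<^sup>2) \<partial>M) = (\<integral>\<^sup>+x. ennreal (exp (b * t) / a\<^sup>2) * ennreal ((G t x)\<^sup>2) \<partial>M)"
    proof (rule nn_integral_cong)
      fix x
      have "(exp (a * t))\<^sup>2 = exp (b * t)" by (simp add: a(2) power2_eq_square exp_add[symmetric])
      then have "(H (x, t))\<^sup>2 = exp (b * t) / a\<^sup>2 * (G t x)\<^sup>2"
        using True by (simp add: H_def wt_def power_mult_distrib power_divide)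
      then show "ennreal ((H (x, t))\<^sup>2) = ennreal (exp (b * t) / a\<^sup>2) * ennreal ((G t x)\<^sup>2)"
        by (subst ennreal_mult'[symmetric]) simp_all
    qed
    also have "\<dots> = ennreal (exp (b * t) / a\<^sup>2) * (\<integral>\<^sup>+x. ennreal ((G t x)\<^sup>2) \<partial>M)"
      by (rule nn_integral_cmult) simp
    also have "(\<integral>\<^sup>+x. ennreal ((G t x)\<^sup>2) \<partial>M) = ennreal ((L2_norm M (G t))\<^sup>2)"
      unfolding L2_norm_power2 by (rule nn_integral_eq_integral[OF L2_square_integrable[OF GL[OF True]]]) simp
    also have "ennreal (exp (b * t) / a\<^sup>2) * ennreal ((L2_norm M (G t))\<^sup>2) =
        ennreal (exp (b * t) / a\<^sup>2 * (L2_norm M (G t))\<^sup>2)"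
      by (subst ennreal_mult'[symmetric]) simp_all
    also have "\<dots> \<le> ennreal (exp (b * t) / a\<^sup>2 * (C * exp (- b * t)))"
      by (intro ennreal_leI mult_left_mono bnd[OF True]) auto
    also have "exp (b * t) / a\<^sup>2 * (C * exp (- b * t)) = C / a\<^sup>2" by (simp add: exp_minus field_simps)
    finally show ?thesis .
  qed (simp add: H_def wt_def)
  have HL: "H \<in> L2 (M \<Otimes>\<^sub>M \<tau>)"
  proof (rule L2I[OF Hm])
    have "(\<integral>\<^sup>+p. ennreal ((H p)\<^sup>2) \<partial>(M \<Otimes>\<^sub>M \<tau>)) = (\<integral>\<^sup>+t. \<integral>\<^sup>+x. ennreal ((H (x, t))\<^sup>2) \<partial>M \<partial>\<tau>)"
      by (rule P.nn_integral_snd[symmetric]) simp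
    also have "\<dots> \<le> (\<integral>\<^sup>+t. ennreal (C / a\<^sup>2) \<partial>\<tau>)"
      by (rule nn_integral_mono) (rule sec)
    also have "\<dots> < \<infinity>" by (simp add: T.emeasure_space_1)
    finally show "integrable (M \<Otimes>\<^sub>M \<tau>) (\<lambda>p. (H p)\<^sup>2)"
      by (intro integrableI_bounded) simp_all
  qed
  have ueq: "(\<lambda>x. \<integral>t. H (x, t) \<partial>\<tau>) = u"
    unfolding u_def \<tau>_def
    by (rule ext, subst integral_density)
       (use a in \<open>auto simp: H_def exponential_density_nonneg dens\<close>)
  note part = P.L2_partial_integral[OF HL, unfolded ueq]
  show "u \<in> L2 M" by (rule part(1))
  fix k assume k: "k \<in> L2 M"
  note [measurable] = L2_measurable[OF k]
  have i: "integrable (M \<Otimes>\<^sub>M \<tau>) (\<lambda>(x, t). H (x, t) * k x)"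
    using L2_integrable_mult[OF HL part(5)[OF k]] by (simp add: case_prod_beta')
  have inner: "(\<lambda>t. \<integral>x. H (x, t) * k x \<partial>M) = (\<lambda>t. wt t * L2_inner M (G t) k)"
    by (simp add: H_def L2_inner_def mult.assoc fun_eq_iff)
  have m: "(\<lambda>t. L2_inner M (G t) k) \<in> borel_measurable borel"
    unfolding L2_inner_def
  proof (rule borel_measurable_lebesgue_integral)
    show "(\<lambda>(t, x). G t x * k x) \<in> borel_measurable (borel \<Otimes>\<^sub>M M)"
      using measurable_compose[OF measurable_pair_swap' Gm] by (simp add: case_prod_beta')
  qed
  have "integrable \<tau> (\<lambda>t. wt t * L2_inner M (G t) k)"
    using P.integrable_snd[OF i] by (simp only: inner)
  then show "integrable lborel (\<lambda>t. indicator {0..} t * L2_inner M (G t) k)"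
    unfolding \<tau>_def
    by (subst (asm) integrable_density) (use m a in \<open>auto simp: exponential_density_nonneg dens\<close>)
  have "L2_inner M u k = (\<integral>t. wt t * L2_inner M (G t) k \<partial>\<tau>)"
    using part(4)[OF k] P.integral_snd[OF i] by (simp add: L2_inner_def[of "M \<Otimes>\<^sub>M \<tau>"] inner case_prod_beta')
  also have "\<dots> = (\<integral>t. indicator {0..} t * L2_inner M (G t) k \<partial>lborel)"
    unfolding \<tau>_def
    by (subst integral_density) (use m a in \<open>auto simp: exponential_density_nonneg dens\<close>)
  finally show "L2_inner M u k = (\<integral>t. indicator {0..} t * L2_inner M (G t) k \<partial>lborel)" .
qed

section \<open>The transition semigroup for a fixed strength of the perturbation\<close>

locale langevin = prob_space M for M :: "'w measure" +
  fixes J :: "real ^ 'd ^ 'd" and \<gamma> \<mu> :: real and W :: "real \<Rightarrow> 'w \<Rightarrow> real ^ 'd"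
    and X :: "(real ^ 'd) \<times> (real ^ 'd) \<Rightarrow> real \<Rightarrow> 'w \<Rightarrow> (real ^ 'd) \<times> (real ^ 'd)"
  assumes skew: "transpose J = - J" and gamma_pos: "\<gamma> > 0"
    and brownian: "standard_brownian_motion M W"
    and solution: "\<And>x. langevin_solution M W J \<gamma> \<mu> x (X x)"
begin

abbreviation G2 :: "((real ^ 'd) \<times> (real ^ 'd)) measure" where "G2 \<equiv> std_gaussian"

abbreviation P where "P \<equiv> markov_semigroup M X"

abbreviation Y where "Y \<equiv> dual_flow J \<gamma> \<mu>"

text \<open>The flow of the deterministic drift, obtained as the adjoint of the dual flow.\<close>

definition K where "K t = adjoint (Y t)"

text \<open>Starting at 0 isolates the noise: any other start merely shifts this law by
  \<open>K t x\<close>.\<close>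

definition noise where "noise t = distr M borel (X 0 t)"

definition \<Theta> where "\<Theta> t p = K t (fst p) + snd p"

lemma X_measurable [measurable]: "0 \<le> t \<Longrightarrow> X x t \<in> borel_measurable M"
  using solution by (auto simp: langevin_solution_def)

lemma K_inner: "v \<bullet> K t x = Y t v \<bullet> x"
  unfolding K_def by (rule adjoint_works[OF dual_flow_linear[OF skew gamma_pos]])

lemma K_linear: "linear (K t)"
  unfolding K_def by (rule adjoint_linear[OF dual_flow_linear[OF skew gamma_pos]])

lemma K_measurable [measurable]: "K t \<in> borel_measurable borel"
  by (rule borel_measurable_linear_euclidean[OF K_linear])

lemma K_K: "0 \<le> s \<Longrightarrow> K t (K s x) = K (s + t) x"
  by (subst vector_eq_ldot[symmetric]) (simp add: K_inner dual_flow_add[OF skew gamma_pos])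

lemma sets_noise [simp, measurable_cong]: "sets (noise t) = sets borel"
  by (simp add: noise_def)

lemma space_noise [simp]: "space (noise t) = UNIV"
  by (simp add: noise_def)

lemma measurable_noise_iff [simp]: "measurable (noise t) N = measurable borel N"
  by (rule measurable_cong_sets) simp_all

lemma prob_space_noise: "0 \<le> t \<Longrightarrow> prob_space (noise t)"
  unfolding noise_def by (rule prob_space_distr) simp

lemma char_noise: "0 \<le> t \<Longrightarrow> char_vec (noise t) v = exp (- ((norm v)\<^sup>2 - (norm (Y t v))\<^sup>2) / 2)"
  unfolding noise_def
  using langevin_char_vec[OF skew gamma_pos _ prob_space_axioms brownian solution, of t 0 v] by simp

lemma law:
  assumes t: "0 \<le> t"
  shows "distr M borel (X x t) = distr (noise t) borel (\<lambda>z. K t x + z)"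
proof (rule char_vec_unique)
  interpret N: prob_space "noise t" by (rule prob_space_noise[OF t])
  show "finite_measure (distr M borel (X x t))"
    by (intro prob_space.finite_measure prob_space_distr) (simp add: t)
  show "finite_measure (distr (noise t) borel (\<lambda>z. K t x + z))"
    by (intro prob_space.finite_measure N.prob_space_distr) simp
  fix v
  have "char_vec (distr (noise t) borel (\<lambda>z. K t x + z)) v = (CLINT z|noise t. iexp (v \<bullet> (K t x + z)))"
    by (rule char_vec_distr) simp
  also have "\<dots> = (CLINT z|noise t. iexp (v \<bullet> K t x) * iexp (v \<bullet> z))"
    by (simp add: inner_add_right exp_add[symmetric] algebra_simps)
  also have "\<dots> = iexp (v \<bullet> K t x) * char_vec (noise t) v" by (simp add: char_vec_def)
  also have "\<dots> = char_vec (distr M borel (X x t)) v"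
    by (simp add: char_noise[OF t] K_inner langevin_char_vec[OF skew gamma_pos t prob_space_axioms brownian solution])
  finally show "char_vec (distr M borel (X x t)) v = char_vec (distr (noise t) borel (\<lambda>z. K t x + z)) v" ..
qed simp_all

lemma P_eq:
  assumes t: "0 \<le> t" and [measurable]: "g \<in> borel_measurable borel"
  shows "P t g x = (\<integral>z. g (K t x + z) \<partial>noise t)"
proof -
  have "P t g x = (\<integral>y. g y \<partial>distr M borel (X x t))"
    unfolding markov_semigroup_def by (subst integral_distr) (simp_all add: t)
  also have "\<dots> = (\<integral>z. g (K t x + z) \<partial>noise t)"
    unfolding law[OF t] by (subst integral_distr) simp_all
  finally show ?thesis .
qed

lemma \<Theta>_measurable: "\<Theta> t \<in> borel_measurable (G2 \<Otimes>\<^sub>M noise t)"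
  unfolding \<Theta>_def by measurable

lemma pair_prob_space_noise: "0 \<le> t \<Longrightarrow> pair_prob_space G2 (noise t)"
  by (intro pair_prob_space.intro pair_sigma_finite.intro prob_space_imp_sigma_finite
      prob_space_std_gaussian prob_space_noise)

text \<open>The variance of the noise is exactly the squared norm that the dual flow loses, so the
  transported Gaussian and the noise add up to a standard Gaussian.\<close>

lemma stationary:
  assumes t: "0 \<le> t"
  shows "distr (G2 \<Otimes>\<^sub>M noise t) borel (\<Theta> t) = G2"
proof (rule char_vec_unique)
  interpret N: prob_space "noise t" by (rule prob_space_noise[OF t])
  interpret A: prob_space G2 by (rule prob_space_std_gaussian)
  show "finite_measure (distr (G2 \<Otimes>\<^sub>M noise t) borel (\<Theta> t))"
    by (intro prob_space.finite_measure prob_space.prob_space_distr prob_space_pair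
        A.prob_space_axioms N.prob_space_axioms \<Theta>_measurable)
  show "finite_measure G2" by (rule A.finite_measure_axioms)
  fix v
  have "char_vec (distr (G2 \<Otimes>\<^sub>M noise t) borel (\<Theta> t)) v =
      char_vec (distr G2 borel (K t)) v * char_vec (distr (noise t) borel (\<lambda>z. z)) v"
    unfolding \<Theta>_def
    by (rule char_vec_pair_sum[OF A.prob_space_axioms N.prob_space_axioms]) simp_all
  also have "distr (noise t) borel (\<lambda>z. z) = noise t" by (rule distr_id2) simp
  also have "char_vec (distr G2 borel (K t)) v = exp (- (norm (Y t v))\<^sup>2 / 2)"
    by (rule char_vec_std_gaussian_linear[OF K_linear K_inner])
  also have "exp (- (norm (Y t v))\<^sup>2 / 2) * char_vec (noise t) v = char_vec G2 v"
    unfolding char_noise[OF t] char_vec_std_gaussian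
    by (simp add: exp_add[symmetric] field_simps flip: of_real_mult)
  finally show "char_vec (distr (G2 \<Otimes>\<^sub>M noise t) borel (\<Theta> t)) v = char_vec G2 v" .
qed simp_all

text \<open>In the coupling \<open>G2 \<Otimes>\<^sub>M noise t\<close> both the start and the end
  have law \<open>G2\<close>, and \<open>P t w\<close> is the conditional expectation of the end
  value given the start.\<close>

lemma P_L2:
  assumes t: "0 \<le> t" and w: "w \<in> L2 G2"
  shows "P t w \<in> L2 G2" "L2_norm G2 (P t w) \<le> L2_norm G2 w" "(\<integral>x. P t w x \<partial>G2) = (\<integral>x. w x \<partial>G2)"
    "AE x in G2. integrable (noise t) (\<lambda>z. w (K t x + z))"
    and P_inner: "\<And>k. k \<in> L2 G2 \<Longrightarrow> L2_inner G2 (P t w) k =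
      L2_inner (G2 \<Otimes>\<^sub>M noise t) (\<lambda>p. w (\<Theta> t p)) (\<lambda>p. k (fst p))"
    and L2_comp_fst: "\<And>k. k \<in> L2 G2 \<Longrightarrow> (\<lambda>p. k (fst p)) \<in> L2 (G2 \<Otimes>\<^sub>M noise t)"
proof -
  interpret Q: pair_prob_space G2 "noise t" by (rule pair_prob_space_noise[OF t])
  have [measurable]: "w \<in> borel_measurable borel" using L2_measurable[OF w] by simp
  note Z = \<Theta>_measurable[of t] stationary[OF t]
  have e: "(\<lambda>x. \<integral>z. w (\<Theta> t (x, z)) \<partial>noise t) = P t w"
    by (simp add: \<Theta>_def P_eq[OF t] fun_eq_iff)
  note * = Q.L2_partial_integral[OF L2_gaussian_compose[OF Z w], unfolded e]
  show "P t w \<in> L2 G2" "L2_norm G2 (P t w) \<le> L2_norm G2 w" "(\<integral>x. P t w x \<partial>G2) = (\<integral>x. w x \<partial>G2)"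
    using *(1-3) L2_norm_gaussian_compose[OF Z w] integral_gaussian_compose[OF Z, of w] by simp_all
  show "AE x in G2. integrable (noise t) (\<lambda>z. w (K t x + z))" using *(6) by (simp add: \<Theta>_def)
  show "\<And>k. k \<in> L2 G2 \<Longrightarrow> L2_inner G2 (P t w) k =
      L2_inner (G2 \<Otimes>\<^sub>M noise t) (\<lambda>p. w (\<Theta> t p)) (\<lambda>p. k (fst p))"
    by (rule *(4))
  show "\<And>k. k \<in> L2 G2 \<Longrightarrow> (\<lambda>p. k (fst p)) \<in> L2 (G2 \<Otimes>\<^sub>M noise t)" by (rule *(5))
qed

lemma P_diff:
  assumes t: "0 \<le> t" and u: "u \<in> L2 G2" and w: "w \<in> L2 G2"
  shows "AE x in G2. P t (\<lambda>x. u x - w x) x = P t u x - P t w x"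
  using P_L2(4)[OF t u] P_L2(4)[OF t w]
proof eventually_elim
  case (elim x)
  have [measurable]: "u \<in> borel_measurable borel" "w \<in> borel_measurable borel"
    using L2_measurable[OF u] L2_measurable[OF w] by simp_all
  show ?case using elim by (simp add: P_eq[OF t])
qed

lemma noise_add:
  assumes s: "0 \<le> s" and t: "0 \<le> t"
  shows "distr (noise s \<Otimes>\<^sub>M noise t) borel (\<Theta> t) = noise (s + t)"
proof (rule char_vec_unique)
  interpret S: prob_space "noise s" by (rule prob_space_noise[OF s])
  interpret T: prob_space "noise t" by (rule prob_space_noise[OF t])
  have m: "\<Theta> t \<in> borel_measurable (noise s \<Otimes>\<^sub>M noise t)" unfolding \<Theta>_def by measurable
  show "finite_measure (distr (noise s \<Otimes>\<^sub>M noise t) borel (\<Theta> t))"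
    by (intro prob_space.finite_measure prob_space.prob_space_distr prob_space_pair
        S.prob_space_axioms T.prob_space_axioms m)
  show "finite_measure (noise (s + t))"
    using s t by (intro prob_space.finite_measure prob_space_noise) simp
  fix v
  have "char_vec (distr (noise s \<Otimes>\<^sub>M noise t) borel (\<Theta> t)) v =
      char_vec (distr (noise s) borel (K t)) v * char_vec (distr (noise t) borel (\<lambda>z. z)) v"
    unfolding \<Theta>_def
    by (rule char_vec_pair_sum[OF S.prob_space_axioms T.prob_space_axioms]) simp_all
  also have "distr (noise t) borel (\<lambda>z. z) = noise t" by (rule distr_id2) simp
  also have "char_vec (distr (noise s) borel (K t)) v = char_vec (noise s) (Y t v)"
    by (rule char_vec_linear[OF K_linear _ K_inner]) simp
  also have "char_vec (noise s) (Y t v) * char_vec (noise t) v = char_vec (noise (s + t)) v"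
    using s t unfolding char_noise[OF t] char_noise[OF s] char_noise[OF add_nonneg_nonneg[OF s t]]
    by (simp add: exp_add[symmetric] dual_flow_add[OF skew gamma_pos] field_simps flip: of_real_mult)
  finally show "char_vec (distr (noise s \<Otimes>\<^sub>M noise t) borel (\<Theta> t)) v = char_vec (noise (s + t)) v" .
qed simp_all

text \<open>A statement about laws: noise over time \<open>s\<close> transported by
  \<open>K t\<close>, plus independent noise over time \<open>t\<close>, is noise over
  \<open>s + t\<close>. Fubini requires integrability of the section, hence the exceptional null
  set.\<close>

lemma P_P:
  assumes s: "0 \<le> s" and t: "0 \<le> t" and w: "w \<in> L2 G2"
  shows "AE x in G2. P s (P t w) x = P (s + t) w x"
proof -
  interpret S: prob_space "noise s" by (rule prob_space_noise[OF s])
  interpret T: prob_space "noise t" by (rule prob_space_noise[OF t])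
  interpret ST: pair_prob_space "noise s" "noise t" ..
  have [measurable]: "w \<in> borel_measurable borel" using L2_measurable[OF w] by simp
  have [measurable]: "P t w \<in> borel_measurable borel" using L2_measurable[OF P_L2(1)[OF t w]] by simp
  have m: "\<Theta> t \<in> borel_measurable (noise s \<Otimes>\<^sub>M noise t)" unfolding \<Theta>_def by measurable
  show ?thesis
    using P_L2(4)[OF add_nonneg_nonneg[OF s t] w]
  proof eventually_elim
    case (elim x)
    define h where "h z = w (K (s + t) x + z)" for z
    have [measurable]: "h \<in> borel_measurable borel" unfolding h_def by measurable
    have i: "integrable (noise s \<Otimes>\<^sub>M noise t) (\<lambda>p. h (\<Theta> t p))"
      using elim unfolding noise_add[OF s t, symmetric]
      by (subst (asm) integrable_distr_eq[OF m]) (simp_all add: h_def)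
    have "P (s + t) w x = (\<integral>z. h z \<partial>noise (s + t))" using s t by (simp add: P_eq h_def)
    also have "\<dots> = (\<integral>p. h (\<Theta> t p) \<partial>(noise s \<Otimes>\<^sub>M noise t))"
      unfolding noise_add[OF s t, symmetric] by (rule integral_distr[OF m]) simp
    also have "\<dots> = (\<integral>y. \<integral>z. h (\<Theta> t (y, z)) \<partial>noise t \<partial>noise s)"
      by (rule ST.integral_fst'[OF i, symmetric])
    also have "\<dots> = P s (P t w) x"
      using s t by (simp add: P_eq h_def \<Theta>_def linear_add[OF K_linear] K_K add.assoc)
    finally show ?case ..
  qed
qed

text \<open>This is uniqueness for the Poisson equation. A vanishing derivative at 0 gives
  \<open>P t w = w\<close> for all positive \<open>t\<close>, by cutting the time into many short
  steps. Equality in the contraction then forces \<open>w\<close> at the end of the coupling to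
  agree with \<open>w\<close> at the start. In Fourier terms, the coefficient at \<open>v\<close>
  equals that at \<open>Y t v\<close> times the transform of the noise; as \<open>Y t v\<close>
  tends to 0, the right-hand side tends to a multiple of the mean of \<open>w\<close>, which is
  0.\<close>

lemma generator_kernel_zero:
  assumes w: "w \<in> L2 G2" and w0: "(\<integral>x. w x \<partial>G2) = 0"
    and gen: "((\<lambda>t. L2_norm G2 (\<lambda>x. (P t w x - w x) / t)) \<longlongrightarrow> 0) (at_right 0)"
  shows "AE x in G2. w x = 0"
proof -
  interpret A: prob_space G2 by (rule prob_space_std_gaussian)
  have [measurable]: "w \<in> borel_measurable borel" using L2_measurable[OF w] by simp
  have step: "L2_norm G2 (\<lambda>x. P (real n * h) w x - w x) \<le> real n * L2_norm G2 (\<lambda>x. P h w x - w x)" if h: "0 \<le> h" for n h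
  proof (induction n)
    case 0
    interpret N: prob_space "noise 0" by (rule prob_space_noise) simp
    have "L2_norm G2 (P 0 w) \<le> L2_norm G2 w" by (rule P_L2) (simp_all add: w)
    have "P 0 w x = w x" for x
    proof -
      \<comment> \<open>At time 0 the dual flow is the identity, so the transform of the noise is
        1.\<close>
      have "noise 0 = return borel 0"
      proof (rule char_vec_unique)
        show "finite_measure (noise 0)" by (rule N.finite_measure_axioms)
        show "finite_measure (return borel (0 :: (real ^ 'd) \<times> (real ^ 'd)))"
          by (intro prob_space.finite_measure prob_space_return) simp
        show "char_vec (noise 0) v = char_vec (return borel 0) v" for v
          by (simp add: char_noise) (simp add: char_vec_def integral_return dual_flow_def)
      qed simp_all
      moreover have "K 0 x = x"
        by (subst vector_eq_ldot[symmetric]) (simp add: K_inner dual_flow_def)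
      ultimately show ?thesis by (simp add: P_eq integral_return)
    qed
    then show ?case by (simp add: L2_norm_def L2_inner_def)
  next
    case (Suc n)
    have nh: "0 \<le> real n * h" using h by simp
    let ?a = "\<lambda>x. P (real n * h) (\<lambda>x. P h w x - w x) x" and ?b = "\<lambda>x. P (real n * h) w x - w x"
    have aL: "?a \<in> L2 G2" by (intro P_L2(1) nh L2_diff h w)
    have bL: "?b \<in> L2 G2" by (intro P_L2(1) nh L2_diff h w)
    have "AE x in G2. P (real (Suc n) * h) w x - w x = ?a x + ?b x"
      using P_diff[OF nh P_L2(1)[OF h w] w] P_P[OF nh h w]
      by eventually_elim (simp add: algebra_simps)
    moreover have "(\<lambda>x. P (real (Suc n) * h) w x - w x) \<in> L2 G2" using h by (intro L2_diff P_L2(1) w) simp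
    ultimately have "L2_norm G2 (\<lambda>x. P (real (Suc n) * h) w x - w x) = L2_norm G2 (\<lambda>x. ?a x + ?b x)"
      by (intro L2_norm_AE_cong L2_measurable L2_add aL bL) auto
    also have "\<dots> \<le> L2_norm G2 ?a + L2_norm G2 ?b" by (rule L2_norm_triangle[OF aL bL])
    also have "L2_norm G2 ?a \<le> L2_norm G2 (\<lambda>x. P h w x - w x)" by (intro P_L2(2) nh L2_diff P_L2(1) h w)
    finally show ?case using Suc by (simp add: algebra_simps)
  qed
  have inv: "L2_norm G2 (\<lambda>x. P t w x - w x) = 0" if t: "0 < t" for t
  proof -
    have "filterlim (\<lambda>n. t / real (Suc n)) (at_right 0) sequentially"
      unfolding filterlim_at
    proof
      have "(\<lambda>n. t * (1 / real (Suc n))) \<longlonglongrightarrow> t * 0"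
        by (intro tendsto_intros lim_1_over_n[THEN LIMSEQ_Suc])
      then show "(\<lambda>n. t / real (Suc n)) \<longlonglongrightarrow> 0" by simp
    qed (use t in \<open>auto intro!: eventuallyI\<close>)
    from filterlim_compose[OF gen this]
    have "(\<lambda>n. t * L2_norm G2 (\<lambda>x. (P (t / real (Suc n)) w x - w x) / (t / real (Suc n)))) \<longlonglongrightarrow> t * 0"
      by (intro tendsto_intros)
    moreover have "L2_norm G2 (\<lambda>x. P t w x - w x) \<le>
        t * L2_norm G2 (\<lambda>x. (P (t / real (Suc n)) w x - w x) / (t / real (Suc n)))" for n
    proof -
      have "real (Suc n) * (t / real (Suc n)) = t" by (simp del: of_nat_Suc)
      then have "L2_norm G2 (\<lambda>x. P t w x - w x) \<le> real (Suc n) * L2_norm G2 (\<lambda>x. P (t / real (Suc n)) w x - w x)"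
        using step[of "t / real (Suc n)" "Suc n"] t by simp
      also have "\<dots> = t * (L2_norm G2 (\<lambda>x. P (t / real (Suc n)) w x - w x) / \<bar>t / real (Suc n)\<bar>)"
        using t by (simp add: abs_of_pos del: of_nat_Suc)
      finally show ?thesis unfolding L2_norm_divide .
    qed
    ultimately have "L2_norm G2 (\<lambda>x. P t w x - w x) \<le> t * 0"
      by (intro LIMSEQ_le_const) auto
    then show ?thesis using L2_norm_nonneg[of G2 "\<lambda>x. P t w x - w x"] by simp
  qed
  \<comment> \<open>Both functions have the norm of \<open>w\<close>, and their inner product is its
    square, so their distance is 0.\<close>
  have coupled: "AE p in G2 \<Otimes>\<^sub>M noise t. w (\<Theta> t p) = w (fst p)" if t: "0 < t" for t
  proof -
    have t0: "0 \<le> t" using t by simp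
    note Z = \<Theta>_measurable[of t] stationary[OF t0]
    have L: "(\<lambda>p. w (\<Theta> t p)) \<in> L2 (G2 \<Otimes>\<^sub>M noise t)" "(\<lambda>p. w (fst p)) \<in> L2 (G2 \<Otimes>\<^sub>M noise t)"
      using L2_gaussian_compose[OF Z w] L2_comp_fst[OF t0 w w] .
    have PL: "P t w \<in> L2 G2" by (rule P_L2(1)[OF t0 w])
    have "AE x in G2. P t w x - w x = 0" by (rule L2_norm_0_AE[OF L2_diff[OF PL w] inv[OF t]])
    then have "L2_inner G2 (P t w) w = L2_inner G2 w w"
      using PL w by (intro L2_inner_AE_cong L2_measurable) auto
    then have "L2_inner (G2 \<Otimes>\<^sub>M noise t) (\<lambda>p. w (\<Theta> t p)) (\<lambda>p. w (fst p)) = (L2_norm G2 w)\<^sup>2"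
      unfolding P_inner[OF t0 w w] by (simp add: L2_inner_self)
    moreover have "L2_norm (G2 \<Otimes>\<^sub>M noise t) (\<lambda>p. w (\<Theta> t p)) = L2_norm G2 w"
      by (rule L2_norm_gaussian_compose[OF Z w])
    moreover have "L2_norm (G2 \<Otimes>\<^sub>M noise t) (\<lambda>p. w (fst p)) = L2_norm G2 w"
    proof (rule L2_norm_gaussian_compose[OF _ _ w])
      interpret N: prob_space "noise t" by (rule prob_space_noise[OF t0])
      show "distr (G2 \<Otimes>\<^sub>M noise t) borel fst = G2"
        using N.distr_pair_fst[of G2] distr_cong[OF refl sets_std_gaussian, of "G2 \<Otimes>\<^sub>M noise t" fst fst] by simp
    qed measurable
    ultimately have "(L2_norm (G2 \<Otimes>\<^sub>M noise t) (\<lambda>p. w (\<Theta> t p) - w (fst p)))\<^sup>2 = 0"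
      by (simp add: L2_norm_diff_power2[OF L])
    then have "L2_norm (G2 \<Otimes>\<^sub>M noise t) (\<lambda>p. w (\<Theta> t p) - w (fst p)) = 0" by simp
    from L2_norm_0_AE[OF L2_diff[OF L] this] show ?thesis by simp
  qed
  have wi: "integrable G2 w" by (rule A.L2_integrable[OF w])
  show ?thesis
  proof (rule AE_zero_if_fourier_zero[OF _ wi])
    fix v
    define \<phi> where "\<phi> = (CLINT x|G2. w x * iexp (v \<bullet> x))"
    have "\<phi> = (CLINT x|G2. w x * iexp (Y t v \<bullet> x)) * char_vec (noise t) v" if t: "0 < t" for t
    proof -
      have t0: "0 \<le> t" using t by simp
      interpret N: prob_space "noise t" by (rule prob_space_noise[OF t0])
      interpret Q: pair_prob_space G2 "noise t" ..
      note [measurable] = \<Theta>_measurable[of t]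
      have "\<phi> = (CLINT p|G2 \<Otimes>\<^sub>M noise t. w (\<Theta> t p) * iexp (v \<bullet> \<Theta> t p))"
        unfolding \<phi>_def by (subst (1) stationary[OF t0, symmetric], subst integral_distr) auto
      also have "\<dots> = (CLINT p|G2 \<Otimes>\<^sub>M noise t. w (fst p) * iexp (v \<bullet> \<Theta> t p))"
        using coupled[OF t] by (intro integral_cong_AE) auto
      also have "\<dots> = (CLINT p|G2 \<Otimes>\<^sub>M noise t. (w (fst p) * iexp (Y t v \<bullet> fst p)) * iexp (v \<bullet> snd p))"
        by (simp add: \<Theta>_def inner_add_right K_inner exp_add[symmetric] algebra_simps)
      also have "\<dots> = (CLINT x|G2. CLINT z|noise t. (w x * iexp (Y t v \<bullet> x)) * iexp (v \<bullet> z))"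
      proof -
        have "integrable (G2 \<Otimes>\<^sub>M noise t) (\<lambda>p. w (fst p))"
          by (rule Q.P.L2_integrable[OF L2_comp_fst[OF t0 w w]])
        then have "integrable (G2 \<Otimes>\<^sub>M noise t) (\<lambda>p. (w (fst p) * iexp (Y t v \<bullet> fst p)) * iexp (v \<bullet> snd p))"
          by (rule Bochner_Integration.integrable_bound) (auto simp: norm_mult)
        from Q.integral_fst'[OF this] show ?thesis by simp
      qed
      also have "\<dots> = (CLINT x|G2. w x * iexp (Y t v \<bullet> x)) * char_vec (noise t) v"
        by (simp add: char_vec_def)
      finally show ?thesis .
    qed
    then have const: "\<phi> = (CLINT x|G2. w x * iexp (Y (real (Suc n)) v \<bullet> x)) *
        exp (- ((norm v)\<^sup>2 - (norm (Y (real (Suc n)) v))\<^sup>2) / 2)" for n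
      by (simp only: char_noise of_nat_0_le_iff of_nat_0_less_iff zero_less_Suc)
    have Y0: "(\<lambda>n. Y (real (Suc n)) v) \<longlonglongrightarrow> 0"
      using LIMSEQ_Suc[OF dual_flow_tendsto_0[OF skew gamma_pos]] .
    have "(\<lambda>n. CLINT x|G2. w x * iexp (Y (real (Suc n)) v \<bullet> x)) \<longlonglongrightarrow> (CLINT x|G2. w x * iexp (0 \<bullet> x))"
    proof (rule integral_dominated_convergence[where w="\<lambda>x. \<bar>w x\<bar>"])
      show "AE x in G2. (\<lambda>n. w x * iexp (Y (real (Suc n)) v \<bullet> x)) \<longlonglongrightarrow> w x * iexp (0 \<bullet> x)"
        by (intro AE_I2 tendsto_intros Y0)
    qed (use wi in \<open>auto simp: norm_mult\<close>)
    also have "(CLINT x|G2. w x * iexp (0 \<bullet> x)) = 0" by (simp add: w0)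
    finally have "(\<lambda>n. (CLINT x|G2. w x * iexp (Y (real (Suc n)) v \<bullet> x)) *
        exp (- ((norm v)\<^sup>2 - (norm (Y (real (Suc n)) v))\<^sup>2) / 2)) \<longlonglongrightarrow>
        0 * complex_of_real (exp (- ((norm v)\<^sup>2 - (norm (0 :: (real ^ 'd) \<times> (real ^ 'd)))\<^sup>2) / 2))"
      by (intro tendsto_intros Y0) simp_all
    then have "(\<lambda>n::nat. \<phi>) \<longlonglongrightarrow> 0" unfolding const[symmetric] by simp
    then show "(CLINT x|G2. w x * iexp (v \<bullet> x)) = 0" by (simp add: LIMSEQ_const_iff \<phi>_def)
  qed simp
qed

end

text \<open>The amplitude of the oscillator is at most 2 exp (- \<beta> t / 2) with \<beta> =
  \<gamma> / (3 + \<gamma>^2) / 2; the rate is \<beta> / 2 times the exponent 4 ln (4/3) / ln 2 of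
  \<open>mehler_decay\<close>.\<close>

definition decay_rate :: "real \<Rightarrow> real" where
  "decay_rate \<gamma> = (4 * ln (4 / 3) / ln 2) * (\<gamma> / (3 + \<gamma>\<^sup>2) / 2 / 2)"

text \<open>The factor 4/3 comes from \<open>mehler_decay\<close>, the exponential from the
  prefactor 2 = exp (ln 2) of the amplitude.\<close>

definition decay_const :: real where
  "decay_const = 4 / 3 * exp (4 * ln (4 / 3) / ln 2 * ln 2)"

lemma decay_rate_pos: "\<gamma> > 0 \<Longrightarrow> decay_rate \<gamma> > 0"
  by (simp add: decay_rate_def add_pos_nonneg)

lemma decay_const_nonneg: "decay_const \<ge> 0"
  by (simp add: decay_const_def)

text \<open>The covariance of \<open>f(q\<^sub>t)\<close> and \<open>k(q\<^sub>0)\<close> in the stationary regime, where \<open>c\<close> is the correlation and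
  \<open>s = \<mu> t\<close> the angle of rotation.\<close>

definition corr :: "real ^ 'd ^ 'd \<Rightarrow> real \<Rightarrow> real \<Rightarrow> (real ^ 'd \<Rightarrow> real) \<Rightarrow> (real ^ 'd \<Rightarrow> real) \<Rightarrow> real" where
  "corr J s c f k = (\<integral>p. f (rot J (- s) (c *\<^sub>R fst p + sqrt (1 - c\<^sup>2) *\<^sub>R snd p)) * k (fst p) \<partial>std_gaussian)"

lemma rot_tendsto:
  assumes "(f \<longlongrightarrow> s) F" "(g \<longlongrightarrow> v) F"
  shows "((\<lambda>x. rot J (f x) (g x)) \<longlongrightarrow> rot J s v) F"
proof -
  have "isCont (\<lambda>p. rot J (fst p) (snd p)) (s, v)"
    using rot_continuous_on[of J] by (simp add: continuous_on_eq_continuous_at)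
  from isCont_tendsto_compose[OF this tendsto_Pair[OF assms]] show ?thesis by simp
qed

lemma osc_tendsto:
  assumes "(f \<longlongrightarrow> s) F"
  shows "((\<lambda>x. osc_q \<gamma> (f x)) \<longlongrightarrow> osc_q \<gamma> s) F" "((\<lambda>x. osc_p \<gamma> (f x)) \<longlongrightarrow> osc_p \<gamma> s) F"
  using isCont_tendsto_compose[OF _ assms, of "osc_q \<gamma>"] isCont_tendsto_compose[OF _ assms, of "osc_p \<gamma>"]
    osc_continuous_on[of UNIV \<gamma>]
  by (simp_all add: continuous_on_eq_continuous_at)

lemma fst_distr:
  "distr (std_gaussian :: ('a::euclidean_space \<times> 'b::euclidean_space) measure) borel fst = std_gaussian"
  by (rule std_gaussian_distr_isometry[where L'="\<lambda>v. (v, 0)"])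
     (simp_all add: linear_fst inner_prod_def norm_prod_def)

section \<open>The position process and the Poisson equation\<close>

context langevin begin

text \<open>A single Gaussian vector \<open>z\<close> reproduces the law of the position at time
  \<open>t\<close>. The noise is isotropic, so the rotation is applied to the deterministic part
  only.\<close>

definition pos :: "real \<Rightarrow> (real ^ 'd) \<times> (real ^ 'd) \<Rightarrow> real ^ 'd \<Rightarrow> real ^ 'd" where
  "pos t x z = rot J (- (\<mu> * t)) (osc_q \<gamma> t *\<^sub>R fst x + osc_p \<gamma> t *\<^sub>R snd x)
     + sqrt (1 - ((osc_q \<gamma> t)\<^sup>2 + (osc_p \<gamma> t)\<^sup>2)) *\<^sub>R z"

definition F :: "(real ^ 'd \<Rightarrow> real) \<Rightarrow> real \<Rightarrow> (real ^ 'd) \<times> (real ^ 'd) \<Rightarrow> real" where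
  "F f t x = (\<integral>z. f (pos t x z) \<partial>std_gaussian)"

lemma pos_inner:
  "v \<bullet> pos t x z = (osc_q \<gamma> t *\<^sub>R rot J (\<mu> * t) v) \<bullet> fst x + (osc_p \<gamma> t *\<^sub>R rot J (\<mu> * t) v) \<bullet> snd x
     + (sqrt (1 - ((osc_q \<gamma> t)\<^sup>2 + (osc_p \<gamma> t)\<^sup>2)) *\<^sub>R v) \<bullet> z"
  by (simp add: pos_def inner_add_right rot_inner_minus[OF skew] linear_add[OF rot_linear] linear_cmul[OF rot_linear])

lemma pos_linear: "linear (\<lambda>p. pos t (fst p) (snd p))"
  by (rule linearI) (simp_all add: pos_def linear_add[OF rot_linear] linear_cmul[OF rot_linear] algebra_simps)

lemma pos_measurable [measurable]:
  assumes [measurable]: "a \<in> borel_measurable N" "b \<in> borel_measurable N" "c \<in> borel_measurable N"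
  shows "(\<lambda>x. pos (a x) (b x) (c x)) \<in> borel_measurable N"
  unfolding pos_def by measurable

lemma pos_noise_nonneg: "0 \<le> t \<Longrightarrow> 0 \<le> 1 - ((osc_q \<gamma> t)\<^sup>2 + (osc_p \<gamma> t)\<^sup>2)"
  using osc_bounds(1)[OF gamma_pos] by simp

lemma position_law:
  assumes t: "0 \<le> t"
  shows "distr M borel (\<lambda>\<omega>. fst (X x t \<omega>)) = distr std_gaussian borel (pos t x)"
proof (rule char_vec_unique)
  interpret A: prob_space "std_gaussian :: (real ^ 'd) measure" by (rule prob_space_std_gaussian)
  note [measurable] = X_measurable[OF t]
  show "finite_measure (distr M borel (\<lambda>\<omega>. fst (X x t \<omega>)))"
    by (intro prob_space.finite_measure prob_space_distr) measurable
  show "finite_measure (distr std_gaussian borel (pos t x))"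
    by (intro prob_space.finite_measure A.prob_space_distr) measurable
  fix v :: "real ^ 'd"
  let ?r = "(osc_q \<gamma> t)\<^sup>2 + (osc_p \<gamma> t)\<^sup>2"
  let ?m = "(osc_q \<gamma> t *\<^sub>R rot J (\<mu> * t) v) \<bullet> fst x + (osc_p \<gamma> t *\<^sub>R rot J (\<mu> * t) v) \<bullet> snd x"
  have "char_vec (distr M borel (\<lambda>\<omega>. fst (X x t \<omega>))) v = char_vec (distr M borel (X x t)) (v, 0)"
    by (subst (1 2) char_vec_distr) (simp_all add: inner_prod_def)
  also have "\<dots> = iexp (dual_flow J \<gamma> \<mu> t (v, 0) \<bullet> x) * exp (- ((norm (v, 0 :: real ^ 'd))\<^sup>2 - (norm (dual_flow J \<gamma> \<mu> t (v, 0)))\<^sup>2) / 2)"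
    by (rule langevin_char_vec[OF skew gamma_pos t prob_space_axioms brownian solution])
  also have "dual_flow J \<gamma> \<mu> t (v, 0) \<bullet> x = ?m"
    unfolding dual_flow_position[OF skew gamma_pos t] by (simp add: inner_prod_def)
  also have "(norm (v, 0 :: real ^ 'd))\<^sup>2 - (norm (dual_flow J \<gamma> \<mu> t (v, 0)))\<^sup>2 = (1 - ?r) * (norm v)\<^sup>2"
    unfolding osc_norm[OF skew gamma_pos t] by (simp add: norm_prod_def algebra_simps)
  finally have 1: "char_vec (distr M borel (\<lambda>\<omega>. fst (X x t \<omega>))) v = iexp ?m * exp (- ((1 - ?r) * (norm v)\<^sup>2) / 2)" .
  have "char_vec (distr std_gaussian borel (pos t x)) v =
      (CLINT z|std_gaussian. iexp ?m * iexp ((sqrt (1 - ?r) *\<^sub>R v) \<bullet> z))"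
    by (subst char_vec_distr) (simp_all add: pos_inner exp_add[symmetric] distrib_left)
  also have "\<dots> = iexp ?m * char_vec std_gaussian (sqrt (1 - ?r) *\<^sub>R v)" by (simp add: char_vec_def)
  also have "char_vec std_gaussian (sqrt (1 - ?r) *\<^sub>R v) = exp (- ((1 - ?r) * (norm v)\<^sup>2) / 2)"
    using pos_noise_nonneg[OF t] by (simp add: char_vec_std_gaussian power_mult_distrib)
  finally show "char_vec (distr M borel (\<lambda>\<omega>. fst (X x t \<omega>))) v = char_vec (distr std_gaussian borel (pos t x)) v"
    using 1 by simp
qed simp_all

lemma F_eq_P:
  assumes t: "0 \<le> t" and [measurable]: "f \<in> borel_measurable borel"
  shows "P t (\<lambda>x. f (fst x)) = F f t"
proof
  fix x
  note [measurable] = X_measurable[OF t]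
  have "P t (\<lambda>x. f (fst x)) x = (\<integral>y. f y \<partial>distr M borel (\<lambda>\<omega>. fst (X x t \<omega>)))"
    unfolding markov_semigroup_def by (rule integral_distr[symmetric]) measurable
  also have "\<dots> = F f t x"
    unfolding position_law[OF t] F_def by (rule integral_distr) measurable
  finally show "P t (\<lambda>x. f (fst x)) x = F f t x" .
qed

lemma pos_distr:
  assumes t: "0 \<le> t"
  shows "distr std_gaussian borel (\<lambda>p. pos t (fst p) (snd p)) = std_gaussian"
proof (rule std_gaussian_distr_isometry[OF pos_linear, where L'="\<lambda>v. ((osc_q \<gamma> t *\<^sub>R rot J (\<mu> * t) v, osc_p \<gamma> t *\<^sub>R rot J (\<mu> * t) v),
     sqrt (1 - ((osc_q \<gamma> t)\<^sup>2 + (osc_p \<gamma> t)\<^sup>2)) *\<^sub>R v)"])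
  fix v :: "real ^ 'd"
  have "(norm ((osc_q \<gamma> t *\<^sub>R rot J (\<mu> * t) v, osc_p \<gamma> t *\<^sub>R rot J (\<mu> * t) v),
     sqrt (1 - ((osc_q \<gamma> t)\<^sup>2 + (osc_p \<gamma> t)\<^sup>2)) *\<^sub>R v))\<^sup>2 = (norm v)\<^sup>2"
    unfolding norm_Pair_power2 using pos_noise_nonneg[OF t]
    by (simp add: rot_norm[OF skew] power_mult_distrib algebra_simps)
  then show "norm ((osc_q \<gamma> t *\<^sub>R rot J (\<mu> * t) v, osc_p \<gamma> t *\<^sub>R rot J (\<mu> * t) v),
     sqrt (1 - ((osc_q \<gamma> t)\<^sup>2 + (osc_p \<gamma> t)\<^sup>2)) *\<^sub>R v) = norm v"
    by (rule power2_eq_imp_eq) simp_all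
qed (simp add: pos_inner inner_prod_def)

lemma F_L2:
  assumes t: "0 \<le> t" and f: "f \<in> L2 std_gaussian"
  shows "F f t \<in> L2 G2" "(\<integral>x. F f t x \<partial>G2) = (\<integral>x. f x \<partial>std_gaussian)"
    "AE x in G2. integrable std_gaussian (\<lambda>z. f (pos t x z))"
    and F_inner: "h \<in> L2 G2 \<Longrightarrow> L2_inner G2 (F f t) h =
      L2_inner std_gaussian (\<lambda>p. f (pos t (fst p) (snd p))) (\<lambda>p. h (fst p))"
proof -
  have [measurable]: "f \<in> borel_measurable borel" using L2_measurable[OF f] by simp
  have Z: "(\<lambda>p. pos t (fst p) (snd p)) \<in> borel_measurable std_gaussian" by simp
  have e: "(\<lambda>x. \<integral>z. (\<lambda>p. f (pos t (fst p) (snd p))) (x, z) \<partial>std_gaussian) = F f t"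
    by (simp add: F_def fun_eq_iff)
  note * = L2_gaussian_partial_integral[OF L2_gaussian_compose[OF Z pos_distr[OF t] f], unfolded e]
  show "F f t \<in> L2 G2" "(\<integral>x. F f t x \<partial>G2) = (\<integral>x. f x \<partial>std_gaussian)"
    "AE x in G2. integrable std_gaussian (\<lambda>z. f (pos t x z))"
    "h \<in> L2 G2 \<Longrightarrow> L2_inner G2 (F f t) h =
      L2_inner std_gaussian (\<lambda>p. f (pos t (fst p) (snd p))) (\<lambda>p. h (fst p))"
    using *(1,3,5) *(4) integral_gaussian_compose[OF Z pos_distr[OF t] \<open>f \<in> borel_measurable borel\<close>]
    by (simp_all only: fst_conv snd_conv)
qed

text \<open>The deterministic part of \<open>pos\<close> is \<open>c\<close> times a standard
  Gaussian vector \<open>U\<close>, where \<open>c\<close> is the amplitude of the oscillator, so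
  \<open>F f t\<close> is \<open>mehler c f\<close> composed with \<open>U\<close>. Both
  coefficients enter because \<open>F f t\<close> depends on position and velocity.\<close>

lemma F_decay:
  assumes t: "0 \<le> t" and f: "f \<in> L2_zero_mean std_gaussian"
  shows "(L2_norm G2 (F f t))\<^sup>2 \<le> decay_const * (L2_norm std_gaussian f)\<^sup>2 * exp (- decay_rate \<gamma> * t)"
proof -
  have fL: "f \<in> L2 std_gaussian" using f by (rule L2_zero_mean_L2)
  define c where "c = sqrt ((osc_q \<gamma> t)\<^sup>2 + (osc_p \<gamma> t)\<^sup>2)"
  have c2: "c\<^sup>2 = (osc_q \<gamma> t)\<^sup>2 + (osc_p \<gamma> t)\<^sup>2" by (simp add: c_def)
  have c: "0 \<le> c" "c \<le> 1" using osc_bounds(1)[OF gamma_pos t] by (simp_all add: c_def)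
  define \<beta> where "\<beta> = \<gamma> / (3 + \<gamma>\<^sup>2) / 2"
  define s where "s = \<beta> * t / 2 - ln 2"
  have cs: "c \<le> exp (- s)"
  proof (rule power2_le_imp_le)
    have "(exp (- s))\<^sup>2 = 4 * exp (- \<beta> * t)"
    proof -
      have "exp (- s) = exp (ln 2 + - (\<beta> * t / 2))" by (simp add: s_def)
      then have "exp (- s) = 2 * exp (- (\<beta> * t / 2))" unfolding exp_add by simp
      then have "(exp (- s))\<^sup>2 = 4 * (exp (- (\<beta> * t / 2)) * exp (- (\<beta> * t / 2)))" unfolding power2_eq_square by (simp only: mult.assoc mult.left_commute)
      also have "exp (- (\<beta> * t / 2)) * exp (- (\<beta> * t / 2)) = exp (- \<beta> * t)"
        unfolding mult_exp_exp by (rule arg_cong[where f=exp]) simp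
      finally show ?thesis .
    qed
    then show "c\<^sup>2 \<le> (exp (- s))\<^sup>2"
      using osc_bounds(2)[OF gamma_pos t] by (simp add: c2 \<beta>_def)
  qed simp
  have norm: "L2_norm G2 (F f t) \<le> L2_norm std_gaussian (mehler c f)"
  \<comment> \<open>\<open>U\<close> involves a division by \<open>c\<close>; for
    \<open>c = 0\<close> the function \<open>F f t\<close> is the mean of \<open>f\<close>, which is
    0.\<close>
  proof (cases "c = 0")
    case True
    then have z: "osc_q \<gamma> t = 0" "osc_p \<gamma> t = 0"
      using c2 by (simp_all add: sum_power2_eq_zero_iff)
    have "rot J s 0 = 0" for s using linear_0[OF rot_linear] .
    then have "F f t x = 0" for x
      using f z by (simp add: F_def pos_def L2_zero_mean_def)
    then have "L2_norm G2 (F f t) = 0" by (simp add: L2_norm_def L2_inner_def)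
    then show ?thesis by (simp add: L2_norm_nonneg)
  next
    case False
    define U where "U x = (1 / c) *\<^sub>R rot J (- (\<mu> * t)) (osc_q \<gamma> t *\<^sub>R fst x + osc_p \<gamma> t *\<^sub>R snd x)" for x
    have U: "U \<in> borel_measurable G2" unfolding U_def by simp
    have "distr G2 borel U = std_gaussian"
    proof (rule std_gaussian_distr_isometry[where L'="\<lambda>v. ((osc_q \<gamma> t / c) *\<^sub>R rot J (\<mu> * t) v, (osc_p \<gamma> t / c) *\<^sub>R rot J (\<mu> * t) v)"])
      show "linear U"
        by (rule linearI) (simp_all add: U_def linear_add[OF rot_linear] linear_cmul[OF rot_linear] algebra_simps)
      show "v \<bullet> U x = ((osc_q \<gamma> t / c) *\<^sub>R rot J (\<mu> * t) v, (osc_p \<gamma> t / c) *\<^sub>R rot J (\<mu> * t) v) \<bullet> x" for v x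
        by (simp add: U_def rot_inner_minus[OF skew] inner_prod_def inner_add_right add_divide_distrib)
      fix v :: "real ^ 'd"
      have "(norm ((osc_q \<gamma> t / c) *\<^sub>R rot J (\<mu> * t) v, (osc_p \<gamma> t / c) *\<^sub>R rot J (\<mu> * t) v))\<^sup>2 =
         ((osc_q \<gamma> t)\<^sup>2 + (osc_p \<gamma> t)\<^sup>2) / c\<^sup>2 * (norm v)\<^sup>2"
        unfolding norm_Pair_power2 by (simp add: rot_norm[OF skew] power_mult_distrib power_divide add_divide_distrib distrib_right)
      also have "\<dots> = (norm v)\<^sup>2" using False by (simp add: c2[symmetric])
      finally show "norm ((osc_q \<gamma> t / c) *\<^sub>R rot J (\<mu> * t) v, (osc_p \<gamma> t / c) *\<^sub>R rot J (\<mu> * t) v) = norm v"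
        by (rule power2_eq_imp_eq) simp_all
    qed
    moreover have "F f t = (\<lambda>x. mehler c f (U x))"
      using False by (simp add: F_def mehler_def pos_def U_def c2 fun_eq_iff)
    ultimately show ?thesis
      using L2_norm_gaussian_compose[OF U _ mehler_L2(1)[OF _ fL]] c by simp
  qed
  have "(L2_norm G2 (F f t))\<^sup>2 \<le> (L2_norm std_gaussian (mehler c f))\<^sup>2"
    by (rule power_mono[OF norm L2_norm_nonneg])
  also have "\<dots> \<le> 4 / 3 * exp (- (4 * ln (4 / 3) / ln 2) * s) * (L2_norm std_gaussian f)\<^sup>2"
    by (rule mehler_decay[OF f c cs])
  also have "- (4 * ln (4 / 3) / ln 2) * s = 4 * ln (4 / 3) / ln 2 * ln 2 + - decay_rate \<gamma> * t"
  proof -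
    have "- k * (\<beta> * t / 2 - l) = k * l + - (k * (\<beta> / 2)) * t" for k l by (simp add: algebra_simps)
    then show ?thesis unfolding s_def decay_rate_def \<beta>_def[symmetric] .
  qed
  also have "4 / 3 * exp (4 * ln (4 / 3) / ln 2 * ln 2 + - decay_rate \<gamma> * t) * (L2_norm std_gaussian f)\<^sup>2 =
      decay_const * (L2_norm std_gaussian f)\<^sup>2 * exp (- decay_rate \<gamma> * t)"
    unfolding exp_add decay_const_def by (simp only: ac_simps)
  finally show ?thesis .
qed

text \<open>Against a function of the initial position, the initial velocity acts as additional
  noise, and only the correlation \<open>osc_q \<gamma> t\<close> survives. \<open>A\<close> and
  \<open>B\<close> give the pair of initial and current position in the two descriptions; their laws
  agree because the adjoints have equal norms.\<close>

lemma F_corr: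
  assumes t: "0 \<le> t" and f: "f \<in> L2 std_gaussian" and k: "k \<in> L2 std_gaussian"
  shows "L2_inner G2 (F f t) (\<lambda>x. k (fst x)) = corr J (\<mu> * t) (osc_q \<gamma> t) f k"
proof -
  have [measurable]: "f \<in> borel_measurable borel" "k \<in> borel_measurable borel"
    using L2_measurable[OF f] L2_measurable[OF k] by simp_all
  let ?a = "osc_q \<gamma> t" and ?b = "osc_p \<gamma> t"
  let ?k = "sqrt (1 - (?a\<^sup>2 + ?b\<^sup>2))" and ?l = "sqrt (1 - ?a\<^sup>2)"
  define A where "A p = (fst (fst p), pos t (fst p) (snd p))" for p
  define B where "B p = (fst p, rot J (- (\<mu> * t)) (?a *\<^sub>R fst p + ?l *\<^sub>R snd p))" for p
  define A' where "A' v = ((fst v + ?a *\<^sub>R rot J (\<mu> * t) (snd v), ?b *\<^sub>R rot J (\<mu> * t) (snd v)), ?k *\<^sub>R snd v)" for v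
  define B' where "B' v = (fst v + ?a *\<^sub>R rot J (\<mu> * t) (snd v), ?l *\<^sub>R rot J (\<mu> * t) (snd v))" for v
  have kf: "(\<lambda>x. k (fst x)) \<in> L2 G2" by (rule L2_gaussian_compose[OF _ fst_distr k]) simp
  have law: "distr std_gaussian borel A = distr std_gaussian borel B"
  proof (rule std_gaussian_distr_eqI[where L1'=A' and L2'=B'])
    show "linear A"
      by (rule linearI) (simp_all add: A_def linear_add[OF pos_linear, simplified] linear_cmul[OF pos_linear, simplified]
          pos_def linear_add[OF rot_linear] linear_cmul[OF rot_linear] algebra_simps)
    show "linear B"
      by (rule linearI) (simp_all add: B_def linear_add[OF rot_linear] linear_cmul[OF rot_linear] algebra_simps)
    show "v \<bullet> A x = A' v \<bullet> x" for v x
      by (simp add: A_def A'_def inner_prod_def pos_inner inner_add_left)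
    show "v \<bullet> B x = B' v \<bullet> x" for v x
      by (simp add: B_def B'_def inner_prod_def rot_inner_minus[OF skew] inner_add_left inner_add_right)
    fix v :: "(real ^ 'd) \<times> (real ^ 'd)"
    have "?a\<^sup>2 \<le> 1" using pos_noise_nonneg[OF t] zero_le_power2[of ?b] by linarith
    then have "(norm (A' v))\<^sup>2 = (norm (B' v))\<^sup>2"
      unfolding A'_def B'_def norm_Pair_power2 using pos_noise_nonneg[OF t]
      by (simp add: rot_norm[OF skew] power_mult_distrib algebra_simps)
    then show "norm (A' v) = norm (B' v)" by (rule power2_eq_imp_eq) simp_all
  qed
  have A: "A \<in> borel_measurable std_gaussian" and B: "B \<in> borel_measurable std_gaussian"
    unfolding A_def B_def by simp_all
  have h: "(\<lambda>y. f (snd y) * k (fst y)) \<in> borel_measurable borel" by measurable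
  have "L2_inner G2 (F f t) (\<lambda>x. k (fst x)) = (\<integral>p. f (snd (A p)) * k (fst (A p)) \<partial>std_gaussian)"
    unfolding F_inner[OF t f kf] by (simp add: L2_inner_def A_def)
  also have "\<dots> = (\<integral>y. f (snd y) * k (fst y) \<partial>distr std_gaussian borel A)"
    by (rule integral_distr[OF A h, symmetric])
  also have "\<dots> = (\<integral>p. f (snd (B p)) * k (fst (B p)) \<partial>std_gaussian)"
    unfolding law by (rule integral_distr[OF B h])
  also have "\<dots> = corr J (\<mu> * t) ?a f k" by (simp add: corr_def B_def)
  finally show ?thesis .
qed

text \<open>The difference is almost everywhere a partial integral of \<open>f\<close> along two
  Gaussian variables that approach each other pointwise, so \<open>L2_norm_compose_tendsto_0\<close>
  applies along every sequence.\<close>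

lemma F_strongly_continuous:
  assumes f: "f \<in> L2 std_gaussian"
  shows "((\<lambda>t. L2_norm G2 (\<lambda>x. F f t x - f (fst x))) \<longlongrightarrow> 0) (at_right 0)"
  unfolding tendsto_at_iff_sequentially
proof (intro allI impI)
  fix s :: "nat \<Rightarrow> real" assume s: "\<forall>i. s i \<in> {0<..} - {0}" and lim: "s \<longlonglongrightarrow> 0"
  let ?H = "std_gaussian :: (((real ^ 'd) \<times> (real ^ 'd)) \<times> (real ^ 'd)) measure"
  have s0: "0 \<le> s n" for n using s[rule_format, of n] by simp
  have [measurable]: "f \<in> borel_measurable borel" using L2_measurable[OF f] by simp
  have Zd: "distr ?H borel (\<lambda>p. fst (fst p)) = std_gaussian"
    by (rule std_gaussian_distr_isometry[where L'="\<lambda>v. ((v, 0), 0)"])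
       (auto intro!: linearI simp: inner_prod_def norm_prod_def)
  have le: "L2_norm G2 (\<lambda>x. F f (s n) x - f (fst x)) \<le> L2_norm ?H (\<lambda>p. f (pos (s n) (fst p) (snd p)) - f (fst (fst p)))" for n
  proof -
    interpret A: prob_space "std_gaussian :: (real ^ 'd) measure" by (rule prob_space_std_gaussian)
    have L: "(\<lambda>p. f (pos (s n) (fst p) (snd p)) - f (fst (fst p))) \<in> L2 ?H"
      by (intro L2_diff L2_gaussian_compose[OF _ pos_distr[OF s0] f] L2_gaussian_compose[OF _ Zd f]) simp_all
    have fL: "(\<lambda>x. f (fst x)) \<in> L2 G2" by (rule L2_gaussian_compose[OF _ fst_distr f]) simp
    have "AE x in G2. F f (s n) x - f (fst x) = (\<integral>z. f (pos (s n) x z) - f (fst x) \<partial>std_gaussian)"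
      using F_L2(3)[OF s0[of n] f]
      by eventually_elim (simp add: F_def A.prob_space[simplified])
    then have "L2_norm G2 (\<lambda>x. F f (s n) x - f (fst x)) = L2_norm G2 (\<lambda>x. \<integral>z. f (pos (s n) x z) - f (fst x) \<partial>std_gaussian)"
      using L2_gaussian_partial_integral(1)[OF L] F_L2(1)[OF s0[of n] f] fL
      by (intro L2_norm_AE_cong L2_measurable L2_diff) simp_all
    also have "\<dots> \<le> L2_norm ?H (\<lambda>p. f (pos (s n) (fst p) (snd p)) - f (fst (fst p)))"
      using L2_gaussian_partial_integral(2)[OF L] by simp
    finally show ?thesis .
  qed
  have "(\<lambda>n. L2_norm ?H (\<lambda>p. f (pos (s n) (fst p) (snd p)) - f (fst (fst p)))) \<longlonglongrightarrow> 0"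
  proof (rule L2_norm_compose_tendsto_0[OF prob_space_std_gaussian _ _ pos_distr[OF s0] Zd _ f])
    show "AE p in ?H. (\<lambda>n. pos (s n) (fst p) (snd p)) \<longlonglongrightarrow> fst (fst p)"
    proof (rule AE_I2)
      fix p :: "((real ^ 'd) \<times> (real ^ 'd)) \<times> (real ^ 'd)"
      have "(\<lambda>n. pos (s n) (fst p) (snd p)) \<longlonglongrightarrow> rot J (- (\<mu> * 0)) (osc_q \<gamma> 0 *\<^sub>R fst (fst p) + osc_p \<gamma> 0 *\<^sub>R snd (fst p))
         + sqrt (1 - ((osc_q \<gamma> 0)\<^sup>2 + (osc_p \<gamma> 0)\<^sup>2)) *\<^sub>R snd p"
        unfolding pos_def by (intro tendsto_intros rot_tendsto osc_tendsto lim)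
      then show "(\<lambda>n. pos (s n) (fst p) (snd p)) \<longlonglongrightarrow> fst (fst p)" by simp
    qed
  qed simp_all
  then show "((\<lambda>t. L2_norm G2 (\<lambda>x. F f t x - f (fst x))) \<circ> s) \<longlonglongrightarrow> 0"
    unfolding o_def by (rule tendsto_sandwich[OF _ _ tendsto_const, rotated 2]) (auto simp: le L2_norm_nonneg)
qed

text \<open>Formally the inverse of the negative generator applied to \<open>f\<close>.\<close>

definition poisson_solution :: "(real ^ 'd \<Rightarrow> real) \<Rightarrow> (real ^ 'd) \<times> (real ^ 'd) \<Rightarrow> real" where
  "poisson_solution f x = (\<integral>t. indicator {0..} t * F f t x \<partial>lborel)"

context
  fixes f :: "real ^ 'd \<Rightarrow> real"
  assumes f: "f \<in> L2_zero_mean std_gaussian"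
begin

lemma f_L2: "f \<in> L2 std_gaussian"
  using f by (rule L2_zero_mean_L2)

lemma f_measurable [measurable]: "f \<in> borel_measurable borel"
  using L2_measurable[OF f_L2] by simp

lemma f_fst_L2: "(\<lambda>x. f (fst x)) \<in> L2 G2"
  by (rule L2_gaussian_compose[OF _ fst_distr f_L2]) simp

lemma F_measurable: "(\<lambda>p. F f (snd p) (fst p)) \<in> borel_measurable (G2 \<Otimes>\<^sub>M borel)"
proof -
  interpret A: prob_space "std_gaussian :: (real ^ 'd) measure" by (rule prob_space_std_gaussian)
  show ?thesis unfolding F_def by measurable
qed

lemma poisson_L2: "poisson_solution f \<in> L2 G2"
  and poisson_integrable: "k \<in> L2 G2 \<Longrightarrow> integrable lborel (\<lambda>t. indicator {0..} t * L2_inner G2 (F f t) k)"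
  and poisson_inner: "k \<in> L2 G2 \<Longrightarrow> L2_inner G2 (poisson_solution f) k = (\<integral>t. indicator {0..} t * L2_inner G2 (F f t) k \<partial>lborel)"
  unfolding poisson_solution_def
  by (rule prob_space.L2_time_integral[OF prob_space_std_gaussian _ F_measurable F_L2(1)[OF _ f_L2] F_decay[OF _ f]
        decay_rate_pos[OF gamma_pos]]; simp)+

text \<open>\<open>P h\<close> moves the time integral to times after \<open>h\<close>. The identity
  is paired with a function \<open>k\<close>, because exchanging \<open>P h\<close> with the time
  integral is then an instance of \<open>L2_time_integral\<close> on the space of the
  coupling.\<close>

lemma P_poisson_inner:
  assumes h: "0 \<le> h" and k: "k \<in> L2 G2"
  shows "L2_inner G2 (P h (poisson_solution f)) k = (\<integral>t. indicator {h..} t * L2_inner G2 (F f t) k \<partial>lborel)"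
proof -
  interpret Q: pair_prob_space G2 "noise h" by (rule pair_prob_space_noise[OF h])
  note Z = \<Theta>_measurable[of h] stationary[OF h]
  note kQ = L2_comp_fst[OF h k k]
  have m: "(\<lambda>p. F f (snd p) (\<Theta> h (fst p))) \<in> borel_measurable ((G2 \<Otimes>\<^sub>M noise h) \<Otimes>\<^sub>M borel)"
  proof -
    note [measurable] = \<Theta>_measurable[of h]
    have "(\<lambda>p. (\<Theta> h (fst p), snd p)) \<in> measurable ((G2 \<Otimes>\<^sub>M noise h) \<Otimes>\<^sub>M borel) (G2 \<Otimes>\<^sub>M borel)"
      by (rule measurable_Pair) (simp_all add: measurable_cong_sets[OF refl sets_std_gaussian])
    from measurable_compose[OF this F_measurable] show ?thesis by simp
  qed
  have "L2_inner G2 (P h (poisson_solution f)) k =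
     L2_inner (G2 \<Otimes>\<^sub>M noise h) (\<lambda>p. \<integral>t. indicator {0..} t * F f t (\<Theta> h p) \<partial>lborel) (\<lambda>p. k (fst p))"
    unfolding P_inner[OF h poisson_L2 k] by (simp add: poisson_solution_def)
  also have "\<dots> = (\<integral>t. indicator {0..} t * L2_inner (G2 \<Otimes>\<^sub>M noise h) (\<lambda>p. F f t (\<Theta> h p)) (\<lambda>p. k (fst p)) \<partial>lborel)"
  proof (rule Q.P.L2_time_integral(3)[OF _ m _ _ decay_rate_pos[OF gamma_pos] kQ])
    show "(\<lambda>p. F f t (\<Theta> h p)) \<in> L2 (G2 \<Otimes>\<^sub>M noise h)" if "0 \<le> t" for t
      by (rule L2_gaussian_compose[OF Z F_L2(1)[OF that f_L2]])
    show "(L2_norm (G2 \<Otimes>\<^sub>M noise h) (\<lambda>p. F f t (\<Theta> h p)))\<^sup>2 \<le>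
        decay_const * (L2_norm std_gaussian f)\<^sup>2 * exp (- decay_rate \<gamma> * t)" if "0 \<le> t" for t
      using F_decay[OF that f] L2_norm_gaussian_compose[OF Z F_L2(1)[OF that f_L2]] by simp
  qed (simp add: space_pair_measure)
  also have "\<dots> = (\<integral>t. indicator {h..} (h + 1 * t) * L2_inner G2 (F f (h + 1 * t)) k \<partial>lborel)"
  proof (rule Bochner_Integration.integral_cong[OF refl])
    fix t :: real
    show "indicator {0..} t * L2_inner (G2 \<Otimes>\<^sub>M noise h) (\<lambda>p. F f t (\<Theta> h p)) (\<lambda>p. k (fst p)) =
       indicator {h..} (h + 1 * t) * L2_inner G2 (F f (h + 1 * t)) k"
    proof (cases "0 \<le> t")
      case True
      have "L2_inner (G2 \<Otimes>\<^sub>M noise h) (\<lambda>p. F f t (\<Theta> h p)) (\<lambda>p. k (fst p)) = L2_inner G2 (P h (F f t)) k"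
        by (rule P_inner[OF h F_L2(1)[OF True f_L2] k, symmetric])
      also have "\<dots> = L2_inner G2 (F f (h + t)) k"
      proof (rule L2_inner_AE_cong)
        show "AE x in G2. P h (F f t) x = F f (h + t) x"
          using P_P[OF h True f_fst_L2] h True by (simp add: F_eq_P)
        show "P h (F f t) \<in> borel_measurable G2" by (rule L2_measurable[OF P_L2(1)[OF h F_L2(1)[OF True f_L2]]])
        show "F f (h + t) \<in> borel_measurable G2"
          using h True by (intro L2_measurable F_L2(1) f_L2) simp
        show "k \<in> borel_measurable G2" by (rule L2_measurable[OF k])
      qed
      finally show ?thesis using True by (simp add: indicator_def)
    qed (simp add: indicator_def)
  qed
  also have "\<dots> = (\<integral>t. indicator {h..} t * L2_inner G2 (F f t) k \<partial>lborel)"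
    using lborel_integral_real_affine[of 1 "\<lambda>t. indicator {h..} t * L2_inner G2 (F f t) k" h] by simp
  finally show ?thesis .
qed

text \<open>Weakly, the difference quotient plus \<open>f\<close> is the average over times in
  \<open>(0, h)\<close> of \<open>f - F f t\<close>.\<close>

lemma poisson_increment:
  assumes h: "0 < h" and k: "k \<in> L2 G2" and e: "\<And>t. 0 < t \<Longrightarrow> t < h \<Longrightarrow> L2_norm G2 (\<lambda>x. F f t x - f (fst x)) \<le> e"
  shows "\<bar>L2_inner G2 (\<lambda>x. (P h (poisson_solution f) x - poisson_solution f x) / h - (- f (fst x))) k\<bar> \<le> e * L2_norm G2 k"
proof -
  let ?u = "poisson_solution f" and ?\<phi> = "\<lambda>t. L2_inner G2 (F f t) k" and ?c = "L2_inner G2 (\<lambda>x. f (fst x)) k"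
  have h0: "0 \<le> h" using h by simp
  have i0: "integrable lborel (\<lambda>t. indicator {0..} t * ?\<phi> t)" by (rule poisson_integrable[OF k])
  have ih: "integrable lborel (\<lambda>t. indicator {h..} t * ?\<phi> t)"
  proof -
    have "integrable lborel (\<lambda>t. indicator {h..} t *\<^sub>R (indicator {0..} t * ?\<phi> t))"
      by (rule integrable_mult_indicator[OF _ i0]) simp
    then show ?thesis using h by (elim back_subst[of "integrable lborel"]) (auto simp: indicator_def fun_eq_iff)
  qed
  have ii: "integrable lborel (\<lambda>t. indicator {0<..<h} t * ?\<phi> t)"
  proof -
    have "integrable lborel (\<lambda>t. indicator {0<..<h} t *\<^sub>R (indicator {0..} t * ?\<phi> t))"
      by (rule integrable_mult_indicator[OF _ i0]) simp
    then show ?thesis using h by (elim back_subst[of "integrable lborel"]) (auto simp: indicator_def fun_eq_iff)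
  qed
  have ic: "integrable lborel (\<lambda>t. indicator {0<..<h} t * ?c)"
    using h by (intro integrable_mult_left) simp_all
  have cint: "(\<integral>t. indicator {0<..<h} t * ?c \<partial>lborel) = h * ?c"
    using h by simp
  have "L2_inner G2 ?u k - L2_inner G2 (P h ?u) k = (\<integral>t. indicator {0..} t * ?\<phi> t - indicator {h..} t * ?\<phi> t \<partial>lborel)"
    unfolding poisson_inner[OF k] P_poisson_inner[OF h0 k] using i0 ih by simp
  also have "\<dots> = (\<integral>t. indicator {0<..<h} t * ?\<phi> t \<partial>lborel)"
  proof (rule integral_cong_AE)
    show "AE t in lborel. indicator {0..} t * ?\<phi> t - indicator {h..} t * ?\<phi> t = indicator {0<..<h} t * ?\<phi> t"
      using AE_lborel_singleton[of 0] by eventually_elim (use h in \<open>auto simp: indicator_def\<close>)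
  qed (use i0 ih ii in simp_all)
  finally have inc: "L2_inner G2 ?u k - L2_inner G2 (P h ?u) k = (\<integral>t. indicator {0<..<h} t * ?\<phi> t \<partial>lborel)" .
  have PL: "P h ?u \<in> L2 G2" by (rule P_L2(1)[OF h0 poisson_L2])
  have "L2_inner G2 (\<lambda>x. (P h ?u x - ?u x) / h - (- f (fst x))) k =
      (1 / h) * (L2_inner G2 (P h ?u) k - L2_inner G2 ?u k) + ?c"
  proof -
    have "L2_inner G2 (\<lambda>x. (1 / h) * (P h ?u x - ?u x) + f (fst x)) k = (1 / h) * (L2_inner G2 (P h ?u) k - L2_inner G2 ?u k) + ?c"
      by (subst L2_inner_add_left[OF L2_scale[OF L2_diff[OF PL poisson_L2]] f_fst_L2 k], subst L2_inner_scale_left,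
          subst L2_inner_diff_left[OF PL poisson_L2 k], rule refl)
    then show ?thesis by simp
  qed
  also have "\<dots> = (1 / h) * (h * ?c - (\<integral>t. indicator {0<..<h} t * ?\<phi> t \<partial>lborel))"
    using h inc by (simp add: field_simps)
  also have "\<dots> = (1 / h) * (\<integral>t. indicator {0<..<h} t * ?c - indicator {0<..<h} t * ?\<phi> t \<partial>lborel)"
    unfolding cint[symmetric] by (subst Bochner_Integration.integral_diff[OF ic ii]) simp
  finally have eq: "L2_inner G2 (\<lambda>x. (P h ?u x - ?u x) / h - (- f (fst x))) k =
     (1 / h) * (\<integral>t. indicator {0<..<h} t * ?c - indicator {0<..<h} t * ?\<phi> t \<partial>lborel)" .
  have "\<bar>\<integral>t. indicator {0<..<h} t * ?c - indicator {0<..<h} t * ?\<phi> t \<partial>lborel\<bar> \<le>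
     (\<integral>t. \<bar>indicator {0<..<h} t * ?c - indicator {0<..<h} t * ?\<phi> t\<bar> \<partial>lborel)"
    by (rule integral_abs_bound)
  also have "\<dots> \<le> (\<integral>t. indicator {0<..<h} t * (e * L2_norm G2 k) \<partial>lborel)"
  proof (rule integral_mono)
    show "integrable lborel (\<lambda>t. \<bar>indicator {0<..<h} t * ?c - indicator {0<..<h} t * ?\<phi> t\<bar>)"
      by (intro integrable_abs Bochner_Integration.integrable_diff ic ii)
    show "integrable lborel (\<lambda>t. indicator {0<..<h} t * (e * L2_norm G2 k))"
      using h by (intro integrable_mult_left) simp_all
    fix t :: real
    show "\<bar>indicator {0<..<h} t * ?c - indicator {0<..<h} t * ?\<phi> t\<bar> \<le> indicator {0<..<h} t * (e * L2_norm G2 k)"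
    proof (cases "0 < t \<and> t < h")
      case True
      then have FL: "F f t \<in> L2 G2" by (intro F_L2(1) f_L2) simp
      have "\<bar>L2_inner G2 (\<lambda>x. F f t x - f (fst x)) k\<bar> \<le> L2_norm G2 (\<lambda>x. F f t x - f (fst x)) * L2_norm G2 k"
        by (rule L2_Cauchy_Schwarz[OF L2_diff[OF FL f_fst_L2] k])
      also have "\<dots> \<le> e * L2_norm G2 k" using True e by (intro mult_right_mono L2_norm_nonneg) auto
      finally show ?thesis using True by (simp add: L2_inner_diff_left[OF FL f_fst_L2 k] abs_minus_commute)
    qed (auto simp: indicator_def)
  qed
  also have "\<dots> = h * (e * L2_norm G2 k)" using h by simp
  finally show ?thesis unfolding eq abs_mult using h by (simp add: field_simps)
qed

text \<open>Taking for \<open>k\<close> the error itself turns the weak bound of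
  \<open>poisson_increment\<close> into a bound of its norm.\<close>

lemma poisson_generator: "(poisson_solution f, \<lambda>x. - f (fst x)) \<in> L2_generator G2 P"
proof -
  let ?u = "poisson_solution f"
  let ?D = "\<lambda>h x. (P h ?u x - ?u x) / h - (- f (fst x))"
  have DL: "(\<lambda>x. (P h ?u x - ?u x) / h) \<in> L2 G2" if "0 \<le> h" for h
    by (intro L2_divide L2_diff P_L2(1) that poisson_L2)
  have fm: "(\<lambda>x. - f (fst x)) \<in> L2 G2" by (rule L2_uminus[OF f_fst_L2])
  have "((\<lambda>h. L2_norm G2 (?D h)) \<longlongrightarrow> 0) (at_right 0)"
  proof (rule tendstoI)
    fix e :: real assume e: "e > 0"
    have "\<forall>\<^sub>F t in at_right 0. L2_norm G2 (\<lambda>x. F f t x - f (fst x)) < e / 2"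
      using F_strongly_continuous[OF f_L2] e by (intro order_tendstoD(2)[where y=0]) auto
    then obtain \<delta> where \<delta>: "\<delta> > 0" "\<And>t. 0 < t \<Longrightarrow> t < \<delta> \<Longrightarrow> L2_norm G2 (\<lambda>x. F f t x - f (fst x)) < e / 2"
      by (auto simp: eventually_at_right_field)
    have "L2_norm G2 (?D h) < e" if h: "0 < h" "h < \<delta>" for h
    proof -
      have L: "?D h \<in> L2 G2" using h by (intro L2_diff DL fm) simp
      have "\<bar>L2_inner G2 (?D h) (?D h)\<bar> \<le> e / 2 * L2_norm G2 (?D h)"
        by (rule poisson_increment[OF h(1) L]) (use \<delta>(2) h in \<open>auto intro!: less_imp_le\<close>)
      then have "L2_norm G2 (?D h) * L2_norm G2 (?D h) \<le> e / 2 * L2_norm G2 (?D h)"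
        unfolding L2_inner_self by (simp add: power2_eq_square)
      then have "L2_norm G2 (?D h) \<le> e / 2"
        using L2_norm_nonneg[of G2 "?D h"] e by (cases "L2_norm G2 (?D h) = 0") (auto simp: mult_le_cancel_right)
      then show ?thesis using e by simp
    qed
    then show "\<forall>\<^sub>F h in at_right 0. dist (L2_norm G2 (?D h)) 0 < e"
      unfolding eventually_at_right_field dist_real_def using \<delta>(1)
      by (intro exI[of _ \<delta>]) (auto simp: L2_norm_nonneg)
  qed
  moreover have "\<forall>\<^sub>F h in at_right 0. (\<lambda>x. (P h ?u x - ?u x) / h) \<in> L2 G2"
    unfolding eventually_at_right_field by (intro exI[of _ 1]) (auto intro: DL)
  ultimately show ?thesis
    using fm poisson_L2 by (simp add: L2_generator_def L2_tendsto_def)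
qed

lemma poisson_mean: "(\<integral>x. poisson_solution f x \<partial>G2) = 0"
proof -
  interpret A: prob_space G2 by (rule prob_space_std_gaussian)
  have "(\<integral>x. poisson_solution f x \<partial>G2) = L2_inner G2 (poisson_solution f) (\<lambda>_. 1)"
    by (simp add: L2_inner_def)
  also have "\<dots> = (\<integral>t. indicator {0..} t * L2_inner G2 (F f t) (\<lambda>_. 1) \<partial>lborel)"
    by (rule poisson_inner[OF A.L2_const])
  also have "\<dots> = (\<integral>t. 0 \<partial>(lborel :: real measure))"
  proof (rule Bochner_Integration.integral_cong[OF refl])
    fix t :: real
    show "indicator {0..} t * L2_inner G2 (F f t) (\<lambda>_. 1) = 0"
      using F_L2(2)[of t, OF _ f_L2] f by (auto simp: L2_inner_def L2_zero_mean_def indicator_def)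
  qed
  finally show ?thesis by simp
qed

lemma corr_integrable:
  assumes k: "k \<in> L2 std_gaussian"
  shows "integrable lborel (\<lambda>t. indicator {0..} t * corr J (\<mu> * t) (osc_q \<gamma> t) f k)"
proof -
  have "(\<lambda>x. k (fst x)) \<in> L2 G2" by (rule L2_gaussian_compose[OF _ fst_distr k]) simp
  from poisson_integrable[OF this] show ?thesis
    by (rule back_subst[of "integrable lborel"]) (auto simp: indicator_def fun_eq_iff F_corr[OF _ f_L2 k])
qed

lemma corr_bound:
  assumes t: "0 \<le> t" and k: "k \<in> L2 std_gaussian"
  shows "\<bar>corr J (\<mu> * t) (osc_q \<gamma> t) f k\<bar> \<le>
    sqrt decay_const * exp (- (decay_rate \<gamma> / 2) * t) * L2_norm std_gaussian f * L2_norm std_gaussian k"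
proof -
  have kf: "(\<lambda>x. k (fst x)) \<in> L2 G2" "L2_norm G2 (\<lambda>x. k (fst x)) = L2_norm std_gaussian k"
    by (rule L2_gaussian_compose[OF _ fst_distr k] L2_norm_gaussian_compose[OF _ fst_distr k]; simp)+
  have "\<bar>corr J (\<mu> * t) (osc_q \<gamma> t) f k\<bar> \<le> L2_norm G2 (F f t) * L2_norm std_gaussian k"
    unfolding F_corr[OF t f_L2 k, symmetric] kf(2)[symmetric]
    by (rule L2_Cauchy_Schwarz[OF F_L2(1)[OF t f_L2] kf(1)])
  also have "L2_norm G2 (F f t) \<le> sqrt decay_const * exp (- (decay_rate \<gamma> / 2) * t) * L2_norm std_gaussian f"
  proof (rule power2_le_imp_le)
    have "(exp (- (decay_rate \<gamma> / 2) * t))\<^sup>2 = exp (- decay_rate \<gamma> * t)"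
      by (simp add: power2_eq_square exp_add[symmetric])
    then show "(L2_norm G2 (F f t))\<^sup>2 \<le> (sqrt decay_const * exp (- (decay_rate \<gamma> / 2) * t) * L2_norm std_gaussian f)\<^sup>2"
      using F_decay[OF t f] by (simp add: power_mult_distrib decay_const_nonneg mult.assoc mult.left_commute mult.commute)
  qed (simp add: decay_const_nonneg L2_norm_nonneg)
  finally show ?thesis by (simp add: mult_right_mono L2_norm_nonneg)
qed

text \<open>Two solutions differ by a centred element of the kernel of the generator, which vanishes
  almost everywhere; the described value is therefore unique although the solution, as a function,
  is not.\<close>

lemma asymptotic_variance_eq:
  "asymptotic_variance M X f = (\<integral>t. indicator {0..} t * corr J (\<mu> * t) (osc_q \<gamma> t) f f \<partial>lborel)"
proof -
  interpret A: prob_space G2 by (rule prob_space_std_gaussian)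
  let ?v = "L2_inner G2 (poisson_solution f) (\<lambda>x. f (fst x))"
  have "asymptotic_variance M X f = ?v"
    unfolding asymptotic_variance_def
  proof (rule the_equality)
    show "\<exists>u. (u, \<lambda>x. - f (fst x)) \<in> L2_generator G2 P \<and> (\<integral>x. u x \<partial>G2) = 0 \<and> ?v = L2_inner G2 u (\<lambda>x. f (fst x))"
      using poisson_generator poisson_mean by blast
    fix v assume "\<exists>u. (u, \<lambda>x. - f (fst x)) \<in> L2_generator G2 P \<and> (\<integral>x. u x \<partial>G2) = 0 \<and> v = L2_inner G2 u (\<lambda>x. f (fst x))"
    then obtain u where u: "(u, \<lambda>x. - f (fst x)) \<in> L2_generator G2 P" "(\<integral>x. u x \<partial>G2) = 0" "v = L2_inner G2 u (\<lambda>x. f (fst x))"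
      by blast
    let ?p = "poisson_solution f"
    let ?Q = "\<lambda>u t x. (P t u x - u x) / t"
    have uL: "u \<in> L2 G2" using u(1) by (simp add: L2_generator_def)
    have fm: "(\<lambda>x. - f (fst x)) \<in> L2 G2" by (rule L2_uminus[OF f_fst_L2])
    have lim: "((\<lambda>t. L2_norm G2 (\<lambda>x. ?Q u t x - (- f (fst x)))) \<longlongrightarrow> 0) (at_right 0)"
      "((\<lambda>t. L2_norm G2 (\<lambda>x. ?Q ?p t x - (- f (fst x)))) \<longlongrightarrow> 0) (at_right 0)"
      using u(1) poisson_generator by (simp_all add: L2_generator_def L2_tendsto_def)
    define w where "w = (\<lambda>x. u x - ?p x)"
    have wL: "w \<in> L2 G2" unfolding w_def by (rule L2_diff[OF uL poisson_L2])
    have "AE x in G2. w x = 0"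
    proof (rule generator_kernel_zero[OF wL])
      show "(\<integral>x. w x \<partial>G2) = 0"
        using u(2) poisson_mean A.L2_integrable[OF uL] A.L2_integrable[OF poisson_L2] by (simp add: w_def)
      have QL: "?Q a t \<in> L2 G2" if "a \<in> L2 G2" "0 \<le> t" for a t
        by (intro L2_divide L2_diff P_L2(1) that)
      have le: "L2_norm G2 (?Q w t) \<le> L2_norm G2 (\<lambda>x. ?Q u t x - (- f (fst x))) + L2_norm G2 (\<lambda>x. ?Q ?p t x - (- f (fst x)))"
        if t: "0 < t" for t
      proof -
        have t0: "0 \<le> t" using t by simp
        have "AE x in G2. ?Q w t x = ?Q u t x - ?Q ?p t x"
          using P_diff[OF t0 uL poisson_L2]
          by eventually_elim (simp add: w_def diff_divide_distrib)
        then have "L2_norm G2 (?Q w t) = L2_norm G2 (\<lambda>x. ?Q u t x - ?Q ?p t x)"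
          by (intro L2_norm_AE_cong L2_measurable QL L2_diff wL uL poisson_L2 t0)
        also have "\<dots> \<le> L2_norm G2 (\<lambda>x. ?Q u t x - (- f (fst x))) + L2_norm G2 (\<lambda>x. - f (fst x) - ?Q ?p t x)"
          by (intro L2_norm_triangle_diff QL uL poisson_L2 fm t0)
        finally show ?thesis unfolding L2_norm_minus_commute[of G2 "\<lambda>x. - f (fst x)"] .
      qed
      show "((\<lambda>t. L2_norm G2 (?Q w t)) \<longlongrightarrow> 0) (at_right 0)"
      proof (rule tendsto_sandwich[OF _ _ tendsto_const])
        show "\<forall>\<^sub>F t in at_right 0. L2_norm G2 (?Q w t) \<le> L2_norm G2 (\<lambda>x. ?Q u t x - (- f (fst x))) + L2_norm G2 (\<lambda>x. ?Q ?p t x - (- f (fst x)))"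
          unfolding eventually_at_right_field using le by (intro exI[of _ 1]) auto
        show "((\<lambda>t. L2_norm G2 (\<lambda>x. ?Q u t x - (- f (fst x))) + L2_norm G2 (\<lambda>x. ?Q ?p t x - (- f (fst x)))) \<longlongrightarrow> 0) (at_right 0)"
          using tendsto_add[OF lim] by simp
      qed (auto simp: L2_norm_nonneg)
    qed
    then have "L2_inner G2 u (\<lambda>x. f (fst x)) = ?v"
      by (intro L2_inner_AE_cong L2_measurable uL poisson_L2 f_fst_L2) (auto simp: w_def)
    with u(3) show "v = ?v" by simp
  qed
  also have "\<dots> = (\<integral>t. indicator {0..} t * L2_inner G2 (F f t) (\<lambda>x. f (fst x)) \<partial>lborel)"
    by (rule poisson_inner[OF f_fst_L2])
  also have "\<dots> = (\<integral>t. indicator {0..} t * corr J (\<mu> * t) (osc_q \<gamma> t) f f \<partial>lborel)"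
    by (rule Bochner_Integration.integral_cong[OF refl]) (auto simp: indicator_def F_corr[OF _ f_L2 f_L2])
  finally show ?thesis .
qed

text \<open>By contractivity of \<open>P t\<close> the difference quotient of the solution has a
  nonpositive inner product with the solution, and it tends to \<open>- f\<close>. A bound of the
  integrand would not do, since \<open>osc_q\<close> may be negative.\<close>

lemma corr_integral_nonneg: "0 \<le> (\<integral>t. indicator {0..} t * corr J (\<mu> * t) (osc_q \<gamma> t) f f \<partial>lborel)"
proof -
  let ?u = "poisson_solution f"
  let ?Q = "\<lambda>t x. (P t ?u x - ?u x) / t"
  have lim: "((\<lambda>t. L2_norm G2 (\<lambda>x. ?Q t x - (- f (fst x)))) \<longlongrightarrow> 0) (at_right 0)"
    using poisson_generator by (simp_all add: L2_generator_def L2_tendsto_def)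
  have fm: "(\<lambda>x. - f (fst x)) \<in> L2 G2" by (rule L2_uminus[OF f_fst_L2])
  have le: "- (L2_norm G2 (\<lambda>x. ?Q t x - (- f (fst x))) * L2_norm G2 ?u) \<le> L2_inner G2 ?u (\<lambda>x. f (fst x))" if t: "0 < t" for t
  proof -
    have t0: "0 \<le> t" using t by simp
    have PL: "P t ?u \<in> L2 G2" by (rule P_L2(1)[OF t0 poisson_L2])
    have QL: "?Q t \<in> L2 G2" by (intro L2_divide L2_diff PL poisson_L2)
    have "L2_inner G2 (P t ?u) ?u \<le> L2_norm G2 ?u * L2_norm G2 ?u"
      using L2_Cauchy_Schwarz[OF PL poisson_L2] mult_right_mono[OF P_L2(2)[OF t0 poisson_L2] L2_norm_nonneg[of G2 ?u]]
      by linarith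
    then have "L2_inner G2 (\<lambda>x. P t ?u x - ?u x) ?u \<le> 0"
      by (simp add: L2_inner_diff_left[OF PL poisson_L2 poisson_L2] L2_inner_self power2_eq_square)
    then have "L2_inner G2 (?Q t) ?u \<le> 0"
      using t L2_inner_scale_left[of G2 "1 / t" "\<lambda>x. P t ?u x - ?u x" ?u] by (simp add: divide_le_0_iff)
    moreover have "L2_inner G2 (\<lambda>x. ?Q t x - (- f (fst x))) ?u = L2_inner G2 (?Q t) ?u + L2_inner G2 ?u (\<lambda>x. f (fst x))"
      using L2_inner_scale_left[of G2 "-1" "\<lambda>x. f (fst x)" ?u]
      by (subst L2_inner_diff_left[OF QL fm poisson_L2]) (simp add: L2_inner_commute)
    moreover have "\<bar>L2_inner G2 (\<lambda>x. ?Q t x - (- f (fst x))) ?u\<bar> \<le> L2_norm G2 (\<lambda>x. ?Q t x - (- f (fst x))) * L2_norm G2 ?u"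
      by (rule L2_Cauchy_Schwarz[OF L2_diff[OF QL fm] poisson_L2])
    ultimately show ?thesis by linarith
  qed
  have "- (0 * L2_norm G2 ?u) \<le> L2_inner G2 ?u (\<lambda>x. f (fst x))"
  proof (rule tendsto_upperbound)
    show "((\<lambda>t. - (L2_norm G2 (\<lambda>x. ?Q t x - (- f (fst x))) * L2_norm G2 ?u)) \<longlongrightarrow> - (0 * L2_norm G2 ?u)) (at_right 0)"
      by (intro tendsto_intros lim)
    show "\<forall>\<^sub>F t in at_right 0. - (L2_norm G2 (\<lambda>x. ?Q t x - (- f (fst x))) * L2_norm G2 ?u) \<le> L2_inner G2 ?u (\<lambda>x. f (fst x))"
      unfolding eventually_at_right_field using le by (intro exI[of _ 1]) auto
  qed simp
  also have "L2_inner G2 ?u (\<lambda>x. f (fst x)) = (\<integral>t. indicator {0..} t * corr J (\<mu> * t) (osc_q \<gamma> t) f f \<partial>lborel)"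
    unfolding poisson_inner[OF f_fst_L2]
    by (rule Bochner_Integration.integral_cong[OF refl]) (auto simp: indicator_def F_corr[OF _ f_L2 f_L2])
  finally show ?thesis by simp
qed

end

end

section \<open>The kernel of the generator of the rotations\<close>

text \<open>The exceptional null set may depend on the angle, which is all that an L2 argument
  delivers.\<close>

definition rot_invariant :: "real ^ 'd ^ 'd \<Rightarrow> (real ^ 'd \<Rightarrow> real) set" where
  "rot_invariant J = {g \<in> L2_zero_mean std_gaussian. \<forall>s. AE x in std_gaussian. g (rot J s x) = g x}"

lemma rot_deriv_eq_sum:
  assumes \<phi>: "\<phi> \<in> Cc_infinity"
  shows "rot_deriv J \<phi> x = (\<Sum>b\<in>Basis. ((J *v x) \<bullet> b) * frechet_derivative \<phi> (at x) b)"
proof -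
  have l: "linear (frechet_derivative \<phi> (at x))"
    using Ck_has_derivative[OF Cc_infinity_Ck[OF \<phi>]] by (rule has_derivative_linear)
  have "frechet_derivative \<phi> (at x) (\<Sum>b\<in>Basis. ((J *v x) \<bullet> b) *\<^sub>R b) =
      (\<Sum>b\<in>Basis. ((J *v x) \<bullet> b) * frechet_derivative \<phi> (at x) b)"
    by (simp add: linear_sum[OF l] linear_cmul[OF l])
  then show ?thesis by (simp add: rot_deriv_def euclidean_representation)
qed

lemma rot_deriv_continuous:
  assumes \<phi>: "\<phi> \<in> Cc_infinity"
  shows "continuous_on UNIV (rot_deriv J \<phi>)"
proof -
  have "continuous_on UNIV (\<lambda>x. frechet_derivative \<phi> (at x) b)" if "b \<in> Basis" for b
    using Cc_infinity_Ck[OF \<phi>, of "Suc 0"] that by simp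
  then have "continuous_on UNIV (\<lambda>x. \<Sum>b\<in>Basis. ((J *v x) \<bullet> b) * frechet_derivative \<phi> (at x) b)"
    by (intro continuous_intros bounded_linear.continuous_on[OF matrix_vector_mul_bounded_linear])
  then show ?thesis by (simp add: rot_deriv_eq_sum[OF \<phi>])
qed

lemma rot_deriv_bounded:
  assumes \<phi>: "\<phi> \<in> Cc_infinity"
  obtains B where "B \<ge> 0" "\<And>x. \<bar>rot_deriv J \<phi> x\<bar> \<le> B"
proof -
  obtain r where r: "r \<ge> 0" "\<And>x. r \<le> norm x \<Longrightarrow> \<phi> x = 0" using Cc_infinity_support[OF \<phi>] by blast
  have "rot_deriv J \<phi> x = 0" if x: "r + 1 \<le> norm x" for x
  proof -
    have "open {y::real ^ 'a. r < norm y}" by (intro open_Collect_less continuous_intros)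
    then have "(\<phi> has_derivative (\<lambda>_. 0)) (at x)"
      by (rule has_derivative_transform_within_open[OF has_derivative_const]) (use x r in auto)
    then have "frechet_derivative \<phi> (at x) = (\<lambda>_. 0)" using frechet_derivative_at by metis
    then show ?thesis by (simp add: rot_deriv_def)
  qed
  from compact_support_bounded[OF rot_deriv_continuous[OF \<phi>] this] that show thesis by blast
qed

lemma rot_deriv_measurable: "\<phi> \<in> Cc_infinity \<Longrightarrow> rot_deriv J \<phi> \<in> borel_measurable borel"
  by (intro borel_measurable_continuous_onI rot_deriv_continuous)

lemma rot_deriv_L2:
  assumes \<phi>: "\<phi> \<in> Cc_infinity" shows "rot_deriv J \<phi> \<in> L2 std_gaussian"
proof -
  obtain B where "\<And>x. \<bar>rot_deriv J \<phi> x\<bar> \<le> B" using rot_deriv_bounded[OF \<phi>] by blast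
  then show ?thesis
    using rot_deriv_measurable[OF \<phi>, of J] by (intro prob_space.L2_bounded[OF prob_space_std_gaussian]) simp_all
qed

lemma rot_path_derivative:
  assumes \<phi>: "\<phi> \<in> Cc_infinity"
  shows "((\<lambda>s. \<phi> (rot J s x)) has_real_derivative rot_deriv J \<phi> (rot J s x)) (at s)"
proof -
  have l: "linear (frechet_derivative \<phi> (at (rot J s x)))"
    using Ck_has_derivative[OF Cc_infinity_Ck[OF \<phi>]] by (rule has_derivative_linear)
  from has_derivative_compose[OF rot_derivative[unfolded has_vector_derivative_def] Ck_has_derivative[OF Cc_infinity_Ck[OF \<phi>]]]
  have "((\<lambda>s. \<phi> (rot J s x)) has_derivative (\<lambda>h. frechet_derivative \<phi> (at (rot J s x)) (h *\<^sub>R (J *v rot J s x)))) (at s)" .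
  then show ?thesis
    by (simp add: has_field_derivative_def rot_deriv_def linear_cmul[OF l] mult_commute_abs)
qed

text \<open>The mean value theorem bounds the quotients by the supremum of
  \<open>rot_deriv J \<phi>\<close>, so their pointwise convergence is dominated.\<close>

lemma rot_difference_quotient:
  assumes \<phi>: "\<phi> \<in> Cc_infinity" and \<delta>: "\<And>n. 0 < \<delta> n" "\<delta> \<longlonglongrightarrow> 0"
  shows "(\<lambda>n. L2_norm std_gaussian (\<lambda>x. (\<phi> (rot J (\<delta> n) x) - \<phi> x) / \<delta> n - rot_deriv J \<phi> x)) \<longlonglongrightarrow> 0"
proof -
  interpret G: prob_space "std_gaussian :: (real ^ 'a) measure" by (rule prob_space_std_gaussian)
  obtain B where B: "B \<ge> 0" "\<And>x. \<bar>rot_deriv J \<phi> x\<bar> \<le> B" using rot_deriv_bounded[OF \<phi>] by blast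
  note [measurable] = Cc_infinity_measurable[OF \<phi>] rot_deriv_measurable[OF \<phi>]
  let ?D = "\<lambda>n x. (\<phi> (rot J (\<delta> n) x) - \<phi> x) / \<delta> n - rot_deriv J \<phi> x"
  have "(\<lambda>n. \<integral>x. (?D n x)\<^sup>2 \<partial>std_gaussian) \<longlonglongrightarrow> (\<integral>x. 0 \<partial>(std_gaussian :: (real ^ 'a) measure))"
  proof (rule integral_dominated_convergence[where w="\<lambda>_. (2 * B)\<^sup>2"])
    show "AE x in std_gaussian. (\<lambda>n. (?D n x)\<^sup>2) \<longlonglongrightarrow> 0"
    proof (rule AE_I2)
      fix x :: "real ^ 'a"
      have "((\<lambda>h. (\<phi> (rot J (0 + h) x) - \<phi> (rot J 0 x)) / h) \<longlongrightarrow> rot_deriv J \<phi> (rot J 0 x)) (at 0)"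
        using rot_path_derivative[OF \<phi>, of J x 0] unfolding DERIV_def .
      moreover have "filterlim \<delta> (at 0) sequentially"
        unfolding filterlim_at using \<delta> by (auto intro!: eventuallyI simp: less_imp_neq[symmetric])
      ultimately have "(\<lambda>n. (\<phi> (rot J (0 + \<delta> n) x) - \<phi> (rot J 0 x)) / \<delta> n) \<longlonglongrightarrow> rot_deriv J \<phi> (rot J 0 x)"
        by (rule filterlim_compose)
      then have "(\<lambda>n. (?D n x)\<^sup>2) \<longlonglongrightarrow> (rot_deriv J \<phi> x - rot_deriv J \<phi> x)\<^sup>2"
        by (intro tendsto_intros) simp
      then show "(\<lambda>n. (?D n x)\<^sup>2) \<longlonglongrightarrow> 0" by simp
    qed
    fix n
    have "\<bar>?D n x\<bar> \<le> 2 * B" for x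
    proof -
      obtain z where "\<phi> (rot J (\<delta> n) x) - \<phi> (rot J 0 x) = (\<delta> n - 0) * rot_deriv J \<phi> (rot J z x)"
        using MVT2[OF \<delta>(1)[of n], of "\<lambda>s. \<phi> (rot J s x)" "\<lambda>s. rot_deriv J \<phi> (rot J s x)"] rot_path_derivative[OF \<phi>]
        by blast
      then have "(\<phi> (rot J (\<delta> n) x) - \<phi> x) / \<delta> n = rot_deriv J \<phi> (rot J z x)"
        using \<delta>(1)[of n] by (simp add: field_simps)
      then show ?thesis using B(2)[of "rot J z x"] B(2)[of x] by linarith
    qed
    then have "(?D n x)\<^sup>2 \<le> (2 * B)\<^sup>2" for x
      using power_mono[OF _ abs_ge_zero, of "?D n x" "2 * B" 2] by (simp only: power2_abs)
    then show "AE x in std_gaussian. norm ((?D n x)\<^sup>2) \<le> (2 * B)\<^sup>2" by simp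
  qed simp_all
  then have "(\<lambda>n. sqrt (\<integral>x. (?D n x)\<^sup>2 \<partial>std_gaussian)) \<longlonglongrightarrow> sqrt 0"
    by (intro tendsto_real_sqrt) simp
  then show ?thesis by (simp add: L2_norm_def L2_inner_def power2_eq_square)
qed

context
  fixes J :: "real ^ 'd ^ 'd"
  assumes J: "transpose J = - J"
begin

lemma
  assumes "f \<in> L2 std_gaussian"
  shows rot_compose_L2: "(\<lambda>x. f (rot J s x)) \<in> L2 std_gaussian"
    and rot_compose_norm: "L2_norm std_gaussian (\<lambda>x. f (rot J s x)) = L2_norm std_gaussian f"
  by (rule L2_gaussian_compose[OF _ rot_distr[OF J] assms] L2_norm_gaussian_compose[OF _ rot_distr[OF J] assms];
      simp add: borel_measurable_linear_euclidean rot_linear)+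

lemma rot_compose_inner:
  assumes "f \<in> L2 std_gaussian" "g \<in> L2 std_gaussian"
  shows "L2_inner std_gaussian (\<lambda>x. f (rot J s x)) (\<lambda>x. g (rot J s x)) = L2_inner std_gaussian f g"
  by (rule L2_inner_gaussian_compose[OF _ rot_distr[OF J] assms]) (simp add: borel_measurable_linear_euclidean rot_linear)

lemma rot_compose_zero_mean:
  assumes "f \<in> L2_zero_mean std_gaussian"
  shows "(\<lambda>x. f (rot J s x)) \<in> L2_zero_mean std_gaussian"
  by (rule L2_zero_mean_gaussian_compose[OF _ rot_distr[OF J] assms]) (simp add: borel_measurable_linear_euclidean rot_linear)

lemma rot_compose_AE:
  assumes "AE x in std_gaussian. Q x" shows "AE x in std_gaussian. Q (rot J s x)"
  by (rule AE_gaussian_compose[OF _ rot_distr[OF J] assms]) (simp add: borel_measurable_linear_euclidean rot_linear)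

text \<open>Angles of one sign suffice by the group law. The sign is a parameter because the kernel
  of the closure yields invariance for positive angles and the ergodic decomposition for negative
  ones.\<close>

lemma rot_invariantI:
  assumes g: "g \<in> L2_zero_mean std_gaussian"
    and inv: "\<And>s. s > 0 \<Longrightarrow> AE x in std_gaussian. g (rot J (\<sigma> * s) x) = g x" and \<sigma>: "\<sigma> = 1 \<or> \<sigma> = - 1"
  shows "g \<in> rot_invariant J"
proof -
  have "AE x in std_gaussian. g (rot J s x) = g x" for s
  proof -
    consider "s = 0" | "\<sigma> * s > 0" | "\<sigma> * (- s) > 0" using \<sigma> by fastforce
    then show ?thesis
    proof cases
      case 2
      then show ?thesis using inv[OF 2] \<sigma> by auto
    next
      case 3
      from rot_compose_AE[OF inv[OF 3], of s] \<sigma> show ?thesis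
        by (auto simp: rot_add[OF J] elim: eventually_mono)
    qed simp
  qed
  with g show ?thesis by (simp add: rot_invariant_def)
qed

text \<open>A mean value inequality in L2: rotations preserve the norm, so the increment over
  \<open>s\<close> is bounded by \<open>Suc n\<close> times the increment over
  \<open>\<delta> n\<close>, and the difference quotients converge to the derivative.\<close>

lemma rot_compose_norm_diff_le:
  assumes \<phi>: "\<phi> \<in> Cc_infinity" and s: "s > 0"
  shows "L2_norm std_gaussian (\<lambda>x. \<phi> (rot J s x) - \<phi> x) \<le> s * L2_norm std_gaussian (rot_deriv J \<phi>)"
proof -
  have \<phi>L: "\<phi> \<in> L2 std_gaussian" by (rule Cc_infinity_L2[OF \<phi>])
  note RL = rot_compose_L2[OF \<phi>L]
  have step: "L2_norm std_gaussian (\<lambda>x. \<phi> (rot J (real n * h) x) - \<phi> x) \<le> real n * L2_norm std_gaussian (\<lambda>x. \<phi> (rot J h x) - \<phi> x)" for n h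
  proof (induction n)
    case 0 then show ?case by (simp add: L2_norm_def L2_inner_def)
  next
    case (Suc n)
    have "L2_norm std_gaussian (\<lambda>x. \<phi> (rot J (real (Suc n) * h) x) - \<phi> x) \<le>
       L2_norm std_gaussian (\<lambda>x. \<phi> (rot J (real (Suc n) * h) x) - \<phi> (rot J (real n * h) x)) +
       L2_norm std_gaussian (\<lambda>x. \<phi> (rot J (real n * h) x) - \<phi> x)"
      by (rule L2_norm_triangle_diff[OF RL RL \<phi>L])
    also have "L2_norm std_gaussian (\<lambda>x. \<phi> (rot J (real (Suc n) * h) x) - \<phi> (rot J (real n * h) x)) =
       L2_norm std_gaussian (\<lambda>x. \<phi> (rot J h x) - \<phi> x)"
      using rot_compose_norm[OF L2_diff[OF RL[of h] \<phi>L], of "real n * h"]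
      by (simp add: rot_add[OF J] distrib_right)
    finally show ?case using Suc by (simp add: algebra_simps)
  qed
  define \<delta> where "\<delta> n = s / real (Suc n)" for n
  have \<delta>: "\<delta> n > 0" "real (Suc n) * \<delta> n = s" for n using s by (simp_all add: \<delta>_def del: of_nat_Suc)
  have "(\<lambda>n. s * (1 / real (Suc n))) \<longlonglongrightarrow> s * 0"
    by (intro tendsto_intros lim_1_over_n[THEN LIMSEQ_Suc])
  then have \<delta>0: "\<delta> \<longlonglongrightarrow> 0" by (simp add: \<delta>_def[abs_def])
  let ?e = "\<lambda>n. L2_norm std_gaussian (\<lambda>x. (\<phi> (rot J (\<delta> n) x) - \<phi> x) / \<delta> n - rot_deriv J \<phi> x)"
  have le: "L2_norm std_gaussian (\<lambda>x. \<phi> (rot J s x) - \<phi> x) \<le> s * (?e n + L2_norm std_gaussian (rot_deriv J \<phi>))" for n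
  proof -
    have QL: "(\<lambda>x. (\<phi> (rot J (\<delta> n) x) - \<phi> x) / \<delta> n) \<in> L2 std_gaussian"
      by (intro L2_divide L2_diff RL \<phi>L)
    have "L2_norm std_gaussian (\<lambda>x. \<phi> (rot J s x) - \<phi> x) \<le> real (Suc n) * L2_norm std_gaussian (\<lambda>x. \<phi> (rot J (\<delta> n) x) - \<phi> x)"
      using step[of "Suc n" "\<delta> n"] unfolding \<delta>(2) .
    also have "\<dots> = s * L2_norm std_gaussian (\<lambda>x. (\<phi> (rot J (\<delta> n) x) - \<phi> x) / \<delta> n)"
      unfolding L2_norm_divide using \<delta>[of n] by (simp add: field_simps del: of_nat_Suc)
    also have "L2_norm std_gaussian (\<lambda>x. (\<phi> (rot J (\<delta> n) x) - \<phi> x) / \<delta> n) \<le> ?e n + L2_norm std_gaussian (rot_deriv J \<phi>)"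
      using L2_norm_triangle_diff[OF QL rot_deriv_L2[OF \<phi>] L2_zero, of J] by simp
    finally show ?thesis using s by simp
  qed
  have "(\<lambda>n. s * (?e n + L2_norm std_gaussian (rot_deriv J \<phi>))) \<longlonglongrightarrow> s * (0 + L2_norm std_gaussian (rot_deriv J \<phi>))"
    by (intro tendsto_intros rot_difference_quotient[OF \<phi> \<delta>(1) \<delta>0])
  from LIMSEQ_le_const[OF this] le show ?thesis by auto
qed

text \<open>The inequality of \<open>rot_compose_norm_diff_le\<close> passes to the limit along a
  sequence whose derivatives tend to 0.\<close>

lemma rot_kernel_subset: "rot_kernel J \<subseteq> rot_invariant J"
proof
  fix g assume "g \<in> rot_kernel J"
  then obtain \<phi> :: "nat \<Rightarrow> real ^ 'd \<Rightarrow> real" where g: "g \<in> L2_zero_mean std_gaussian"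
    and \<phi>: "\<And>n. \<phi> n \<in> Cc_infinity" and l1: "L2_tendsto std_gaussian \<phi> g sequentially"
    and l2: "L2_tendsto std_gaussian (\<lambda>n. rot_deriv J (\<phi> n)) (\<lambda>_. 0) sequentially"
    by (auto simp: rot_kernel_def rot_closure_def)
  have gL: "g \<in> L2 std_gaussian" using g by (rule L2_zero_mean_L2)
  have "AE x in std_gaussian. g (rot J (1 * s) x) = g x" if s: "s > 0" for s
  proof -
    let ?a = "\<lambda>n. L2_norm std_gaussian (\<lambda>x. \<phi> n x - g x)" and ?b = "\<lambda>n. L2_norm std_gaussian (rot_deriv J (\<phi> n))"
    have "L2_norm std_gaussian (\<lambda>x. g (rot J s x) - g x) \<le> ?a n + s * ?b n + ?a n" for n
    proof -
      have \<phi>L: "\<phi> n \<in> L2 std_gaussian" by (rule Cc_infinity_L2[OF \<phi>])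
      note L = rot_compose_L2[OF gL, of s] rot_compose_L2[OF \<phi>L, of s] \<phi>L gL
      have "L2_norm std_gaussian (\<lambda>x. g (rot J s x) - g x) \<le>
         L2_norm std_gaussian (\<lambda>x. g (rot J s x) - \<phi> n (rot J s x)) +
         (L2_norm std_gaussian (\<lambda>x. \<phi> n (rot J s x) - \<phi> n x) + ?a n)"
        using L2_norm_triangle_diff[OF L(1,2,4)] L2_norm_triangle_diff[OF L(2,3,4)] by linarith
      also have "L2_norm std_gaussian (\<lambda>x. g (rot J s x) - \<phi> n (rot J s x)) = ?a n"
        using rot_compose_norm[OF L2_diff[OF gL \<phi>L], of s] by (simp add: L2_norm_minus_commute[of _ g])
      also have "L2_norm std_gaussian (\<lambda>x. \<phi> n (rot J s x) - \<phi> n x) \<le> s * ?b n"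
        by (rule rot_compose_norm_diff_le[OF \<phi> s])
      finally show ?thesis by simp
    qed
    moreover have "(\<lambda>n. ?a n + s * ?b n + ?a n) \<longlonglongrightarrow> 0 + s * 0 + 0"
      using l1 l2 by (intro tendsto_intros) (simp_all add: L2_tendsto_def)
    ultimately have "L2_norm std_gaussian (\<lambda>x. g (rot J s x) - g x) \<le> 0 + s * 0 + 0"
      by (intro LIMSEQ_le_const[of _ _ "L2_norm std_gaussian (\<lambda>x. g (rot J s x) - g x)"]) auto
    then have "L2_norm std_gaussian (\<lambda>x. g (rot J s x) - g x) = 0"
      using L2_norm_nonneg[of std_gaussian "\<lambda>x. g (rot J s x) - g x"] by simp
    from L2_norm_0_AE[OF L2_diff[OF rot_compose_L2[OF gL] gL] this] show ?thesis by simp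
  qed
  then show "g \<in> rot_invariant J" by (rule rot_invariantI[OF g]) simp_all
qed

text \<open>Averaging a test function over a long orbit, by a Riemann sum of small mesh \<open>\<delta>\<close> and \<open>m \<delta> = T\<close>, makes
  \<open>Jq \<sqdot> \<nabla>\<close> of it small, because the sum of difference quotients telescopes to \<open>O(1 / T)\<close>.\<close>

lemma rot_average:
  assumes \<phi>: "\<phi> \<in> Cc_infinity" "\<phi> \<in> L2_zero_mean std_gaussian" and g: "g \<in> rot_invariant J" and e: "e > 0"
  obtains \<psi> where "\<psi> \<in> Cc_infinity" "\<psi> \<in> L2_zero_mean std_gaussian"
    "L2_norm std_gaussian (\<lambda>x. \<psi> x - g x) \<le> L2_norm std_gaussian (\<lambda>x. \<phi> x - g x)"
    "L2_norm std_gaussian (rot_deriv J \<psi>) < e"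
proof -
  let ?N = "L2_norm (std_gaussian :: (real ^ 'd) measure)"
  have \<phi>L: "\<phi> \<in> L2 std_gaussian" by (rule Cc_infinity_L2[OF \<phi>(1)])
  have DL: "rot_deriv J \<phi> \<in> L2 std_gaussian" by (rule rot_deriv_L2[OF \<phi>(1)])
  have gL: "g \<in> L2 std_gaussian" using g by (auto simp: rot_invariant_def intro: L2_zero_mean_L2)
  \<comment> \<open>The telescoped sum has norm at most \<open>2 * ?N \<phi> / T\<close>, which this
    choice keeps below \<open>e / 2\<close>; the summand 1 makes \<open>T\<close> positive.\<close>
  define T where "T = 4 * (?N \<phi> + 1) / e"
  have T: "T > 0" using e L2_norm_nonneg[of std_gaussian \<phi>] by (simp add: T_def add_nonneg_pos)
  define d where "d n = T / real (Suc n)" for n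
  have d: "d n > 0" "real (Suc n) * d n = T" for n using T by (simp_all add: d_def del: of_nat_Suc)
  have "(\<lambda>n. T * (1 / real (Suc n))) \<longlonglongrightarrow> T * 0"
    by (intro tendsto_intros lim_1_over_n[THEN LIMSEQ_Suc])
  then have "d \<longlonglongrightarrow> 0" by (simp add: d_def[abs_def])
  from rot_difference_quotient[OF \<phi>(1) d(1) this, of J]
  have "\<forall>\<^sub>F n in sequentially. ?N (\<lambda>x. (\<phi> (rot J (d n) x) - \<phi> x) / d n - rot_deriv J \<phi> x) < e / 2"
    using e by (intro order_tendstoD(2)[where y=0]) auto
  then obtain n where n: "?N (\<lambda>x. (\<phi> (rot J (d n) x) - \<phi> x) / d n - rot_deriv J \<phi> x) < e / 2"
    by (auto dest: eventually_happens)
  define m where "m = Suc n"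
  define \<delta> where "\<delta> = d n"
  have m: "real m > 0" "real m * \<delta> = T" "\<delta> > 0" using d by (simp_all add: m_def \<delta>_def del: of_nat_Suc)
  define \<psi> where "\<psi> x = (1 / real m) * (\<Sum>j<m. \<phi> (rot J (real j * \<delta>) x))" for x
  obtain r where r: "r \<ge> 0" "\<And>x. r \<le> norm x \<Longrightarrow> \<phi> x = 0" using Cc_infinity_support[OF \<phi>(1)] by blast
  have \<phi>R: "(\<lambda>x. \<phi> (rot J s x)) \<in> Cc_infinity" for s
    using Ck_compose_linear[OF rot_linear Cc_infinity_Ck[OF \<phi>(1)]] r
    by - (rule Cc_infinityI[where r=r], simp_all add: rot_norm[OF J])
  have 1: "\<psi> \<in> Cc_infinity" unfolding \<psi>_def by (intro Cc_infinity_scale Cc_infinity_sum \<phi>R)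
  have avg: "?N (\<lambda>x. (1 / real m) * (\<Sum>j<m. h (rot J (real j * \<delta>) x))) \<le> ?N h" if h: "h \<in> L2 std_gaussian" for h
  proof -
    have "?N (\<lambda>x. (1 / real m) * (\<Sum>j<m. h (rot J (real j * \<delta>) x))) = (1 / real m) * ?N (\<lambda>x. \<Sum>j<m. h (rot J (real j * \<delta>) x))"
      using m by (subst L2_norm_scale) simp
    also have "\<dots> \<le> (1 / real m) * (\<Sum>j<m. ?N (\<lambda>x. h (rot J (real j * \<delta>) x)))"
      using m by (intro mult_left_mono L2_norm_triangle_sum rot_compose_L2 h) auto
    also have "\<dots> = ?N h" using m by (simp add: rot_compose_norm[OF h])
    finally show ?thesis .
  qed
  have 2: "\<psi> \<in> L2_zero_mean std_gaussian"
  proof -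
    have "(\<lambda>x. \<Sum>j\<in>A. \<phi> (rot J (real j * \<delta>) x)) \<in> L2_zero_mean std_gaussian" if "finite A" for A :: "nat set"
      using that
    proof induction
      case (insert j A)
      then show ?case
        by (simp add: L2_zero_mean_add[OF prob_space_std_gaussian] rot_compose_zero_mean[OF \<phi>(2)])
    qed (simp add: L2_zero_mean_def L2_zero)
    then show ?thesis unfolding \<psi>_def by (intro L2_zero_mean_scale) simp
  qed
  have 3: "?N (\<lambda>x. \<psi> x - g x) \<le> ?N (\<lambda>x. \<phi> x - g x)"
  proof -
    have "AE x in std_gaussian. \<forall>j\<in>{..<m}. g (rot J (real j * \<delta>) x) = g x"
      using g by (intro AE_finite_allI) (auto simp: rot_invariant_def)
    then have "AE x in std_gaussian. \<psi> x - g x = (1 / real m) * (\<Sum>j<m. \<phi> (rot J (real j * \<delta>) x) - g (rot J (real j * \<delta>) x))"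
    proof eventually_elim
      case (elim x)
      then have "(\<Sum>j<m. \<phi> (rot J (real j * \<delta>) x) - g (rot J (real j * \<delta>) x)) = (\<Sum>j<m. \<phi> (rot J (real j * \<delta>) x)) - real m * g x"
        by (simp add: sum_subtractf)
      then show ?case using m by (simp add: \<psi>_def field_simps)
    qed
    then have "?N (\<lambda>x. \<psi> x - g x) = ?N (\<lambda>x. (1 / real m) * (\<Sum>j<m. \<phi> (rot J (real j * \<delta>) x) - g (rot J (real j * \<delta>) x)))"
      by (intro L2_norm_AE_cong L2_measurable L2_diff L2_scale L2_sum rot_compose_L2 \<phi>L gL Cc_infinity_L2[OF 1])
    also have "\<dots> \<le> ?N (\<lambda>x. \<phi> x - g x)" using avg[OF L2_diff[OF \<phi>L gL]] .
    finally show ?thesis .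
  qed
  \<comment> \<open>\<open>rot J s\<close> commutes with \<open>J\<close>, so the rotational
    derivative of an orbit average is the orbit average of the derivative.\<close>
  have deriv: "rot_deriv J \<psi> x = (1 / real m) * (\<Sum>j<m. rot_deriv J \<phi> (rot J (real j * \<delta>) x))" for x
  proof -
    have hR: "(rot J s has_derivative rot J s) (at x)" for s
      using rot_linear[of J s] by (simp add: bounded_linear_imp_has_derivative linear_conv_bounded_linear)
    have h: "((\<lambda>x. \<phi> (rot J s x)) has_derivative (\<lambda>h. frechet_derivative \<phi> (at (rot J s x)) (rot J s h))) (at x)" for s
      by (rule has_derivative_compose[OF hR Ck_has_derivative[OF Cc_infinity_Ck[OF \<phi>(1)]]])
    have "(\<psi> has_derivative (\<lambda>h. (1 / real m) * (\<Sum>j<m. frechet_derivative \<phi> (at (rot J (real j * \<delta>) x)) (rot J (real j * \<delta>) h)))) (at x)"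
      unfolding \<psi>_def[abs_def] by (intro has_derivative_mult_right has_derivative_sum h)
    from frechet_derivative_at[OF this, THEN fun_cong, of "J *v x"]
    show ?thesis by (simp add: rot_deriv_def rot_commute)
  qed
  have 4: "?N (rot_deriv J \<psi>) < e"
  proof -
    let ?q = "\<lambda>x. (\<phi> (rot J \<delta> x) - \<phi> x) / \<delta>"
    have qL: "?q \<in> L2 std_gaussian" by (intro L2_divide L2_diff rot_compose_L2 \<phi>L)
    let ?S = "\<lambda>h x. (1 / real m) * (\<Sum>j<m. h (rot J (real j * \<delta>) x))"
    have SL: "?S h \<in> L2 std_gaussian" if "h \<in> L2 std_gaussian" for h
      by (intro L2_scale L2_sum rot_compose_L2 that)
    have tel: "?S ?q x = (\<phi> (rot J T x) - \<phi> x) / T" for x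
    proof -
      have "(\<Sum>j<k. ?q (rot J (real j * \<delta>) x)) = (\<phi> (rot J (real k * \<delta>) x) - \<phi> x) / \<delta>" for k
        by (induction k) (simp_all add: rot_add[OF J] distrib_right add_divide_distrib diff_divide_distrib add.commute)
      then have "?S ?q x = (\<phi> (rot J (real m * \<delta>) x) - \<phi> x) / (real m * \<delta>)" by simp
      then show ?thesis unfolding m(2) .
    qed
    have "?N (rot_deriv J \<psi>) = ?N (?S (rot_deriv J \<phi>))" by (simp add: deriv[abs_def])
    also have "\<dots> \<le> ?N (\<lambda>x. ?S (rot_deriv J \<phi>) x - ?S ?q x) + ?N (?S ?q)"
      using L2_norm_triangle_diff[OF SL[OF DL] SL[OF qL] L2_zero] by simp
    also have "?N (\<lambda>x. ?S (rot_deriv J \<phi>) x - ?S ?q x) = ?N (?S (\<lambda>x. rot_deriv J \<phi> x - ?q x))"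
      by (simp only: sum_subtractf right_diff_distrib)
    also have "\<dots> \<le> ?N (\<lambda>x. rot_deriv J \<phi> x - ?q x)" by (rule avg[OF L2_diff[OF DL qL]])
    also have "\<dots> < e / 2" using n by (simp only: L2_norm_minus_commute[of _ "rot_deriv J \<phi>"] \<delta>_def)
    also have "?N (?S ?q) = ?N (\<lambda>x. \<phi> (rot J T x) - \<phi> x) / T"
      using T unfolding tel by (simp add: L2_norm_divide)
    also have "?N (\<lambda>x. \<phi> (rot J T x) - \<phi> x) \<le> ?N \<phi> + ?N \<phi>"
      using L2_norm_triangle[OF rot_compose_L2[OF \<phi>L] L2_uminus[OF \<phi>L], of T] L2_norm_scale[of std_gaussian "-1" \<phi>]
      by (simp add: rot_compose_norm[OF \<phi>L])
    also have "(?N \<phi> + ?N \<phi>) / T \<le> e / 2"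
      using e L2_norm_nonneg[of std_gaussian \<phi>] by (simp add: T_def field_simps)
    finally show ?thesis using T by (simp add: divide_right_mono)
  qed
  from 1 2 3 4 show thesis by (rule that)
qed

text \<open>Conversely, an invariant function is approximated by test functions, and their orbit
  averages are no further from it and have small derivatives; the tolerances
  \<open>1 / Suc n\<close> give the sequence that the closure asks for.\<close>

lemma rot_kernel_eq: "rot_kernel J = rot_invariant J"
proof (rule equalityI[OF rot_kernel_subset], rule subsetI)
  fix g assume g: "g \<in> rot_invariant J"
  then have g0: "g \<in> L2_zero_mean std_gaussian" by (simp add: rot_invariant_def)
  have "\<exists>\<psi>. \<psi> \<in> Cc_infinity \<and> \<psi> \<in> L2_zero_mean std_gaussian \<and>
     L2_norm std_gaussian (\<lambda>x. \<psi> x - g x) < 1 / Suc n \<and> L2_norm std_gaussian (rot_deriv J \<psi>) < 1 / Suc n" for n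
  proof -
    have pos: "1 / real (Suc n) > 0" by simp
    obtain \<phi> where \<phi>: "\<phi> \<in> Cc_infinity" "\<phi> \<in> L2_zero_mean std_gaussian" "L2_norm std_gaussian (\<lambda>x. g x - \<phi> x) < 1 / Suc n"
      using test_functions_dense[OF g0 pos] by blast
    obtain \<psi> where "\<psi> \<in> Cc_infinity" "\<psi> \<in> L2_zero_mean std_gaussian"
      "L2_norm std_gaussian (\<lambda>x. \<psi> x - g x) \<le> L2_norm std_gaussian (\<lambda>x. \<phi> x - g x)"
      "L2_norm std_gaussian (rot_deriv J \<psi>) < 1 / Suc n"
      using rot_average[OF \<phi>(1,2) g pos] by blast
    then show ?thesis using \<phi>(3) unfolding L2_norm_minus_commute[of _ g] by force
  qed
  then obtain \<psi> where \<psi>: "\<And>n. \<psi> n \<in> Cc_infinity" "\<And>n. \<psi> n \<in> L2_zero_mean std_gaussian"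
     "\<And>n. L2_norm std_gaussian (\<lambda>x. \<psi> n x - g x) < 1 / Suc n" "\<And>n. L2_norm std_gaussian (rot_deriv J (\<psi> n)) < 1 / Suc n"
    by metis
  have lim0: "a \<longlonglongrightarrow> 0" if "\<And>n. 0 \<le> a n" "\<And>n. a n < 1 / Suc n" for a :: "nat \<Rightarrow> real"
    by (rule tendsto_sandwich[OF _ _ tendsto_const lim_1_over_n[THEN LIMSEQ_Suc]])
       (auto simp: that less_imp_le[OF that(2)] simp del: of_nat_Suc intro!: eventuallyI)
  have "L2_tendsto std_gaussian \<psi> g sequentially"
    unfolding L2_tendsto_def using lim0[OF L2_norm_nonneg \<psi>(3)] g0 \<psi>(2)
    by (auto intro: L2_zero_mean_L2 intro!: always_eventually)
  moreover have "L2_tendsto std_gaussian (\<lambda>n. rot_deriv J (\<psi> n)) (\<lambda>_. 0) sequentially"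
    unfolding L2_tendsto_def using lim0[OF L2_norm_nonneg \<psi>(4)] rot_deriv_L2[OF \<psi>(1)] by (auto intro: L2_zero)
  ultimately show "g \<in> rot_kernel J"
    unfolding rot_kernel_def rot_closure_def using g0 \<psi>(1,2) by (auto simp: L2_zero_mean_def L2_zero)
qed

end

section \<open>The limit of strong rotation\<close>

text \<open>Continuity in the correlation is strong, for each fixed \<open>k\<close>: the difference
  is a partial integral of \<open>k\<close> along two Gaussian mixtures that approach each other
  pointwise.\<close>

lemma mehler_continuous:
  fixes k :: "'a::euclidean_space \<Rightarrow> real"
  assumes k: "k \<in> L2 std_gaussian" and c: "\<And>n. \<bar>c n\<bar> \<le> 1" "\<bar>c'\<bar> \<le> 1" and lim: "c \<longlonglongrightarrow> c'"
  shows "(\<lambda>n. L2_norm std_gaussian (\<lambda>x. mehler (c n) k x - mehler c' k x)) \<longlonglongrightarrow> 0"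
proof -
  let ?Z = "\<lambda>c p. c *\<^sub>R fst p + sqrt (1 - c\<^sup>2) *\<^sub>R snd (p :: 'a \<times> 'a)"
  have lim': "(\<lambda>n. L2_norm std_gaussian (\<lambda>p. k (?Z (c n) p) - k (?Z c' p))) \<longlonglongrightarrow> 0"
    by (rule L2_norm_compose_tendsto_0[OF prob_space_std_gaussian _ _ mehler_mix_distr[OF c(1)] mehler_mix_distr[OF c(2)] _ k])
       (simp_all, intro AE_I2 tendsto_intros lim)
  have "L2_norm std_gaussian (\<lambda>x. mehler (c n) k x - mehler c' k x) \<le>
      L2_norm std_gaussian (\<lambda>p. k (?Z (c n) p) - k (?Z c' p))" for n
  proof -
    have L: "(\<lambda>p. k (?Z (c n) p) - k (?Z c' p)) \<in> L2 std_gaussian"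
      by (intro L2_diff mehler_mix_L2 c k)
    have "AE x in std_gaussian. mehler (c n) k x - mehler c' k x =
        (\<integral>y. k (c n *\<^sub>R x + sqrt (1 - (c n)\<^sup>2) *\<^sub>R y) - k (c' *\<^sub>R x + sqrt (1 - c'\<^sup>2) *\<^sub>R y) \<partial>std_gaussian)"
      using mehler_L2(4)[OF c(1)[of n] k] mehler_L2(4)[OF c(2) k]
      by eventually_elim (simp add: mehler_def)
    then have "L2_norm std_gaussian (\<lambda>x. mehler (c n) k x - mehler c' k x) = L2_norm std_gaussian
        (\<lambda>x. \<integral>y. k (c n *\<^sub>R x + sqrt (1 - (c n)\<^sup>2) *\<^sub>R y) - k (c' *\<^sub>R x + sqrt (1 - c'\<^sup>2) *\<^sub>R y) \<partial>std_gaussian)"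
      using L2_gaussian_partial_integral(1)[OF L] mehler_L2(1)[OF c(1)[of n] k] mehler_L2(1)[OF c(2) k]
      by (intro L2_norm_AE_cong L2_measurable L2_diff) simp_all
    also have "\<dots> \<le> L2_norm std_gaussian (\<lambda>p. k (?Z (c n) p) - k (?Z c' p))"
      using L2_gaussian_partial_integral(2)[OF L] by simp
    finally show ?thesis .
  qed
  then show ?thesis
    by (intro Lim_null_comparison[OF _ lim'] always_eventually) (simp add: L2_norm_nonneg)
qed

section \<open>Covariances of rotated functions\<close>

context
  fixes J :: "real ^ 'd ^ 'd"
  assumes J: "transpose J = - J"
begin

text \<open>The rotation acts on the first function and the Mehler operator on the second, so the
  dependence on the angle and that on the correlation can be estimated separately.\<close>

lemma corr_eq_mehler:
  assumes c: "\<bar>c\<bar> \<le> 1" and f: "f \<in> L2 std_gaussian" and k: "k \<in> L2 std_gaussian"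
  shows "corr J s c f k = L2_inner std_gaussian (\<lambda>x. f (rot J (- s) x)) (mehler c k)"
proof -
  have "corr J s c f k = L2_inner std_gaussian (mehler c (\<lambda>x. f (rot J (- s) x))) k"
    unfolding mehler_inner[OF c rot_compose_L2[OF J f] k] by (simp add: corr_def L2_inner_def)
  also have "\<dots> = L2_inner std_gaussian (\<lambda>x. f (rot J (- s) x)) (mehler c k)"
    by (rule mehler_symmetric[OF c rot_compose_L2[OF J f] k])
  finally show ?thesis .
qed

lemma corr_abs_le:
  assumes c: "\<bar>c\<bar> \<le> 1" and f: "f \<in> L2 std_gaussian" and k: "k \<in> L2 std_gaussian"
  shows "\<bar>corr J s c f k\<bar> \<le> L2_norm std_gaussian f * L2_norm std_gaussian k"
proof -
  have "\<bar>corr J s c f k\<bar> \<le> L2_norm std_gaussian (\<lambda>x. f (rot J (- s) x)) * L2_norm std_gaussian (mehler c k)"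
    unfolding corr_eq_mehler[OF assms] by (intro L2_Cauchy_Schwarz rot_compose_L2 J f mehler_L2(1) c k)
  also have "\<dots> \<le> L2_norm std_gaussian f * L2_norm std_gaussian k"
    using mehler_L2(2)[OF c k] by (simp add: rot_compose_norm[OF J f] mult_left_mono L2_norm_nonneg)
  finally show ?thesis .
qed

lemma corr_diff_left:
  assumes c: "\<bar>c\<bar> \<le> 1" and f: "f \<in> L2 std_gaussian" "g \<in> L2 std_gaussian" and k: "k \<in> L2 std_gaussian"
  shows "corr J s c (\<lambda>x. f x - g x) k = corr J s c f k - corr J s c g k"
  unfolding corr_eq_mehler[OF c f(1) k] corr_eq_mehler[OF c f(2) k] corr_eq_mehler[OF c L2_diff[OF f] k]
  by (rule L2_inner_diff_left[OF rot_compose_L2[OF J f(1)] rot_compose_L2[OF J f(2)] mehler_L2(1)[OF c k]])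

lemma corr_add_left:
  assumes c: "\<bar>c\<bar> \<le> 1" and f: "f \<in> L2 std_gaussian" "g \<in> L2 std_gaussian" and k: "k \<in> L2 std_gaussian"
  shows "corr J s c (\<lambda>x. f x + g x) k = corr J s c f k + corr J s c g k"
  unfolding corr_eq_mehler[OF c f(1) k] corr_eq_mehler[OF c f(2) k] corr_eq_mehler[OF c L2_add[OF f] k]
  by (rule L2_inner_add_left[OF rot_compose_L2[OF J f(1)] rot_compose_L2[OF J f(2)] mehler_L2(1)[OF c k]])

lemma corr_scale_left: "corr J s c (\<lambda>x. a * f x) k = a * corr J s c f k"
  by (simp add: corr_def mult.assoc)

lemma corr_symmetric:
  assumes c: "\<bar>c\<bar> \<le> 1" and f: "f \<in> L2 std_gaussian" and k: "k \<in> L2 std_gaussian"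
  shows "corr J 0 c f k = corr J 0 c k f"
  unfolding corr_eq_mehler[OF c f k] corr_eq_mehler[OF c k f]
  using mehler_symmetric[OF c f k] by (simp add: L2_inner_commute)

lemma corr_diff_right:
  assumes c: "\<bar>c\<bar> \<le> 1" and f: "f \<in> L2 std_gaussian" "g \<in> L2 std_gaussian" and k: "k \<in> L2 std_gaussian"
  shows "corr J 0 c k (\<lambda>x. f x - g x) = corr J 0 c k f - corr J 0 c k g"
  unfolding corr_symmetric[OF c k L2_diff[OF f]] corr_symmetric[OF c k f(1)] corr_symmetric[OF c k f(2)]
  by (rule corr_diff_left[OF c f k])

lemma corr_rot: "corr J s c (\<lambda>x. f (rot J (- \<delta>) x)) k = corr J (s + \<delta>) c f k"
  by (simp add: corr_def rot_add[OF J] add.commute)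

lemma corr_1:
  assumes f: "f \<in> L2 std_gaussian" and k: "k \<in> L2 std_gaussian"
  shows "corr J 0 1 f k = L2_inner std_gaussian f k"
proof -
  interpret G: prob_space "std_gaussian :: (real ^ 'd) measure" by (rule prob_space_std_gaussian)
  have "mehler 1 k = k" by (simp add: mehler_def fun_eq_iff G.prob_space[simplified])
  then show ?thesis using corr_eq_mehler[OF _ f k, of 1 0] by simp
qed

lemma rot_invariant_L2: "g \<in> rot_invariant J \<Longrightarrow> g \<in> L2 std_gaussian"
  by (auto simp: rot_invariant_def intro: L2_zero_mean_L2)

lemma corr_invariant:
  assumes c: "\<bar>c\<bar> \<le> 1" and f: "f \<in> rot_invariant J" and k: "k \<in> L2 std_gaussian"
  shows "corr J s c f k = corr J 0 c f k"
proof -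
  have fL: "f \<in> L2 std_gaussian" by (rule rot_invariant_L2[OF f])
  have "AE x in std_gaussian. f (rot J (- s) x) = f x" using f by (simp add: rot_invariant_def)
  then show ?thesis
    unfolding corr_eq_mehler[OF c fL k]
    by (intro L2_inner_AE_cong L2_measurable rot_compose_L2[OF J fL] mehler_L2(1)[OF c k]) simp
qed

text \<open>The Gaussian noise is isotropic, so the Mehler operators commute with the
  rotations.\<close>

lemma mehler_invariant:
  assumes c: "\<bar>c\<bar> \<le> 1" and k: "k \<in> rot_invariant J"
  shows "AE x in std_gaussian. mehler c k (rot J s x) = mehler c k x"
proof -
  have kL: "k \<in> L2 std_gaussian" by (rule rot_invariant_L2[OF k])
  have [measurable]: "k \<in> borel_measurable borel" using L2_measurable[OF kL] by simp
  have "mehler c k (rot J s x) = mehler c (\<lambda>x. k (rot J s x)) x" for x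
  proof -
    have "mehler c k (rot J s x) = (\<integral>y. k (c *\<^sub>R rot J s x + sqrt (1 - c\<^sup>2) *\<^sub>R rot J s y) \<partial>std_gaussian)"
      unfolding mehler_def
      by (rule integral_gaussian_compose[OF _ rot_distr[OF J], symmetric])
         (simp_all add: borel_measurable_linear_euclidean rot_linear)
    then show ?thesis
      by (simp add: mehler_def linear_add[OF rot_linear] linear_cmul[OF rot_linear])
  qed
  moreover have "AE x in std_gaussian. mehler c (\<lambda>x. k (rot J s x)) x = mehler c k x"
    using k by (intro mehler_AE_cong c rot_compose_L2[OF J kL] kL) (simp add: rot_invariant_def)
  ultimately show ?thesis by simp
qed

text \<open>\<open>mehler c k\<close> is again invariant, and rotations preserve the inner product,
  so \<open>f\<close> and its rotation have the same covariance with \<open>k\<close>.\<close>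

lemma corr_coboundary_invariant:
  assumes c: "\<bar>c\<bar> \<le> 1" and f: "f \<in> L2 std_gaussian" and k: "k \<in> rot_invariant J"
  shows "corr J 0 c (\<lambda>x. f (rot J (- \<delta>) x) - f x) k = 0"
proof -
  have kL: "k \<in> L2 std_gaussian" by (rule rot_invariant_L2[OF k])
  note m = mehler_L2(1)[OF c kL]
  have "L2_inner std_gaussian (mehler c k) (\<lambda>x. f (rot J (- \<delta>) x)) =
      L2_inner std_gaussian (\<lambda>x. mehler c k (rot J (- \<delta>) x)) (\<lambda>x. f (rot J (- \<delta>) x))"
    using mehler_invariant[OF c k, of "- \<delta>"]
    by (intro L2_inner_AE_cong L2_measurable m rot_compose_L2 J f) (auto elim: eventually_mono)
  also have "\<dots> = L2_inner std_gaussian (mehler c k) f" by (rule rot_compose_inner[OF J m f])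
  finally show ?thesis
    unfolding corr_diff_left[OF c rot_compose_L2[OF J f] f kL]
    by (simp add: corr_eq_mehler[OF c f kL] corr_eq_mehler[OF c rot_compose_L2[OF J f] kL] L2_inner_commute[of _ "mehler c k"])
qed

lemma corr_measurable:
  assumes f: "f \<in> L2 std_gaussian" and k: "k \<in> L2 std_gaussian"
    and [measurable]: "s \<in> borel_measurable M" "c \<in> borel_measurable M"
  shows "(\<lambda>t. corr J (s t) (c t) f k) \<in> borel_measurable M"
proof -
  interpret G: prob_space "std_gaussian :: ((real ^ 'd) \<times> (real ^ 'd)) measure" by (rule prob_space_std_gaussian)
  have [measurable]: "f \<in> borel_measurable borel" "k \<in> borel_measurable borel"
    using L2_measurable[OF f] L2_measurable[OF k] by simp_all
  show ?thesis unfolding corr_def by measurable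
qed

end

section \<open>Bounds uniform in the strength of the perturbation, and the limit\<close>

locale langevin_family =
  fixes M :: "'w measure" and J :: "real ^ 'd ^ 'd" and \<gamma> :: real and W :: "real \<Rightarrow> 'w \<Rightarrow> real ^ 'd"
    and X :: "real \<Rightarrow> (real ^ 'd) \<times> (real ^ 'd) \<Rightarrow> real \<Rightarrow> 'w \<Rightarrow> (real ^ 'd) \<times> (real ^ 'd)"
  assumes family: "\<And>\<mu>. langevin M J \<gamma> \<mu> W (X \<mu>)"
begin

abbreviation G :: "(real ^ 'd) measure" where "G \<equiv> std_gaussian"

lemma J: "transpose J = - J" and \<gamma>: "\<gamma> > 0"
  using langevin.skew[OF family] langevin.gamma_pos[OF family] by blast+

sublocale G: prob_space G
  by (rule prob_space_std_gaussian)

definition cov_integral :: "real \<Rightarrow> (real ^ 'd \<Rightarrow> real) \<Rightarrow> (real ^ 'd \<Rightarrow> real) \<Rightarrow> real" where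
  "cov_integral \<mu> f k = (\<integral>t. indicator {0..} t * corr J (\<mu> * t) (osc_q \<gamma> t) f k \<partial>lborel)"

text \<open>A majorant of the normalised covariance that depends neither on \<mu> nor on the
  angle.\<close>

definition bnd :: "real \<Rightarrow> real" where
  "bnd t = sqrt decay_const * exp (- (decay_rate \<gamma> / 2) * t)"

lemma bnd_nonneg: "0 \<le> bnd t"
  by (simp add: bnd_def decay_const_nonneg)

lemma bnd_integrable: "integrable lborel (\<lambda>t. indicator {0..} t * bnd t)"
proof -
  have r: "decay_rate \<gamma> / 2 > 0" using decay_rate_pos[OF \<gamma>] by simp
  interpret E: prob_space "density lborel (exponential_density (decay_rate \<gamma> / 2))"
    by (rule prob_space_exponential_density[OF r])
  have "integrable lborel (\<lambda>t. exponential_density (decay_rate \<gamma> / 2) t * 1)"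
    using E.integrable_const[of "1::real"] r
    by (subst (asm) integrable_density) (auto simp: exponential_density_nonneg)
  then have "integrable lborel (\<lambda>t. sqrt decay_const / (decay_rate \<gamma> / 2) * (exponential_density (decay_rate \<gamma> / 2) t * 1))"
    by (rule integrable_mult_right)
  then show ?thesis
    by (rule back_subst[of "integrable lborel"])
       (use r in \<open>auto simp: fun_eq_iff bnd_def exponential_density_def indicator_def mult.commute\<close>)
qed

definition total :: real where
  "total = (\<integral>t. indicator {0..} t * bnd t \<partial>lborel)"

lemma total_nonneg: "0 \<le> total"
  unfolding total_def by (rule Bochner_Integration.integral_nonneg) (simp add: bnd_nonneg)

lemma osc_q_abs_le: "0 \<le> t \<Longrightarrow> \<bar>osc_q \<gamma> t\<bar> \<le> 1"
  using osc_bounds(1)[OF \<gamma>, of t] zero_le_power2[of "osc_p \<gamma> t"]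
  unfolding abs_square_le_1[symmetric] by linarith

text \<open>An arbitrary angle \<open>s\<close> at time \<open>t\<close> is attained for the
  strength \<open>s / t\<close>, so the bound for a fixed strength covers it; this is why
  \<open>t\<close> is positive.\<close>

lemma corr_bound:
  assumes f: "f \<in> L2_zero_mean G" and k: "k \<in> L2 G" and t: "0 < t"
  shows "\<bar>corr J s (osc_q \<gamma> t) f k\<bar> \<le> bnd t * (L2_norm G f * L2_norm G k)"
  using langevin.corr_bound[OF family[of "s / t"] f _ k, of t] t by (simp add: bnd_def mult.assoc)

lemma cov_integral_integrable:
  assumes f: "f \<in> L2_zero_mean G" and k: "k \<in> L2 G"
  shows "integrable lborel (\<lambda>t. indicator {0..} t * corr J (\<mu> * t) (osc_q \<gamma> t) f k)"
  by (rule langevin.corr_integrable[OF family f k])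

lemma cov_integral_abs_le:
  assumes f: "f \<in> L2_zero_mean G" and k: "k \<in> L2 G"
  shows "\<bar>cov_integral \<mu> f k\<bar> \<le> total * (L2_norm G f * L2_norm G k)"
proof -
  have "\<bar>cov_integral \<mu> f k\<bar> \<le> (\<integral>t. \<bar>indicator {0..} t * corr J (\<mu> * t) (osc_q \<gamma> t) f k\<bar> \<partial>lborel)"
    unfolding cov_integral_def by (rule integral_abs_bound)
  also have "\<dots> \<le> (\<integral>t. (indicator {0..} t * bnd t) * (L2_norm G f * L2_norm G k) \<partial>lborel)"
  proof (rule integral_mono_AE)
    show "AE t in lborel. \<bar>indicator {0..} t * corr J (\<mu> * t) (osc_q \<gamma> t) f k\<bar> \<le>
        indicator {0..} t * bnd t * (L2_norm G f * L2_norm G k)"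
      using AE_lborel_singleton[of 0]
      by eventually_elim (use corr_bound[OF f k] in \<open>auto simp: indicator_def\<close>)
  qed (intro integrable_abs cov_integral_integrable[OF f k] integrable_mult_left bnd_integrable)+
  also have "\<dots> = total * (L2_norm G f * L2_norm G k)" by (simp add: total_def)
  finally show ?thesis .
qed

lemma cov_integral_cong:
  assumes "\<And>t. 0 \<le> t \<Longrightarrow> corr J (\<mu> * t) (osc_q \<gamma> t) f k = corr J (\<mu>' * t) (osc_q \<gamma> t) f' k'"
  shows "cov_integral \<mu> f k = cov_integral \<mu>' f' k'"
  unfolding cov_integral_def using assms by (intro Bochner_Integration.integral_cong refl) (simp add: indicator_def)

lemma cov_integral_diff_left:
  assumes f: "f \<in> L2_zero_mean G" "g \<in> L2_zero_mean G" and k: "k \<in> L2 G"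
  shows "cov_integral \<mu> (\<lambda>x. f x - g x) k = cov_integral \<mu> f k - cov_integral \<mu> g k"
proof -
  have "cov_integral \<mu> f k - cov_integral \<mu> g k = (\<integral>t. indicator {0..} t * corr J (\<mu> * t) (osc_q \<gamma> t) f k -
       indicator {0..} t * corr J (\<mu> * t) (osc_q \<gamma> t) g k \<partial>lborel)"
    unfolding cov_integral_def by (rule Bochner_Integration.integral_diff[symmetric]) (intro cov_integral_integrable f k)+
  also have "\<dots> = cov_integral \<mu> (\<lambda>x. f x - g x) k"
    unfolding cov_integral_def using f k
    by (intro Bochner_Integration.integral_cong refl)
       (simp add: indicator_def corr_diff_left[OF J osc_q_abs_le] L2_zero_mean_L2)
  finally show ?thesis ..
qed

lemma cov_integral_add_left:
  assumes f: "f \<in> L2_zero_mean G" "g \<in> L2_zero_mean G" and k: "k \<in> L2 G"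
  shows "cov_integral \<mu> (\<lambda>x. f x + g x) k = cov_integral \<mu> f k + cov_integral \<mu> g k"
proof -
  have "cov_integral \<mu> f k + cov_integral \<mu> g k = (\<integral>t. indicator {0..} t * corr J (\<mu> * t) (osc_q \<gamma> t) f k +
       indicator {0..} t * corr J (\<mu> * t) (osc_q \<gamma> t) g k \<partial>lborel)"
    unfolding cov_integral_def by (rule Bochner_Integration.integral_add[symmetric]) (intro cov_integral_integrable f k)+
  also have "\<dots> = cov_integral \<mu> (\<lambda>x. f x + g x) k"
    unfolding cov_integral_def using f k
    by (intro Bochner_Integration.integral_cong refl)
       (simp add: indicator_def corr_add_left[OF J osc_q_abs_le] L2_zero_mean_L2)
  finally show ?thesis ..
qed

lemma cov_integral_scale_left: "cov_integral \<mu> (\<lambda>x. a * f x) k = a * cov_integral \<mu> f k"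
  by (simp add: cov_integral_def corr_scale_left[OF J] mult.left_commute)

text \<open>With \<open>\<epsilon> = \<delta> / \<mu>\<close>, rotating by the extra angle \<open>\<delta>\<close> is a shift of the time in \<open>\<mu> t\<close> by \<open>\<epsilon>\<close>; shifting
  the time also in the correlation costs an error that vanishes as \<open>\<epsilon> \<longrightarrow> 0\<close>, and the shift of both only
  removes the time interval \<open>[0, \<epsilon>]\<close>.\<close>

lemma cov_integral_coboundary_tendsto_0:
  assumes f: "f \<in> L2_zero_mean G" and k: "k \<in> L2 G" and \<delta>: "\<delta> > 0"
  shows "((\<lambda>\<mu>. cov_integral \<mu> (\<lambda>x. f (rot J (- \<delta>) x) - f x) k) \<longlongrightarrow> 0) at_top"
proof -
  have fL: "f \<in> L2 G" using f by (rule L2_zero_mean_L2)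
  define C where "C = L2_norm G f * L2_norm G k"
  have C: "C \<ge> 0" by (simp add: C_def L2_norm_nonneg)
  define \<Phi> where "\<Phi> t s = corr J s (osc_q \<gamma> t) f k" for t s
  note \<Phi>m [measurable] = corr_measurable[OF J fL k, of _ borel, folded \<Phi>_def]
  have m\<Phi> [measurable]: "(\<lambda>t. \<Phi> (a t) (b t)) \<in> borel_measurable borel"
    if [measurable]: "a \<in> borel_measurable borel" "b \<in> borel_measurable borel" for a b
    unfolding \<Phi>_def by (rule corr_measurable[OF J fL k]) measurable
  have \<Phi>b: "\<bar>\<Phi> t s\<bar> \<le> bnd t * C" if "0 < t" for t s
    unfolding \<Phi>_def C_def by (rule corr_bound[OF f k that])
  \<comment> \<open>\<open>D\<close> compares the correlations at times \<open>t\<close> and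
    \<open>t + \<delta> / \<mu>\<close> at the same angle; \<open>R\<close> collects the interval
    that the shift removes.\<close>
  define D where "D \<mu> t = indicator {0..} t * (\<Phi> t (\<mu> * (t + \<delta> / \<mu>)) - \<Phi> (t + \<delta> / \<mu>) (\<mu> * (t + \<delta> / \<mu>)))" for \<mu> t
  define R where "R \<mu> t = indicator {0..\<delta> / \<mu>} t * \<Phi> t (\<mu> * t)" for \<mu> t
  have iR: "integrable lborel (R \<mu>)" for \<mu>
  proof -
    have "integrable lborel (\<lambda>t. indicator {0..\<delta> / \<mu>} t *\<^sub>R (indicator {0..} t * \<Phi> t (\<mu> * t)))"
      using cov_integral_integrable[OF f k, of \<mu>] by (intro integrable_mult_indicator) (simp_all add: \<Phi>_def)
    then show ?thesis
      by (rule back_subst[of "integrable lborel"]) (auto simp: R_def indicator_def fun_eq_iff)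
  qed
  have iS: "integrable lborel (\<lambda>t. indicator {0..} t * \<Phi> (t + e) (\<mu> * (t + e)))" if e: "e > 0" for e \<mu>
  proof -
    have "integrable lborel (\<lambda>t. indicator {e..} t *\<^sub>R (indicator {0..} t * \<Phi> t (\<mu> * t)))"
      using cov_integral_integrable[OF f k, of \<mu>] by (intro integrable_mult_indicator) (simp_all add: \<Phi>_def)
    then have "integrable lborel (\<lambda>t. indicator {e..} (e + 1 * t) *\<^sub>R (indicator {0..} (e + 1 * t) * \<Phi> (e + 1 * t) (\<mu> * (e + 1 * t))))"
      by (rule lborel_integrable_real_affine) simp
    then show ?thesis
      by (rule back_subst[of "integrable lborel"]) (use e in \<open>auto simp: indicator_def fun_eq_iff add.commute\<close>)
  qed
  have bnd_mono: "bnd (t + e) \<le> bnd t" if "e \<ge> 0" for t e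
    using that decay_rate_pos[OF \<gamma>] unfolding bnd_def
    by (intro mult_left_mono) (auto simp: decay_const_nonneg mult_right_mono_neg)
  have Db: "AE t in lborel. norm (D \<mu> t) \<le> 2 * C * (indicator {0..} t * bnd t)" if \<mu>: "\<mu> > 0" for \<mu>
    using AE_lborel_singleton[of 0]
  proof eventually_elim
    case (elim t)
    have e: "\<delta> / \<mu> > 0" using \<delta> \<mu> by simp
    show ?case
    proof (cases "0 < t")
      case True
      have "bnd (t + \<delta> / \<mu>) * C \<le> bnd t * C" using bnd_mono[of "\<delta> / \<mu>" t] e C by (intro mult_right_mono) auto
      moreover have "\<bar>\<Phi> (t + \<delta> / \<mu>) (\<mu> * (t + \<delta> / \<mu>))\<bar> \<le> bnd (t + \<delta> / \<mu>) * C" using True e by (intro \<Phi>b) simp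
      moreover have "\<bar>\<Phi> t (\<mu> * (t + \<delta> / \<mu>))\<bar> \<le> bnd t * C" by (rule \<Phi>b[OF True])
      ultimately have "\<bar>\<Phi> t (\<mu> * (t + \<delta> / \<mu>)) - \<Phi> (t + \<delta> / \<mu>) (\<mu> * (t + \<delta> / \<mu>))\<bar> \<le> 2 * (bnd t * C)"
        by linarith
      then show ?thesis using True by (simp add: D_def mult.commute mult.left_commute)
    qed (use elim in \<open>auto simp: D_def indicator_def\<close>)
  qed
  have iD: "integrable lborel (D \<mu>)" if \<mu>: "\<mu> > 0" for \<mu>
  proof (rule Bochner_Integration.integrable_bound)
    show "integrable lborel (\<lambda>t. 2 * C * (indicator {0..} t * bnd t))"
      by (intro integrable_mult_right bnd_integrable)
    show "D \<mu> \<in> borel_measurable lborel" unfolding D_def by measurable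
    show "AE t in lborel. norm (D \<mu> t) \<le> norm (2 * C * (indicator {0..} t * bnd t))"
      using Db[OF \<mu>] by eventually_elim (simp add: C bnd_nonneg)
  qed
  have split: "cov_integral \<mu> (\<lambda>x. f (rot J (- \<delta>) x) - f x) k = (\<integral>t. D \<mu> t \<partial>lborel) - (\<integral>t. R \<mu> t \<partial>lborel)"
    if \<mu>: "\<mu> > 0" for \<mu>
  proof -
    let ?e = "\<delta> / \<mu>"
    have e: "?e > 0" using \<delta> \<mu> by simp
    have \<mu>e: "\<mu> * (t + ?e) = \<mu> * t + \<delta>" for t using \<mu> by (simp add: field_simps)
    have fr: "(\<lambda>x. f (rot J (- \<delta>) x)) \<in> L2_zero_mean G" by (rule rot_compose_zero_mean[OF J f])
    have "cov_integral \<mu> (\<lambda>x. f (rot J (- \<delta>) x)) k = (\<integral>t. indicator {0..} t * \<Phi> t (\<mu> * (t + ?e)) \<partial>lborel)"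
      unfolding cov_integral_def \<Phi>_def \<mu>e by (simp add: corr_rot[OF J])
    also have "\<dots> = (\<integral>t. D \<mu> t + indicator {0..} t * \<Phi> (t + ?e) (\<mu> * (t + ?e)) \<partial>lborel)"
      by (intro Bochner_Integration.integral_cong refl) (simp add: D_def right_diff_distrib)
    also have "\<dots> = (\<integral>t. D \<mu> t \<partial>lborel) + (\<integral>t. indicator {0..} t * \<Phi> (t + ?e) (\<mu> * (t + ?e)) \<partial>lborel)"
      by (rule Bochner_Integration.integral_add[OF iD[OF \<mu>] iS[OF e]])
    also have "(\<integral>t. indicator {0..} t * \<Phi> (t + ?e) (\<mu> * (t + ?e)) \<partial>lborel) = (\<integral>t. indicator {?e..} t * \<Phi> t (\<mu> * t) \<partial>lborel)"
      using lborel_integral_real_affine[of 1 "\<lambda>t. indicator {?e..} t * \<Phi> t (\<mu> * t)" ?e]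
      by (simp add: indicator_def add.commute)
    also have "\<dots> = (\<integral>t. indicator {0..} t * \<Phi> t (\<mu> * t) - R \<mu> t \<partial>lborel)"
    proof (rule integral_cong_AE)
      show "AE t in lborel. indicator {?e..} t * \<Phi> t (\<mu> * t) = indicator {0..} t * \<Phi> t (\<mu> * t) - R \<mu> t"
        using AE_lborel_singleton[of ?e] by eventually_elim (use e in \<open>auto simp: R_def indicator_def\<close>)
    qed (use borel_measurable_integrable[OF iR[of \<mu>]] in measurable)
    also have "\<dots> = cov_integral \<mu> f k - (\<integral>t. R \<mu> t \<partial>lborel)"
      using cov_integral_integrable[OF f k, of \<mu>] iR by (simp add: cov_integral_def \<Phi>_def)
    finally show ?thesis by (simp add: cov_integral_diff_left[OF fr f k])
  qed
  have limR: "((\<lambda>\<mu>. \<integral>t. R \<mu> t \<partial>lborel) \<longlongrightarrow> 0) at_top"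
  proof (rule Lim_null_comparison)
    show "((\<lambda>\<mu>. C * (\<delta> / \<mu>)) \<longlongrightarrow> 0) at_top"
      using tendsto_mult[OF tendsto_const[of "C * \<delta>"] tendsto_inverse_0_at_top[OF filterlim_ident]]
      by (simp add: divide_inverse mult.assoc)
    show "\<forall>\<^sub>F \<mu> in at_top. norm (\<integral>t. R \<mu> t \<partial>lborel) \<le> C * (\<delta> / \<mu>)"
      using eventually_gt_at_top[of 0]
    proof eventually_elim
      case (elim \<mu>)
      have "norm (\<integral>t. R \<mu> t \<partial>lborel) \<le> (\<integral>t. \<bar>R \<mu> t\<bar> \<partial>lborel)"
        using integral_abs_bound[of lborel "R \<mu>"] by simp
      also have "\<dots> \<le> (\<integral>t. indicator {0..\<delta> / \<mu>} t * C \<partial>lborel)"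
      proof (rule integral_mono[OF integrable_abs[OF iR]])
        show "integrable lborel (\<lambda>t. indicator {0..\<delta> / \<mu>} t * C)" by (intro integrable_mult_left integrable_real_indicator) (simp_all add: emeasure_lborel_Icc_eq)
        show "\<bar>R \<mu> t\<bar> \<le> indicator {0..\<delta> / \<mu>} t * C" for t
          using corr_abs_le[OF J osc_q_abs_le fL k, of t "\<mu> * t"] by (auto simp: R_def \<Phi>_def C_def indicator_def)
      qed
      also have "\<dots> = C * (\<delta> / \<mu>)" using \<delta> elim by simp
      finally show ?case .
    qed
  qed
  have limD: "((\<lambda>\<mu>. \<integral>t. D \<mu> t \<partial>lborel) \<longlongrightarrow> (\<integral>t. 0 \<partial>(lborel :: real measure))) at_top"
  proof (rule integral_dominated_convergence_at_top[where w="\<lambda>t. 2 * C * (indicator {0..} t * bnd t)"])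
    show "D \<mu> \<in> borel_measurable lborel" for \<mu> unfolding D_def by measurable
    show "integrable lborel (\<lambda>t. 2 * C * (indicator {0..} t * bnd t))"
      by (intro integrable_mult_right bnd_integrable)
    show "\<forall>\<^sub>F \<mu> in at_top. AE t in lborel. norm (D \<mu> t) \<le> 2 * C * (indicator {0..} t * bnd t)"
      using eventually_gt_at_top[of 0] by eventually_elim (rule Db)
    show "AE t in lborel. ((\<lambda>\<mu>. D \<mu> t) \<longlongrightarrow> 0) at_top"
    proof (rule AE_I2)
      fix t :: real
      show "((\<lambda>\<mu>. D \<mu> t) \<longlongrightarrow> 0) at_top"
      proof (cases "0 \<le> t")
        case True
        \<comment> \<open>The absolute value keeps the argument of \<open>osc_q\<close> nonnegative
          along the whole sequence, so that every correlation has modulus at most 1, as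
          \<open>mehler_continuous\<close> requires.\<close>
        have lim: "((\<lambda>\<mu>. L2_norm G f * L2_norm G (\<lambda>x. mehler (osc_q \<gamma> (t + \<delta> / \<bar>\<mu>\<bar>)) k x - mehler (osc_q \<gamma> t) k x)) \<longlongrightarrow> L2_norm G f * 0) at_top"
        proof (rule tendsto_mult[OF tendsto_const], rule tendsto_at_topI_sequentially)
          fix \<mu> :: "nat \<Rightarrow> real" assume \<mu>: "filterlim \<mu> at_top sequentially"
          have "(\<lambda>n. t + \<delta> * inverse \<bar>\<mu> n\<bar>) \<longlonglongrightarrow> t + \<delta> * 0"
            by (intro tendsto_intros tendsto_inverse_0_at_top filterlim_at_infinity_imp_norm_at_top[where f=\<mu>, unfolded real_norm_def]
                filterlim_at_top_imp_at_infinity \<mu>)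
          then have "(\<lambda>n. osc_q \<gamma> (t + \<delta> / \<bar>\<mu> n\<bar>)) \<longlonglongrightarrow> osc_q \<gamma> t"
            by (intro osc_tendsto) (simp add: divide_inverse)
          then show "(\<lambda>n. L2_norm G (\<lambda>x. mehler (osc_q \<gamma> (t + \<delta> / \<bar>\<mu> n\<bar>)) k x - mehler (osc_q \<gamma> t) k x)) \<longlonglongrightarrow> 0"
            using True \<delta> by (intro mehler_continuous[OF k] osc_q_abs_le) simp_all
        qed
        show ?thesis
        proof (rule Lim_null_comparison[OF _ lim[unfolded mult_zero_right]])
          show "\<forall>\<^sub>F \<mu> in at_top. norm (D \<mu> t) \<le> L2_norm G f * L2_norm G (\<lambda>x. mehler (osc_q \<gamma> (t + \<delta> / \<bar>\<mu>\<bar>)) k x - mehler (osc_q \<gamma> t) k x)"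
            using eventually_gt_at_top[of 0]
          proof eventually_elim
            case (elim \<mu>)
            let ?a = "osc_q \<gamma> t" and ?b = "osc_q \<gamma> (t + \<delta> / \<bar>\<mu>\<bar>)" and ?s = "\<mu> * (t + \<delta> / \<mu>)"
            have c: "\<bar>?a\<bar> \<le> 1" "\<bar>?b\<bar> \<le> 1" using True \<delta> by (auto intro!: osc_q_abs_le)
            note L = rot_compose_L2[OF J fL, of "- ?s"] mehler_L2(1)[OF c(1) k] mehler_L2(1)[OF c(2) k]
            have "norm (D \<mu> t) = \<bar>corr J ?s ?a f k - corr J ?s ?b f k\<bar>"
              using True elim by (simp add: D_def \<Phi>_def)
            also have "\<dots> = \<bar>L2_inner G (\<lambda>x. f (rot J (- ?s) x)) (\<lambda>x. mehler ?a k x - mehler ?b k x)\<bar>"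
              unfolding corr_eq_mehler[OF J c(1) fL k] corr_eq_mehler[OF J c(2) fL k] L2_inner_diff_right[OF L(2,3,1)] ..
            also have "\<dots> \<le> L2_norm G (\<lambda>x. f (rot J (- ?s) x)) * L2_norm G (\<lambda>x. mehler ?a k x - mehler ?b k x)"
              by (rule L2_Cauchy_Schwarz[OF L(1) L2_diff[OF L(2,3)]])
            finally show ?case
              unfolding rot_compose_norm[OF J fL] L2_norm_minus_commute[of _ "mehler ?a k"] .
          qed
        qed
      qed (simp add: D_def)
    qed
  qed simp
  have "((\<lambda>\<mu>. (\<integral>t. D \<mu> t \<partial>lborel) - (\<integral>t. R \<mu> t \<partial>lborel)) \<longlongrightarrow> 0 - 0) at_top"
    using limD limR by (intro tendsto_diff) simp_all
  moreover have "\<forall>\<^sub>F \<mu> in at_top. (\<integral>t. D \<mu> t \<partial>lborel) - (\<integral>t. R \<mu> t \<partial>lborel) = cov_integral \<mu> (\<lambda>x. f (rot J (- \<delta>) x) - f x) k"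
    using eventually_gt_at_top[of 0] by eventually_elim (simp add: split)
  ultimately show ?thesis by (simp add: Lim_transform_eventually)
qed

text \<open>The first condition is tested against every \<open>k\<close> in L2, which together with
  \<open>cov_integral_abs_le\<close> makes the set closed. The second one removes the cross terms at
  \<mu> = 0; for \<open>c = 1\<close> it is orthogonality to the invariant functions.\<close>

definition vanishing :: "(real ^ 'd \<Rightarrow> real) set" where
  "vanishing = {\<psi> \<in> L2_zero_mean G. (\<forall>k\<in>L2 G. ((\<lambda>\<mu>. cov_integral \<mu> \<psi> k) \<longlongrightarrow> 0) at_top) \<and>
     (\<forall>k\<in>rot_invariant J. \<forall>c. \<bar>c\<bar> \<le> 1 \<longrightarrow> corr J 0 c \<psi> k = 0)}"

lemma vanishing_L2: "\<psi> \<in> vanishing \<Longrightarrow> \<psi> \<in> L2 G"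
  by (auto simp: vanishing_def intro: L2_zero_mean_L2)

lemma vanishing_add:
  assumes \<phi>: "\<phi> \<in> vanishing" and \<psi>: "\<psi> \<in> vanishing"
  shows "(\<lambda>x. \<phi> x + \<psi> x) \<in> vanishing"
proof -
  have "((\<lambda>\<mu>. cov_integral \<mu> (\<lambda>x. \<phi> x + \<psi> x) k) \<longlongrightarrow> 0) at_top" if "k \<in> L2 G" for k
    using \<phi> \<psi> that by (simp add: vanishing_def cov_integral_add_left tendsto_add_zero)
  moreover have "corr J 0 c (\<lambda>x. \<phi> x + \<psi> x) k = 0" if "k \<in> rot_invariant J" "\<bar>c\<bar> \<le> 1" for k c
    using \<phi> \<psi> that corr_add_left[OF J that(2) vanishing_L2[OF \<phi>] vanishing_L2[OF \<psi>] rot_invariant_L2[OF J that(1)]]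
    by (simp add: vanishing_def)
  moreover have "(\<lambda>x. \<phi> x + \<psi> x) \<in> L2_zero_mean G"
    using \<phi> \<psi> by (intro L2_zero_mean_add prob_space_std_gaussian) (simp_all add: vanishing_def)
  ultimately show ?thesis by (simp add: vanishing_def)
qed

lemma vanishing_scale: "\<psi> \<in> vanishing \<Longrightarrow> (\<lambda>x. c * \<psi> x) \<in> vanishing"
  by (auto simp: vanishing_def L2_zero_mean_scale cov_integral_scale_left corr_scale_left[OF J] intro!: tendsto_mult_right_zero)

text \<open>Both conditions are continuous in \<open>\<psi>\<close> for fixed \<open>k\<close>,
  uniformly in \<mu> and in the correlation; the constant for the covariance integral is
  \<open>total\<close>.\<close>

lemma vanishing_closed:
  assumes \<psi>: "\<psi> \<in> L2 G" and ap: "\<And>e. e > 0 \<Longrightarrow> \<exists>\<phi>\<in>vanishing. L2_norm G (\<lambda>x. \<psi> x - \<phi> x) < e"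
  shows "\<psi> \<in> vanishing"
proof -
  have \<psi>0: "\<psi> \<in> L2_zero_mean G"
    by (rule L2_zero_mean_closed[OF prob_space_std_gaussian \<psi>]) (use ap in \<open>fastforce simp: vanishing_def\<close>)
  have 1: "((\<lambda>\<mu>. cov_integral \<mu> \<psi> k) \<longlongrightarrow> 0) at_top" if k: "k \<in> L2 G" for k
  proof (rule tendstoI)
    fix e :: real assume e: "e > 0"
    define K where "K = total * L2_norm G k + 1"
    have K: "K > 0" using total_nonneg L2_norm_nonneg[of G k] by (simp add: K_def add_nonneg_pos)
    obtain \<phi> where \<phi>: "\<phi> \<in> vanishing" "L2_norm G (\<lambda>x. \<psi> x - \<phi> x) < e / (2 * K)"
      using ap[of "e / (2 * K)"] e K by auto
    have \<phi>0: "\<phi> \<in> L2_zero_mean G" using \<phi>(1) by (simp add: vanishing_def)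
    have d: "\<bar>cov_integral \<mu> \<psi> k - cov_integral \<mu> \<phi> k\<bar> \<le> e / 2" for \<mu>
    proof -
      have "\<bar>cov_integral \<mu> \<psi> k - cov_integral \<mu> \<phi> k\<bar> \<le> total * (L2_norm G (\<lambda>x. \<psi> x - \<phi> x) * L2_norm G k)"
        using cov_integral_abs_le[OF L2_zero_mean_diff[OF prob_space_std_gaussian \<psi>0 \<phi>0] k, of \<mu>]
        by (simp add: cov_integral_diff_left[OF \<psi>0 \<phi>0 k])
      also have "\<dots> = (total * L2_norm G k) * L2_norm G (\<lambda>x. \<psi> x - \<phi> x)" by (simp only: ac_simps)
      also have "\<dots> \<le> K * (e / (2 * K))"
        using \<phi>(2) K total_nonneg by (intro mult_mono) (auto simp: K_def L2_norm_nonneg)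
      also have "\<dots> = e / 2" using K by simp
      finally show ?thesis .
    qed
    have "\<forall>\<^sub>F \<mu> in at_top. dist (cov_integral \<mu> \<phi> k) 0 < e / 2"
      using \<phi>(1) k e unfolding vanishing_def by (intro tendstoD) auto
    then show "\<forall>\<^sub>F \<mu> in at_top. dist (cov_integral \<mu> \<psi> k) 0 < e"
    proof eventually_elim
      case (elim \<mu>)
      then show ?case using d[of \<mu>] unfolding dist_real_def by linarith
    qed
  qed
  have 2: "corr J 0 c \<psi> k = 0" if k: "k \<in> rot_invariant J" and c: "\<bar>c\<bar> \<le> 1" for k c
  proof (rule ccontr)
    assume nz: "corr J 0 c \<psi> k \<noteq> 0"
    have kL: "k \<in> L2 G" by (rule rot_invariant_L2[OF J k])
    define K where "K = L2_norm G k + 1"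
    have K: "K > 0" using L2_norm_nonneg[of G k] by (simp add: K_def)
    define e where "e = \<bar>corr J 0 c \<psi> k\<bar>"
    have e: "e > 0" using nz by (simp add: e_def)
    obtain \<phi> where \<phi>: "\<phi> \<in> vanishing" "L2_norm G (\<lambda>x. \<psi> x - \<phi> x) < e / K" using ap[of "e / K"] e K by auto
    have \<phi>L: "\<phi> \<in> L2 G" by (rule vanishing_L2[OF \<phi>(1)])
    have "corr J 0 c \<phi> k = 0" using \<phi>(1) k c by (simp add: vanishing_def)
    then have "e \<le> L2_norm G (\<lambda>x. \<psi> x - \<phi> x) * L2_norm G k"
      using corr_abs_le[OF J c L2_diff[OF \<psi> \<phi>L] kL, of 0] corr_diff_left[OF J c \<psi> \<phi>L kL, of 0] by (simp add: e_def)
    also have "\<dots> \<le> L2_norm G (\<lambda>x. \<psi> x - \<phi> x) * K" by (simp add: K_def mult_left_mono L2_norm_nonneg)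
    also have "\<dots> < e" using \<phi>(2) K by (simp add: pos_less_divide_eq)
    finally show False by simp
  qed
  show ?thesis using \<psi>0 1 2 by (simp add: vanishing_def)
qed

lemma coboundary_vanishing:
  assumes f: "f \<in> L2_zero_mean G" and \<delta>: "\<delta> > 0"
  shows "(\<lambda>x. f (rot J (- \<delta>) x) - f x) \<in> vanishing"
  unfolding vanishing_def
  using cov_integral_coboundary_tendsto_0[OF f _ \<delta>] corr_coboundary_invariant[OF J _ L2_zero_mean_L2[OF f]]
    L2_zero_mean_diff[OF prob_space_std_gaussian rot_compose_zero_mean[OF J f] f]
  by simp

text \<open>The mean ergodic argument of von Neumann: the residual \<open>w\<close> is orthogonal to
  its own coboundary, so its inner product with its rotation is its squared norm. As the rotation
  preserves the norm, the two coincide.\<close>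

lemma decomposition:
  assumes f: "f \<in> L2_zero_mean G"
  obtains g where "g \<in> vanishing" "(\<lambda>x. f x - g x) \<in> rot_invariant J"
proof -
  have fL: "f \<in> L2 G" using f by (rule L2_zero_mean_L2)
  obtain g where g: "g \<in> vanishing" "\<And>h. h \<in> vanishing \<Longrightarrow> L2_inner G (\<lambda>x. f x - g x) h = 0"
  proof (rule G.L2_projection[of vanishing f])
    show "vanishing \<subseteq> L2 G" using vanishing_L2 by blast
    show "vanishing \<noteq> {}" using coboundary_vanishing[OF f, of 1] by auto
  qed (use vanishing_add vanishing_scale vanishing_closed fL that in blast)+
  define w where "w = (\<lambda>x. f x - g x)"
  have w0: "w \<in> L2_zero_mean G"
    unfolding w_def using g(1) by (intro L2_zero_mean_diff[OF prob_space_std_gaussian f]) (simp add: vanishing_def)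
  have wL: "w \<in> L2 G" using w0 by (rule L2_zero_mean_L2)
  have "AE x in G. w (rot J (- 1 * s) x) = w x" if s: "s > 0" for s
  proof -
    have RL: "(\<lambda>x. w (rot J (- s) x)) \<in> L2 G" by (rule rot_compose_L2[OF J wL])
    have "L2_inner G w (\<lambda>x. w (rot J (- s) x) - w x) = 0"
      using g(2)[OF coboundary_vanishing[OF w0 s]] by (simp add: w_def)
    then have "L2_inner G (\<lambda>x. w (rot J (- s) x)) w = (L2_norm G w)\<^sup>2"
      unfolding L2_inner_diff_right[OF RL wL wL] by (simp add: L2_inner_self L2_inner_commute)
    then have "(L2_norm G (\<lambda>x. w (rot J (- s) x) - w x))\<^sup>2 = 0"
      unfolding L2_norm_diff_power2[OF RL wL] by (simp add: rot_compose_norm[OF J wL])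
    then have "L2_norm G (\<lambda>x. w (rot J (- s) x) - w x) = 0" by simp
    from L2_norm_0_AE[OF L2_diff[OF RL wL] this] show ?thesis by simp
  qed
  then have "w \<in> rot_invariant J" by (rule rot_invariantI[OF J w0]) simp_all
  with g(1) show thesis unfolding w_def by (rule that)
qed

lemma vanishing_orthogonal:
  assumes g: "g \<in> vanishing" and h: "h \<in> rot_invariant J"
  shows "L2_inner G g h = 0"
  using g h corr_1[OF J vanishing_L2[OF g] rot_invariant_L2[OF J h]] by (auto simp: vanishing_def)

text \<open>The residual of \<open>decomposition\<close> shows that a projection exists, but the
  chosen representative may differ from it on a null set. The difference \<open>d\<close> is
  invariant and orthogonal to itself, and the closedness of \<open>vanishing\<close> absorbs
  it.\<close>

lemma kernel_projection_decomposition: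
  assumes f: "f \<in> L2_zero_mean G"
  defines "p \<equiv> kernel_projection J f"
  shows "p \<in> rot_invariant J" "(\<lambda>x. f x - p x) \<in> vanishing"
proof -
  have fL: "f \<in> L2 G" using f by (rule L2_zero_mean_L2)
  obtain g where g: "g \<in> vanishing" "(\<lambda>x. f x - g x) \<in> rot_invariant J" using decomposition[OF f] by blast
  have gL: "g \<in> L2 G" by (rule vanishing_L2[OF g(1)])
  have "(\<lambda>x. f x - g x) \<in> rot_kernel J \<and> (\<forall>h\<in>rot_kernel J. L2_inner G (\<lambda>q. f q - (f q - g q)) h = 0)"
    using g vanishing_orthogonal[OF g(1)] by (simp add: rot_kernel_eq[OF J])
  then have p: "p \<in> rot_invariant J" "\<And>h. h \<in> rot_invariant J \<Longrightarrow> L2_inner G (\<lambda>q. f q - p q) h = 0"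
    unfolding p_def kernel_projection_def rot_kernel_eq[OF J, symmetric]
    by (rule someI2[of _ "\<lambda>x. f x - g x"]; simp)+
  show "p \<in> rot_invariant J" by (rule p(1))
  have pL: "p \<in> L2 G" by (rule rot_invariant_L2[OF J p(1)])
  define d where "d = (\<lambda>x. (f x - g x) - p x)"
  have d: "d \<in> rot_invariant J"
  proof -
    have "AE x in G. d (rot J s x) = d x" for s
    proof -
      have "AE x in G. f (rot J s x) - g (rot J s x) = f x - g x" "AE x in G. p (rot J s x) = p x"
        using g(2) p(1) by (simp_all add: rot_invariant_def)
      then show ?thesis by eventually_elim (simp add: d_def)
    qed
    moreover have "d \<in> L2_zero_mean G"
      unfolding d_def using g(2) p(1)
      by (intro L2_zero_mean_diff[OF prob_space_std_gaussian, of "\<lambda>x. f x - g x" p]) (simp_all add: rot_invariant_def)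
    ultimately show ?thesis by (simp add: rot_invariant_def)
  qed
  have dL: "d \<in> L2 G" by (rule rot_invariant_L2[OF J d])
  have fp: "(\<lambda>x. f x - p x) \<in> L2 G" by (rule L2_diff[OF fL pL])
  have "d = (\<lambda>x. (f x - p x) - g x)" by (simp add: d_def fun_eq_iff)
  then have "L2_inner G d d = L2_inner G (\<lambda>x. f x - p x) d - L2_inner G g d"
    using L2_inner_diff_left[OF fp gL dL] by simp
  then have "(L2_norm G d)\<^sup>2 = 0"
    using p(2)[OF d] vanishing_orthogonal[OF g(1) d] by (simp add: L2_inner_self)
  then have "L2_norm G (\<lambda>x. (f x - p x) - g x) = 0"
    using \<open>d = (\<lambda>x. (f x - p x) - g x)\<close> by simp
  then show "(\<lambda>x. f x - p x) \<in> vanishing"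
    using g(1) by (intro vanishing_closed[OF fp] bexI[of _ g]) simp_all
qed

lemma asymptotic_variance_eq_cov_integral: "f \<in> L2_zero_mean G \<Longrightarrow> asymptotic_variance M (X \<mu>) f = cov_integral \<mu> f f"
  unfolding cov_integral_def by (rule langevin.asymptotic_variance_eq[OF family])

lemma cov_integral_nonneg: "f \<in> L2_zero_mean G \<Longrightarrow> 0 \<le> cov_integral \<mu> f f"
  unfolding cov_integral_def by (rule langevin.corr_integral_nonneg[OF family])

text \<open>Covariances with \<open>p\<close> in the first place do not feel the rotation, and at
  angle 0 those of \<open>p\<close> and \<open>g\<close> vanish in both orders. What remains is the
  covariance integral of \<open>g\<close> with \<open>f\<close>: it vanishes in the limit, and at
  \<mu> = 0 it equals that of \<open>g\<close> with itself, which is nonnegative.\<close>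

lemma limit_and_inequality:
  assumes f: "f \<in> L2_zero_mean G"
  defines "p \<equiv> kernel_projection J f"
  shows "((\<lambda>\<mu>. cov_integral \<mu> f f) \<longlongrightarrow> cov_integral 0 p p) at_top" "cov_integral 0 p p \<le> cov_integral 0 f f"
proof -
  define g where "g = (\<lambda>x. f x - p x)"
  have p: "p \<in> rot_invariant J" and g: "g \<in> vanishing"
    using kernel_projection_decomposition[OF f] by (simp_all add: p_def g_def)
  have p0: "p \<in> L2_zero_mean G" using p by (simp add: rot_invariant_def)
  have g0: "g \<in> L2_zero_mean G" using g by (simp add: vanishing_def)
  note L = L2_zero_mean_L2[OF f] L2_zero_mean_L2[OF p0] L2_zero_mean_L2[OF g0]
  have f_eq: "f = (\<lambda>x. p x + g x)" by (simp add: g_def)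
  have gp: "corr J 0 (osc_q \<gamma> t) g p = 0" if "0 \<le> t" for t
    using g p osc_q_abs_le[OF that] by (simp add: vanishing_def)
  have pg: "corr J 0 (osc_q \<gamma> t) p g = 0" if "0 \<le> t" for t
    using corr_symmetric[OF J osc_q_abs_le[OF that] L(2,3)] gp[OF that] by simp
  have "cov_integral \<mu> p f = cov_integral 0 p p" for \<mu>
  proof (rule cov_integral_cong)
    fix t :: real assume t: "0 \<le> t"
    note c = osc_q_abs_le[OF t]
    have "corr J (\<mu> * t) (osc_q \<gamma> t) p f = corr J 0 (osc_q \<gamma> t) p f" by (rule corr_invariant[OF J c p L(1)])
    also have "\<dots> = corr J 0 (osc_q \<gamma> t) p p"
      using corr_diff_right[OF J c L(1,2,2)] pg[OF t] by (simp add: g_def)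
    finally show "corr J (\<mu> * t) (osc_q \<gamma> t) p f = corr J (0 * t) (osc_q \<gamma> t) p p" by simp
  qed
  then have split: "cov_integral \<mu> f f = cov_integral 0 p p + cov_integral \<mu> g f" for \<mu>
    using cov_integral_add_left[OF p0 g0 L(1), of \<mu>] by (simp add: f_eq[symmetric])
  have "((\<lambda>\<mu>. cov_integral \<mu> g f) \<longlongrightarrow> 0) at_top" using g L(1) by (simp add: vanishing_def)
  then have "((\<lambda>\<mu>. cov_integral 0 p p + cov_integral \<mu> g f) \<longlongrightarrow> cov_integral 0 p p + 0) at_top" by (intro tendsto_intros)
  then show "((\<lambda>\<mu>. cov_integral \<mu> f f) \<longlongrightarrow> cov_integral 0 p p) at_top" by (simp add: split)
  have "cov_integral 0 g f = cov_integral 0 g g"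
  proof (rule cov_integral_cong)
    fix t :: real assume t: "0 \<le> t"
    show "corr J (0 * t) (osc_q \<gamma> t) g f = corr J (0 * t) (osc_q \<gamma> t) g g"
      using corr_diff_right[OF J osc_q_abs_le[OF t] L(1,2,3)] gp[OF t] by (simp add: g_def)
  qed
  then show "cov_integral 0 p p \<le> cov_integral 0 f f" using cov_integral_nonneg[OF g0, of 0] by (simp add: split)
qed

end

theorem theorem5:
  fixes J :: "real ^ 'd ^ 'd" and \<gamma> :: real
    and M :: "'w measure" and W :: "real \<Rightarrow> 'w \<Rightarrow> real ^ 'd"
    and X :: "real \<Rightarrow> (real ^ 'd) \<times> (real ^ 'd) \<Rightarrow> real \<Rightarrow> 'w \<Rightarrow> (real ^ 'd) \<times> (real ^ 'd)"
    and f :: "real ^ 'd \<Rightarrow> real"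
  assumes "transpose J = - J"
    and "\<gamma> > 0"
    and "prob_space M"
    and "standard_brownian_motion M W"
    and "\<And>\<mu> x. langevin_solution M W J \<gamma> \<mu> x (X \<mu> x)"
    and "f \<in> L2_zero_mean std_gaussian"
  shows "((\<lambda>\<mu>. asymptotic_variance M (X \<mu>) f)
            \<longlongrightarrow> asymptotic_variance M (X 0) (kernel_projection J f)) at_top \<and>
         asymptotic_variance M (X 0) (kernel_projection J f) \<le> asymptotic_variance M (X 0) f"
proof -
  interpret langevin_family M J \<gamma> W X
    using assms(1-5)
    by (simp add: langevin_family_def langevin_def langevin_axioms_def)
  have p: "kernel_projection J f \<in> L2_zero_mean std_gaussian"
    using kernel_projection_decomposition(1)[OF assms(6)] by (simp add: rot_invariant_def)
  show ?thesis
    using limit_and_inequality[OF assms(6)]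
    by (simp add: asymptotic_variance_eq_cov_integral[OF assms(6)] asymptotic_variance_eq_cov_integral[OF p])
qed

end
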